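(* Let $0<\alpha<1/2$ and let $\theta^0\in H^{2-2\alpha}(\mathbb R^2)$. Let $\theta\in C([0,T^* ),H^{2-2\alpha}(\mathbb R^2))$ be the maximal solution of the supercritical surface quasi-geostrophic equation $$\partial_t\theta+|D|^{2\alpha}\theta+u_\theta\cdot\nabla\theta=0,\qquad \theta(0,x)=\theta^0(x),$$ where $u_\theta=(-\partial_2|D|^{-1}\theta,\ \partial_1|D|^{-1}\theta)$. If $T^*<\infty$, then $$\int_0^{T^*}\big\||D|^{\alpha}\theta(\tau)\big\|_{H^{2-2\alpha}}^2\,d\tau=\infty.$$
   Context: $|D|^s$ is the Fourier multiplier $\widehat{|D|^s f}(\xi)=|\xi|^s\widehat f(\xi)$. $H^s(\mathbb R^2)$ is the inhomogeneous Sobolev space; for $s>0$ its norm is taken to be $\|f\|_{H^s}^2=\|f\|_{L^2}^2+\||D|^sf\|_{L^2}^2$ (equivalent to the usual one). It is known (and used as background) that for every $\theta^0\in H^{2-2\alpha}(\mathbb R^2)$ there is a unique time $T^*\in(0,\infty]$ and a unique solution $\theta\in C([0,T^* ),H^{2-2\alpha}(\mathbb R^2))$ of the equation, which cannot be continued as such a solution beyond $T^*$; this is called the maximal solution and $T^*$ its maximal time. *)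

theory Defs
  imports "HOL-Analysis.Analysis"
begin

type_synonym pt = "real ^ 2"

definition L2 :: "(pt \<Rightarrow> real) \<Rightarrow> bool" where
  "L2 f \<longleftrightarrow> f \<in> borel_measurable lborel \<and> integrable lborel (\<lambda>x. (f x)\<^sup>2)"

definition L2c :: "(pt \<Rightarrow> complex) \<Rightarrow> bool" where
  "L2c F \<longleftrightarrow> F \<in> borel_measurable lborel \<and> integrable lborel (\<lambda>x. (cmod (F x))\<^sup>2)"

text \<open>Fourier transform of an integrable function, unitary normalisation in dimension 2:
  hat f (xi) = (2 pi)^(-1) int f(x) e^(-i xi.x) dx.\<close>
definition ft1 :: "(pt \<Rightarrow> real) \<Rightarrow> pt \<Rightarrow> complex" where
  "ft1 f \<xi> = complex_of_real (1 / (2 * pi)) *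
     (LINT x|lborel. complex_of_real (f x) * cis (- (\<xi> \<bullet> x)))"

text \<open>Plancherel Fourier transform on L^2: F is (a representative of) the Fourier transform
  of f iff F is the L^2-limit of the transforms of the truncations of f to balls.\<close>
definition is_ft :: "(pt \<Rightarrow> real) \<Rightarrow> (pt \<Rightarrow> complex) \<Rightarrow> bool" where
  "is_ft f F \<longleftrightarrow> L2 f \<and> L2c F \<and>
     ((\<lambda>R::real. \<integral>\<^sup>+ \<xi>. ennreal ((cmod (F \<xi> - ft1 (\<lambda>x. indicator (ball 0 R) x * f x) \<xi>))\<^sup>2) \<partial>lborel)
        \<longlongrightarrow> 0) at_top"

definition ft :: "(pt \<Rightarrow> real) \<Rightarrow> pt \<Rightarrow> complex" where
  "ft f = (SOME F. is_ft f F)"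

definition is_mult :: "(pt \<Rightarrow> complex) \<Rightarrow> (pt \<Rightarrow> real) \<Rightarrow> (pt \<Rightarrow> real) \<Rightarrow> bool" where
  "is_mult m f g \<longleftrightarrow> (\<exists>F. is_ft f F \<and> is_ft g (\<lambda>\<xi>. m \<xi> * F \<xi>))"

definition fmult :: "(pt \<Rightarrow> complex) \<Rightarrow> (pt \<Rightarrow> real) \<Rightarrow> pt \<Rightarrow> real" where
  "fmult m f = (SOME g. is_mult m f g)"

definition Dpow :: "real \<Rightarrow> (pt \<Rightarrow> real) \<Rightarrow> pt \<Rightarrow> real" where
  "Dpow s f = fmult (\<lambda>\<xi>. complex_of_real (norm \<xi> powr s)) f"

definition dpart :: "2 \<Rightarrow> (pt \<Rightarrow> real) \<Rightarrow> pt \<Rightarrow> real" where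
  "dpart j f = fmult (\<lambda>\<xi>. \<i> * complex_of_real (\<xi> $ j)) f"

definition vel1 :: "(pt \<Rightarrow> real) \<Rightarrow> pt \<Rightarrow> real" where
  "vel1 f = fmult (\<lambda>\<xi>. - (\<i> * complex_of_real (\<xi> $ 2)) / complex_of_real (norm \<xi>)) f"

definition vel2 :: "(pt \<Rightarrow> real) \<Rightarrow> pt \<Rightarrow> real" where
  "vel2 f = fmult (\<lambda>\<xi>. (\<i> * complex_of_real (\<xi> $ 1)) / complex_of_real (norm \<xi>)) f"

text \<open>Squared H^s norm ||f||_{L^2}^2 + |||D|^s f||_{L^2}^2 (computed on the Fourier side via
  Plancherel), valued in [0,\<infinity>].\<close>
definition Hs_sqnorm :: "real \<Rightarrow> (pt \<Rightarrow> real) \<Rightarrow> ennreal" where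
  "Hs_sqnorm s f = (\<integral>\<^sup>+ x. ennreal ((f x)\<^sup>2) \<partial>lborel)
      + (\<integral>\<^sup>+ \<xi>. ennreal ((norm \<xi> powr s * cmod (ft f \<xi>))\<^sup>2) \<partial>lborel)"

definition in_Hs :: "real \<Rightarrow> (pt \<Rightarrow> real) \<Rightarrow> bool" where
  "in_Hs s f \<longleftrightarrow> (\<exists>F. is_ft f F) \<and> Hs_sqnorm s f < \<infinity>"

definition cont_Hs :: "real \<Rightarrow> real \<Rightarrow> (real \<Rightarrow> pt \<Rightarrow> real) \<Rightarrow> bool" where
  "cont_Hs s T \<theta> \<longleftrightarrow> (\<forall>t\<in>{0..<T}. in_Hs s (\<theta> t)) \<and>
     (\<forall>t0\<in>{0..<T}. ((\<lambda>t. Hs_sqnorm s (\<lambda>x. \<theta> t x - \<theta> t0 x)) \<longlongrightarrow> 0) (at t0 within {0..<T}))"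

definition sqg_rhs :: "real \<Rightarrow> (pt \<Rightarrow> real) \<Rightarrow> pt \<Rightarrow> real" where
  "sqg_rhs \<alpha> f x = Dpow (2 * \<alpha>) f x + vel1 f x * dpart 1 f x + vel2 f x * dpart 2 f x"

definition sqg_sol :: "real \<Rightarrow> (pt \<Rightarrow> real) \<Rightarrow> real \<Rightarrow> (real \<Rightarrow> pt \<Rightarrow> real) \<Rightarrow> bool" where
  "sqg_sol \<alpha> \<theta>0 T \<theta> \<longleftrightarrow> cont_Hs (2 - 2 * \<alpha>) T \<theta> \<and>
     (\<forall>t\<in>{0..<T}. \<forall>\<phi>. L2 \<phi> \<longrightarrow>
        set_integrable lborel {0..t} (\<lambda>\<tau>. LINT x|lborel. sqg_rhs \<alpha> (\<theta> \<tau>) x * \<phi> x) \<and>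
        (LINT x|lborel. \<theta> t x * \<phi> x) =
          (LINT x|lborel. \<theta>0 x * \<phi> x)
          - (LINT \<tau>:{0..t}|lborel. (LINT x|lborel. sqg_rhs \<alpha> (\<theta> \<tau>) x * \<phi> x)))"

definition sqg_maximal :: "real \<Rightarrow> (pt \<Rightarrow> real) \<Rightarrow> real \<Rightarrow> (real \<Rightarrow> pt \<Rightarrow> real) \<Rightarrow> bool" where
  "sqg_maximal \<alpha> \<theta>0 T \<theta> \<longleftrightarrow> 0 < T \<and> sqg_sol \<alpha> \<theta>0 T \<theta> \<and>
     \<not> (\<exists>T' \<theta>'. T' > T \<and> sqg_sol \<alpha> \<theta>0 T' \<theta>' \<and>
           (\<forall>t\<in>{0..<T}. AE x in lborel. \<theta>' t x = \<theta> t x))"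

end

theory Submission
  imports Defs "HOL-Probability.Probability"
begin

text \<open>Let \<open>y(t)\<close> be the squared \<open>L^2\<close> norm of \<open>|D|^(2-\<alpha>) \<theta>(t)\<close>, which is bounded by the integrand.
  Data with finite \<open>y(s)\<close> can be solved for a time of at least \<open>c / y(s)\<close>, where \<open>c\<close> depends on \<open>\<alpha>\<close> only:
  the commutator of \<open>|D|^(2-\<alpha>)\<close> with the transport term contributes at most \<open>C y\<close> times the \<open>L^2\<close> norm of
  \<open>|D|^2 \<theta>\<close> to the growth of \<open>y\<close>, the dissipation absorbs the second factor, and \<open>y' \<le> C' y^2\<close> remains.
  The \<open>L^2\<close> energy estimate for differences shows that this solution agrees with \<open>\<theta>\<close> while both exist. Hence
  \<open>y(s) \<ge> c / (T* - s)\<close> for all \<open>s < T*\<close>, since otherwise \<open>\<theta>\<close> could be continued, and \<open>c / (T* - s)\<close> is not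
  integrable up to \<open>T*\<close>.

  Everything is done on the Fourier side, where the transport term becomes the bilinear operator \<open>Bop\<close>.
  Solutions are constructed by an Euler scheme for the equation truncated to \<open>|\<xi>| < N\<close>; a one-sided Gronwall
  inequality for the piecewise linear interpolants makes them Cauchy in \<open>L^2\<close> as \<open>N\<close> grows and the step shrinks.\<close>

subsection \<open>Square integrable functions\<close>

text \<open>The time \<open>c / y\<close> is dictated by scaling. The equation is invariant under
  passing from \<theta>(t, x) to \<lambda>^(2\<alpha>-1) \<theta>(\<lambda>^(2\<alpha>) t, \<lambda>
  x). The \<open>L^2\<close> norm of |D|^(2-2\<alpha>) \<theta> does not change, so its size alone
  cannot yield an existence time, whereas \<open>y\<close>, half a dissipation higher, scales like
  an inverse time; hence \<open>y' \<le> C' y^2\<close>. The obstacle is that \<theta> is only known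
  in H^(2-2\<alpha>), so the growth of \<open>y\<close> cannot be estimated along \<theta> itself.
  The energy inequality for \<open>y\<close> is applied to band-limited functions, for which every
  pairing is finite, and reaches \<theta> through uniqueness; the estimate for differences therefore
  asks for the higher regularity of one of the two functions only. Where \<open>y(s)\<close> is
  infinite there is nothing to show. Energy estimates in both norms rest on one trilinear inequality
  with the weight |\<xi> - \<eta>|^(-a) |\<eta>|^(a-1), used for a = \<alpha> and a = 1 - \<alpha>;
  its total degree -1 is the one that scaling permits in the plane.\<close>

definition ip :: "(pt \<Rightarrow> complex) \<Rightarrow> (pt \<Rightarrow> complex) \<Rightarrow> complex" where
  "ip F G = (LINT x|lborel. F x * cnj (G x))"

text \<open>A function whose squared modulus is not integrable gets the value 0, so a bound on
  \<open>l2\<close> is informative only together with \<open>L2c\<close>.\<close>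

definition l2 :: "(pt \<Rightarrow> complex) \<Rightarrow> real" where
  "l2 F = sqrt (LINT x|lborel. (cmod (F x))\<^sup>2)"

lemma L2c_measurable [measurable_dest]: "L2c F \<Longrightarrow> F \<in> borel_measurable borel"
  by (simp add: L2c_def)

lemma L2c_integrable: "L2c F \<Longrightarrow> integrable lborel (\<lambda>x. (cmod (F x))\<^sup>2)"
  by (simp add: L2c_def)

lemma l2_nonneg [simp]: "l2 F \<ge> 0"
  by (simp add: l2_def)

lemma l2_sq: "(l2 F)\<^sup>2 = (LINT x|lborel. (cmod (F x))\<^sup>2)"
  by (simp add: l2_def)

lemma nn_integral_L2c: "L2c F \<Longrightarrow> (\<integral>\<^sup>+x. ennreal ((cmod (F x))\<^sup>2) \<partial>lborel) = ennreal ((l2 F)\<^sup>2)"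
  by (simp add: l2_sq nn_integral_eq_integral L2c_def)

lemma L2c_if_nn_le:
  assumes [measurable]: "F \<in> borel_measurable borel" and "0 \<le> c"
    and le: "(\<integral>\<^sup>+x. ennreal ((cmod (F x))\<^sup>2) \<partial>lborel) \<le> ennreal (c\<^sup>2)"
  shows "L2c F" "l2 F \<le> c"
proof -
  show L: "L2c F"
    unfolding L2c_def using le
    by (auto intro!: integrableI_bounded simp: le_less_trans[OF _ ennreal_less_top])
  have "ennreal ((l2 F)\<^sup>2) \<le> ennreal (c\<^sup>2)"
    using le by (simp add: nn_integral_L2c[OF L])
  then have "(l2 F)\<^sup>2 \<le> c\<^sup>2" by simp
  then show "l2 F \<le> c"
    by (rule power2_le_imp_le) fact
qed

lemma L2c_if_nn_finite:
  assumes [measurable]: "F \<in> borel_measurable borel"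
    and "(\<integral>\<^sup>+x. ennreal ((cmod (F x))\<^sup>2) \<partial>lborel) < \<infinity>"
  shows "L2c F"
  unfolding L2c_def using assms by (auto intro!: integrableI_bounded)

lemma L2c_dominated:
  assumes F: "L2c F" and [measurable]: "G \<in> borel_measurable borel" and c: "0 \<le> c"
    and le: "AE x in lborel. cmod (G x) \<le> c * cmod (F x)"
  shows "L2c G" "l2 G \<le> c * l2 F"
proof -
  note [measurable] = L2c_measurable[OF F]
  have "(\<integral>\<^sup>+x. ennreal ((cmod (G x))\<^sup>2) \<partial>lborel) \<le> (\<integral>\<^sup>+x. ennreal (c\<^sup>2) * ennreal ((cmod (F x))\<^sup>2) \<partial>lborel)"
    using le by (intro nn_integral_mono_AE) (auto simp: ennreal_mult[symmetric] power_mult_distrib[symmetric] intro!: power_mono ennreal_leI)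
  also have "\<dots> = ennreal ((c * l2 F)\<^sup>2)"
    by (subst nn_integral_cmult) (auto simp: nn_integral_L2c[OF F] ennreal_mult[symmetric] power_mult_distrib)
  finally have *: "(\<integral>\<^sup>+x. ennreal ((cmod (G x))\<^sup>2) \<partial>lborel) \<le> ennreal ((c * l2 F)\<^sup>2)" .
  show "L2c G" "l2 G \<le> c * l2 F"
    using L2c_if_nn_le[OF _ _ *] c by auto
qed

lemma L2c_zero [simp]: "L2c (\<lambda>x. 0)"
  by (simp add: L2c_def)

lemma l2_zero [simp]: "l2 (\<lambda>x. 0) = 0"
  by (simp add: l2_def)

lemma L2c_cmult: "L2c F \<Longrightarrow> L2c (\<lambda>x. c * F x)"
  by (rule L2c_dominated(1)[where c="cmod c" and F=F]) (auto simp: norm_mult)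

lemma L2c_uminus: "L2c F \<Longrightarrow> L2c (\<lambda>x. - F x)"
  using L2c_cmult[of F "-1"] by simp

lemma borel_measurable_cnj [measurable]:
  assumes [measurable]: "F \<in> borel_measurable M"
  shows "(\<lambda>x. cnj (F x)) \<in> borel_measurable M"
  by (rule borel_measurable_continuous_on[OF _ assms, of cnj]) (intro continuous_intros)

lemma L2c_cnj: "L2c F \<Longrightarrow> L2c (\<lambda>x. cnj (F x))"
  by (rule L2c_dominated(1)[where c=1 and F=F]) auto

lemma L2c_add:
  assumes "L2c F" "L2c G"
  shows "L2c (\<lambda>x. F x + G x)"
proof -
  note [measurable] = L2c_measurable[OF assms(1)] L2c_measurable[OF assms(2)]
  have *: "(a + b)\<^sup>2 \<le> 2 * a\<^sup>2 + 2 * b\<^sup>2" for a b :: real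
    using sum_squares_bound[of a b] by (simp add: power2_sum)
  have "integrable lborel (\<lambda>x. (cmod (F x + G x))\<^sup>2)"
  proof (rule Bochner_Integration.integrable_bound)
    show "integrable lborel (\<lambda>x. 2 * (cmod (F x))\<^sup>2 + 2 * (cmod (G x))\<^sup>2)"
      using assms by (simp add: L2c_def)
    show "AE x in lborel. norm ((cmod (F x + G x))\<^sup>2) \<le> norm (2 * (cmod (F x))\<^sup>2 + 2 * (cmod (G x))\<^sup>2)"
    proof (rule AE_I2)
      fix x
      have "(cmod (F x + G x))\<^sup>2 \<le> (cmod (F x) + cmod (G x))\<^sup>2"
        by (intro power_mono norm_triangle_ineq) auto
      then show "norm ((cmod (F x + G x))\<^sup>2) \<le> norm (2 * (cmod (F x))\<^sup>2 + 2 * (cmod (G x))\<^sup>2)"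
        using *[of "cmod (F x)" "cmod (G x)"] by (simp del: power_mono_iff)
    qed
  qed simp
  then show ?thesis by (simp add: L2c_def)
qed

lemma L2c_diff: "L2c F \<Longrightarrow> L2c G \<Longrightarrow> L2c (\<lambda>x. F x - G x)"
  using L2c_add[of F "\<lambda>x. - G x"] L2c_uminus[of G] by simp

lemma L2c_cong_AE:
  assumes "L2c F" "AE x in lborel. F x = G x" "G \<in> borel_measurable borel"
  shows "L2c G"
  using assms by (intro L2c_dominated(1)[OF assms(1), of G 1]) auto

lemma l2_cong_AE:
  assumes "L2c F" "AE x in lborel. F x = G x" "G \<in> borel_measurable borel"
  shows "l2 F = l2 G"
  unfolding l2_def using assms
  by (intro arg_cong[where f=sqrt] integral_cong_AE) (auto simp: L2c_def)

section \<open>The Cauchy--Schwarz inequality and the inner product\<close>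

lemma ennreal_le_if_square_le:
  fixes x :: ennreal
  assumes "x\<^sup>2 \<le> (ennreal r)\<^sup>2" "0 \<le> r"
  shows "x \<le> ennreal r"
proof (cases x)
  case (real y)
  have "y\<^sup>2 \<le> r\<^sup>2"
    using assms real by (simp add: ennreal_power)
  then have "y \<le> r" using assms(2) by (rule power2_le_imp_le)
  then show ?thesis using real by (simp add: ennreal_leI)
next
  case top
  then show ?thesis using assms by (simp add: ennreal_power top_unique)
qed

lemma nn_Cauchy_Schwarz:
  fixes u v :: "'a \<Rightarrow> ennreal"
  assumes [measurable]: "u \<in> borel_measurable M" "v \<in> borel_measurable M"
    and "(\<integral>\<^sup>+x. (u x)\<^sup>2 \<partial>M) \<le> ennreal (a\<^sup>2)" "(\<integral>\<^sup>+x. (v x)\<^sup>2 \<partial>M) \<le> ennreal (b\<^sup>2)" "0 \<le> a" "0 \<le> b"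
  shows "(\<integral>\<^sup>+x. u x * v x \<partial>M) \<le> ennreal (a * b)"
proof -
  have "(\<integral>\<^sup>+x. u x * v x \<partial>M)\<^sup>2 \<le> (\<integral>\<^sup>+x. (u x)\<^sup>2 \<partial>M) * (\<integral>\<^sup>+x. (v x)\<^sup>2 \<partial>M)"
    by (rule Cauchy_Schwarz_nn_integral) auto
  also have "\<dots> \<le> ennreal (a\<^sup>2) * ennreal (b\<^sup>2)"
    by (intro mult_mono assms) auto
  also have "\<dots> = (ennreal (a * b))\<^sup>2"
    using assms by (simp add: ennreal_mult[symmetric] ennreal_power power_mult_distrib)
  finally show ?thesis
    using assms(5,6) by (intro ennreal_le_if_square_le) auto
qed

lemma nn_integral_L2c': "L2c F \<Longrightarrow> (\<integral>\<^sup>+x. (ennreal (cmod (F x)))\<^sup>2 \<partial>lborel) = ennreal ((l2 F)\<^sup>2)"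
  using nn_integral_L2c[of F] by (simp add: ennreal_power)

lemma nn_integral_mult_le:
  assumes "L2c F" "L2c G"
  shows "(\<integral>\<^sup>+x. ennreal (cmod (F x)) * ennreal (cmod (G x)) \<partial>lborel) \<le> ennreal (l2 F * l2 G)"
  using assms by (intro nn_Cauchy_Schwarz) (auto simp: nn_integral_L2c' L2c_def)

lemma integrable_mult_L2c:
  assumes "L2c F" "L2c G"
  shows "integrable lborel (\<lambda>x. F x * G x)"
proof -
  note [measurable] = L2c_measurable[OF assms(1)] L2c_measurable[OF assms(2)]
  show ?thesis
    by (rule integrableI_bounded)
      (use le_less_trans[OF nn_integral_mult_le[OF assms] ennreal_less_top] in \<open>auto simp: norm_mult ennreal_mult\<close>)
qed

lemma integrable_ip: "L2c F \<Longrightarrow> L2c G \<Longrightarrow> integrable lborel (\<lambda>x. F x * cnj (G x))"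
  using integrable_mult_L2c[of F "\<lambda>x. cnj (G x)"] by (simp add: L2c_cnj)

text \<open>A function that is not integrable has Bochner integral 0 and satisfies the bound as
  well, so later estimates can be read off from Lebesgue integrals of the modulus.\<close>

lemma norm_integral_le_nn:
  fixes f :: "'a \<Rightarrow> 'b::{banach, second_countable_topology}"
  assumes "(\<integral>\<^sup>+x. ennreal (norm (f x)) \<partial>M) \<le> ennreal c" "0 \<le> c"
  shows "norm (integral\<^sup>L M f) \<le> c"
proof (cases "integrable M f")
  case True
  have "ennreal (norm (integral\<^sup>L M f)) \<le> ennreal c"
    using integral_norm_bound_ennreal[OF True] assms(1) by (rule order_trans)
  then show ?thesis using assms(2) by simp
qed (use assms(2) in \<open>simp add: not_integrable_integral_eq\<close>)

lemma ip_bound: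
  assumes "L2c F" "L2c G"
  shows "cmod (ip F G) \<le> l2 F * l2 G"
  unfolding ip_def
  by (rule norm_integral_le_nn) (use nn_integral_mult_le[OF assms] in \<open>auto simp: norm_mult ennreal_mult\<close>)

lemma Re_ip_bound: "L2c F \<Longrightarrow> L2c G \<Longrightarrow> \<bar>Re (ip F G)\<bar> \<le> l2 F * l2 G"
  using ip_bound[of F G] abs_Re_le_cmod[of "ip F G"] by linarith

lemma ip_add_left: "L2c F \<Longrightarrow> L2c G \<Longrightarrow> L2c H \<Longrightarrow> ip (\<lambda>x. F x + G x) H = ip F H + ip G H"
  unfolding ip_def by (simp add: distrib_right integrable_ip)

lemma ip_diff_left: "L2c F \<Longrightarrow> L2c G \<Longrightarrow> L2c H \<Longrightarrow> ip (\<lambda>x. F x - G x) H = ip F H - ip G H"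
  unfolding ip_def by (simp add: left_diff_distrib integrable_ip)

lemma ip_add_right: "L2c F \<Longrightarrow> L2c G \<Longrightarrow> L2c H \<Longrightarrow> ip H (\<lambda>x. F x + G x) = ip H F + ip H G"
  unfolding ip_def by (simp add: distrib_left integrable_ip)

lemma ip_diff_right: "L2c F \<Longrightarrow> L2c G \<Longrightarrow> L2c H \<Longrightarrow> ip H (\<lambda>x. F x - G x) = ip H F - ip H G"
  unfolding ip_def by (simp add: right_diff_distrib integrable_ip)

lemma ip_cmult_left: "ip (\<lambda>x. c * F x) H = c * ip F H"
  unfolding ip_def by (simp add: mult.assoc)

lemma ip_cmult_right: "ip F (\<lambda>x. c * H x) = cnj c * ip F H"
  unfolding ip_def by (simp add: mult.left_commute)

lemma ip_commute: "ip G F = cnj (ip F G)"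
  unfolding ip_def by (subst Bochner_Integration.integral_cnj[symmetric]) (simp add: mult.commute)

lemma ip_self: "ip F F = complex_of_real ((l2 F)\<^sup>2)"
  unfolding ip_def l2_sq by (subst integral_complex_of_real[symmetric]) (simp only: complex_norm_square)

lemma ip_cong_AE:
  assumes "AE x in lborel. F x = F' x" "AE x in lborel. G x = G' x"
    and [measurable]: "F \<in> borel_measurable borel" "F' \<in> borel_measurable borel" "G \<in> borel_measurable borel" "G' \<in> borel_measurable borel"
  shows "ip F G = ip F' G'"
  unfolding ip_def using assms(1,2) by (intro integral_cong_AE) auto

lemma l2_add_sq:
  assumes "L2c F" "L2c G"
  shows "(l2 (\<lambda>x. F x + G x))\<^sup>2 = (l2 F)\<^sup>2 + 2 * Re (ip F G) + (l2 G)\<^sup>2"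
proof -
  have L: "L2c (\<lambda>x. F x + G x)" by (intro L2c_add assms)
  have "complex_of_real ((l2 (\<lambda>x. F x + G x))\<^sup>2) = ip F (\<lambda>x. F x + G x) + ip G (\<lambda>x. F x + G x)"
    unfolding ip_self[symmetric] by (rule ip_add_left[OF assms L])
  also have "\<dots> = ip F F + ip F G + (ip G F + ip G G)"
    by (simp only: ip_add_right[OF assms assms(1)] ip_add_right[OF assms assms(2)])
  finally have "Re (complex_of_real ((l2 (\<lambda>x. F x + G x))\<^sup>2)) = Re (ip F F + ip F G + (ip G F + ip G G))"
    by (rule arg_cong)
  moreover have "Re (ip G F) = Re (ip F G)"
    by (subst ip_commute) simp
  ultimately show ?thesis
    by (simp add: ip_self)
qed

lemma l2_diff_sq:
  assumes "L2c F" "L2c G"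
  shows "(l2 (\<lambda>x. F x - c * G x))\<^sup>2 = (l2 F)\<^sup>2 - 2 * Re (cnj c * ip F G) + (cmod c)\<^sup>2 * (l2 G)\<^sup>2"
proof -
  have 1: "(l2 (\<lambda>x. F x + (-c) * G x))\<^sup>2 = (l2 F)\<^sup>2 + 2 * Re (ip F (\<lambda>x. (-c) * G x)) + (l2 (\<lambda>x. (-c) * G x))\<^sup>2"
    by (rule l2_add_sq) (intro assms L2c_cmult)+
  have 2: "(l2 (\<lambda>x. (-c) * G x))\<^sup>2 = (cmod c)\<^sup>2 * (l2 G)\<^sup>2"
    by (simp add: l2_sq norm_mult power_mult_distrib)
  have 3: "Re (ip F (\<lambda>x. (-c) * G x)) = - Re (cnj c * ip F G)"
    by (subst ip_cmult_right) simp
  show ?thesis using 1 unfolding 2 3 by simp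
qed

lemma l2_cmult: "l2 (\<lambda>x. c * F x) = cmod c * l2 F"
  by (simp add: l2_def norm_mult power_mult_distrib real_sqrt_mult)

lemma l2_uminus: "l2 (\<lambda>x. - F x) = l2 F"
  by (simp add: l2_def)

lemma l2_triangle:
  assumes "L2c F" "L2c G"
  shows "l2 (\<lambda>x. F x + G x) \<le> l2 F + l2 G"
proof (rule power2_le_imp_le)
  show "(l2 (\<lambda>x. F x + G x))\<^sup>2 \<le> (l2 F + l2 G)\<^sup>2"
    using l2_add_sq[OF assms] Re_ip_bound[OF assms] by (simp add: power2_sum)
qed simp

lemma l2_triangle_diff:
  assumes "L2c F" "L2c G"
  shows "l2 (\<lambda>x. F x - G x) \<le> l2 F + l2 G"
  using l2_triangle[OF assms(1) L2c_uminus[OF assms(2)]] by (simp add: l2_uminus)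

lemma l2_commute: "l2 (\<lambda>x. F x - G x) = l2 (\<lambda>x. G x - F x)"
  by (simp add: l2_def norm_minus_commute)

lemma l2_triangle3:
  assumes "L2c F" "L2c G" "L2c H"
  shows "l2 (\<lambda>x. F x - H x) \<le> l2 (\<lambda>x. F x - G x) + l2 (\<lambda>x. G x - H x)"
  using l2_triangle[of "\<lambda>x. F x - G x" "\<lambda>x. G x - H x"] assms by (simp add: L2c_diff)

lemma l2_diff_abs:
  assumes "L2c F" "L2c G"
  shows "\<bar>l2 F - l2 G\<bar> \<le> l2 (\<lambda>x. F x - G x)"
  using l2_triangle[of "\<lambda>x. F x - G x" G] l2_triangle[of "\<lambda>x. G x - F x" F] assms l2_commute[of F G]
  by (simp add: L2c_diff)

lemma l2_eq_0_AE:
  assumes "L2c F" "l2 F = 0"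
  shows "AE x in lborel. F x = 0"
proof -
  note [measurable] = L2c_measurable[OF assms(1)]
  have "(\<integral>\<^sup>+x. ennreal ((cmod (F x))\<^sup>2) \<partial>lborel) = 0"
    using nn_integral_L2c[OF assms(1)] assms(2) by simp
  then show ?thesis
    by (subst (asm) nn_integral_0_iff_AE) auto
qed
 
text \<open>Lower semicontinuity of the norm. It carries the H^(2-\<alpha>) bound over to the limit
  of the scheme, where the weighted norms are bounded but not known to converge.\<close>

lemma L2c_Fatou:
  assumes L: "\<And>n. L2c (F n)" and b: "\<And>n. l2 (F n) \<le> c" and [measurable]: "G \<in> borel_measurable borel"
    and lim: "AE x in lborel. (\<lambda>n. F n x) \<longlonglongrightarrow> G x"
  shows "L2c G" "l2 G \<le> c"
proof -
  note [measurable] = L2c_measurable[OF L]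
  have c: "0 \<le> c" using b[of 0] l2_nonneg[of "F 0"] by linarith
  have "(\<integral>\<^sup>+x. ennreal ((cmod (G x))\<^sup>2) \<partial>lborel) = (\<integral>\<^sup>+x. liminf (\<lambda>n. ennreal ((cmod (F n x))\<^sup>2)) \<partial>lborel)"
  proof (rule nn_integral_cong_AE, use lim in eventually_elim)
    fix x assume "(\<lambda>n. F n x) \<longlonglongrightarrow> G x"
    then have "(\<lambda>n. ennreal ((cmod (F n x))\<^sup>2)) \<longlonglongrightarrow> ennreal ((cmod (G x))\<^sup>2)"
      by (intro tendsto_intros)
    then show "ennreal ((cmod (G x))\<^sup>2) = liminf (\<lambda>n. ennreal ((cmod (F n x))\<^sup>2))"
      by (intro lim_imp_Liminf[symmetric]) auto
  qed
  also have "\<dots> \<le> liminf (\<lambda>n. \<integral>\<^sup>+x. ennreal ((cmod (F n x))\<^sup>2) \<partial>lborel)"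
    by (rule nn_integral_liminf) auto
  also have "\<dots> \<le> ennreal (c\<^sup>2)"
    by (intro Liminf_le always_eventually allI) (auto simp: nn_integral_L2c[OF L] intro!: power_mono b)
  finally have "(\<integral>\<^sup>+x. ennreal ((cmod (G x))\<^sup>2) \<partial>lborel) \<le> ennreal (c\<^sup>2)" .
  from L2c_if_nn_le[OF _ c this] show "L2c G" "l2 G \<le> c" by auto
qed

lemma l2_fast_Cauchy_diff:
  assumes L: "\<And>n. L2c (F n)" and d: "\<And>n. l2 (\<lambda>x. F (Suc n) x - F n x) \<le> (1/2)^n"
  shows "l2 (\<lambda>x. F (n + k) x - F n x) \<le> 2 * (1/2)^n"
proof -
  \<comment> \<open>The subtracted tail of the geometric series makes the induction on
    \<open>k\<close> close.\<close>
  have "l2 (\<lambda>x. F (n + k) x - F n x) \<le> 2 * (1/2)^n - 2 * (1/2)^(n+k)"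
  proof (induction k)
    case (Suc k)
    have "l2 (\<lambda>x. F (n + Suc k) x - F n x) \<le> l2 (\<lambda>x. F (Suc (n + k)) x - F (n + k) x) + l2 (\<lambda>x. F (n + k) x - F n x)"
      using l2_triangle3[OF L L L, of "Suc (n+k)" n "n+k"] by simp
    also have "\<dots> \<le> 2 * (1/2)^n - 2 * (1/2)^(n + Suc k)"
      using Suc d[of "n+k"] by simp
    finally show ?case .
  qed simp
  also have "\<dots> \<le> 2 * (1/2)^n" by simp
  finally show ?thesis .
qed

text \<open>The limit is prescribed pointwise so that it inherits pointwise symmetries of the sequence.\<close>

lemma Riesz_Fischer:
  assumes L: "\<And>n. L2c (F n)" and d: "\<And>n. l2 (\<lambda>x. F (Suc n) x - F n x) \<le> (1/2)^n"
    and G_def: "G = (\<lambda>x. if convergent (\<lambda>n. F n x) then lim (\<lambda>n. F n x) else 0)"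
  shows "L2c G" "\<And>n. l2 (\<lambda>x. F n x - G x) \<le> 2 * (1/2)^n" "AE x in lborel. (\<lambda>n. F n x) \<longlonglongrightarrow> G x"
proof -
  note [measurable] = L2c_measurable[OF L]
  \<comment> \<open>The squared norms of the increments are at most 4^(-n), so weighting them with
    2^n leaves a convergent sum. Its finiteness at a point forces decay of order 2^(-n/2) there,
    hence convergence.\<close>
  define D where "D n x = F (Suc n) x - F n x" for n x
  have LD: "L2c (D n)" for n unfolding D_def by (intro L2c_diff L)
  note [measurable] = L2c_measurable[OF LD]
  have "(\<integral>\<^sup>+x. (\<Sum>n. ennreal (2^n) * ennreal ((cmod (D n x))\<^sup>2)) \<partial>lborel)
      = (\<Sum>n. ennreal (2^n) * ennreal ((l2 (D n))\<^sup>2))"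
    by (subst nn_integral_suminf) (auto simp: nn_integral_cmult nn_integral_L2c[OF LD])
  also have "\<dots> \<le> (\<Sum>n. ennreal ((1/2)^n))"
  proof (intro suminf_le)
    fix n
    have "(l2 (D n))\<^sup>2 \<le> ((1/2)^n)\<^sup>2"
      using d[of n] unfolding D_def by (intro power_mono) auto
    then have "2^n * (l2 (D n))\<^sup>2 \<le> 2^n * ((1/2)^n)\<^sup>2" by simp
    also have "\<dots> = (1/2)^n"
      by (simp add: power2_eq_square power_divide)
    finally show "ennreal (2^n) * ennreal ((l2 (D n))\<^sup>2) \<le> ennreal ((1/2)^n)"
      by (simp add: ennreal_mult[symmetric])
  qed auto
  also have "\<dots> = ennreal (\<Sum>n. (1/2)^n)"
    by (intro suminf_ennreal2) (auto simp: summable_geometric)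
  also have "\<dots> < \<infinity>" by simp
  finally have "AE x in lborel. (\<Sum>n. ennreal (2^n) * ennreal ((cmod (D n x))\<^sup>2)) \<noteq> \<infinity>"
    by (intro nn_integral_PInf_AE) auto
  then have conv: "AE x in lborel. convergent (\<lambda>n. F n x)"
  proof eventually_elim
    fix x assume fin: "(\<Sum>n. ennreal (2^n) * ennreal ((cmod (D n x))\<^sup>2)) \<noteq> \<infinity>"
    then obtain C where C: "C \<ge> 0" "(\<Sum>n. ennreal (2^n) * ennreal ((cmod (D n x))\<^sup>2)) = ennreal C"
      by (cases "(\<Sum>n. ennreal (2^n) * ennreal ((cmod (D n x))\<^sup>2))") auto
    have "2^n * (cmod (D n x))\<^sup>2 \<le> C" for n
    proof -
      have "ennreal (2^n) * ennreal ((cmod (D n x))\<^sup>2) \<le> (\<Sum>n. ennreal (2^n) * ennreal ((cmod (D n x))\<^sup>2))"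
        using sum_le_suminf[of "\<lambda>n. ennreal (2^n) * ennreal ((cmod (D n x))\<^sup>2)" "{n}"] by simp
      then show ?thesis using C by (simp add: ennreal_mult[symmetric])
    qed
    then have "(cmod (D n x))\<^sup>2 \<le> C / 2^n" for n
      by (simp add: pos_le_divide_eq mult.commute)
    moreover have "(sqrt C * (1 / sqrt 2)^n)\<^sup>2 = C / 2^n" for n
    proof -
      have "((1 / sqrt 2)^n)\<^sup>2 = ((1 / sqrt 2)\<^sup>2)^n" by (simp only: power_mult[symmetric] mult.commute)
      then show ?thesis using C(1) by (simp add: power_mult_distrib power_divide)
    qed
    ultimately have "(cmod (D n x))\<^sup>2 \<le> (sqrt C * (1 / sqrt 2)^n)\<^sup>2" for n
      by simp
    then have le: "cmod (D n x) \<le> sqrt C * (1 / sqrt 2)^n" for n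
      by (rule power2_le_imp_le) (use C(1) in auto)
    have "summable (\<lambda>n. sqrt C * (1 / sqrt 2)^n)"
      by (rule summable_mult, rule summable_geometric) simp
    then have "summable (\<lambda>n. D n x)"
      by (rule summable_comparison_test'[where N=0]) (rule le)
    then have "convergent (\<lambda>n. \<Sum>i<n. D i x)"
      by (simp add: summable_iff_convergent)
    then have "convergent (\<lambda>n. F n x - F 0 x)"
      unfolding D_def by (simp only: sum_lessThan_telescope[of "\<lambda>n. F n x"])
    then show "convergent (\<lambda>n. F n x)"
      using convergent_add[OF _ convergent_const[of "F 0 x"]] by force
  qed
  have [measurable]: "G \<in> borel_measurable borel"
    unfolding G_def Cauchy_convergent_iff[symmetric]
    by (intro measurable_If borel_measurable_lim_metric) measurable
  show lim: "AE x in lborel. (\<lambda>n. F n x) \<longlonglongrightarrow> G x"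
    using conv by eventually_elim (auto simp: G_def convergent_LIMSEQ_iff)
  have FG: "L2c (\<lambda>x. F n x - G x) \<and> l2 (\<lambda>x. F n x - G x) \<le> 2 * (1/2)^n" for n
  proof -
    let ?E = "\<lambda>k x. F n x - F (n + k) x"
    have 1: "L2c (?E k)" for k by (intro L2c_diff L)
    have 2: "l2 (?E k) \<le> 2 * (1/2)^n" for k
      using l2_fast_Cauchy_diff[OF L d, of n k] by (subst l2_commute)
    have 3: "AE x in lborel. (\<lambda>k. ?E k x) \<longlonglongrightarrow> F n x - G x"
      using lim
    proof eventually_elim
      fix x assume "(\<lambda>k. F k x) \<longlonglongrightarrow> G x"
      then have "(\<lambda>k. F (k + n) x) \<longlonglongrightarrow> G x"
        by (rule LIMSEQ_ignore_initial_segment)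
      then show "(\<lambda>k. ?E k x) \<longlonglongrightarrow> F n x - G x"
        unfolding add.commute[of n] by (intro tendsto_intros)
    qed
    show ?thesis
      using L2c_Fatou[of ?E, OF 1 2 _ 3] by simp
  qed
  then show "\<And>n. l2 (\<lambda>x. F n x - G x) \<le> 2 * (1/2)^n" by blast
  show "L2c G"
    using L2c_diff[OF L[of 0], of "\<lambda>x. F 0 x - G x"] FG[of 0] by simp
qed

section \<open>Invariance of Lebesgue measure under translations and reflections\<close>

lemma distr_lborel_uminus: "distr lborel borel uminus = (lborel :: 'a::euclidean_space measure)"
  by (subst lborel_affine[of "-1" 0]) (auto simp: density_1 one_ennreal_def[symmetric])

lemma nn_integral_shift:
  fixes f :: "'a::euclidean_space \<Rightarrow> ennreal"
  assumes [measurable]: "f \<in> borel_measurable borel"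
  shows "(\<integral>\<^sup>+x. f (c + x) \<partial>lborel) = (\<integral>\<^sup>+x. f x \<partial>lborel)"
  by (subst (2) lborel_distr_plus[of c, symmetric]) (simp add: nn_integral_distr)

lemma nn_integral_reflect:
  fixes f :: "'a::euclidean_space \<Rightarrow> ennreal"
  assumes [measurable]: "f \<in> borel_measurable borel"
  shows "(\<integral>\<^sup>+x. f (- x) \<partial>lborel) = (\<integral>\<^sup>+x. f x \<partial>lborel)"
  by (subst (2) distr_lborel_uminus[symmetric]) (simp add: nn_integral_distr)

lemma nn_integral_const_minus:
  fixes f :: "'a::euclidean_space \<Rightarrow> ennreal"
  assumes [measurable]: "f \<in> borel_measurable borel"
  shows "(\<integral>\<^sup>+x. f (c - x) \<partial>lborel) = (\<integral>\<^sup>+x. f x \<partial>lborel)"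
  using nn_integral_reflect[of "\<lambda>x. f (c + x)"] nn_integral_shift[of f c] by simp

lemma integral_shift:
  fixes f :: "'a::euclidean_space \<Rightarrow> 'b::{banach, second_countable_topology}"
  assumes [measurable]: "f \<in> borel_measurable borel"
  shows "(LINT x|lborel. f (c + x)) = (LINT x|lborel. f x)"
  by (subst (2) lborel_distr_plus[of c, symmetric]) (simp add: integral_distr)

lemma integral_reflect:
  fixes f :: "'a::euclidean_space \<Rightarrow> 'b::{banach, second_countable_topology}"
  assumes [measurable]: "f \<in> borel_measurable borel"
  shows "(LINT x|lborel. f (- x)) = (LINT x|lborel. f x)"
  by (subst (2) distr_lborel_uminus[symmetric]) (simp add: integral_distr)

lemma integrable_shift:
  fixes f :: "'a::euclidean_space \<Rightarrow> 'b::{banach, second_countable_topology}"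
  assumes "integrable lborel f"
  shows "integrable lborel (\<lambda>x. f (c + x))"
  using integrable_distr[of "(+) c" lborel borel f] assms by (simp add: lborel_distr_plus)

lemma integrable_reflect:
  fixes f :: "'a::euclidean_space \<Rightarrow> 'b::{banach, second_countable_topology}"
  assumes "integrable lborel f"
  shows "integrable lborel (\<lambda>x. f (- x))"
  using integrable_distr[of uminus lborel borel f] assms by (simp add: distr_lborel_uminus)

lemma AE_reflect:
  assumes "AE x in lborel. P (x::'a::euclidean_space)"
  shows "AE x in lborel. P (- x)"
  using AE_distrD[of uminus lborel borel P] assms unfolding distr_lborel_uminus by simp

lemma AE_shift:
  assumes "AE x in lborel. P (x::'a::euclidean_space)"
  shows "AE x in lborel. P (c + x)"
  using AE_distrD[of "(+) c" lborel borel P] assms unfolding lborel_distr_plus by simp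

lemma AE_const_minus:
  assumes "AE x in lborel. P (x::'a::euclidean_space)"
  shows "AE x in lborel. P (c - x)"
  using AE_reflect[OF AE_shift[OF assms, of c]] by simp

lemma L2c_shift:
  assumes "L2c F"
  shows "L2c (\<lambda>x. F (c + x))" "l2 (\<lambda>x. F (c + x)) = l2 F"
proof -
  note [measurable] = L2c_measurable[OF assms]
  show "L2c (\<lambda>x. F (c + x))"
    using integrable_shift[OF L2c_integrable[OF assms], of c] by (simp add: L2c_def)
  show "l2 (\<lambda>x. F (c + x)) = l2 F"
    using integral_shift[of "\<lambda>x. (cmod (F x))\<^sup>2" c] by (simp add: l2_def)
qed

lemma L2c_reflect:
  assumes "L2c F"
  shows "L2c (\<lambda>x. F (- x))" "l2 (\<lambda>x. F (- x)) = l2 F"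
proof -
  note [measurable] = L2c_measurable[OF assms]
  show "L2c (\<lambda>x. F (- x))"
    using integrable_reflect[OF L2c_integrable[OF assms]] by (simp add: L2c_def)
  show "l2 (\<lambda>x. F (- x)) = l2 F"
    using integral_reflect[of "\<lambda>x. (cmod (F x))\<^sup>2"] by (simp add: l2_def)
qed

lemma L2c_const_minus:
  assumes "L2c F"
  shows "L2c (\<lambda>x. F (c - x))" "l2 (\<lambda>x. F (c - x)) = l2 F"
  using L2c_reflect[OF L2c_shift(1)[OF assms, of c]] L2c_shift(2)[OF assms, of c] by simp_all

subsection \<open>Gaussian integrals\<close>

lemma borel_measurable_cis [measurable]:
  assumes [measurable]: "f \<in> borel_measurable M"
  shows "(\<lambda>x. cis (f x)) \<in> borel_measurable M"
  by (rule borel_measurable_continuous_on[OF _ assms, of cis]) (intro continuous_intros)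

lemma nn_integral_scale:
  fixes f :: "'a::euclidean_space \<Rightarrow> ennreal"
  assumes [measurable]: "f \<in> borel_measurable borel" and c: "c > 0"
  shows "(\<integral>\<^sup>+x. f x \<partial>lborel) = ennreal (c ^ DIM('a)) * (\<integral>\<^sup>+x. f (c *\<^sub>R x) \<partial>lborel)"
  by (subst lborel_affine[of c 0])
    (use c in \<open>auto simp: nn_integral_density nn_integral_distr nn_integral_cmult\<close>)

lemma integral_affine:
  fixes f :: "'a::euclidean_space \<Rightarrow> 'b::{banach, second_countable_topology}"
  assumes [measurable]: "f \<in> borel_measurable borel" and c: "c > 0"
  shows "(LINT x|lborel. f x) = c ^ DIM('a) *\<^sub>R (LINT x|lborel. f (t + c *\<^sub>R x))"
  by (subst lborel_affine[of c t])
    (use c in \<open>auto simp: integral_density integral_distr\<close>)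

lemma integral_prod_Basis:
  fixes f :: "'a::euclidean_space \<Rightarrow> real \<Rightarrow> complex"
  assumes f: "\<And>b. b \<in> Basis \<Longrightarrow> integrable lborel (f b)"
  shows "(LINT x|lborel. (\<Prod>b\<in>Basis. f b (x \<bullet> b))) = (\<Prod>b\<in>Basis. LINT u|lborel. f b u)"
    and "integrable lborel (\<lambda>x. \<Prod>b\<in>Basis. f b (x \<bullet> b))"
proof -
  interpret product_sigma_finite "\<lambda>b::'a. lborel :: real measure" ..
  let ?M = "\<Pi>\<^sub>M b\<in>(Basis::'a set). (lborel :: real measure)"
  let ?S = "\<lambda>g. \<Sum>b\<in>(Basis::'a set). g b *\<^sub>R b"
  have [measurable]: "\<And>b. b \<in> Basis \<Longrightarrow> f b \<in> borel_measurable borel"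
    using f by (auto dest: borel_measurable_integrable)
  have S [measurable]: "?S \<in> measurable ?M borel" by measurable
  have P [measurable]: "(\<lambda>x. \<Prod>b\<in>Basis. f b (x \<bullet> b)) \<in> borel_measurable borel" by measurable
  have e: "(\<Prod>b\<in>Basis. f b (?S g \<bullet> b)) = (\<Prod>b\<in>Basis. f b (g b))" for g
    by (intro prod.cong refl) (simp add: inner_sum_left_Basis)
  show "(LINT x|lborel. (\<Prod>b\<in>Basis. f b (x \<bullet> b))) = (\<Prod>b\<in>Basis. LINT u|lborel. f b u)"
    by (subst lborel_eq, subst integral_distr[OF S P]) (simp only: e product_integral_prod[OF finite_Basis f])
  show "integrable lborel (\<lambda>x. \<Prod>b\<in>Basis. f b (x \<bullet> b))"
    by (subst lborel_eq, subst integrable_distr_eq[OF S P]) (simp only: e, rule product_integrable_prod[OF finite_Basis f])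
qed

text \<open>Up to the factor sqrt(2 pi) the integral is the characteristic function of the standard
  normal distribution.\<close>

lemma gauss_ft_real:
  "(LINT u|lborel. complex_of_real (exp (- u\<^sup>2 / 2)) * cis (u * t)) = complex_of_real (sqrt (2 * pi) * exp (- t\<^sup>2 / 2))"
  "integrable lborel (\<lambda>u. complex_of_real (exp (- u\<^sup>2 / 2)) * cis (u * t))"
proof -
  have e: "exp (- u\<^sup>2 / 2) = sqrt (2 * pi) * std_normal_density u" for u
    by (simp add: std_normal_density_def)
  have "complex_of_real (exp (- t\<^sup>2 / 2)) = char std_normal_distribution t"
    by (simp add: char_std_normal_distribution)
  also have "\<dots> = (LINT u|lborel. std_normal_density u *\<^sub>R iexp (t * u))"
    unfolding char_def by (subst integral_density) (auto simp: normal_density_nonneg)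
  finally have "(LINT u|lborel. complex_of_real (std_normal_density u) * cis (u * t)) = complex_of_real (exp (- t\<^sup>2 / 2))"
    by (simp add: scaleR_conv_of_real cis_conv_exp mult.commute)
  moreover have "(LINT u|lborel. complex_of_real (exp (- u\<^sup>2 / 2)) * cis (u * t))
      = complex_of_real (sqrt (2 * pi)) * (LINT u|lborel. complex_of_real (std_normal_density u) * cis (u * t))"
    by (subst integral_mult_right_zero[symmetric]) (simp only: e of_real_mult mult.assoc)
  ultimately show "(LINT u|lborel. complex_of_real (exp (- u\<^sup>2 / 2)) * cis (u * t)) = complex_of_real (sqrt (2 * pi) * exp (- t\<^sup>2 / 2))"
    by simp
  have "integrable lborel (\<lambda>u. complex_of_real (sqrt (2 * pi) * std_normal_density u) * cis (u * t))"
    by (rule Bochner_Integration.integrable_bound[where f="\<lambda>u. sqrt (2 * pi) * std_normal_density u"])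
      (auto simp: norm_mult)
  then show "integrable lborel (\<lambda>u. complex_of_real (exp (- u\<^sup>2 / 2)) * cis (u * t))"
    by (simp only: e)
qed

lemma cis_sum: "finite A \<Longrightarrow> cis (\<Sum>i\<in>A. f i) = (\<Prod>i\<in>A. cis (f i))"
  by (induction A rule: finite_induct) (auto simp: cis_mult[symmetric])

text \<open>The Gaussian and the character are both products over the coordinates, so the
  one-dimensional formula applies in each of them.\<close>

lemma gauss_ft:
  fixes x :: pt
  shows "(LINT \<xi>|lborel. complex_of_real (exp (- (norm \<xi>)\<^sup>2 / 2)) * cis (\<xi> \<bullet> x)) = complex_of_real (2 * pi * exp (- (norm x)\<^sup>2 / 2))"
    and "integrable lborel (\<lambda>\<xi>. complex_of_real (exp (- (norm \<xi>)\<^sup>2 / 2)) * cis (\<xi> \<bullet> x))"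
proof -
  define f where "f b u = complex_of_real (exp (- u\<^sup>2 / 2)) * cis (u * (x \<bullet> b))" for b :: pt and u
  have nrm: "(norm y)\<^sup>2 = (\<Sum>b\<in>Basis. (y \<bullet> b)\<^sup>2)" for y :: pt
    by (subst power2_norm_eq_inner, subst euclidean_inner) (simp add: power2_eq_square)
  have exps: "exp (- (norm y)\<^sup>2 / 2) = (\<Prod>b\<in>Basis. exp (- (y \<bullet> b)\<^sup>2 / 2))" for y :: pt
    by (subst exp_sum[symmetric]) (auto simp: nrm sum_negf sum_divide_distrib)
  have e: "(\<lambda>\<xi>. complex_of_real (exp (- (norm \<xi>)\<^sup>2 / 2)) * cis (\<xi> \<bullet> x)) = (\<lambda>\<xi>. \<Prod>b\<in>Basis. f b (\<xi> \<bullet> b))"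
    unfolding f_def prod.distrib of_real_prod[symmetric] exps[symmetric]
    by (subst cis_sum[symmetric]) (auto simp: euclidean_inner[symmetric])
  have int: "integrable lborel (f b)" for b
    unfolding f_def by (rule gauss_ft_real)
  have "(LINT \<xi>|lborel. (\<Prod>b\<in>Basis. f b (\<xi> \<bullet> b))) = (\<Prod>b\<in>Basis. complex_of_real (sqrt (2 * pi) * exp (- (x \<bullet> b)\<^sup>2 / 2)))"
    by (subst integral_prod_Basis(1)[OF int]) (simp only: f_def[abs_def] gauss_ft_real(1))
  also have "\<dots> = complex_of_real (sqrt (2 * pi) ^ 2 * exp (- (norm x)\<^sup>2 / 2))"
    by (simp only: of_real_prod[symmetric] prod.distrib exps[symmetric]) simp
  finally show "(LINT \<xi>|lborel. complex_of_real (exp (- (norm \<xi>)\<^sup>2 / 2)) * cis (\<xi> \<bullet> x)) = complex_of_real (2 * pi * exp (- (norm x)\<^sup>2 / 2))"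
    unfolding e by simp
  show "integrable lborel (\<lambda>\<xi>. complex_of_real (exp (- (norm \<xi>)\<^sup>2 / 2)) * cis (\<xi> \<bullet> x))"
    unfolding e by (rule integral_prod_Basis(2)[OF int])
qed

lemma integrable_gauss: "integrable lborel (\<lambda>\<xi>::pt. exp (- (norm \<xi>)\<^sup>2 / 2))"
  using integrable_norm[OF gauss_ft(2)[of 0]] by (simp add: norm_mult)

lemma integral_gauss: "(LINT \<xi>|lborel. exp (- (norm (\<xi>::pt))\<^sup>2 / 2)) = 2 * pi"
proof -
  have "complex_of_real (LINT \<xi>|lborel. exp (- (norm (\<xi>::pt))\<^sup>2 / 2)) = complex_of_real (2 * pi)"
    using gauss_ft(1)[of 0] by (subst integral_complex_of_real[symmetric]) simp
  then show ?thesis by (simp only: of_real_eq_iff)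
qed

lemma gauss_ft_scaled:
  fixes x :: pt
  assumes e: "e > 0"
  shows "(LINT \<xi>|lborel. complex_of_real (exp (- e\<^sup>2 * (norm \<xi>)\<^sup>2 / 2)) * cis (\<xi> \<bullet> x))
      = complex_of_real (2 * pi / e\<^sup>2 * exp (- (norm x)\<^sup>2 / (2 * e\<^sup>2)))"
    and "integrable lborel (\<lambda>\<xi>::pt. exp (- e\<^sup>2 * (norm \<xi>)\<^sup>2 / 2))"
proof -
  let ?f = "\<lambda>\<xi>. complex_of_real (exp (- e\<^sup>2 * (norm \<xi>)\<^sup>2 / 2)) * cis (\<xi> \<bullet> x)"
  have "(LINT \<xi>|lborel. ?f \<xi>) = (1/e) ^ DIM(pt) *\<^sub>R (LINT \<xi>|lborel. ?f (0 + (1/e) *\<^sub>R \<xi>))"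
    using e by (intro integral_affine) auto
  also have "(\<lambda>\<xi>. ?f (0 + (1/e) *\<^sub>R \<xi>)) = (\<lambda>\<xi>. complex_of_real (exp (- (norm \<xi>)\<^sup>2 / 2)) * cis (\<xi> \<bullet> ((1/e) *\<^sub>R x)))"
    using e by (simp add: power_mult_distrib power_divide)
  also have "(1/e) ^ DIM(pt) *\<^sub>R (LINT \<xi>|lborel. complex_of_real (exp (- (norm \<xi>)\<^sup>2 / 2)) * cis (\<xi> \<bullet> ((1/e) *\<^sub>R x)))
      = complex_of_real (2 * pi / e\<^sup>2 * exp (- (norm x)\<^sup>2 / (2 * e\<^sup>2)))"
    unfolding gauss_ft(1) using e by (simp add: power_divide power_mult_distrib) (simp add: scaleR_conv_of_real)
  finally show "(LINT \<xi>|lborel. ?f \<xi>) = complex_of_real (2 * pi / e\<^sup>2 * exp (- (norm x)\<^sup>2 / (2 * e\<^sup>2)))" .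
  have "(\<integral>\<^sup>+\<xi>. ennreal (exp (- (norm (\<xi>::pt))\<^sup>2 / 2)) \<partial>lborel) < \<infinity>"
    using integrable_gauss by (simp add: integrable_iff_bounded)
  also have "(\<integral>\<^sup>+\<xi>. ennreal (exp (- (norm (\<xi>::pt))\<^sup>2 / 2)) \<partial>lborel)
      = ennreal (e ^ DIM(pt)) * (\<integral>\<^sup>+\<xi>. ennreal (exp (- (norm (e *\<^sub>R (\<xi>::pt)))\<^sup>2 / 2)) \<partial>lborel)"
    using e by (intro nn_integral_scale) auto
  finally have "(\<integral>\<^sup>+\<xi>. ennreal (exp (- (norm (e *\<^sub>R (\<xi>::pt)))\<^sup>2 / 2)) \<partial>lborel) < \<infinity>"
    using e by (auto simp: ennreal_mult_less_top)
  then show "integrable lborel (\<lambda>\<xi>::pt. exp (- e\<^sup>2 * (norm \<xi>)\<^sup>2 / 2))"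
    by (intro integrableI_bounded) (auto simp: power_mult_distrib)
qed

subsection \<open>Continuity of translations\<close>

lemma Fubini_swap:
  fixes f :: "'a::euclidean_space \<Rightarrow> 'b::euclidean_space \<Rightarrow> 'c::{banach, second_countable_topology}"
  assumes [measurable]: "case_prod f \<in> borel_measurable (borel \<Otimes>\<^sub>M borel)"
    and fin: "(\<integral>\<^sup>+x. \<integral>\<^sup>+y. ennreal (norm (f x y)) \<partial>lborel \<partial>lborel) < \<infinity>"
  shows "integrable (lborel \<Otimes>\<^sub>M lborel) (case_prod f)"
    and "(LINT x|lborel. LINT y|lborel. f x y) = (LINT y|lborel. LINT x|lborel. f x y)"
proof -
  have s: "sets (lborel \<Otimes>\<^sub>M lborel :: ('a \<times> 'b) measure) = sets (borel \<Otimes>\<^sub>M borel)"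
    by (intro sets_pair_measure_cong) auto
  have [measurable]: "case_prod f \<in> borel_measurable (lborel \<Otimes>\<^sub>M lborel)"
    using assms(1) by (simp add: measurable_cong_sets[OF s refl])
  show *: "integrable (lborel \<Otimes>\<^sub>M lborel) (case_prod f)"
  proof (rule integrableI_bounded)
    have "(\<integral>\<^sup>+p. ennreal (norm (case_prod f p)) \<partial>(lborel \<Otimes>\<^sub>M lborel)) = (\<integral>\<^sup>+x. \<integral>\<^sup>+y. ennreal (norm (f x y)) \<partial>lborel \<partial>lborel)"
      by (subst lborel.nn_integral_fst[symmetric]) auto
    then show "(\<integral>\<^sup>+p. ennreal (norm (case_prod f p)) \<partial>(lborel \<Otimes>\<^sub>M lborel)) < \<infinity>"
      using fin by simp
  qed measurable
  show "(LINT x|lborel. LINT y|lborel. f x y) = (LINT y|lborel. LINT x|lborel. f x y)"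
    by (rule lborel_pair.Fubini_integral[OF *, symmetric])
qed

lemma nn_Fubini_swap:
  fixes f :: "'a::euclidean_space \<Rightarrow> 'b::euclidean_space \<Rightarrow> ennreal"
  assumes "case_prod f \<in> borel_measurable (borel \<Otimes>\<^sub>M borel)"
  shows "(\<integral>\<^sup>+x. \<integral>\<^sup>+y. f x y \<partial>lborel \<partial>lborel) = (\<integral>\<^sup>+y. \<integral>\<^sup>+x. f x y \<partial>lborel \<partial>lborel)"
proof -
  have s: "sets (lborel \<Otimes>\<^sub>M lborel :: ('a \<times> 'b) measure) = sets (borel \<Otimes>\<^sub>M borel)"
    by (intro sets_pair_measure_cong) auto
  have "case_prod f \<in> borel_measurable (lborel \<Otimes>\<^sub>M lborel)"
    using assms by (simp add: measurable_cong_sets[OF s refl])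
  then show ?thesis
    by (rule lborel_pair.Fubini'[symmetric])
qed

text \<open>The \<open>L^1\<close> modulus of continuity of \<open>f\<close> under translation by
  \<open>h\<close>.\<close>

definition tdist :: "(pt \<Rightarrow> real) \<Rightarrow> pt \<Rightarrow> real" where
  "tdist f h = (LINT x|lborel. \<bar>f (h + x) - f x\<bar>)"

text \<open>For p, q in {0, 1} one has |p - q| = p + q - 2pq, so only the integral of the product of
  the two indicators depends on the shift. That product vanishes off \<open>U\<close>, and at points
  of \<open>U\<close> it converges because \<open>U\<close> is open; the boundary never
  enters.\<close>

lemma tdist_open:
  fixes h :: "nat \<Rightarrow> pt"
  assumes U: "open U" "emeasure lborel U < \<infinity>" and h: "h \<longlonglongrightarrow> 0"
  shows "(\<lambda>n. tdist (indicator U) (h n)) \<longlonglongrightarrow> 0"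
proof -
  have [measurable]: "U \<in> sets borel" using U by simp
  let ?I = "indicator U :: pt \<Rightarrow> real"
  have int: "integrable lborel ?I" using U by (simp add: integrable_indicator_iff)
  have int': "integrable lborel (\<lambda>x. ?I (c + x))" for c by (rule integrable_shift[OF int])
  have intp: "integrable lborel (\<lambda>x. ?I (c + x) * ?I x)" for c
    by (rule Bochner_Integration.integrable_bound[OF int]) (auto simp: indicator_def)
  have eq: "tdist ?I c = 2 * (LINT x|lborel. ?I x) - 2 * (LINT x|lborel. ?I (c + x) * ?I x)" for c
  proof -
    have "tdist ?I c = (LINT x|lborel. (?I (c + x) + ?I x) - 2 * (?I (c + x) * ?I x))"
      unfolding tdist_def by (intro Bochner_Integration.integral_cong) (auto simp: indicator_def)
    also have "\<dots> = (LINT x|lborel. ?I (c + x)) + (LINT x|lborel. ?I x) - 2 * (LINT x|lborel. ?I (c + x) * ?I x)"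
      using int int' intp by simp
    also have "(LINT x|lborel. ?I (c + x)) = (LINT x|lborel. ?I x)"
      by (rule integral_shift) simp
    finally show ?thesis by simp
  qed
  have "(\<lambda>n. LINT x|lborel. ?I (h n + x) * ?I x) \<longlonglongrightarrow> (LINT x|lborel. ?I x)"
  proof (rule integral_dominated_convergence[where w="?I"])
    show "AE x in lborel. (\<lambda>n. ?I (h n + x) * ?I x) \<longlonglongrightarrow> ?I x"
    proof (rule AE_I2)
      fix x
      show "(\<lambda>n. ?I (h n + x) * ?I x) \<longlonglongrightarrow> ?I x"
      proof (cases "x \<in> U")
        case True
        have "(\<lambda>n. h n + x) \<longlonglongrightarrow> 0 + x" by (intro tendsto_intros h)
        then have "\<forall>\<^sub>F n in sequentially. h n + x \<in> U"
          using topological_tendstoD[OF _ U(1)] True by simp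
        then have "\<forall>\<^sub>F n in sequentially. ?I (h n + x) * ?I x = ?I x"
          by eventually_elim (use True in simp)
        then show ?thesis by (rule tendsto_eventually)
      qed simp
    qed
  qed (auto simp: int indicator_def)
  from tendsto_diff[OF tendsto_const[of "2 * (LINT x|lborel. ?I x)"] tendsto_mult[OF tendsto_const[of 2] this]]
  show ?thesis unfolding eq by simp
qed

lemma tdist_le:
  assumes f: "integrable lborel f" and g: "integrable lborel g"
  shows "tdist f h \<le> tdist g h + 2 * (LINT x|lborel. \<bar>f x - g x\<bar>)"
proof -
  have i: "integrable lborel (\<lambda>x. \<bar>f x - g x\<bar>)" using f g by simp
  have i': "integrable lborel (\<lambda>x. \<bar>f (h + x) - g (h + x)\<bar>)" using integrable_shift[OF i] by simp
  have j: "integrable lborel (\<lambda>x. \<bar>g (h + x) - g x\<bar>)" using integrable_shift[OF g] g by simp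
  have [measurable]: "f \<in> borel_measurable borel" "g \<in> borel_measurable borel" using f g by auto
  have "tdist f h \<le> (LINT x|lborel. \<bar>g (h + x) - g x\<bar> + (\<bar>f (h + x) - g (h + x)\<bar> + \<bar>f x - g x\<bar>))"
    unfolding tdist_def using i i' j integrable_shift[OF f, of h] f by (intro integral_mono) auto
  also have "\<dots> = tdist g h + ((LINT x|lborel. \<bar>f (h + x) - g (h + x)\<bar>) + (LINT x|lborel. \<bar>f x - g x\<bar>))"
    using i i' j by (simp add: tdist_def)
  also have "(LINT x|lborel. \<bar>f (h + x) - g (h + x)\<bar>) = (LINT x|lborel. \<bar>f x - g x\<bar>)"
    by (rule integral_shift[of "\<lambda>x. \<bar>f x - g x\<bar>"]) simp
  finally show ?thesis by simp
qed

lemma tdist_nonneg: "tdist f h \<ge> 0"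
  unfolding tdist_def by simp

lemma tendsto_0_if_le_eps:
  fixes a :: "nat \<Rightarrow> real"
  assumes nn: "\<And>n. 0 \<le> a n"
    and ap: "\<And>e. e > 0 \<Longrightarrow> \<exists>b. b \<longlonglongrightarrow> 0 \<and> (\<forall>n. a n \<le> b n + e)"
  shows "a \<longlonglongrightarrow> 0"
proof (rule LIMSEQ_I)
  fix r :: real assume r: "r > 0"
  then obtain b where b: "b \<longlonglongrightarrow> 0" "\<And>n. a n \<le> b n + r/2"
    using ap[of "r/2"] by auto
  obtain N where "\<And>n. n \<ge> N \<Longrightarrow> norm (b n - 0) < r/2"
    using LIMSEQ_D[OF b(1), of "r/2"] r by auto
  then have "norm (a n - 0) < r" if "n \<ge> N" for n
    using b(2)[of n] nn[of n] that by fastforce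
  then show "\<exists>N. \<forall>n\<ge>N. norm (a n - 0) < r" by blast
qed

text \<open>By \<open>tdist_le\<close>, changing \<open>f\<close> changes \<open>tdist\<close> by at
  most twice the \<open>L^1\<close> distance, uniformly in the shift. So a Borel set may be replaced
  by an open superset of almost the same measure, and a general function by its simple
  approximations.\<close>

lemma tdist_tendsto_0:
  fixes h :: "nat \<Rightarrow> pt"
  assumes f: "integrable lborel f" and h: "h \<longlonglongrightarrow> 0"
  shows "(\<lambda>n. tdist f (h n)) \<longlonglongrightarrow> 0"
  using f
proof (induction f rule: integrable_induct)
  case (base A c)
  have [measurable]: "A \<in> sets borel" using base by simp
  have intA: "integrable lborel (indicator A :: pt \<Rightarrow> real)" using base by (simp add: integrable_indicator_iff)
  have "(\<lambda>n. tdist (indicator A) (h n)) \<longlonglongrightarrow> 0"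
  proof (rule tendsto_0_if_le_eps)
    fix e :: real assume e: "e > 0"
    obtain U where U: "open U" "A \<subseteq> U" "emeasure lborel (U - A) < ennreal (e/2)"
      using outer_regular_lborel[of A "e/2"] e by auto
    have [measurable]: "U \<in> sets borel" using U by simp
    have "emeasure lborel U = emeasure lborel A + emeasure lborel (U - A)"
      using U(2) by (subst plus_emeasure) (auto simp: Un_absorb1)
    then have fin: "emeasure lborel U < \<infinity>"
      using base(2) U(3) by (auto simp: less_top[symmetric] intro: order.strict_trans)
    then have intU: "integrable lborel (indicator U :: pt \<Rightarrow> real)" by (simp add: integrable_indicator_iff)
    have "(LINT x|lborel. \<bar>indicator A x - indicator U x\<bar>) = (LINT x|lborel. indicator (U - A) x :: real)"
      using U(2) by (intro Bochner_Integration.integral_cong) (auto simp: indicator_def)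
    also have "\<dots> \<le> e / 2"
    proof -
      have "ennreal (measure lborel (U - A)) < ennreal (e/2)"
        using U(3) by (subst emeasure_eq_ennreal_measure[symmetric]) auto
      then show ?thesis using e by (simp add: ennreal_less_iff)
    qed
    finally have "tdist (indicator A) (h n) \<le> tdist (indicator U) (h n) + e" for n
      using tdist_le[OF intA intU, of "h n"] by linarith
    then show "\<exists>b. b \<longlonglongrightarrow> 0 \<and> (\<forall>n. tdist (indicator A) (h n) \<le> b n + e)"
      using tdist_open[OF U(1) fin h] by blast
  qed (rule tdist_nonneg)
  then have "(\<lambda>n. \<bar>c\<bar> * tdist (indicator A) (h n)) \<longlonglongrightarrow> 0"
    using tendsto_mult_right_zero by blast
  moreover have "tdist (\<lambda>x. indicator A x *\<^sub>R c) k = \<bar>c\<bar> * tdist (indicator A) k" for k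
    unfolding tdist_def integral_mult_right_zero[symmetric]
    by (intro Bochner_Integration.integral_cong refl) (simp add: left_diff_distrib[symmetric] abs_mult)
  ultimately show ?case by simp
next
  case (add f g)
  have le: "tdist (\<lambda>x. f x + g x) k \<le> tdist f k + tdist g k" for k
  proof -
    have i: "integrable lborel (\<lambda>x. \<bar>f (k + x) - f x\<bar>)" "integrable lborel (\<lambda>x. \<bar>g (k + x) - g x\<bar>)"
      "integrable lborel (\<lambda>x. \<bar>(f (k + x) + g (k + x)) - (f x + g x)\<bar>)"
      using integrable_shift[OF add.hyps(1)] integrable_shift[OF add.hyps(2)] add.hyps by auto
    have "tdist (\<lambda>x. f x + g x) k \<le> (LINT x|lborel. \<bar>f (k + x) - f x\<bar> + \<bar>g (k + x) - g x\<bar>)"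
      unfolding tdist_def by (intro integral_mono i Bochner_Integration.integrable_add) auto
    also have "\<dots> = tdist f k + tdist g k"
      unfolding tdist_def by (intro Bochner_Integration.integral_add i)
    finally show ?thesis .
  qed
  have "(\<lambda>n. tdist f (h n) + tdist g (h n)) \<longlonglongrightarrow> 0 + 0"
    by (intro tendsto_add add.IH)
  then have lim: "(\<lambda>n. tdist f (h n) + tdist g (h n)) \<longlonglongrightarrow> 0" by simp
  show ?case
    by (rule tendsto_sandwich[OF _ _ tendsto_const lim]) (auto simp: tdist_nonneg le)
next
  case (lim f s)
  have [measurable]: "f \<in> borel_measurable borel" "\<And>i. s i \<in> borel_measurable borel" using lim.hyps(1,4) by auto
  have "(\<lambda>i. LINT x|lborel. \<bar>f x - s i x\<bar>) \<longlonglongrightarrow> (LINT x|(lborel::pt measure). 0)"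
  proof (rule integral_dominated_convergence[where w="\<lambda>x. 3 * \<bar>f x\<bar>"])
    show "AE x in lborel. (\<lambda>i. \<bar>f x - s i x\<bar>) \<longlonglongrightarrow> 0"
    proof (rule AE_I2)
      fix x
      have "(\<lambda>i. \<bar>f x - s i x\<bar>) \<longlonglongrightarrow> \<bar>f x - f x\<bar>" using lim.hyps(2)[of x] by (intro tendsto_intros) auto
      then show "(\<lambda>i. \<bar>f x - s i x\<bar>) \<longlonglongrightarrow> 0" by simp
    qed
    show "AE x in lborel. norm \<bar>f x - s i x\<bar> \<le> 3 * \<bar>f x\<bar>" for i
    proof (rule AE_I2)
      fix x show "norm \<bar>f x - s i x\<bar> \<le> 3 * \<bar>f x\<bar>" using lim.hyps(3)[of x i] by auto
    qed
  qed (use lim.hyps in auto)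
  then have L: "(\<lambda>i. LINT x|lborel. \<bar>f x - s i x\<bar>) \<longlonglongrightarrow> 0" by simp
  show ?case
  proof (rule tendsto_0_if_le_eps)
    fix e :: real assume "e > 0"
    then obtain i where "norm ((LINT x|lborel. \<bar>f x - s i x\<bar>) - 0) < e/2"
      using LIMSEQ_D[OF L, of "e/2"] by auto
    then have "tdist f (h n) \<le> tdist (s i) (h n) + e" for n
      using tdist_le[OF lim.hyps(4) lim.hyps(1)[of i], of "h n"] by auto
    then show "\<exists>b. b \<longlonglongrightarrow> 0 \<and> (\<forall>n. tdist f (h n) \<le> b n + e)"
      using lim.IH by blast
  qed (rule tdist_nonneg)
qed

text \<open>This turns \<open>L^1\<close> continuity of translations, applied to squares, into
  \<open>L^2\<close> continuity for nonnegative functions.\<close>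

lemma abs_diff_square_le:
  fixes a b :: real
  assumes "a \<ge> 0" "b \<ge> 0"
  shows "(a - b)\<^sup>2 \<le> \<bar>a\<^sup>2 - b\<^sup>2\<bar>"
proof -
  have "(a - b)\<^sup>2 = \<bar>a - b\<bar> * \<bar>a - b\<bar>" by (simp add: power2_eq_square)
  also have "\<dots> \<le> \<bar>a - b\<bar> * \<bar>a + b\<bar>" using assms by (intro mult_left_mono) auto
  also have "\<dots> = \<bar>a\<^sup>2 - b\<^sup>2\<bar>" by (simp add: abs_mult[symmetric] power2_eq_square algebra_simps)
  finally show ?thesis .
qed

text \<open>The function is split into the positive and negative parts of its real and imaginary
  parts, since \<open>abs_diff_square_le\<close> compares nonnegative numbers.\<close>

lemma l2_translation_tendsto_0:
  fixes h :: "nat \<Rightarrow> pt"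
  assumes f: "L2c f" and h: "h \<longlonglongrightarrow> 0"
  shows "(\<lambda>n. l2 (\<lambda>x. f (h n + x) - f x)) \<longlonglongrightarrow> 0"
proof -
  note [measurable] = L2c_measurable[OF f]
  define p1 p2 p3 p4 where "p1 x = max (Re (f x)) 0" and "p2 x = max (- Re (f x)) 0"
    and "p3 x = max (Im (f x)) 0" and "p4 x = max (- Im (f x)) 0" for x
  have sq: "(Re z)\<^sup>2 \<le> (cmod z)\<^sup>2" "(Im z)\<^sup>2 \<le> (cmod z)\<^sup>2" for z
    by (simp_all add: cmod_power2)
  have mx: "(max a 0)\<^sup>2 \<le> a\<^sup>2" for a :: real by (auto simp: max_def)
  have int: "integrable lborel (\<lambda>x. (p1 x)\<^sup>2)" "integrable lborel (\<lambda>x. (p2 x)\<^sup>2)"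
    "integrable lborel (\<lambda>x. (p3 x)\<^sup>2)" "integrable lborel (\<lambda>x. (p4 x)\<^sup>2)"
  proof -
    have aux: "integrable lborel (\<lambda>x. (p x)\<^sup>2)"
      if [measurable]: "p \<in> borel_measurable borel" and le: "\<And>x. (p x)\<^sup>2 \<le> (cmod (f x))\<^sup>2" for p :: "pt \<Rightarrow> real"
      by (rule Bochner_Integration.integrable_bound[OF L2c_integrable[OF f]]) (use le in auto)
    have [measurable]: "p1 \<in> borel_measurable borel" "p2 \<in> borel_measurable borel" "p3 \<in> borel_measurable borel" "p4 \<in> borel_measurable borel"
      unfolding p1_def p2_def p3_def p4_def by measurable
    have "(p1 x)\<^sup>2 \<le> (cmod (f x))\<^sup>2 \<and> (p2 x)\<^sup>2 \<le> (cmod (f x))\<^sup>2 \<and> (p3 x)\<^sup>2 \<le> (cmod (f x))\<^sup>2 \<and> (p4 x)\<^sup>2 \<le> (cmod (f x))\<^sup>2" for x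
      using mx[of "Re (f x)"] mx[of "- Re (f x)"] mx[of "Im (f x)"] mx[of "- Im (f x)"] sq[of "f x"]
      unfolding p1_def p2_def p3_def p4_def power2_minus by linarith
    then show "integrable lborel (\<lambda>x. (p1 x)\<^sup>2)" "integrable lborel (\<lambda>x. (p2 x)\<^sup>2)"
    "integrable lborel (\<lambda>x. (p3 x)\<^sup>2)" "integrable lborel (\<lambda>x. (p4 x)\<^sup>2)"
      by (auto intro!: aux)
  qed
  let ?B = "\<lambda>k. 2 * (tdist (\<lambda>x. (p1 x)\<^sup>2) k + tdist (\<lambda>x. (p2 x)\<^sup>2) k + tdist (\<lambda>x. (p3 x)\<^sup>2) k + tdist (\<lambda>x. (p4 x)\<^sup>2) k)"
  have le: "(l2 (\<lambda>x. f (k + x) - f x))\<^sup>2 \<le> ?B k" for k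
  proof -
    have i: "integrable lborel (\<lambda>x. \<bar>(p1 (k + x))\<^sup>2 - (p1 x)\<^sup>2\<bar>)" "integrable lborel (\<lambda>x. \<bar>(p2 (k + x))\<^sup>2 - (p2 x)\<^sup>2\<bar>)"
       "integrable lborel (\<lambda>x. \<bar>(p3 (k + x))\<^sup>2 - (p3 x)\<^sup>2\<bar>)" "integrable lborel (\<lambda>x. \<bar>(p4 (k + x))\<^sup>2 - (p4 x)\<^sup>2\<bar>)"
      using integrable_shift[OF int(1)] integrable_shift[OF int(2)] integrable_shift[OF int(3)] integrable_shift[OF int(4)] int by auto
    have "(l2 (\<lambda>x. f (k + x) - f x))\<^sup>2 = (LINT x|lborel. (cmod (f (k + x) - f x))\<^sup>2)"
      by (simp add: l2_sq)
    also have "\<dots> \<le> (LINT x|lborel. 2 * (\<bar>(p1 (k + x))\<^sup>2 - (p1 x)\<^sup>2\<bar> + \<bar>(p2 (k + x))\<^sup>2 - (p2 x)\<^sup>2\<bar>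
        + \<bar>(p3 (k + x))\<^sup>2 - (p3 x)\<^sup>2\<bar> + \<bar>(p4 (k + x))\<^sup>2 - (p4 x)\<^sup>2\<bar>))"
    proof (rule integral_mono)
      show "integrable lborel (\<lambda>x. (cmod (f (k + x) - f x))\<^sup>2)"
        by (intro L2c_integrable L2c_diff L2c_shift f)
      fix x
      have d: "(a - b)\<^sup>2 \<le> 2 * a\<^sup>2 + 2 * b\<^sup>2" for a b :: real
        using sum_squares_bound[of a "-b"] by (simp add: power2_diff)
      have R: "Re (f (k + x) - f x) = (p1 (k + x) - p1 x) - (p2 (k + x) - p2 x)"
        and I: "Im (f (k + x) - f x) = (p3 (k + x) - p3 x) - (p4 (k + x) - p4 x)"
        by (auto simp: p1_def p2_def p3_def p4_def max_def)
      have fin: "A \<le> 2 * (a' + b' + c' + d')"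
        if "A \<le> (2 * a + 2 * b) + (2 * c + 2 * d)" "a \<le> a'" "b \<le> b'" "c \<le> c'" "d \<le> d'" for A a b c d a' b' c' d' :: real
        using that by argo
      have nn: "p1 y \<ge> 0" "p2 y \<ge> 0" "p3 y \<ge> 0" "p4 y \<ge> 0" for y
        by (auto simp: p1_def p2_def p3_def p4_def)
      have "(cmod (f (k + x) - f x))\<^sup>2 \<le> (2 * (p1 (k + x) - p1 x)\<^sup>2 + 2 * (p2 (k + x) - p2 x)\<^sup>2) + (2 * (p3 (k + x) - p3 x)\<^sup>2 + 2 * (p4 (k + x) - p4 x)\<^sup>2)"
        unfolding cmod_power2 R I by (intro add_mono d)
      then show "(cmod (f (k + x) - f x))\<^sup>2 \<le> 2 * (\<bar>(p1 (k + x))\<^sup>2 - (p1 x)\<^sup>2\<bar> + \<bar>(p2 (k + x))\<^sup>2 - (p2 x)\<^sup>2\<bar>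
        + \<bar>(p3 (k + x))\<^sup>2 - (p3 x)\<^sup>2\<bar> + \<bar>(p4 (k + x))\<^sup>2 - (p4 x)\<^sup>2\<bar>)"
        using abs_diff_square_le[OF nn(1)[of "k+x"] nn(1)[of x]] abs_diff_square_le[OF nn(2)[of "k+x"] nn(2)[of x]]
          abs_diff_square_le[OF nn(3)[of "k+x"] nn(3)[of x]] abs_diff_square_le[OF nn(4)[of "k+x"] nn(4)[of x]]
        by (rule fin)
    qed (use i in auto)
    also have "\<dots> = ?B k"
      using i by (simp add: tdist_def)
    finally show ?thesis .
  qed
  have "(\<lambda>n. ?B (h n)) \<longlonglongrightarrow> 2 * (0 + 0 + 0 + 0)"
    by (intro tendsto_mult tendsto_add tendsto_const tdist_tendsto_0 int h)
  then have B: "(\<lambda>n. ?B (h n)) \<longlonglongrightarrow> 0" by simp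
  have "(\<lambda>n. (l2 (\<lambda>x. f (h n + x) - f x))\<^sup>2) \<longlonglongrightarrow> 0"
    by (rule tendsto_sandwich[OF always_eventually always_eventually tendsto_const B]) (simp, intro allI le)
  then show ?thesis by simp
qed

subsection \<open>Plancherel's theorem\<close>

definition ftc :: "(pt \<Rightarrow> complex) \<Rightarrow> pt \<Rightarrow> complex" where
  "ftc f \<xi> = complex_of_real (1 / (2 * pi)) * (LINT x|lborel. f x * cis (- (\<xi> \<bullet> x)))"

definition iftc :: "(pt \<Rightarrow> complex) \<Rightarrow> pt \<Rightarrow> complex" where
  "iftc f x = ftc f (- x)"

definition L12 :: "(pt \<Rightarrow> complex) \<Rightarrow> bool" where
  "L12 f \<longleftrightarrow> L2c f \<and> integrable lborel f"

lemma ftc_measurable [measurable]: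
  assumes [measurable]: "f \<in> borel_measurable borel"
  shows "ftc f \<in> borel_measurable borel"
  unfolding ftc_def by measurable

lemma iftc_measurable [measurable]:
  assumes [measurable]: "f \<in> borel_measurable borel"
  shows "iftc f \<in> borel_measurable borel"
  unfolding iftc_def by measurable

lemma ftc_bound:
  assumes "integrable lborel f"
  shows "cmod (ftc f \<xi>) \<le> (1 / (2 * pi)) * (LINT x|lborel. cmod (f x))"
proof -
  have "cmod (LINT x|lborel. f x * cis (- (\<xi> \<bullet> x))) \<le> (LINT x|lborel. cmod (f x * cis (- (\<xi> \<bullet> x))))"
    by (rule integral_norm_bound)
  then show ?thesis
    by (simp add: ftc_def norm_mult norm_divide divide_right_mono)
qed

lemma integrable_mult_bounded:
  fixes f g :: "'a \<Rightarrow> complex"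
  assumes f: "integrable M f" and [measurable]: "g \<in> borel_measurable M" and b: "\<And>x. cmod (g x) \<le> c"
  shows "integrable M (\<lambda>x. f x * g x)"
proof -
  have [measurable]: "f \<in> borel_measurable M" using f by auto
  show ?thesis
  proof (rule Bochner_Integration.integrable_bound)
    show "integrable M (\<lambda>x. c * cmod (f x))" using f by simp
    show "AE x in M. norm (f x * g x) \<le> norm (c * cmod (f x))"
    proof (rule AE_I2)
      fix x
      have "cmod (f x) * cmod (g x) \<le> cmod (f x) * c" by (intro mult_left_mono b) auto
      also have "\<dots> \<le> \<bar>c\<bar> * cmod (f x)" by (simp add: mult.commute mult_right_mono)
      finally show "norm (f x * g x) \<le> norm (c * cmod (f x))" by (simp add: norm_mult abs_mult)
    qed
  qed measurable
qed

lemma ftc_mult_formula: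
  assumes f: "integrable lborel f" and g: "integrable lborel g"
  shows "(LINT \<xi>|lborel. g \<xi> * ftc f \<xi>) = (LINT x|lborel. f x * ftc g x)"
proof -
  have [measurable]: "f \<in> borel_measurable borel" "g \<in> borel_measurable borel" using f g by auto
  have fin: "(\<integral>\<^sup>+x. ennreal (cmod (f x)) \<partial>lborel) < \<infinity>" "(\<integral>\<^sup>+x. ennreal (cmod (g x)) \<partial>lborel) < \<infinity>"
    using f g by (auto simp: integrable_iff_bounded)
  have 1: "(LINT \<xi>|lborel. LINT x|lborel. g \<xi> * (f x * cis (- (\<xi> \<bullet> x)))) = (LINT x|lborel. LINT \<xi>|lborel. g \<xi> * (f x * cis (- (\<xi> \<bullet> x))))"
  proof (rule Fubini_swap(2))
    have "(\<integral>\<^sup>+\<xi>. \<integral>\<^sup>+x. ennreal (norm (g \<xi> * (f x * cis (- (\<xi> \<bullet> x))))) \<partial>lborel \<partial>lborel)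
        = (\<integral>\<^sup>+x. ennreal (cmod (g x)) \<partial>lborel) * (\<integral>\<^sup>+x. ennreal (cmod (f x)) \<partial>lborel)"
      by (simp add: norm_mult ennreal_mult nn_integral_cmult nn_integral_multc)
    then show "(\<integral>\<^sup>+\<xi>. \<integral>\<^sup>+x. ennreal (norm (g \<xi> * (f x * cis (- (\<xi> \<bullet> x))))) \<partial>lborel \<partial>lborel) < \<infinity>"
      using fin by (simp add: ennreal_mult_less_top)
  qed measurable
  have "(LINT \<xi>|lborel. g \<xi> * ftc f \<xi>) = complex_of_real (1 / (2 * pi)) * (LINT \<xi>|lborel. LINT x|lborel. g \<xi> * (f x * cis (- (\<xi> \<bullet> x))))"
    unfolding ftc_def by (simp only: integral_mult_right_zero[symmetric] mult_ac)
  also have "\<dots> = complex_of_real (1 / (2 * pi)) * (LINT x|lborel. f x * (LINT \<xi>|lborel. g \<xi> * cis (- (\<xi> \<bullet> x))))"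
    unfolding 1 by (simp only: integral_mult_right_zero[symmetric] mult_ac)
  also have "\<dots> = (LINT x|lborel. f x * ftc g x)"
    unfolding ftc_def by (simp only: integral_mult_right_zero[symmetric] mult_ac inner_commute)
  finally show ?thesis .
qed

lemma cnj_ftc: "cnj (ftc f \<xi>) = ftc (\<lambda>x. cnj (f x)) (- \<xi>)"
  unfolding ftc_def by (simp add: Bochner_Integration.integral_cnj[symmetric] cis_cnj del: Bochner_Integration.integral_cnj)

text \<open>A damped Plancherel identity. The Gaussian makes the double integral converge
  absolutely, and its own transform is a Gaussian of width \<open>e\<close>. After the substitution
  y = x + e w the right side is a Gaussian average of the autocorrelation of \<open>f\<close> at the
  lag e w.\<close>

lemma gauss_Plancherel:
  assumes f: "L12 f" and e: "e > 0"
  shows "(LINT \<xi>|lborel. complex_of_real (exp (- e\<^sup>2 * (norm \<xi>)\<^sup>2 / 2) * (cmod (ftc f \<xi>))\<^sup>2))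
     = complex_of_real (1 / (2 * pi)) * (LINT w|lborel. complex_of_real (exp (- (norm w)\<^sup>2 / 2)) * ip f (\<lambda>x. f (e *\<^sub>R w + x)))"
    (is "?L = _")
proof -
  have L: "L2c f" and I: "integrable lborel f" using f by (auto simp: L12_def)
  note [measurable] = L2c_measurable[OF L]
  define G where "G \<xi> = complex_of_real (exp (- e\<^sup>2 * (norm \<xi>)\<^sup>2 / 2))" for \<xi> :: pt
  have G: "integrable lborel G" unfolding G_def using gauss_ft_scaled(2)[OF e] by simp
  have [measurable]: "G \<in> borel_measurable borel" using G by auto
  have IG: "integrable lborel (\<lambda>\<xi>. G \<xi> * cnj (ftc f \<xi>))"
    by (rule integrable_mult_bounded[OF G]) (use ftc_bound[OF I] in auto)
  have cG: "cnj (G \<xi>) = G \<xi>" for \<xi> by (simp add: G_def)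
  have "?L = (LINT \<xi>|lborel. (G \<xi> * cnj (ftc f \<xi>)) * ftc f \<xi>)"
    by (simp only: G_def of_real_mult complex_norm_square mult_ac)
  also have "\<dots> = (LINT x|lborel. f x * ftc (\<lambda>\<xi>. G \<xi> * cnj (ftc f \<xi>)) x)"
    by (rule ftc_mult_formula[OF I IG])
  also have "\<dots> = (LINT x|lborel. LINT w|lborel. complex_of_real (1 / (2 * pi)) * (complex_of_real (exp (- (norm w)\<^sup>2 / 2)) * (f x * cnj (f (x + e *\<^sub>R w)))))"
  proof (intro Bochner_Integration.integral_cong refl)
    fix x
    have J: "integrable lborel (\<lambda>\<xi>. G \<xi> * cis (\<xi> \<bullet> x))"
      by (rule integrable_mult_bounded[OF G, where c=1]) auto
    have K: "ftc (\<lambda>\<xi>. G \<xi> * cis (\<xi> \<bullet> x)) y = complex_of_real (1 / e\<^sup>2 * exp (- (norm (x - y))\<^sup>2 / (2 * e\<^sup>2)))" for y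
    proof -
      have "(LINT \<xi>|lborel. G \<xi> * cis (\<xi> \<bullet> x) * cis (- (y \<bullet> \<xi>))) = (LINT \<xi>|lborel. G \<xi> * cis (\<xi> \<bullet> (x - y)))"
        by (simp add: mult.assoc cis_mult inner_diff_right inner_commute)
      then show ?thesis
        unfolding ftc_def G_def gauss_ft_scaled(1)[OF e] by simp
    qed
    have "cnj (ftc (\<lambda>\<xi>. G \<xi> * cnj (ftc f \<xi>)) x) = complex_of_real (1 / (2 * pi)) * (LINT \<xi>|lborel. (G \<xi> * cis (\<xi> \<bullet> x)) * ftc f \<xi>)"
    proof -
      have neg: "ftc h (- x) = complex_of_real (1 / (2 * pi)) * (LINT \<xi>|lborel. h \<xi> * cis (\<xi> \<bullet> x))" for h
        by (simp add: ftc_def inner_commute)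
      have "cnj (ftc (\<lambda>\<xi>. G \<xi> * cnj (ftc f \<xi>)) x) = ftc (\<lambda>\<xi>. G \<xi> * ftc f \<xi>) (- x)"
        by (subst cnj_ftc) (simp only: complex_cnj_mult complex_cnj_cnj cG)
      then show ?thesis by (simp only: neg mult_ac)
    qed
    also have "\<dots> = complex_of_real (1 / (2 * pi)) * (LINT y|lborel. f y * complex_of_real (1 / e\<^sup>2 * exp (- (norm (x - y))\<^sup>2 / (2 * e\<^sup>2))))"
      by (simp only: ftc_mult_formula[OF I J] K)
    also have "(LINT y|lborel. f y * complex_of_real (1 / e\<^sup>2 * exp (- (norm (x - y))\<^sup>2 / (2 * e\<^sup>2))))
        = e ^ DIM(pt) *\<^sub>R (LINT w|lborel. f (x + e *\<^sub>R w) * complex_of_real (1 / e\<^sup>2 * exp (- (norm (x - (x + e *\<^sub>R w)))\<^sup>2 / (2 * e\<^sup>2))))"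
      by (rule integral_affine) (use e in auto)
    also have "\<dots> = (LINT w|lborel. e\<^sup>2 *\<^sub>R (f (x + e *\<^sub>R w) * complex_of_real (1 / e\<^sup>2 * exp (- (norm (x - (x + e *\<^sub>R w)))\<^sup>2 / (2 * e\<^sup>2)))))"
      by simp
    also have "\<dots> = (LINT w|lborel. f (x + e *\<^sub>R w) * complex_of_real (exp (- (norm w)\<^sup>2 / 2)))"
      using e by (intro Bochner_Integration.integral_cong refl) (simp add: power_mult_distrib, simp add: scaleR_conv_of_real)
    finally have "cnj (cnj (ftc (\<lambda>\<xi>. G \<xi> * cnj (ftc f \<xi>)) x))
        = cnj (complex_of_real (1 / (2 * pi)) * (LINT w|lborel. f (x + e *\<^sub>R w) * complex_of_real (exp (- (norm w)\<^sup>2 / 2))))"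
      by (rule arg_cong)
    then have "ftc (\<lambda>\<xi>. G \<xi> * cnj (ftc f \<xi>)) x
        = complex_of_real (1 / (2 * pi)) * (LINT w|lborel. cnj (f (x + e *\<^sub>R w)) * complex_of_real (exp (- (norm w)\<^sup>2 / 2)))"
      by (simp add: Bochner_Integration.integral_cnj[symmetric] del: Bochner_Integration.integral_cnj)
    then show "f x * ftc (\<lambda>\<xi>. G \<xi> * cnj (ftc f \<xi>)) x
      = (LINT w|lborel. complex_of_real (1 / (2 * pi)) * (complex_of_real (exp (- (norm w)\<^sup>2 / 2)) * (f x * cnj (f (x + e *\<^sub>R w)))))"
      by (simp only: integral_mult_right_zero[symmetric] mult_ac)
  qed
  also have "\<dots> = (LINT w|lborel. LINT x|lborel. complex_of_real (1 / (2 * pi)) * (complex_of_real (exp (- (norm w)\<^sup>2 / 2)) * (f x * cnj (f (x + e *\<^sub>R w)))))"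
  proof (rule Fubini_swap(2))
    let ?N = "\<lambda>x w. ennreal (norm (complex_of_real (1 / (2 * pi)) * (complex_of_real (exp (- (norm w)\<^sup>2 / 2)) * (f x * cnj (f (x + e *\<^sub>R w))))))"
    have "(\<integral>\<^sup>+x. \<integral>\<^sup>+w. ?N x w \<partial>lborel \<partial>lborel) = (\<integral>\<^sup>+w. \<integral>\<^sup>+x. ?N x w \<partial>lborel \<partial>lborel)"
      by (rule nn_Fubini_swap) measurable
    also have "\<dots> \<le> (\<integral>\<^sup>+w. ennreal (1 / (2 * pi) * (l2 f * l2 f)) * ennreal (exp (- (norm (w::pt))\<^sup>2 / 2)) \<partial>lborel)"
    proof (intro nn_integral_mono)
      fix w :: pt
      have "(\<integral>\<^sup>+x. ?N x w \<partial>lborel) = (\<integral>\<^sup>+x. ennreal (1 / (2 * pi) * exp (- (norm w)\<^sup>2 / 2)) * (ennreal (cmod (f x)) * ennreal (cmod (f (e *\<^sub>R w + x)))) \<partial>lborel)"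
        by (intro nn_integral_cong) (simp add: norm_mult norm_divide ennreal_mult[symmetric] add.commute mult_ac)
      also have "\<dots> = ennreal (1 / (2 * pi) * exp (- (norm w)\<^sup>2 / 2)) * (\<integral>\<^sup>+x. ennreal (cmod (f x)) * ennreal (cmod (f (e *\<^sub>R w + x))) \<partial>lborel)"
        by (rule nn_integral_cmult) measurable
      also have "\<dots> \<le> ennreal (1 / (2 * pi) * exp (- (norm w)\<^sup>2 / 2)) * ennreal (l2 f * l2 f)"
        using nn_integral_mult_le[OF L L2c_shift(1)[OF L, of "e *\<^sub>R w"]] by (intro mult_left_mono) (auto simp: L2c_shift(2)[OF L])
      finally show "(\<integral>\<^sup>+x. ?N x w \<partial>lborel) \<le> ennreal (1 / (2 * pi) * (l2 f * l2 f)) * ennreal (exp (- (norm w)\<^sup>2 / 2))"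
        by (simp add: ennreal_mult[symmetric] mult_ac)
    qed
    also have "\<dots> = ennreal (1 / (2 * pi) * (l2 f * l2 f)) * (\<integral>\<^sup>+w. ennreal (exp (- (norm (w::pt))\<^sup>2 / 2)) \<partial>lborel)"
      by (rule nn_integral_cmult) measurable
    also have "\<dots> < \<infinity>"
      using integrable_gauss by (auto simp: integrable_iff_bounded ennreal_mult_less_top)
    finally show "(\<integral>\<^sup>+x. \<integral>\<^sup>+w. ?N x w \<partial>lborel \<partial>lborel) < \<infinity>" .
  qed measurable
  also have "\<dots> = complex_of_real (1 / (2 * pi)) * (LINT w|lborel. complex_of_real (exp (- (norm w)\<^sup>2 / 2)) * ip f (\<lambda>x. f (e *\<^sub>R w + x)))"
    by (simp only: integral_mult_right_zero ip_def add.commute)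
  finally show ?thesis .
qed

text \<open>Let the width tend to 0 in \<open>gauss_Plancherel\<close>. The autocorrelation tends to
  \<open>ip f f\<close> by continuity of translations, and the left side increases to the full
  integral, so monotone convergence yields finiteness and equality together.\<close>

theorem Plancherel_L12:
  assumes f: "L12 f"
  shows "L2c (ftc f)" "l2 (ftc f) = l2 f"
proof -
  have L: "L2c f" and I: "integrable lborel f" using f by (auto simp: L12_def)
  note [measurable] = L2c_measurable[OF L]
  define e where "e n = 1 / real (Suc n)" for n
  have e: "e n > 0" for n by (simp add: e_def)
  have e0: "e \<longlonglongrightarrow> 0" unfolding e_def by (rule LIMSEQ_Suc[OF lim_1_over_n])
  have e_dec: "e n \<le> e m" if "m \<le> n" for m n unfolding e_def using that by (simp add: frac_le)
  let ?g = "\<lambda>n \<xi>. exp (- (e n)\<^sup>2 * (norm \<xi>)\<^sup>2 / 2) * (cmod (ftc f \<xi>))\<^sup>2"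
  let ?A = "\<lambda>n. complex_of_real (1 / (2 * pi)) * (LINT w|lborel. complex_of_real (exp (- (norm w)\<^sup>2 / 2)) * ip f (\<lambda>x. f (e n *\<^sub>R w + x)))"
  have ipm [measurable]: "(\<lambda>w. ip f (\<lambda>x. f (c *\<^sub>R w + x))) \<in> borel_measurable borel" for c
    unfolding ip_def by measurable
  have "(\<lambda>n. LINT w|lborel. complex_of_real (exp (- (norm w)\<^sup>2 / 2)) * ip f (\<lambda>x. f (e n *\<^sub>R w + x)))
      \<longlonglongrightarrow> (LINT w|lborel. complex_of_real (exp (- (norm (w::pt))\<^sup>2 / 2)) * ip f f)"
  proof (rule integral_dominated_convergence[where w="\<lambda>w. exp (- (norm w)\<^sup>2 / 2) * (l2 f * l2 f)"])
    show "AE w in lborel. (\<lambda>n. complex_of_real (exp (- (norm w)\<^sup>2 / 2)) * ip f (\<lambda>x. f (e n *\<^sub>R w + x)))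
        \<longlonglongrightarrow> complex_of_real (exp (- (norm w)\<^sup>2 / 2)) * ip f f"
    proof (intro AE_I2 tendsto_mult tendsto_const)
      fix w :: pt
      have "(\<lambda>n. e n *\<^sub>R w) \<longlonglongrightarrow> 0 *\<^sub>R w" by (intro tendsto_scaleR e0 tendsto_const)
      then have "(\<lambda>n. e n *\<^sub>R w) \<longlonglongrightarrow> 0" by simp
      from tendsto_mult_right_zero[OF l2_translation_tendsto_0[OF L this], of "l2 f"]
      have lim: "(\<lambda>n. l2 f * l2 (\<lambda>x. f (e n *\<^sub>R w + x) - f x)) \<longlonglongrightarrow> 0" .
      have "norm (ip f (\<lambda>x. f (e n *\<^sub>R w + x)) - ip f f) \<le> l2 f * l2 (\<lambda>x. f (e n *\<^sub>R w + x) - f x)" for n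
        using ip_bound[OF L L2c_diff[OF L2c_shift(1)[OF L, of "e n *\<^sub>R w"] L]]
        by (simp add: ip_diff_right[OF L2c_shift(1)[OF L] L L])
      then have "(\<lambda>n. ip f (\<lambda>x. f (e n *\<^sub>R w + x)) - ip f f) \<longlonglongrightarrow> 0"
        by (intro Lim_null_comparison[OF _ lim]) (auto intro: always_eventually)
      then show "(\<lambda>n. ip f (\<lambda>x. f (e n *\<^sub>R w + x))) \<longlonglongrightarrow> ip f f"
        by (simp add: Lim_null[symmetric])
    qed
    show "AE w in lborel. norm (complex_of_real (exp (- (norm w)\<^sup>2 / 2)) * ip f (\<lambda>x. f (e n *\<^sub>R w + x)))
        \<le> exp (- (norm w)\<^sup>2 / 2) * (l2 f * l2 f)" for n
    proof (rule AE_I2)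
      fix w :: pt
      show "norm (complex_of_real (exp (- (norm w)\<^sup>2 / 2)) * ip f (\<lambda>x. f (e n *\<^sub>R w + x)))
        \<le> exp (- (norm w)\<^sup>2 / 2) * (l2 f * l2 f)"
        using ip_bound[OF L L2c_shift(1)[OF L, of "e n *\<^sub>R w"]] by (simp add: norm_mult L2c_shift(2)[OF L])
    qed
  qed (use integrable_gauss in \<open>auto intro!: integrable_mult_left\<close>)
  from tendsto_mult[OF tendsto_const this, of "complex_of_real (1 / (2 * pi))"]
  have "?A \<longlonglongrightarrow> complex_of_real (1 / (2 * pi)) * (LINT w|lborel. complex_of_real (exp (- (norm (w::pt))\<^sup>2 / 2)) * ip f f)" .
  also have "complex_of_real (1 / (2 * pi)) * (LINT w|lborel. complex_of_real (exp (- (norm (w::pt))\<^sup>2 / 2)) * ip f f) = complex_of_real ((l2 f)\<^sup>2)"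
    by (simp only: integral_mult_left_zero integral_complex_of_real integral_gauss ip_self) simp
  finally have "(\<lambda>n. Re (?A n)) \<longlonglongrightarrow> Re (complex_of_real ((l2 f)\<^sup>2))" by (rule tendsto_Re)
  then have limA: "(\<lambda>n. ennreal (Re (?A n))) \<longlonglongrightarrow> ennreal ((l2 f)\<^sup>2)"
    by (intro tendsto_ennrealI) (simp only: Re_complex_of_real)
  have eqA: "(\<integral>\<^sup>+\<xi>. ennreal (?g n \<xi>) \<partial>lborel) = ennreal (Re (?A n))" for n
  proof -
    define c where "c = 1 / (2 * pi) * (LINT x|lborel. cmod (f x))"
    have c: "0 \<le> c" by (simp add: c_def)
    have int: "integrable lborel (?g n)"
    proof (rule Bochner_Integration.integrable_bound)
      show "integrable lborel (\<lambda>\<xi>. c\<^sup>2 * exp (- (e n)\<^sup>2 * (norm (\<xi>::pt))\<^sup>2 / 2))"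
        by (intro integrable_mult_right gauss_ft_scaled(2) e)
      show "AE \<xi> in lborel. norm (?g n \<xi>) \<le> norm (c\<^sup>2 * exp (- (e n)\<^sup>2 * (norm \<xi>)\<^sup>2 / 2))"
      proof (rule AE_I2)
        fix \<xi> :: pt
        have "(cmod (ftc f \<xi>))\<^sup>2 \<le> c\<^sup>2"
          using ftc_bound[OF I, of \<xi>] by (intro power_mono) (auto simp: c_def)
        then show "norm (?g n \<xi>) \<le> norm (c\<^sup>2 * exp (- (e n)\<^sup>2 * (norm \<xi>)\<^sup>2 / 2))"
          by (simp add: mult.commute mult_left_mono)
      qed
    qed measurable
    have "complex_of_real (LINT \<xi>|lborel. ?g n \<xi>) = ?A n"
      unfolding integral_complex_of_real[symmetric] by (rule gauss_Plancherel[OF f e])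
    then have "(LINT \<xi>|lborel. ?g n \<xi>) = Re (?A n)" by (metis Re_complex_of_real)
    moreover have "(\<integral>\<^sup>+\<xi>. ennreal (?g n \<xi>) \<partial>lborel) = ennreal (LINT \<xi>|lborel. ?g n \<xi>)"
      by (rule nn_integral_eq_integral[OF int]) simp
    ultimately show ?thesis by simp
  qed
  have "(\<lambda>n. \<integral>\<^sup>+\<xi>. ennreal (?g n \<xi>) \<partial>lborel) \<longlonglongrightarrow> (\<integral>\<^sup>+\<xi>. ennreal ((cmod (ftc f \<xi>))\<^sup>2) \<partial>lborel)"
  proof (rule nn_integral_LIMSEQ)
    show "incseq (\<lambda>n \<xi>. ennreal (?g n \<xi>))"
    proof (intro incseq_SucI le_funI ennreal_leI mult_right_mono)
      fix n and \<xi> :: pt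
      have "(e (Suc n))\<^sup>2 * (norm \<xi>)\<^sup>2 \<le> (e n)\<^sup>2 * (norm \<xi>)\<^sup>2"
        using e_dec[of n "Suc n"] e[of "Suc n"] by (intro mult_right_mono power_mono) auto
      then show "exp (- (e n)\<^sup>2 * (norm \<xi>)\<^sup>2 / 2) \<le> exp (- (e (Suc n))\<^sup>2 * (norm \<xi>)\<^sup>2 / 2)" by simp
    qed simp
    fix \<xi> :: pt
    have "(\<lambda>n. ?g n \<xi>) \<longlonglongrightarrow> exp (- 0\<^sup>2 * (norm \<xi>)\<^sup>2 / 2) * (cmod (ftc f \<xi>))\<^sup>2"
      by (intro tendsto_intros e0) auto
    then show "(\<lambda>n. ennreal (?g n \<xi>)) \<longlonglongrightarrow> ennreal ((cmod (ftc f \<xi>))\<^sup>2)"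
      by (intro tendsto_ennrealI) simp
  qed measurable
  then have eq: "(\<integral>\<^sup>+\<xi>. ennreal ((cmod (ftc f \<xi>))\<^sup>2) \<partial>lborel) = ennreal ((l2 f)\<^sup>2)"
    unfolding eqA using limA by (rule LIMSEQ_unique)
  show Lf: "L2c (ftc f)"
    by (rule L2c_if_nn_finite) (auto simp: eq)
  have "ennreal ((l2 (ftc f))\<^sup>2) = ennreal ((l2 f)\<^sup>2)"
    using nn_integral_L2c[OF Lf] eq by simp
  then show "l2 (ftc f) = l2 f" by simp
qed

subsection \<open>The Fourier transform on square integrable functions\<close>

text \<open>It plays two roles: on the physical side it is the truncation to balls from
  \<open>is_ft\<close>, on the Fourier side the projection to frequencies below
  \<open>R\<close>.\<close>

definition trunc :: "real \<Rightarrow> (pt \<Rightarrow> complex) \<Rightarrow> pt \<Rightarrow> complex" where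
  "trunc R f x = complex_of_real (indicator (ball 0 R) x) * f x"

lemma L2c_trunc: "L2c f \<Longrightarrow> L2c (trunc R f)"
  unfolding trunc_def by (rule L2c_dominated(1)[where c=1 and F=f]) (auto simp: norm_mult indicator_def)

lemma L2c_indicator_ball: "L2c (\<lambda>x. complex_of_real (indicator (ball 0 R) x))"
proof -
  have "integrable lborel (indicator (ball 0 R) :: pt \<Rightarrow> real)"
    using emeasure_bounded_finite[of "ball (0::pt) R"] by (simp add: integrable_indicator_iff)
  moreover have "(\<lambda>x. (cmod (complex_of_real (indicator (ball 0 R) x)))\<^sup>2) = (indicator (ball 0 R) :: pt \<Rightarrow> real)"
    by (auto simp: indicator_def)
  ultimately show ?thesis unfolding L2c_def by simp
qed

lemma L12_trunc: "L2c f \<Longrightarrow> L12 (trunc R f)"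
  unfolding L12_def using L2c_trunc integrable_mult_L2c[OF L2c_indicator_ball[of R], of f]
  by (simp add: trunc_def[abs_def])

lemma l2_trunc_tendsto_0:
  assumes f: "L2c f"
  shows "((\<lambda>R. l2 (\<lambda>x. f x - trunc R f x)) \<longlongrightarrow> 0) at_top"
proof -
  note [measurable] = L2c_measurable[OF f]
  have m [measurable]: "trunc R f \<in> borel_measurable borel" for R using L2c_trunc[OF f] by (rule L2c_measurable)
  have "((\<lambda>R. LINT x|lborel. (cmod (f x - trunc R f x))\<^sup>2) \<longlongrightarrow> (LINT x|(lborel::pt measure). 0)) at_top"
  proof (rule integral_dominated_convergence_at_top[where w="\<lambda>x. (cmod (f x))\<^sup>2"])
    show "AE x in lborel. ((\<lambda>R. (cmod (f x - trunc R f x))\<^sup>2) \<longlongrightarrow> 0) at_top"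
    proof (rule AE_I2)
      fix x
      have "\<forall>\<^sub>F R in at_top. (cmod (f x - trunc R f x))\<^sup>2 = 0"
        using eventually_gt_at_top[of "norm x"] by eventually_elim (simp add: trunc_def)
      then show "((\<lambda>R. (cmod (f x - trunc R f x))\<^sup>2) \<longlongrightarrow> 0) at_top"
        by (rule tendsto_eventually)
    qed
    show "\<forall>\<^sub>F R in at_top. AE x in lborel. norm ((cmod (f x - trunc R f x))\<^sup>2) \<le> (cmod (f x))\<^sup>2"
      by (auto simp: trunc_def indicator_def)
  qed (use f in \<open>auto intro: L2c_integrable\<close>)
  from tendsto_real_sqrt[OF this] show ?thesis by (simp add: l2_def)
qed

lemma ip_ftc:
  assumes f: "integrable lborel f" and h: "integrable lborel h"
  shows "ip (ftc f) h = ip f (iftc h)"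
proof -
  have "ip (ftc f) h = (LINT \<xi>|lborel. cnj (h \<xi>) * ftc f \<xi>)"
    by (simp add: ip_def mult.commute)
  also have "\<dots> = (LINT x|lborel. f x * ftc (\<lambda>\<xi>. cnj (h \<xi>)) x)"
    by (rule ftc_mult_formula) (use f h in auto)
  also have "\<dots> = ip f (iftc h)"
    by (simp add: ip_def iftc_def cnj_ftc)
  finally show ?thesis .
qed

lemma iftc_L12:
  assumes "L12 f"
  shows "L2c (iftc f)" "l2 (iftc f) = l2 f"
  unfolding iftc_def[abs_def] using L2c_reflect[OF Plancherel_L12(1)[OF assms]] Plancherel_L12(2)[OF assms] by simp_all

text \<open>The transform is pinned down by duality against functions in \<open>L^1\<close> and
  \<open>L^2\<close> instead of by a limit, which makes linearity and conjugation immediate.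
  \<open>is_ft_iff\<close> identifies it with the limit in \<open>is_ft\<close>.\<close>

definition is_ftc :: "(pt \<Rightarrow> complex) \<Rightarrow> (pt \<Rightarrow> complex) \<Rightarrow> bool" where
  "is_ftc f F \<longleftrightarrow> L2c f \<and> L2c F \<and> (\<forall>h. L12 h \<longrightarrow> ip F h = ip f (iftc h))"

lemma is_ftcD: "is_ftc f F \<Longrightarrow> L2c f" "is_ftc f F \<Longrightarrow> L2c F" "is_ftc f F \<Longrightarrow> L12 h \<Longrightarrow> ip F h = ip f (iftc h)"
  by (auto simp: is_ftc_def)

lemma is_ftc_L12: "L12 f \<Longrightarrow> is_ftc f (ftc f)"
  unfolding is_ftc_def using Plancherel_L12(1) ip_ftc by (auto simp: L12_def)

lemma L12_L2c: "L12 h \<Longrightarrow> L2c h"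
  by (simp add: L12_def)

lemma is_ftc_add:
  assumes "is_ftc f F" "is_ftc g G"
  shows "is_ftc (\<lambda>x. f x + g x) (\<lambda>x. F x + G x)"
  using assms unfolding is_ftc_def by (simp add: L2c_add ip_add_left L12_L2c iftc_L12(1))

lemma is_ftc_diff:
  assumes "is_ftc f F" "is_ftc g G"
  shows "is_ftc (\<lambda>x. f x - g x) (\<lambda>x. F x - G x)"
  using assms unfolding is_ftc_def by (simp add: L2c_diff ip_diff_left L12_L2c iftc_L12(1))

lemma is_ftc_cmult: "is_ftc f F \<Longrightarrow> is_ftc (\<lambda>x. c * f x) (\<lambda>x. c * F x)"
  unfolding is_ftc_def by (simp add: L2c_cmult ip_cmult_left)

text \<open>The truncations of \<open>F\<close> are themselves admissible test functions and tend to
  \<open>F\<close>.\<close>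

lemma ip_L12_zero_AE:
  assumes F: "L2c F" and z: "\<And>h. L12 h \<Longrightarrow> ip F h = 0"
  shows "AE x in lborel. F x = 0"
proof (rule l2_eq_0_AE[OF F])
  have "(l2 F)\<^sup>2 \<le> l2 F * l2 (\<lambda>x. F x - trunc R F x)" for R
  proof -
    have "ip F (\<lambda>x. F x - trunc R F x) = ip F F"
      using z[OF L12_trunc[OF F]] by (simp add: ip_diff_right F L2c_trunc)
    then have "cmod (complex_of_real ((l2 F)\<^sup>2)) \<le> l2 F * l2 (\<lambda>x. F x - trunc R F x)"
      using ip_bound[OF F L2c_diff[OF F L2c_trunc[OF F]], of R] by (simp only: ip_self)
    then show ?thesis by (simp only: norm_of_real abs_power2)
  qed
  moreover have "((\<lambda>R. l2 F * l2 (\<lambda>x. F x - trunc R F x)) \<longlongrightarrow> 0) at_top"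
    by (rule tendsto_mult_right_zero[OF l2_trunc_tendsto_0[OF F]])
  ultimately have "(l2 F)\<^sup>2 \<le> 0"
    by (intro tendsto_lowerbound[of _ 0 at_top]) (auto intro: always_eventually)
  then show "l2 F = 0" by simp
qed

lemma is_ftc_unique:
  assumes "is_ftc f F" "is_ftc f G"
  shows "AE x in lborel. F x = G x"
proof -
  have "AE x in lborel. F x - G x = 0"
    using assms by (intro ip_L12_zero_AE) (auto simp: is_ftc_def L2c_diff ip_diff_left L12_def)
  then show ?thesis by simp
qed

lemma tendsto_if_norm_le:
  fixes a :: "nat \<Rightarrow> 'a::real_normed_vector"
  assumes "b \<longlonglongrightarrow> 0" and le: "\<And>n. norm (a n - l) \<le> b n"
  shows "a \<longlonglongrightarrow> l"
proof (rule LIM_zero_cancel, rule Lim_null_comparison[OF _ assms(1)])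
  show "\<forall>\<^sub>F n in sequentially. norm (a n - l) \<le> b n" by (intro always_eventually allI le)
qed

text \<open>By Plancherel the transforms of the truncations are as close to each other as the
  truncations, so suitable radii give a rapidly convergent sequence. The exact distance to every
  truncated transform is recorded because \<open>is_ft_iff\<close> compares this construction with
  the limit in \<open>is_ft\<close>.\<close>

theorem is_ftc_exists:
  assumes f: "L2c f"
  shows "\<exists>F. is_ftc f F \<and> l2 F = l2 f \<and> (\<forall>R. l2 (\<lambda>x. F x - ftc (trunc R f) x) = l2 (\<lambda>x. f x - trunc R f x))"
proof -
  note T = L12_trunc[OF f]
  have "\<exists>R. l2 (\<lambda>x. f x - trunc R f x) < (1/2)^(n+1)" for n :: nat
    using order_tendstoD(2)[OF l2_trunc_tendsto_0[OF f], of "(1/2)^(n+1)"]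
    by (auto simp: eventually_at_top_linorder)
  then obtain R where R: "\<And>n. l2 (\<lambda>x. f x - trunc (R n) f x) < (1/2)^(n+1)" by metis
  have diff: "L2c (\<lambda>x. ftc (trunc a f) x - ftc (trunc b f) x) \<and>
    l2 (\<lambda>x. ftc (trunc a f) x - ftc (trunc b f) x) = l2 (\<lambda>x. trunc a f x - trunc b f x)" for a b
  proof -
    have L: "L12 (\<lambda>x. trunc a f x - trunc b f x)"
      using T by (auto simp: L12_def L2c_diff)
    have "ftc (trunc a f) \<xi> - ftc (trunc b f) \<xi> = ftc (\<lambda>x. trunc a f x - trunc b f x) \<xi>" for \<xi>
    proof -
      have i: "integrable lborel (\<lambda>x. trunc c f x * cis (- (\<xi> \<bullet> x)))" for c
        using T[of c] by (intro integrable_mult_bounded[where c=1]) (auto simp: L12_def)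
      show ?thesis unfolding ftc_def by (simp add: left_diff_distrib right_diff_distrib i diff_divide_distrib)
    qed
    then show ?thesis using Plancherel_L12[OF L] by simp
  qed
  define F where "F = (\<lambda>n. ftc (trunc (R n) f))"
  have LF: "L2c (F n)" for n unfolding F_def by (rule Plancherel_L12(1)[OF T])
  have "l2 (\<lambda>x. F (Suc n) x - F n x) \<le> (1/2)^n" for n
  proof -
    have "l2 (\<lambda>x. F (Suc n) x - F n x) = l2 (\<lambda>x. trunc (R (Suc n)) f x - trunc (R n) f x)"
      unfolding F_def using diff by blast
    also have "\<dots> \<le> l2 (\<lambda>x. trunc (R (Suc n)) f x - f x) + l2 (\<lambda>x. f x - trunc (R n) f x)"
      by (intro l2_triangle3 f L2c_trunc)
    also have "\<dots> \<le> (1/2)^(Suc n + 1) + (1/2)^(n+1)"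
      using R[of "Suc n"] R[of n] l2_commute[of f "trunc (R (Suc n)) f"] by linarith
    also have "\<dots> \<le> (1/2)^n" by simp
    finally show ?thesis .
  qed
  from Riesz_Fischer[OF LF this refl]
  obtain G where G: "L2c G" "\<And>n. l2 (\<lambda>x. F n x - G x) \<le> 2 * (1/2)^n" by blast
  have half0: "(\<lambda>n. c * (1/2)^n) \<longlonglongrightarrow> 0" for c :: real
    by (intro tendsto_mult_right_zero LIMSEQ_power_zero) simp
  have lim: "(\<lambda>n. l2 (\<lambda>x. F n x - G x)) \<longlonglongrightarrow> 0"
    by (rule tendsto_sandwich[OF always_eventually always_eventually tendsto_const half0[of 2]]) (use G(2) in auto)
  have lim2: "(\<lambda>n. l2 (\<lambda>x. f x - trunc (R n) f x)) \<longlonglongrightarrow> 0"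
  proof (rule tendsto_sandwich[OF always_eventually always_eventually tendsto_const half0[of "1/2"]])
    show "\<forall>n. l2 (\<lambda>x. f x - trunc (R n) f x) \<le> 1 / 2 * (1 / 2) ^ n"
    proof
      fix n show "l2 (\<lambda>x. f x - trunc (R n) f x) \<le> 1 / 2 * (1 / 2) ^ n" using R[of n] by simp
    qed
  qed simp
  have dist: "l2 (\<lambda>x. G x - ftc (trunc r f) x) = l2 (\<lambda>x. f x - trunc r f x)" for r
  proof (rule LIMSEQ_unique)
    have Lr: "L2c (ftc (trunc r f))" by (rule Plancherel_L12(1)[OF T])
    have "\<bar>l2 (\<lambda>x. F n x - ftc (trunc r f) x) - l2 (\<lambda>x. G x - ftc (trunc r f) x)\<bar> \<le> l2 (\<lambda>x. F n x - G x)" for n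
      using l2_diff_abs[OF L2c_diff[OF LF[of n] Lr] L2c_diff[OF G(1) Lr]] by simp
    then show "(\<lambda>n. l2 (\<lambda>x. F n x - ftc (trunc r f) x)) \<longlonglongrightarrow> l2 (\<lambda>x. G x - ftc (trunc r f) x)"
      by (intro tendsto_if_norm_le[OF lim]) (simp only: real_norm_def)
    have "\<bar>l2 (\<lambda>x. trunc (R n) f x - trunc r f x) - l2 (\<lambda>x. f x - trunc r f x)\<bar> \<le> l2 (\<lambda>x. f x - trunc (R n) f x)" for n
      using l2_diff_abs[OF L2c_diff[OF L2c_trunc[OF f, of "R n"] L2c_trunc[OF f, of r]] L2c_diff[OF f L2c_trunc[OF f, of r]]]
        l2_commute[of f "trunc (R n) f"] by simp
    then have "(\<lambda>n. l2 (\<lambda>x. trunc (R n) f x - trunc r f x)) \<longlonglongrightarrow> l2 (\<lambda>x. f x - trunc r f x)"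
      by (intro tendsto_if_norm_le[OF lim2]) (simp only: real_norm_def)
    then show "(\<lambda>n. l2 (\<lambda>x. F n x - ftc (trunc r f) x)) \<longlonglongrightarrow> l2 (\<lambda>x. f x - trunc r f x)"
      unfolding F_def using diff by simp
  qed
  have "l2 G = l2 f"
  proof (rule LIMSEQ_unique)
    have "\<bar>l2 (F n) - l2 G\<bar> \<le> l2 (\<lambda>x. F n x - G x)" for n
      using l2_diff_abs[OF LF[of n] G(1)] by simp
    then show "(\<lambda>n. l2 (F n)) \<longlonglongrightarrow> l2 G"
      by (intro tendsto_if_norm_le[OF lim]) (simp only: real_norm_def)
    have "\<bar>l2 (F n) - l2 f\<bar> \<le> l2 (\<lambda>x. f x - trunc (R n) f x)" for n
      using l2_diff_abs[OF L2c_trunc[OF f, of "R n"] f] l2_commute[of f "trunc (R n) f"]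
      by (simp add: F_def Plancherel_L12(2)[OF T])
    then show "(\<lambda>n. l2 (F n)) \<longlonglongrightarrow> l2 f"
      by (intro tendsto_if_norm_le[OF lim2]) (simp only: real_norm_def)
  qed
  moreover have "is_ftc f G"
    unfolding is_ftc_def
  proof (intro conjI allI impI f G(1))
    fix h assume h: "L12 h"
    then have Lh: "L2c h" by (simp add: L12_def)
    show "ip G h = ip f (iftc h)"
    proof (rule LIMSEQ_unique)
      have "cmod (ip (F n) h - ip G h) \<le> l2 (\<lambda>x. F n x - G x) * l2 h" for n
        using ip_bound[OF L2c_diff[OF LF[of n] G(1)] Lh] by (simp add: ip_diff_left LF G Lh)
      then show "(\<lambda>n. ip (F n) h) \<longlonglongrightarrow> ip G h"
        by (intro tendsto_if_norm_le[OF tendsto_mult_left_zero[OF lim]])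
      have "cmod (ip (F n) h - ip f (iftc h)) \<le> l2 (\<lambda>x. f x - trunc (R n) f x) * l2 h" for n
      proof -
        have "ip (F n) h = ip (trunc (R n) f) (iftc h)"
          unfolding F_def by (rule is_ftcD(3)[OF is_ftc_L12[OF T] h])
        then have "ip (F n) h - ip f (iftc h) = - ip (\<lambda>x. f x - trunc (R n) f x) (iftc h)"
          by (simp add: ip_diff_left f L2c_trunc iftc_L12(1)[OF h])
        then show ?thesis
          using ip_bound[OF L2c_diff[OF f L2c_trunc[OF f]] iftc_L12(1)[OF h], of "R n"] by (simp add: iftc_L12(2)[OF h])
      qed
      then show "(\<lambda>n. ip (F n) h) \<longlonglongrightarrow> ip f (iftc h)"
        by (intro tendsto_if_norm_le[OF tendsto_mult_left_zero[OF lim2]])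
    qed
  qed
  ultimately show ?thesis using dist by blast
qed

lemma is_ftc_l2:
  assumes "is_ftc f F"
  shows "l2 F = l2 f"
proof -
  obtain G where G: "is_ftc f G" "l2 G = l2 f"
    using is_ftc_exists[OF is_ftcD(1)[OF assms]] by blast
  have "l2 F = l2 G"
    by (rule l2_cong_AE[OF is_ftcD(2)[OF assms] is_ftc_unique[OF assms G(1)] L2c_measurable[OF is_ftcD(2)[OF G(1)]]])
  then show ?thesis using G by simp
qed

text \<open>Polarisation: norms of sums give the real part, and multiplying one argument by \<i>
  turns the imaginary part into a real part.\<close>

theorem is_ftc_ip:
  assumes f: "is_ftc f F" and g: "is_ftc g G"
  shows "ip F G = ip f g"
proof -
  have re: "Re (ip F G) = Re (ip f g)" if f: "is_ftc f F" and g: "is_ftc g G" for f F g G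
    using l2_add_sq[OF is_ftcD(1)[OF f] is_ftcD(1)[OF g]] l2_add_sq[OF is_ftcD(2)[OF f] is_ftcD(2)[OF g]]
      is_ftc_l2[OF f] is_ftc_l2[OF g] is_ftc_l2[OF is_ftc_add[OF f g]] by simp
  have "Re (ip F G) = Re (ip f g)" by (rule re[OF f g])
  moreover have "Im (ip F G) = Im (ip f g)"
    using re[OF f is_ftc_cmult[OF g, of \<i>]] by (simp add: ip_cmult_right)
  ultimately show ?thesis by (rule complex_eqI)
qed

lemma is_ftc_cong_AE:
  assumes "is_ftc f F" "AE x in lborel. f x = g x" "AE x in lborel. F x = G x"
    and [measurable]: "g \<in> borel_measurable borel" "G \<in> borel_measurable borel"
  shows "is_ftc g G"
proof -
  note m [measurable] = L2c_measurable[OF is_ftcD(1)[OF assms(1)]] L2c_measurable[OF is_ftcD(2)[OF assms(1)]]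
  show ?thesis unfolding is_ftc_def
  proof (intro conjI allI impI)
    show "L2c g" "L2c G"
      using L2c_cong_AE[OF is_ftcD(1)[OF assms(1)] assms(2)] L2c_cong_AE[OF is_ftcD(2)[OF assms(1)] assms(3)] by auto
    fix h assume h: "L12 h"
    then have [measurable]: "h \<in> borel_measurable borel" by (auto simp: L12_def)
    have "ip G h = ip F h" using assms(3) by (intro ip_cong_AE) auto
    also have "\<dots> = ip f (iftc h)" by (rule is_ftcD(3)[OF assms(1) h])
    also have "\<dots> = ip g (iftc h)" using assms(2) by (intro ip_cong_AE) auto
    finally show "ip G h = ip g (iftc h)" .
  qed
qed

lemma is_ftc_inj:
  assumes "is_ftc f F" "is_ftc g F"
  shows "AE x in lborel. f x = g x"
proof -
  have "is_ftc (\<lambda>x. f x - g x) (\<lambda>x. F x - F x)" by (rule is_ftc_diff[OF assms])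
  then have "l2 (\<lambda>x. f x - g x) = 0" using is_ftc_l2 by fastforce
  then have "AE x in lborel. f x - g x = 0"
    by (intro l2_eq_0_AE L2c_diff is_ftcD(1)[OF assms(1)] is_ftcD(1)[OF assms(2)])
  then show ?thesis by simp
qed

text \<open>Both the transform and its reflection are isometries, and they are adjoint
  to each other, so they are mutually inverse.\<close>

lemma is_ftc_inversion:
  assumes "is_ftc F G"
  shows "is_ftc (\<lambda>x. G (- x)) F"
  unfolding is_ftc_def
proof (intro conjI allI impI is_ftcD(1)[OF assms] L2c_reflect is_ftcD(2)[OF assms])
  fix h assume h: "L12 h"
  note [measurable] = L2c_measurable[OF is_ftcD(2)[OF assms]] L2c_measurable[OF Plancherel_L12(1)[OF h]]
  have "ip F h = ip G (ftc h)"
    by (rule is_ftc_ip[OF assms is_ftc_L12[OF h], symmetric])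
  also have "\<dots> = ip (\<lambda>x. G (- x)) (iftc h)"
    unfolding ip_def iftc_def using integral_reflect[of "\<lambda>x. G x * cnj (ftc h x)"] by simp
  finally show "ip F h = ip (\<lambda>x. G (- x)) (iftc h)" .
qed

lemma is_ftc_surj: "L2c F \<Longrightarrow> \<exists>f. is_ftc f F"
  using is_ftc_exists[of F] is_ftc_inversion by blast

lemma is_ftc_iftc: "L12 F \<Longrightarrow> is_ftc (iftc F) F"
  using is_ftc_inversion[OF is_ftc_L12] unfolding iftc_def[abs_def] by blast

lemma iftc_cnj_reflect:
  assumes [measurable]: "h \<in> borel_measurable borel"
  shows "iftc (\<lambda>\<xi>. cnj (h (- \<xi>))) x = cnj (iftc h x)"
  using integral_reflect[of "\<lambda>\<xi>. cnj (h \<xi>) * cis (- (x \<bullet> \<xi>))"]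
  unfolding iftc_def cnj_ftc by (simp add: ftc_def)

text \<open>Combined with uniqueness this makes transforms of real functions Hermitian almost
  everywhere; combined with injectivity it gives the converse.\<close>

lemma is_ftc_cnj:
  assumes "is_ftc f F"
  shows "is_ftc (\<lambda>x. cnj (f x)) (\<lambda>\<xi>. cnj (F (- \<xi>)))"
  unfolding is_ftc_def
proof (intro conjI allI impI L2c_cnj L2c_reflect is_ftcD(1)[OF assms] is_ftcD(2)[OF assms])
  fix h assume h: "L12 h"
  have [measurable]: "h \<in> borel_measurable borel" using h by (auto simp: L12_def)
  note [measurable] = L2c_measurable[OF is_ftcD(2)[OF assms]]
  have h': "L12 (\<lambda>\<xi>. cnj (h (- \<xi>)))"
    using h by (auto simp: L12_def intro!: L2c_cnj L2c_reflect(1) integrable_reflect)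
  have "ip (\<lambda>\<xi>. cnj (F (- \<xi>))) h = (LINT \<xi>|lborel. cnj (F \<xi>) * cnj (h (- \<xi>)))"
    unfolding ip_def using integral_reflect[of "\<lambda>\<xi>. cnj (F (-\<xi>)) * cnj (h \<xi>)"] by simp
  also have "\<dots> = cnj (ip F (\<lambda>\<xi>. cnj (h (- \<xi>))))"
    unfolding ip_def by (subst Bochner_Integration.integral_cnj[symmetric]) simp
  also have "\<dots> = cnj (ip f (\<lambda>x. cnj (iftc h x)))"
    unfolding is_ftcD(3)[OF assms h'] by (simp add: iftc_cnj_reflect ip_def)
  also have "\<dots> = ip (\<lambda>x. cnj (f x)) (iftc h)"
    unfolding ip_def by (subst Bochner_Integration.integral_cnj[symmetric]) simp
  finally show "ip (\<lambda>\<xi>. cnj (F (- \<xi>))) h = ip (\<lambda>x. cnj (f x)) (iftc h)" .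
qed

subsection \<open>Convolutions and products\<close>

definition norm1 :: "(pt \<Rightarrow> complex) \<Rightarrow> real" where
  "norm1 F = (LINT x|lborel. cmod (F x))"

lemma norm1_nonneg [simp]: "norm1 F \<ge> 0"
  by (simp add: norm1_def)

lemma nn_integral_norm1: "integrable lborel F \<Longrightarrow> (\<integral>\<^sup>+x. ennreal (cmod (F x)) \<partial>lborel) = ennreal (norm1 F)"
  by (simp add: norm1_def nn_integral_eq_integral)

text \<open>Splitting \<open>f\<close> as sqrt f times sqrt f in the Cauchy--Schwarz inequality
  leaves one factor that integrates to the \<open>L^1\<close> norm and one to which Fubini and
  translation invariance apply.\<close>

lemma nn_Young:
  fixes f :: "'a::euclidean_space \<Rightarrow> real" and g :: "'a \<Rightarrow> ennreal"
  assumes [measurable]: "f \<in> borel_measurable borel" "g \<in> borel_measurable borel" and nn: "\<And>x. f x \<ge> 0"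
  shows "(\<integral>\<^sup>+\<xi>. (\<integral>\<^sup>+\<eta>. ennreal (f (\<xi> - \<eta>)) * g \<eta> \<partial>lborel)\<^sup>2 \<partial>lborel)
    \<le> (\<integral>\<^sup>+x. ennreal (f x) \<partial>lborel)\<^sup>2 * (\<integral>\<^sup>+x. (g x)\<^sup>2 \<partial>lborel)"
proof -
  let ?A = "\<integral>\<^sup>+x. ennreal (f x) \<partial>lborel"
  have s: "ennreal (sqrt (f x)) * ennreal (sqrt (f x)) = ennreal (f x)" for x
    using nn[of x] by (simp add: ennreal_mult[symmetric])
  have "(\<integral>\<^sup>+\<xi>. (\<integral>\<^sup>+\<eta>. ennreal (f (\<xi> - \<eta>)) * g \<eta> \<partial>lborel)\<^sup>2 \<partial>lborel)
      \<le> (\<integral>\<^sup>+\<xi>. ?A * (\<integral>\<^sup>+\<eta>. ennreal (f (\<xi> - \<eta>)) * (g \<eta>)\<^sup>2 \<partial>lborel) \<partial>lborel)"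
  proof (intro nn_integral_mono)
    fix \<xi> :: 'a
    have "(\<integral>\<^sup>+\<eta>. ennreal (f (\<xi> - \<eta>)) * g \<eta> \<partial>lborel)\<^sup>2 = (\<integral>\<^sup>+\<eta>. ennreal (sqrt (f (\<xi> - \<eta>))) * (ennreal (sqrt (f (\<xi> - \<eta>))) * g \<eta>) \<partial>lborel)\<^sup>2"
      by (simp only: mult.assoc[symmetric] s)
    also have "\<dots> \<le> (\<integral>\<^sup>+\<eta>. (ennreal (sqrt (f (\<xi> - \<eta>))))\<^sup>2 \<partial>lborel) * (\<integral>\<^sup>+\<eta>. (ennreal (sqrt (f (\<xi> - \<eta>))) * g \<eta>)\<^sup>2 \<partial>lborel)"
      by (rule Cauchy_Schwarz_nn_integral) measurable
    also have "(\<lambda>\<eta>. (ennreal (sqrt (f (\<xi> - \<eta>))))\<^sup>2) = (\<lambda>\<eta>. ennreal (f (\<xi> - \<eta>)))"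
      by (simp only: power2_eq_square s)
    also have "(\<integral>\<^sup>+\<eta>. ennreal (f (\<xi> - \<eta>)) \<partial>lborel) = ?A"
      by (rule nn_integral_const_minus) measurable
    also have "(\<lambda>\<eta>. (ennreal (sqrt (f (\<xi> - \<eta>))) * g \<eta>)\<^sup>2) = (\<lambda>\<eta>. ennreal (f (\<xi> - \<eta>)) * (g \<eta>)\<^sup>2)"
      by (simp only: power_mult_distrib power2_eq_square[of "ennreal _"] s)
    finally show "(\<integral>\<^sup>+\<eta>. ennreal (f (\<xi> - \<eta>)) * g \<eta> \<partial>lborel)\<^sup>2 \<le> ?A * (\<integral>\<^sup>+\<eta>. ennreal (f (\<xi> - \<eta>)) * (g \<eta>)\<^sup>2 \<partial>lborel)" .
  qed
  also have "\<dots> = ?A * (\<integral>\<^sup>+\<xi>. \<integral>\<^sup>+\<eta>. ennreal (f (\<xi> - \<eta>)) * (g \<eta>)\<^sup>2 \<partial>lborel \<partial>lborel)"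
    by (rule nn_integral_cmult) measurable
  also have "(\<integral>\<^sup>+\<xi>. \<integral>\<^sup>+\<eta>. ennreal (f (\<xi> - \<eta>)) * (g \<eta>)\<^sup>2 \<partial>lborel \<partial>lborel) = (\<integral>\<^sup>+\<eta>. \<integral>\<^sup>+\<xi>. ennreal (f (\<xi> - \<eta>)) * (g \<eta>)\<^sup>2 \<partial>lborel \<partial>lborel)"
    by (rule nn_Fubini_swap) measurable
  also have "\<dots> = (\<integral>\<^sup>+\<eta>. ?A * (g \<eta>)\<^sup>2 \<partial>lborel)"
  proof (intro nn_integral_cong)
    fix \<eta> :: 'a
    have "(\<integral>\<^sup>+\<xi>. ennreal (f (\<xi> - \<eta>)) * (g \<eta>)\<^sup>2 \<partial>lborel) = (\<integral>\<^sup>+\<xi>. ennreal (f (- \<eta> + \<xi>)) \<partial>lborel) * (g \<eta>)\<^sup>2"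
      by (subst nn_integral_multc[symmetric]) auto
    also have "(\<integral>\<^sup>+\<xi>. ennreal (f (- \<eta> + \<xi>)) \<partial>lborel) = ?A"
      by (rule nn_integral_shift) measurable
    finally show "(\<integral>\<^sup>+\<xi>. ennreal (f (\<xi> - \<eta>)) * (g \<eta>)\<^sup>2 \<partial>lborel) = ?A * (g \<eta>)\<^sup>2" .
  qed
  also have "?A * \<dots> = ?A\<^sup>2 * (\<integral>\<^sup>+x. (g x)\<^sup>2 \<partial>lborel)"
    by (subst nn_integral_cmult) (auto simp: power2_eq_square mult.assoc)
  finally show ?thesis .
qed

lemma nn_Young_L2c:
  assumes F: "integrable lborel F" and G: "L2c G"
  shows "(\<integral>\<^sup>+\<xi>. (\<integral>\<^sup>+\<eta>. ennreal (cmod (F (\<xi> - \<eta>))) * ennreal (cmod (G \<eta>)) \<partial>lborel)\<^sup>2 \<partial>lborel) \<le> ennreal ((norm1 F * l2 G)\<^sup>2)"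
proof -
  have [measurable]: "F \<in> borel_measurable borel" "G \<in> borel_measurable borel"
    using F L2c_measurable[OF G] by auto
  show ?thesis
    using nn_Young[of "\<lambda>x. cmod (F x)" "\<lambda>x. ennreal (cmod (G x))"]
    by (simp add: nn_integral_norm1[OF F] nn_integral_L2c[OF G] power_mult_distrib ennreal_mult ennreal_power)
qed

text \<open>Stated for any kernel dominated by a convolution kernel, so that it serves both plain
  convolutions and the operator \<open>Bop\<close>.\<close>

lemma L2c_kernel:
  assumes F: "integrable lborel F" and G: "L2c G"
    and [measurable]: "case_prod K \<in> borel_measurable (borel \<Otimes>\<^sub>M borel)"
    and K: "\<And>\<xi> \<eta>. cmod (K \<xi> \<eta>) \<le> cmod (F (\<xi> - \<eta>)) * cmod (G \<eta>)"
  shows "L2c (\<lambda>\<xi>. LINT \<eta>|lborel. K \<xi> \<eta>)" "l2 (\<lambda>\<xi>. LINT \<eta>|lborel. K \<xi> \<eta>) \<le> norm1 F * l2 G"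
proof -
  have [measurable]: "F \<in> borel_measurable borel" "G \<in> borel_measurable borel"
    using F L2c_measurable[OF G] by auto
  have le: "ennreal ((cmod (LINT \<eta>|lborel. K \<xi> \<eta>))\<^sup>2) \<le> (\<integral>\<^sup>+\<eta>. ennreal (cmod (F (\<xi> - \<eta>))) * ennreal (cmod (G \<eta>)) \<partial>lborel)\<^sup>2" (is "_ \<le> ?R\<^sup>2") for \<xi>
  proof -
    have "ennreal (cmod (LINT \<eta>|lborel. K \<xi> \<eta>)) \<le> ?R"
    proof (cases "integrable lborel (K \<xi>)")
      case True
      have "ennreal (cmod (LINT \<eta>|lborel. K \<xi> \<eta>)) \<le> (\<integral>\<^sup>+\<eta>. ennreal (cmod (K \<xi> \<eta>)) \<partial>lborel)"
        by (rule integral_norm_bound_ennreal[OF True])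
      also have "\<dots> \<le> ?R"
        by (intro nn_integral_mono) (simp add: ennreal_mult[symmetric] K)
      finally show ?thesis .
    qed (simp add: not_integrable_integral_eq)
    then have "(ennreal (cmod (LINT \<eta>|lborel. K \<xi> \<eta>)))\<^sup>2 \<le> ?R\<^sup>2" by (rule power_mono_ennreal)
    then show ?thesis by (simp add: ennreal_power)
  qed
  have le2: "(\<integral>\<^sup>+\<xi>. ennreal ((cmod (LINT \<eta>|lborel. K \<xi> \<eta>))\<^sup>2) \<partial>lborel) \<le> ennreal ((norm1 F * l2 G)\<^sup>2)"
    by (rule order_trans[OF nn_integral_mono[OF le] nn_Young_L2c[OF F G]])
  have nn: "0 \<le> norm1 F * l2 G" by simp
  have m: "(\<lambda>\<xi>. LINT \<eta>|lborel. K \<xi> \<eta>) \<in> borel_measurable borel" by measurable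
  show "L2c (\<lambda>\<xi>. LINT \<eta>|lborel. K \<xi> \<eta>)" "l2 (\<lambda>\<xi>. LINT \<eta>|lborel. K \<xi> \<eta>) \<le> norm1 F * l2 G"
    by (rule L2c_if_nn_le[OF m nn le2])+
qed

lemma nn_trilinear_Young:
  assumes F: "integrable lborel F" and G: "L2c G" and H: "L2c H"
  shows "(\<integral>\<^sup>+\<xi>. \<integral>\<^sup>+\<eta>. ennreal (cmod (F (\<xi> - \<eta>)) * cmod (G \<eta>) * cmod (H \<xi>)) \<partial>lborel \<partial>lborel) \<le> ennreal (norm1 F * l2 G * l2 H)"
proof -
  have [measurable]: "F \<in> borel_measurable borel" "G \<in> borel_measurable borel" "H \<in> borel_measurable borel"
    using F L2c_measurable[OF G] L2c_measurable[OF H] by auto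
  have "(\<integral>\<^sup>+\<xi>. \<integral>\<^sup>+\<eta>. ennreal (cmod (F (\<xi> - \<eta>)) * cmod (G \<eta>) * cmod (H \<xi>)) \<partial>lborel \<partial>lborel)
      = (\<integral>\<^sup>+\<xi>. (\<integral>\<^sup>+\<eta>. ennreal (cmod (F (\<xi> - \<eta>))) * ennreal (cmod (G \<eta>)) \<partial>lborel) * ennreal (cmod (H \<xi>)) \<partial>lborel)"
    by (simp add: ennreal_mult nn_integral_multc)
  also have "\<dots> \<le> ennreal ((norm1 F * l2 G) * l2 H)"
    using nn_Young_L2c[OF F G] by (intro nn_Cauchy_Schwarz) (auto simp: nn_integral_L2c'[OF H])
  finally show ?thesis .
qed

lemma integral_const_minus:
  fixes f :: "'a::euclidean_space \<Rightarrow> 'b::{banach, second_countable_topology}"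
  assumes [measurable]: "f \<in> borel_measurable borel"
  shows "(LINT x|lborel. f (c - x)) = (LINT x|lborel. f x)"
  using integral_reflect[of "\<lambda>x. f (c + x)"] integral_shift[of f c] by simp

text \<open>As \<open>F\<close> is integrable, \<open>f\<close> is an absolutely convergent
  superposition of characters. Each character is moved onto the test function, where it acts as a
  translation in frequency; undoing the translation produces the convolution.\<close>

theorem is_ftc_mult:
  assumes f: "is_ftc f F" and F: "integrable lborel F" and g: "is_ftc g G"
  shows "is_ftc (\<lambda>x. f x * g x) (\<lambda>\<xi>. complex_of_real (1 / (2 * pi)) * (LINT \<eta>|lborel. F (\<xi> - \<eta>) * G \<eta>))"
proof -
  note Lf = is_ftcD(1)[OF f] and LF = is_ftcD(2)[OF f] and Lg = is_ftcD(1)[OF g] and LG = is_ftcD(2)[OF g]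
  note [measurable] = L2c_measurable[OF Lf] L2c_measurable[OF LF] L2c_measurable[OF Lg] L2c_measurable[OF LG]
  let ?c = "complex_of_real (1 / (2 * pi))"
  have L12F: "L12 F" using F LF by (simp add: L12_def)
  have ff: "AE x in lborel. f x = iftc F x"
    by (rule is_ftc_inj[OF f is_ftc_iftc[OF L12F]])
  have iF: "iftc F x = ?c * (LINT \<zeta>|lborel. F \<zeta> * cis (x \<bullet> \<zeta>))" for x
    by (simp add: iftc_def ftc_def)
  have conv: "L2c (\<lambda>\<xi>. LINT \<eta>|lborel. F (\<xi> - \<eta>) * G \<eta>)"
    by (rule L2c_kernel(1)[OF F LG]) (auto simp: norm_mult)
  have "is_ftc (\<lambda>x. iftc F x * g x) (\<lambda>\<xi>. ?c * (LINT \<eta>|lborel. F (\<xi> - \<eta>) * G \<eta>))"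
    unfolding is_ftc_def
  proof (intro conjI allI impI L2c_cmult conv)
    show "L2c (\<lambda>x. iftc F x * g x)"
    proof (rule L2c_dominated(1)[OF Lg, where c="1 / (2 * pi) * (LINT x|lborel. cmod (F x))"])
      show "AE x in lborel. cmod (iftc F x * g x) \<le> (1 / (2 * pi) * (LINT x|lborel. cmod (F x))) * cmod (g x)"
        unfolding norm_mult iftc_def by (intro AE_I2 mult_right_mono ftc_bound F norm_ge_zero)
    qed auto
    fix h assume h: "L12 h"
    then have Lh: "L2c h" by (rule L12_L2c)
    note [measurable] = L2c_measurable[OF Lh]
    \<comment> \<open>Modulation on the physical side is translation on the Fourier side.\<close>
    have s: "cis (- (x \<bullet> \<zeta>)) * iftc h x = iftc (\<lambda>\<eta>. h (\<zeta> + \<eta>)) x" for x \<zeta>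
    proof -
      have "(LINT \<eta>|lborel. h (\<zeta> + \<eta>) * cis (x \<bullet> ((\<zeta> + \<eta>) - \<zeta>))) = (LINT \<eta>|lborel. h \<eta> * cis (x \<bullet> (\<eta> - \<zeta>)))"
        by (rule integral_shift[of "\<lambda>\<eta>. h \<eta> * cis (x \<bullet> (\<eta> - \<zeta>))"]) measurable
      also have "\<dots> = (LINT \<eta>|lborel. cis (- (x \<bullet> \<zeta>)) * (h \<eta> * cis (x \<bullet> \<eta>)))"
        by (intro Bochner_Integration.integral_cong refl) (simp add: inner_diff_right cis_mult mult.left_commute)
      finally show ?thesis by (simp add: iftc_def ftc_def)
    qed
    have L12h: "L12 (\<lambda>\<eta>. h (\<zeta> + \<eta>))" for \<zeta>
      using h by (auto simp: L12_def intro: L2c_shift(1) integrable_shift)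
    have Li: "L2c (iftc h)" by (rule iftc_L12(1)[OF h])
    have "ip (\<lambda>x. iftc F x * g x) (iftc h) = ?c * (LINT x|lborel. LINT \<zeta>|lborel. F \<zeta> * (cis (x \<bullet> \<zeta>) * (g x * cnj (iftc h x))))"
      unfolding ip_def iF by (simp only: integral_mult_right_zero[symmetric] integral_mult_left_zero[symmetric] mult_ac)
    also have "(LINT x|lborel. LINT \<zeta>|lborel. F \<zeta> * (cis (x \<bullet> \<zeta>) * (g x * cnj (iftc h x))))
       = (LINT \<zeta>|lborel. LINT x|lborel. F \<zeta> * (cis (x \<bullet> \<zeta>) * (g x * cnj (iftc h x))))"
    proof (rule Fubini_swap(2))
      have "(\<integral>\<^sup>+x. \<integral>\<^sup>+\<zeta>. ennreal (norm (F \<zeta> * (cis (x \<bullet> \<zeta>) * (g x * cnj (iftc h x))))) \<partial>lborel \<partial>lborel)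
          = ennreal (norm1 F) * (\<integral>\<^sup>+x. ennreal (cmod (g x)) * ennreal (cmod (iftc h x)) \<partial>lborel)"
        by (simp add: norm_mult ennreal_mult nn_integral_multc nn_integral_norm1[OF F] nn_integral_cmult)
      also have "\<dots> \<le> ennreal (norm1 F) * ennreal (l2 g * l2 (iftc h))"
        by (intro mult_left_mono nn_integral_mult_le Lg Li) auto
      also have "\<dots> < \<infinity>" by (simp add: ennreal_mult_less_top)
      finally show "(\<integral>\<^sup>+x. \<integral>\<^sup>+\<zeta>. ennreal (norm (F \<zeta> * (cis (x \<bullet> \<zeta>) * (g x * cnj (iftc h x))))) \<partial>lborel \<partial>lborel) < \<infinity>" .
    qed measurable
    also have "\<dots> = (LINT \<zeta>|lborel. LINT \<xi>|lborel. F \<zeta> * (G (\<xi> - \<zeta>) * cnj (h \<xi>)))"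
    proof (rule Bochner_Integration.integral_cong[OF refl])
      fix \<zeta>
      have "(LINT x|lborel. F \<zeta> * (cis (x \<bullet> \<zeta>) * (g x * cnj (iftc h x)))) = F \<zeta> * (LINT x|lborel. g x * cnj (cis (- (x \<bullet> \<zeta>)) * iftc h x))"
        by (subst integral_mult_right_zero[symmetric]) (simp add: cis_cnj mult_ac)
      also have "(LINT x|lborel. g x * cnj (cis (- (x \<bullet> \<zeta>)) * iftc h x)) = ip G (\<lambda>\<eta>. h (\<zeta> + \<eta>))"
        unfolding s using is_ftcD(3)[OF g L12h, of \<zeta>] by (simp add: ip_def)
      also have "\<dots> = (LINT \<xi>|lborel. G ((\<zeta> + \<xi>) - \<zeta>) * cnj (h (\<zeta> + \<xi>)))"
        by (simp add: ip_def)
      also have "\<dots> = (LINT \<xi>|lborel. G (\<xi> - \<zeta>) * cnj (h \<xi>))"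
        by (rule integral_shift[of "\<lambda>\<xi>. G (\<xi> - \<zeta>) * cnj (h \<xi>)"]) measurable
      finally show "(LINT x|lborel. F \<zeta> * (cis (x \<bullet> \<zeta>) * (g x * cnj (iftc h x)))) = (LINT \<xi>|lborel. F \<zeta> * (G (\<xi> - \<zeta>) * cnj (h \<xi>)))"
        by simp
    qed
    also have "\<dots> = (LINT \<xi>|lborel. LINT \<zeta>|lborel. F \<zeta> * (G (\<xi> - \<zeta>) * cnj (h \<xi>)))"
    proof (rule Fubini_swap(2))
      have "(\<integral>\<^sup>+\<zeta>. \<integral>\<^sup>+\<xi>. ennreal (norm (F \<zeta> * (G (\<xi> - \<zeta>) * cnj (h \<xi>)))) \<partial>lborel \<partial>lborel)
          \<le> (\<integral>\<^sup>+\<zeta>. ennreal (cmod (F \<zeta>)) * ennreal (l2 G * l2 h) \<partial>lborel)"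
      proof (intro nn_integral_mono)
        fix \<zeta>
        have "(\<integral>\<^sup>+\<xi>. ennreal (norm (F \<zeta> * (G (\<xi> - \<zeta>) * cnj (h \<xi>)))) \<partial>lborel)
            = ennreal (cmod (F \<zeta>)) * (\<integral>\<^sup>+\<xi>. ennreal (cmod (G (- \<zeta> + \<xi>))) * ennreal (cmod (h \<xi>)) \<partial>lborel)"
          by (subst nn_integral_cmult[symmetric]) (auto simp: norm_mult ennreal_mult)
        also have "\<dots> \<le> ennreal (cmod (F \<zeta>)) * ennreal (l2 G * l2 h)"
          using nn_integral_mult_le[OF L2c_shift(1)[OF LG, of "- \<zeta>"] Lh] unfolding L2c_shift(2)[OF LG] by (rule mult_left_mono) simp
        finally show "(\<integral>\<^sup>+\<xi>. ennreal (norm (F \<zeta> * (G (\<xi> - \<zeta>) * cnj (h \<xi>)))) \<partial>lborel) \<le> ennreal (cmod (F \<zeta>)) * ennreal (l2 G * l2 h)" .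
      qed
      also have "\<dots> = ennreal (norm1 F) * ennreal (l2 G * l2 h)"
        by (subst nn_integral_multc) (auto simp: nn_integral_norm1[OF F])
      also have "\<dots> < \<infinity>" by (simp add: ennreal_mult_less_top)
      finally show "(\<integral>\<^sup>+\<zeta>. \<integral>\<^sup>+\<xi>. ennreal (norm (F \<zeta> * (G (\<xi> - \<zeta>) * cnj (h \<xi>)))) \<partial>lborel \<partial>lborel) < \<infinity>" .
    qed measurable
    also have "\<dots> = (LINT \<xi>|lborel. (LINT \<eta>|lborel. F (\<xi> - \<eta>) * G \<eta>) * cnj (h \<xi>))"
    proof (rule Bochner_Integration.integral_cong[OF refl])
      fix \<xi>
      have "(LINT \<zeta>|lborel. F \<zeta> * (G (\<xi> - \<zeta>) * cnj (h \<xi>))) = (LINT \<zeta>|lborel. F \<zeta> * G (\<xi> - \<zeta>)) * cnj (h \<xi>)"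
        by (simp add: mult.assoc[symmetric])
      also have "(LINT \<zeta>|lborel. F \<zeta> * G (\<xi> - \<zeta>)) = (LINT \<eta>|lborel. F (\<xi> - \<eta>) * G \<eta>)"
        using integral_const_minus[of "\<lambda>\<zeta>. F \<zeta> * G (\<xi> - \<zeta>)" \<xi>] by simp
      finally show "(LINT \<zeta>|lborel. F \<zeta> * (G (\<xi> - \<zeta>) * cnj (h \<xi>))) = (LINT \<eta>|lborel. F (\<xi> - \<eta>) * G \<eta>) * cnj (h \<xi>)" .
    qed
    finally show "ip (\<lambda>\<xi>. ?c * (LINT \<eta>|lborel. F (\<xi> - \<eta>) * G \<eta>)) h = ip (\<lambda>x. iftc F x * g x) (iftc h)"
      unfolding ip_cmult_left by (simp add: ip_def)
  qed
  then show ?thesis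
    by (rule is_ftc_cong_AE) (use ff in \<open>auto elim: eventually_mono\<close>)
qed

subsection \<open>Real functions and Fourier multipliers\<close>

abbreviation cr :: "(pt \<Rightarrow> real) \<Rightarrow> pt \<Rightarrow> complex" where
  "cr f \<equiv> (\<lambda>x. complex_of_real (f x))"

definition herm :: "(pt \<Rightarrow> complex) \<Rightarrow> bool" where
  "herm F \<longleftrightarrow> (\<forall>\<xi>. F (- \<xi>) = cnj (F \<xi>))"

lemma measurable_cr_iff: "cr f \<in> borel_measurable M \<longleftrightarrow> f \<in> borel_measurable M"
proof
  assume "cr f \<in> borel_measurable M"
  then have "(\<lambda>x. Re (cr f x)) \<in> borel_measurable M" by measurable
  then show "f \<in> borel_measurable M" by simp
qed simp

lemma L2_iff: "L2 f \<longleftrightarrow> L2c (cr f)"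
  by (simp add: L2_def L2c_def measurable_cr_iff)

lemma ft1_trunc: "ft1 (\<lambda>x. indicator (ball 0 R) x * f x) = ftc (trunc R (cr f))"
  by (simp add: ft1_def[abs_def] ftc_def[abs_def] trunc_def)

lemma is_ft_iff: "is_ft f F \<longleftrightarrow> is_ftc (cr f) F"
proof (cases "L2 f \<and> L2c F")
  case True
  then have f: "L2c (cr f)" and F: "L2c F" by (auto simp: L2_iff)
  obtain G where G: "is_ftc (cr f) G" "\<And>R. l2 (\<lambda>x. G x - ftc (trunc R (cr f)) x) = l2 (\<lambda>x. cr f x - trunc R (cr f) x)"
    using is_ftc_exists[OF f] by blast
  have LG: "L2c G" by (rule is_ftcD(2)[OF G(1)])
  have LT: "L2c (ftc (trunc R (cr f)))" for R by (rule Plancherel_L12(1)[OF L12_trunc[OF f]])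
  have G0: "((\<lambda>R. l2 (\<lambda>x. G x - ftc (trunc R (cr f)) x)) \<longlongrightarrow> 0) at_top"
    unfolding G(2) by (rule l2_trunc_tendsto_0[OF f])
  have "is_ft f F \<longleftrightarrow> ((\<lambda>R. ennreal ((l2 (\<lambda>x. F x - ftc (trunc R (cr f)) x))\<^sup>2)) \<longlongrightarrow> ennreal 0) at_top"
    unfolding is_ft_def ft1_trunc using True by (simp add: nn_integral_L2c[OF L2c_diff[OF F LT]])
  also have "\<dots> \<longleftrightarrow> ((\<lambda>R. (l2 (\<lambda>x. F x - ftc (trunc R (cr f)) x))\<^sup>2) \<longlongrightarrow> 0) at_top"
    by (subst tendsto_ennreal_iff) (auto intro: always_eventually)
  also have "\<dots> \<longleftrightarrow> ((\<lambda>R. l2 (\<lambda>x. F x - ftc (trunc R (cr f)) x)) \<longlongrightarrow> 0) at_top" (is "_ \<longleftrightarrow> ?lim")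
    by simp
  also have "\<dots> \<longleftrightarrow> is_ftc (cr f) F"
  proof
    assume F0: ?lim
    have "l2 (\<lambda>x. G x - F x) \<le> l2 (\<lambda>x. G x - ftc (trunc R (cr f)) x) + l2 (\<lambda>x. F x - ftc (trunc R (cr f)) x)" for R
      using l2_triangle3[OF LG LT[of R] F] l2_commute[of F "ftc (trunc R (cr f))"] by linarith
    moreover have "((\<lambda>R. l2 (\<lambda>x. G x - ftc (trunc R (cr f)) x) + l2 (\<lambda>x. F x - ftc (trunc R (cr f)) x)) \<longlongrightarrow> 0 + 0) at_top"
      by (intro tendsto_add G0 F0)
    ultimately have "l2 (\<lambda>x. G x - F x) \<le> 0 + 0"
      by (intro tendsto_lowerbound[of _ "0 + 0" at_top]) (auto intro: always_eventually)
    then have "l2 (\<lambda>x. G x - F x) = 0" using l2_nonneg[of "\<lambda>x. G x - F x"] by linarith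
    then have "AE x in lborel. G x - F x = 0" by (intro l2_eq_0_AE L2c_diff LG F)
    then have "AE x in lborel. G x = F x" by simp
    from is_ftc_cong_AE[OF G(1) _ this] show "is_ftc (cr f) F"
      using L2c_measurable[OF F] L2c_measurable[OF f] by simp
  next
    assume "is_ftc (cr f) F"
    then have ae: "AE x in lborel. G x = F x" by (rule is_ftc_unique[OF G(1)])
    have "l2 (\<lambda>x. F x - ftc (trunc R (cr f)) x) = l2 (\<lambda>x. G x - ftc (trunc R (cr f)) x)" for R
    proof (rule l2_cong_AE)
      show "AE x in lborel. F x - ftc (trunc R (cr f)) x = G x - ftc (trunc R (cr f)) x"
        using ae by eventually_elim simp
    qed (auto intro: L2c_diff F LT LG L2c_measurable)
    then show ?lim using G0 by simp
  qed
  finally show ?thesis .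
qed (auto simp: is_ft_def is_ftc_def L2_iff)

lemma is_ft_ft:
  assumes "L2 f"
  shows "is_ft f (ft f)"
proof -
  obtain F where "is_ft f F"
    using is_ftc_exists[of "cr f"] assms by (auto simp: is_ft_iff L2_iff)
  then show ?thesis unfolding ft_def by (rule someI[of "is_ft f"])
qed

lemma is_ftD: "is_ft f F \<Longrightarrow> L2 f" "is_ft f F \<Longrightarrow> L2c F"
  by (simp_all add: is_ft_def)

lemma is_ft_unique: "is_ft f F \<Longrightarrow> is_ft f G \<Longrightarrow> AE x in lborel. F x = G x"
  unfolding is_ft_iff by (rule is_ftc_unique)

lemma is_ft_cong_AE:
  assumes "is_ft f F" "AE x in lborel. F x = G x" "G \<in> borel_measurable borel"
  shows "is_ft f G"
  using assms is_ftc_cong_AE[of "cr f" F "cr f" G] L2c_measurable[OF is_ftcD(1)]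
  by (auto simp: is_ft_iff)

lemma is_ft_inj:
  assumes "is_ft f F" "is_ft g F"
  shows "AE x in lborel. f x = g x"
  using is_ftc_inj[of "cr f" F "cr g"] assms by (simp add: is_ft_iff)

lemma is_ft_herm_AE:
  assumes "is_ft f F"
  shows "AE \<xi> in lborel. F \<xi> = cnj (F (- \<xi>))"
  using is_ftc_unique[of "cr f" F] is_ftc_cnj[of "cr f" F] assms by (simp add: is_ft_iff)

text \<open>Under the Hermitian symmetry the inverse transform and its complex conjugate have the
  same transform, so the inverse transform is real almost everywhere.\<close>

lemma is_ft_surj:
  assumes F: "L2c F" and h: "AE \<xi> in lborel. F \<xi> = cnj (F (- \<xi>))"
  shows "\<exists>f. is_ft f F"
proof -
  note [measurable] = L2c_measurable[OF F]
  obtain g where g: "is_ftc g F" using is_ftc_surj[OF F] by blast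
  note [measurable] = L2c_measurable[OF is_ftcD(1)[OF g]]
  have "is_ftc (\<lambda>x. cnj (g x)) F"
    by (rule is_ftc_cong_AE[OF is_ftc_cnj[OF g]]) (use h in \<open>auto elim: eventually_mono\<close>)
  then have "AE x in lborel. g x = cnj (g x)" by (rule is_ftc_inj[OF g])
  then have "AE x in lborel. g x = cr (\<lambda>x. Re (g x)) x"
    by eventually_elim (metis complex_is_Real_iff Reals_cnj_iff of_real_Re)
  then have "is_ftc (cr (\<lambda>x. Re (g x))) F"
    by (rule is_ftc_cong_AE[OF g]) auto
  then show ?thesis unfolding is_ft_iff[symmetric] by blast
qed

text \<open>The choice made by \<open>ft\<close> is Hermitian only almost everywhere. Averaging with
  the reflected conjugate makes the symmetry hold at every point and, for square integrable
  \<open>f\<close>, changes the values on a null set only.\<close>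

definition hat :: "(pt \<Rightarrow> real) \<Rightarrow> pt \<Rightarrow> complex" where
  "hat f \<xi> = (ft f \<xi> + cnj (ft f (- \<xi>))) / 2"

lemma herm_hat: "herm (hat f)"
  by (simp add: herm_def hat_def add.commute)

lemma hat_AE: "L2 f \<Longrightarrow> AE \<xi> in lborel. ft f \<xi> = hat f \<xi>"
  using is_ft_herm_AE[OF is_ft_ft] by (auto simp: hat_def elim: eventually_mono)

lemma is_ft_hat:
  assumes f: "L2 f"
  shows "is_ft f (hat f)"
proof -
  note [measurable] = L2c_measurable[OF is_ftD(2)[OF is_ft_ft[OF f]]]
  show ?thesis
    by (rule is_ft_cong_AE[OF is_ft_ft[OF f] hat_AE[OF f]]) (simp add: hat_def[abs_def])
qed

lemma L2c_hat: "L2 f \<Longrightarrow> L2c (hat f)"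
  using is_ft_hat is_ftD by blast

lemma integral_eq_ip:
  assumes "is_ft f F" "is_ft g G"
  shows "(LINT x|lborel. f x * g x) = Re (ip F G)"
proof -
  have "ip F G = ip (cr f) (cr g)" using is_ftc_ip assms by (simp add: is_ft_iff)
  also have "\<dots> = complex_of_real (LINT x|lborel. f x * g x)"
    unfolding ip_def integral_complex_of_real[symmetric] by simp
  finally show ?thesis by simp
qed

lemma is_ft_diff: "is_ft f F \<Longrightarrow> is_ft g G \<Longrightarrow> is_ft (\<lambda>x. f x - g x) (\<lambda>x. F x - G x)"
  using is_ftc_diff[of "cr f" F "cr g" G] by (simp add: is_ft_iff)

lemma is_ft_add: "is_ft f F \<Longrightarrow> is_ft g G \<Longrightarrow> is_ft (\<lambda>x. f x + g x) (\<lambda>x. F x + G x)"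
  using is_ftc_add[of "cr f" F "cr g" G] by (simp add: is_ft_iff)

lemma is_ft_mult:
  assumes "is_ft f F" "integrable lborel F" "is_ft g G"
  shows "is_ft (\<lambda>x. f x * g x) (\<lambda>\<xi>. complex_of_real (1 / (2 * pi)) * (LINT \<eta>|lborel. F (\<xi> - \<eta>) * G \<eta>))"
  using is_ftc_mult[of "cr f" F "cr g" G] assms by (simp add: is_ft_iff)

text \<open>The symmetry of \<open>m\<close> makes m F the transform of a real function, so the
  choice in \<open>fmult\<close> is made from a nonempty set. Whatever is chosen, its transform
  agrees with m F almost everywhere.\<close>

lemma is_ft_fmult:
  assumes f: "is_ft f F" and [measurable]: "m \<in> borel_measurable borel" and m: "\<And>\<xi>. m (- \<xi>) = cnj (m \<xi>)"
    and L: "L2c (\<lambda>\<xi>. m \<xi> * F \<xi>)"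
  shows "is_ft (fmult m f) (\<lambda>\<xi>. m \<xi> * F \<xi>)"
proof -
  have "AE \<xi> in lborel. m \<xi> * F \<xi> = cnj (m (- \<xi>) * F (- \<xi>))"
    using is_ft_herm_AE[OF f] by eventually_elim (simp add: m)
  from is_ft_surj[OF L this] obtain g where g: "is_ft g (\<lambda>\<xi>. m \<xi> * F \<xi>)" by blast
  then have "is_mult m f g" using f unfolding is_mult_def by blast
  then have "is_mult m f (fmult m f)" unfolding fmult_def by (rule someI[of "is_mult m f"])
  then obtain F' where F': "is_ft f F'" "is_ft (fmult m f) (\<lambda>\<xi>. m \<xi> * F' \<xi>)"
    unfolding is_mult_def by blast
  have "AE \<xi> in lborel. m \<xi> * F' \<xi> = m \<xi> * F \<xi>"
    using is_ft_unique[OF F'(1) f] by eventually_elim simp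
  then show ?thesis
    by (rule is_ft_cong_AE[OF F'(2)]) (rule L2c_measurable[OF L])
qed

subsection \<open>Power weights in the plane\<close>

lemma cball_borel [measurable]: "cball x r \<in> sets borel"
  by (intro borel_closed closed_cball)

lemma emeasure_cball_pt: "emeasure lborel (cball (0::pt) r) < \<infinity>"
  by (rule emeasure_bounded_finite) simp

text \<open>The weight is dominated by a sum over discs of radius 2^(-n), with the factor 4 bounding
  2^(2b), the variation inside one dyadic ring. The terms of that sum are geometric with ratio
  2^(-(2-2b)), which is below 1 because b < 1.\<close>

lemma powr_ball_finite:
  fixes b :: real
  assumes b: "0 \<le> b" "b < 1"
  shows "(\<integral>\<^sup>+\<eta>. indicator (cball (0::pt) 1) \<eta> * ennreal (norm \<eta> powr (- 2 * b)) \<partial>lborel) < \<infinity>"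
proof -
  define c where "c n = ((1/2::real) ^ n)" for n
  have c0: "c n > 0" for n by (simp add: c_def)
  define m where "m = measure lborel (cball (0::pt) 1)"
  have m: "emeasure lborel (cball (0::pt) 1) = ennreal m"
    unfolding m_def using emeasure_cball_pt[of 1] by (intro emeasure_eq_ennreal_measure) (auto simp: less_top)
  have m0: "m \<ge> 0" by (simp add: m_def)
  have mc: "emeasure lborel (cball (0::pt) r) = ennreal (r^2 * m)" if r: "r > 0" for r
  proof -
    have "emeasure lborel (cball (0::pt) r) = (\<integral>\<^sup>+x. indicator (cball (0::pt) r) x \<partial>lborel)" by simp
    also have "\<dots> = ennreal (r ^ DIM(pt)) * (\<integral>\<^sup>+x. indicator (cball (0::pt) r) (r *\<^sub>R x) \<partial>lborel)"
      by (rule nn_integral_scale) (use r in auto)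
    also have "(\<lambda>x. indicator (cball (0::pt) r) (r *\<^sub>R x) :: ennreal) = indicator (cball (0::pt) 1)"
      using r by (auto simp: indicator_def fun_eq_iff)
    finally show ?thesis using m by (simp add: ennreal_mult m_def)
  qed
  have pt: "indicator (cball (0::pt) 1) \<eta> * ennreal (norm \<eta> powr (- 2 * b))
      \<le> (\<Sum>n. ennreal (4 * (1/c n) powr (2 * b)) * indicator (cball (0::pt) (c n)) \<eta>)" for \<eta>
  proof (cases "\<eta> \<in> cball 0 1 \<and> \<eta> \<noteq> 0")
    case True
    then have n0: "0 < norm \<eta>" "norm \<eta> \<le> 1" by auto
    have "\<exists>n. c n < norm \<eta>" unfolding c_def using n0 real_arch_pow_inv[of "norm \<eta>" "1/2"] by auto
    define N where "N = (LEAST n. c n < norm \<eta>)"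
    have N: "c N < norm \<eta>" unfolding N_def using \<open>\<exists>n. c n < norm \<eta>\<close> by (rule LeastI_ex)
    have "N \<noteq> 0" using N n0 by (auto simp: c_def intro: ccontr)
    then obtain k where k: "N = Suc k" by (cases N) auto
    have "\<not> c k < norm \<eta>" using not_less_Least[of k "\<lambda>n. c n < norm \<eta>"] k by (auto simp: N_def)
    then have in_k: "norm \<eta> \<le> c k" by simp
    have "c k / 2 \<le> norm \<eta>" using N k by (simp add: c_def)
    then have "norm \<eta> powr (- 2 * b) \<le> (c k / 2) powr (- 2 * b)"
      using b c0[of k] by (intro powr_mono2') auto
    also have "\<dots> = (2 * (1 / c k)) powr (2 * b)"
      using c0[of k] by (simp add: powr_minus_divide powr_divide powr_mult)
    also have "\<dots> = 2 powr (2 * b) * (1 / c k) powr (2 * b)" using c0[of k] powr_mult[of 2 "1 / c k" "2 * b"] by simp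
    also have "\<dots> \<le> 4 * (1 / c k) powr (2 * b)"
    proof (rule mult_right_mono)
      have "2 powr (2 * b) \<le> 2 powr (2::real)" using b by (intro powr_mono) auto
      then show "2 powr (2 * b) \<le> (4::real)" by simp
    qed simp
    finally have "ennreal (norm \<eta> powr (- 2 * b)) \<le> ennreal (4 * (1/c k) powr (2 * b)) * indicator (cball (0::pt) (c k)) \<eta>"
      using in_k by (simp add: ennreal_leI)
    also have "\<dots> \<le> (\<Sum>n. ennreal (4 * (1/c n) powr (2 * b)) * indicator (cball (0::pt) (c n)) \<eta>)"
      using sum_le_suminf[of "\<lambda>n. ennreal (4 * (1/c n) powr (2 * b)) * indicator (cball (0::pt) (c n)) \<eta>" "{k}"]
      by (simp del: sum_mult_indicator)
    finally show ?thesis using True by simp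
  qed auto
  define q where "q = (1/2::real) powr (2 - 2 * b)"
  have q: "0 \<le> q" "q < 1" unfolding q_def using b powr_less_mono'[of "1/2" 0 "2 - 2*b"] by auto
  have q_pow: "4 * (1/c n) powr (2 * b) * ((c n)^2 * m) = 4 * m * q ^ n" for n
  proof -
    have "(1/c n) powr (2 * b) * (c n)^2 = (c n) powr (- 2 * b) * (c n) powr 2"
      using c0[of n] by (simp add: powr_minus_divide powr_divide)
    also have "\<dots> = (c n) powr (2 - 2 * b)" by (simp add: powr_add[symmetric])
    also have "\<dots> = q ^ n"
      unfolding q_def c_def by (simp add: powr_powr powr_realpow[symmetric] mult.commute)
    finally show ?thesis by simp
  qed
  have "(\<integral>\<^sup>+\<eta>. indicator (cball (0::pt) 1) \<eta> * ennreal (norm \<eta> powr (- 2 * b)) \<partial>lborel)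
      \<le> (\<integral>\<^sup>+\<eta>. (\<Sum>n. ennreal (4 * (1/c n) powr (2 * b)) * indicator (cball (0::pt) (c n)) \<eta>) \<partial>lborel)"
    by (intro nn_integral_mono pt)
  also have "\<dots> = (\<Sum>n. ennreal (4 * (1/c n) powr (2 * b)) * ennreal ((c n)^2 * m))"
    by (subst nn_integral_suminf) (auto simp: nn_integral_cmult_indicator mc[OF c0])
  also have "\<dots> = (\<Sum>n. ennreal (4 * m * q ^ n))"
    by (intro suminf_cong) (simp add: ennreal_mult[symmetric] q_pow m0)
  also have "\<dots> = ennreal (\<Sum>n. 4 * m * q ^ n)"
    using q by (intro suminf_ennreal2 summable_mult summable_geometric) (auto simp: m_def)
  also have "\<dots> < \<infinity>" by simp
  finally show ?thesis .
qed

text \<open>The \<open>L^2\<close> norm of |\<eta>|^(-b) on the unit disc; scaling by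
  \<open>r\<close> multiplies it by r^(1-b).\<close>

definition wball :: "real \<Rightarrow> real" where
  "wball b = sqrt (enn2real (\<integral>\<^sup>+\<eta>. indicator (cball (0::pt) 1) \<eta> * ennreal (norm \<eta> powr (- 2 * b)) \<partial>lborel))"

lemma wball_nonneg [simp]: "wball b \<ge> 0"
  by (simp add: wball_def)

lemma nn_powr_ball:
  assumes b: "0 \<le> b" "b < 1" and r: "r \<ge> 0"
  shows "(\<integral>\<^sup>+\<eta>. (indicator (cball (0::pt) r) \<eta> * ennreal (norm \<eta> powr (- b)))\<^sup>2 \<partial>lborel) \<le> ennreal ((wball b * r powr (1 - b))\<^sup>2)"
proof (cases "r = 0")
  case True
  have "(indicator (cball (0::pt) r) \<eta> * ennreal (norm \<eta> powr (- b)))\<^sup>2 = 0" for \<eta>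
    using True by (cases "\<eta> = 0") (auto simp: indicator_def)
  then have "(\<integral>\<^sup>+\<eta>. (indicator (cball (0::pt) r) \<eta> * ennreal (norm \<eta> powr (- b)))\<^sup>2 \<partial>lborel) = (\<integral>\<^sup>+\<eta>. 0 \<partial>(lborel::pt measure))"
    by (intro nn_integral_cong)
  then show ?thesis by simp
next
  case False
  with r have r: "r > 0" by simp
  have e: "(indicator (cball (0::pt) s) \<eta> * ennreal (norm \<eta> powr (- b)))\<^sup>2 = indicator (cball (0::pt) s) \<eta> * ennreal (norm \<eta> powr (- 2 * b))" for s \<eta>
    by (auto simp: indicator_def power2_eq_square ennreal_mult[symmetric] powr_add[symmetric])
  have "(\<integral>\<^sup>+\<eta>. (indicator (cball (0::pt) r) \<eta> * ennreal (norm \<eta> powr (- b)))\<^sup>2 \<partial>lborel)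
     = ennreal (r ^ DIM(pt)) * (\<integral>\<^sup>+\<eta>. indicator (cball (0::pt) r) (r *\<^sub>R \<eta>) * ennreal (norm (r *\<^sub>R \<eta>) powr (- 2 * b)) \<partial>lborel)"
    unfolding e by (rule nn_integral_scale) (use r in auto)
  also have "(\<lambda>\<eta>. indicator (cball (0::pt) r) (r *\<^sub>R \<eta>) * ennreal (norm (r *\<^sub>R \<eta>) powr (- 2 * b)))
     = (\<lambda>\<eta>. ennreal (r powr (- 2 * b)) * (indicator (cball (0::pt) 1) \<eta> * ennreal (norm \<eta> powr (- 2 * b))))"
    using r by (auto simp: indicator_def fun_eq_iff powr_mult ennreal_mult)
  also have "(\<integral>\<^sup>+\<eta>. ennreal (r powr (- 2 * b)) * (indicator (cball (0::pt) 1) \<eta> * ennreal (norm \<eta> powr (- 2 * b))) \<partial>lborel)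
     = ennreal (r powr (- 2 * b)) * (\<integral>\<^sup>+\<eta>. (indicator (cball (0::pt) 1) \<eta> * ennreal (norm \<eta> powr (- 2 * b))) \<partial>lborel)"
    by (rule nn_integral_cmult) measurable
  also have "(\<integral>\<^sup>+\<eta>. (indicator (cball (0::pt) 1) \<eta> * ennreal (norm \<eta> powr (- 2 * b))) \<partial>lborel) = ennreal ((wball b)\<^sup>2)"
    using powr_ball_finite[OF b] by (simp add: wball_def less_top)
  also have "ennreal (r ^ DIM(pt)) * (ennreal (r powr (- 2 * b)) * ennreal ((wball b)\<^sup>2)) = ennreal (r ^ 2 * (r powr (- 2 * b) * (wball b)\<^sup>2))"
    using r by (simp add: ennreal_mult)
  also have "r ^ 2 * (r powr (- 2 * b) * (wball b)\<^sup>2) = (wball b * r powr (1 - b))\<^sup>2"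
  proof -
    have "(r powr (1 - b))\<^sup>2 = r powr (2 - 2 * b)" by (simp add: power2_eq_square powr_add[symmetric])
    also have "\<dots> = r powr 2 * r powr (- 2 * b)" by (simp add: powr_add[symmetric])
    also have "\<dots> = r ^ 2 * r powr (- 2 * b)" using r by simp
    finally show ?thesis by (simp add: power_mult_distrib mult_ac)
  qed
  finally show ?thesis by simp
qed

lemma nn_weighted_ball:
  fixes p :: "pt \<Rightarrow> ennreal"
  assumes b: "0 \<le> b" "b < 1" and r: "r \<ge> 0" and [measurable]: "p \<in> borel_measurable borel"
    and p: "(\<integral>\<^sup>+x. (p x)\<^sup>2 \<partial>lborel) \<le> ennreal (P\<^sup>2)" "P \<ge> 0"
  shows "(\<integral>\<^sup>+\<eta>. indicator (cball 0 r) \<eta> * (ennreal (norm \<eta> powr (- b)) * p \<eta>) \<partial>lborel) \<le> ennreal (wball b * r powr (1 - b) * P)"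
proof -
  have "(\<integral>\<^sup>+\<eta>. indicator (cball 0 r) \<eta> * (ennreal (norm \<eta> powr (- b)) * p \<eta>) \<partial>lborel)
    = (\<integral>\<^sup>+\<eta>. (indicator (cball 0 r) \<eta> * ennreal (norm \<eta> powr (- b))) * p \<eta> \<partial>lborel)"
    by (simp only: mult.assoc)
  also have "\<dots> \<le> ennreal ((wball b * r powr (1 - b)) * P)"
    by (rule nn_Cauchy_Schwarz) (use nn_powr_ball[OF b r] p in auto)
  finally show ?thesis .
qed

subsection \<open>The trilinear estimate\<close>

lemma powr_third_le:
  assumes "0 \<le> b" "b \<le> 1" "(0::real) \<le> r"
  shows "(r / 3) powr (b - 1) \<le> r powr (b - 1) * 3"
proof -
  have "3 powr (1 - b) \<le> 3 powr (1::real)" using assms by (intro powr_mono) auto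
  then have t: "3 powr (1 - b) \<le> (3::real)" by simp
  have e: "1 / 3 powr (b - 1) = (3::real) powr (1 - b)"
    using powr_minus_divide[of 3 "b - 1"] by simp
  have "(r / 3) powr (b - 1) = r powr (b - 1) * (1 / 3 powr (b - 1))"
    using assms by (simp add: powr_divide)
  also have "\<dots> \<le> r powr (b - 1) * 3"
    unfolding e by (intro mult_left_mono t) auto
  finally show ?thesis .
qed

text \<open>The abstract form of Schur's test: the Cauchy--Schwarz inequality for the measure with
  density \<open>w\<close> on the product, where each factor contributes sqrt C.\<close>

lemma nn_bilinear_Cauchy_Schwarz:
  fixes w u v :: "'a::euclidean_space \<Rightarrow> 'b::euclidean_space \<Rightarrow> ennreal"
  assumes "case_prod w \<in> borel_measurable (borel \<Otimes>\<^sub>M borel)" "case_prod u \<in> borel_measurable (borel \<Otimes>\<^sub>M borel)"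
    "case_prod v \<in> borel_measurable (borel \<Otimes>\<^sub>M borel)"
    and nn: "C \<ge> 0" "y \<ge> 0" "z \<ge> 0"
    and u: "(\<integral>\<^sup>+q. \<integral>\<^sup>+p. w q p * (u q p)\<^sup>2 \<partial>lborel \<partial>lborel) \<le> ennreal (C * y\<^sup>2)"
    and v: "(\<integral>\<^sup>+q. \<integral>\<^sup>+p. w q p * (v q p)\<^sup>2 \<partial>lborel \<partial>lborel) \<le> ennreal (C * z\<^sup>2)"
  shows "(\<integral>\<^sup>+q. \<integral>\<^sup>+p. w q p * u q p * v q p \<partial>lborel \<partial>lborel) \<le> ennreal (C * y * z)"
proof -
  have s: "sets (lborel \<Otimes>\<^sub>M lborel :: ('a \<times> 'b) measure) = sets (borel \<Otimes>\<^sub>M borel)"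
    by (intro sets_pair_measure_cong) auto
  have [measurable]: "case_prod w \<in> borel_measurable (lborel \<Otimes>\<^sub>M lborel)" "case_prod u \<in> borel_measurable (lborel \<Otimes>\<^sub>M lborel)"
    "case_prod v \<in> borel_measurable (lborel \<Otimes>\<^sub>M lborel)"
    using assms(1-3) by (simp_all add: measurable_cong_sets[OF s refl])
  let ?M = "density (lborel \<Otimes>\<^sub>M lborel) (case_prod w)"
  have e: "(\<integral>\<^sup>+z. f z \<partial>?M) = (\<integral>\<^sup>+q. \<integral>\<^sup>+p. w q p * f (q, p) \<partial>lborel \<partial>lborel)"
    if [measurable]: "f \<in> borel_measurable (lborel \<Otimes>\<^sub>M lborel)" for f
    by (subst nn_integral_density) (auto simp: lborel.nn_integral_fst[symmetric])
  have "(\<integral>\<^sup>+z. case_prod u z * case_prod v z \<partial>?M) \<le> ennreal ((sqrt C * y) * (sqrt C * z))"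
    by (rule nn_Cauchy_Schwarz) (use u v nn in \<open>auto simp: e power_mult_distrib\<close>)
  then show ?thesis using nn by (simp add: e mult_ac)
qed

text \<open>Schur's test for the interaction in which \<open>p\<close> carries the lowest frequency: by Cauchy--Schwarz
  the integral of \<open>|p|^-b P(p)\<close> over \<open>|p| \<le> 3r\<close> is at most \<open>C r^(1-b) |P|\<close>, which the weight
  \<open>|q|^-(1-b)\<close> absorbs.\<close>

lemma Schur_low:
  fixes P g1 g2 :: "pt \<Rightarrow> ennreal"
  assumes b: "0 \<le> b" "b < 1"
    and [measurable]: "P \<in> borel_measurable borel" "g1 \<in> borel_measurable borel" "g2 \<in> borel_measurable borel"
    and nP: "(\<integral>\<^sup>+x. (P x)\<^sup>2 \<partial>lborel) \<le> ennreal (x\<^sup>2)" "x \<ge> 0"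
    and n1: "(\<integral>\<^sup>+x. (g1 x)\<^sup>2 \<partial>lborel) \<le> ennreal (y\<^sup>2)" "y \<ge> 0"
    and n2: "(\<integral>\<^sup>+x. (g2 x)\<^sup>2 \<partial>lborel) \<le> ennreal (z\<^sup>2)" "z \<ge> 0"
  shows "(\<integral>\<^sup>+q. \<integral>\<^sup>+p. (if norm p \<le> 3 * norm q \<and> norm p \<le> 3 * norm (p + q) \<and> norm (p + q) \<le> 3 * norm q
        then ennreal (norm p powr (- b) * norm q powr (b - 1)) * P p * g1 q * g2 (p + q) else 0) \<partial>lborel \<partial>lborel)
      \<le> ennreal (9 * wball b * x * y * z)"
proof -
  let ?R = "\<lambda>p q::pt. norm p \<le> 3 * norm q \<and> norm p \<le> 3 * norm (p + q) \<and> norm (p + q) \<le> 3 * norm q"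
  have [measurable]: "Measurable.pred (borel \<Otimes>\<^sub>M borel) (\<lambda>z. ?R (snd z) (fst z))" by measurable
  define w where "w q p = (if ?R p q then ennreal (norm p powr (- b) * norm q powr (b - 1)) * P p else 0)" for q p
  have [measurable]: "(\<lambda>z. w (fst z) (snd z)) \<in> borel_measurable (borel \<Otimes>\<^sub>M borel)" unfolding w_def by measurable
  have [measurable]: "case_prod w \<in> borel_measurable (borel \<Otimes>\<^sub>M borel)"
    using \<open>(\<lambda>z. w (fst z) (snd z)) \<in> borel_measurable (borel \<Otimes>\<^sub>M borel)\<close> by (simp add: case_prod_beta')
  \<comment> \<open>Integrating with \<open>q\<close> fixed costs only 3^(1-b), at most 3. With p +
    q fixed there is one more factor 3, whence 9.\<close>
  define C where "C = 9 * wball b * x"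
  have C0: "C \<ge> 0" unfolding C_def using nP by simp
  have cancel: "r powr (b - 1) * r powr (1 - b) \<le> 1" for r :: real
    by (simp add: powr_add[symmetric])
  have three: "3 powr (1 - b) \<le> (3::real)"
  proof -
    have "3 powr (1 - b) \<le> 3 powr (1::real)" using b by (intro powr_mono) auto
    then show ?thesis by simp
  qed
  have A: "(\<integral>\<^sup>+p. w q p \<partial>lborel) \<le> ennreal C" for q
  proof -
    have "(\<integral>\<^sup>+p. w q p \<partial>lborel) \<le> (\<integral>\<^sup>+p. ennreal (norm q powr (b - 1)) * (indicator (cball 0 (3 * norm q)) p * (ennreal (norm p powr (- b)) * P p)) \<partial>lborel)"
      unfolding w_def by (intro nn_integral_mono) (auto simp: ennreal_mult mult_ac)
    also have "\<dots> = ennreal (norm q powr (b - 1)) * (\<integral>\<^sup>+p. indicator (cball 0 (3 * norm q)) p * (ennreal (norm p powr (- b)) * P p) \<partial>lborel)"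
      by (rule nn_integral_cmult) measurable
    also have "\<dots> \<le> ennreal (norm q powr (b - 1)) * ennreal (wball b * (3 * norm q) powr (1 - b) * x)"
      by (intro mult_left_mono nn_weighted_ball b nP) auto
    also have "\<dots> = ennreal ((norm q powr (b - 1) * norm q powr (1 - b)) * (3 powr (1 - b) * (wball b * x)))"
      using nP by (simp add: ennreal_mult[symmetric] powr_mult mult_ac)
    also have "\<dots> \<le> ennreal (1 * (3 * (wball b * x)))"
      using nP cancel[of "norm q"] three by (intro ennreal_leI mult_mono) auto
    also have "\<dots> \<le> ennreal C" unfolding C_def using nP by (intro ennreal_leI) auto
    finally show ?thesis .
  qed
  \<comment> \<open>Now r = p + q is held fixed. In the region |r| is at most 3|q|, so the negative
    power of |q| may be traded for that of |r| at the cost of a factor 3.\<close>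
  have B: "(\<integral>\<^sup>+p. w (r - p) p \<partial>lborel) \<le> ennreal C" for r
  proof -
    have "(\<integral>\<^sup>+p. w (r - p) p \<partial>lborel) \<le> (\<integral>\<^sup>+p. ennreal (3 * norm r powr (b - 1)) * (indicator (cball 0 (3 * norm r)) p * (ennreal (norm p powr (- b)) * P p)) \<partial>lborel)"
    proof (intro nn_integral_mono)
      fix p :: pt
      show "w (r - p) p \<le> ennreal (3 * norm r powr (b - 1)) * (indicator (cball 0 (3 * norm r)) p * (ennreal (norm p powr (- b)) * P p))"
      proof (cases "?R p (r - p)")
        case True
        then have n: "norm p \<le> 3 * norm r" "norm r \<le> 3 * norm (r - p)" by auto
        have "norm (r - p) powr (b - 1) \<le> 3 * norm r powr (b - 1)"
        proof (cases "r = 0")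
          case False
          have "norm (r - p) powr (b - 1) \<le> (norm r / 3) powr (b - 1)"
            using b False n by (intro powr_mono2') auto
          also have "\<dots> \<le> norm r powr (b - 1) * 3" using b by (intro powr_third_le) auto
          finally show ?thesis by simp
        qed (use n in auto)
        then have "norm p powr (- b) * norm (r - p) powr (b - 1) \<le> norm p powr (- b) * (3 * norm r powr (b - 1))"
          by (intro mult_left_mono) auto
        then have "ennreal (norm p powr (- b) * norm (r - p) powr (b - 1)) * P p \<le> ennreal (norm p powr (- b) * (3 * norm r powr (b - 1))) * P p"
          by (intro mult_right_mono ennreal_leI) auto
        then show ?thesis using True n unfolding w_def by (simp add: ennreal_mult mult_ac)
      qed (auto simp: w_def)
    qed
    also have "\<dots> = ennreal (3 * norm r powr (b - 1)) * (\<integral>\<^sup>+p. indicator (cball 0 (3 * norm r)) p * (ennreal (norm p powr (- b)) * P p) \<partial>lborel)"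
      by (rule nn_integral_cmult) measurable
    also have "\<dots> \<le> ennreal (3 * norm r powr (b - 1)) * ennreal (wball b * (3 * norm r) powr (1 - b) * x)"
      by (intro mult_left_mono nn_weighted_ball b nP) auto
    also have "\<dots> = ennreal ((norm r powr (b - 1) * norm r powr (1 - b)) * (3 * (3 powr (1 - b)) * (wball b * x)))"
      using nP by (simp add: ennreal_mult[symmetric] powr_mult mult_ac)
    also have "\<dots> \<le> ennreal (1 * (3 * 3 * (wball b * x)))"
      using nP cancel[of "norm r"] three by (intro ennreal_leI mult_mono) auto
    also have "\<dots> = ennreal C" by (simp add: C_def mult.assoc)
    finally show ?thesis .
  qed
  have "(\<integral>\<^sup>+q. \<integral>\<^sup>+p. (if ?R p q then ennreal (norm p powr (- b) * norm q powr (b - 1)) * P p * g1 q * g2 (p + q) else 0) \<partial>lborel \<partial>lborel)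
     = (\<integral>\<^sup>+q. \<integral>\<^sup>+p. w q p * g1 q * g2 (p + q) \<partial>lborel \<partial>lborel)"
    unfolding w_def by (intro nn_integral_cong) auto
  also have "\<dots> \<le> ennreal (C * y * z)"
  proof (rule nn_bilinear_Cauchy_Schwarz[where w=w and u="\<lambda>q p. g1 q" and v="\<lambda>q p. g2 (p + q)", OF _ _ _ C0 n1(2) n2(2)])
    have "(\<integral>\<^sup>+q. \<integral>\<^sup>+p. w q p * (g1 q)\<^sup>2 \<partial>lborel \<partial>lborel) \<le> (\<integral>\<^sup>+q. ennreal C * (g1 q)\<^sup>2 \<partial>lborel)"
      by (intro nn_integral_mono) (simp add: nn_integral_multc A mult_right_mono)
    also have "\<dots> \<le> ennreal C * ennreal (y\<^sup>2)"
      by (subst nn_integral_cmult) (auto intro!: mult_left_mono n1)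
    finally show "(\<integral>\<^sup>+q. \<integral>\<^sup>+p. w q p * (g1 q)\<^sup>2 \<partial>lborel \<partial>lborel) \<le> ennreal (C * y\<^sup>2)"
      using C0 by (simp add: ennreal_mult)
    have "(\<integral>\<^sup>+q. \<integral>\<^sup>+p. w q p * (g2 (p + q))\<^sup>2 \<partial>lborel \<partial>lborel) = (\<integral>\<^sup>+p. \<integral>\<^sup>+q. w q p * (g2 (p + q))\<^sup>2 \<partial>lborel \<partial>lborel)"
      by (rule nn_Fubini_swap) measurable
    also have "\<dots> = (\<integral>\<^sup>+p. \<integral>\<^sup>+r. w (r - p) p * (g2 r)\<^sup>2 \<partial>lborel \<partial>lborel)"
    proof (rule nn_integral_cong)
      fix p :: pt
      show "(\<integral>\<^sup>+q. w q p * (g2 (p + q))\<^sup>2 \<partial>lborel) = (\<integral>\<^sup>+r. w (r - p) p * (g2 r)\<^sup>2 \<partial>lborel)"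
        using nn_integral_shift[of "\<lambda>r. w (r - p) p * (g2 r)\<^sup>2" p] by simp
    qed
    also have "\<dots> = (\<integral>\<^sup>+r. \<integral>\<^sup>+p. w (r - p) p * (g2 r)\<^sup>2 \<partial>lborel \<partial>lborel)"
      by (rule nn_Fubini_swap) measurable
    also have "\<dots> \<le> (\<integral>\<^sup>+r. ennreal C * (g2 r)\<^sup>2 \<partial>lborel)"
      by (intro nn_integral_mono) (simp add: nn_integral_multc B mult_right_mono)
    also have "\<dots> \<le> ennreal C * ennreal (z\<^sup>2)"
      by (subst nn_integral_cmult) (auto intro!: mult_left_mono n2)
    finally show "(\<integral>\<^sup>+q. \<integral>\<^sup>+p. w q p * (g2 (p + q))\<^sup>2 \<partial>lborel \<partial>lborel) \<le> ennreal (C * z\<^sup>2)"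
      using C0 by (simp add: ennreal_mult)
  qed measurable
  finally show ?thesis by (simp only: C_def)
qed

text \<open>The three regions are those where \<open>\<eta>\<close>, \<open>\<xi> - \<eta>\<close> or \<open>\<xi>\<close> respectively is the lowest frequency.\<close>

theorem trilinear_estimate:
  fixes f g h :: "pt \<Rightarrow> ennreal"
  assumes a: "0 < a" "a < 1"
    and [measurable]: "f \<in> borel_measurable borel" "g \<in> borel_measurable borel" "h \<in> borel_measurable borel"
    and nf: "(\<integral>\<^sup>+x. (f x)\<^sup>2 \<partial>lborel) \<le> ennreal (x\<^sup>2)" "x \<ge> 0"
    and ng: "(\<integral>\<^sup>+x. (g x)\<^sup>2 \<partial>lborel) \<le> ennreal (y\<^sup>2)" "y \<ge> 0"
    and nh: "(\<integral>\<^sup>+x. (h x)\<^sup>2 \<partial>lborel) \<le> ennreal (z\<^sup>2)" "z \<ge> 0"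
  shows "(\<integral>\<^sup>+\<xi>. \<integral>\<^sup>+\<eta>. ennreal (norm (\<xi> - \<eta>) powr (- a) * norm \<eta> powr (a - 1)) * f \<xi> * g (\<xi> - \<eta>) * h \<eta> \<partial>lborel \<partial>lborel)
      \<le> ennreal ((9 * wball (1 - a) + 9 * wball a + 27 * wball 0) * x * y * z)"
proof -
  let ?T = "\<lambda>\<xi> \<eta>. ennreal (norm (\<xi> - \<eta>) powr (- a) * norm \<eta> powr (a - 1)) * f \<xi> * g (\<xi> - \<eta>) * h \<eta>"
  define R where "R p q \<longleftrightarrow> norm p \<le> 3 * norm q \<and> norm p \<le> 3 * norm (p + q) \<and> norm (p + q) \<le> 3 * norm q" for p q :: pt
  have [measurable]: "Measurable.pred M (\<lambda>z. R (u z) (v z))"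
    if [measurable]: "u \<in> borel_measurable M" "v \<in> borel_measurable M" for u v :: "'z \<Rightarrow> pt" and M :: "'z measure"
    unfolding R_def by measurable
  define T1 where "T1 \<xi> \<eta> = (if R \<eta> (\<xi> - \<eta>) then ?T \<xi> \<eta> else 0)" for \<xi> \<eta>
  define T2 where "T2 \<xi> \<eta> = (if R (\<xi> - \<eta>) \<eta> then ?T \<xi> \<eta> else 0)" for \<xi> \<eta>
  define T3 where "T3 \<xi> \<eta> = (if R \<xi> (\<eta> - \<xi>) \<and> norm (\<eta> - \<xi>) \<le> 3 * norm \<eta> then ?T \<xi> \<eta> else 0)" for \<xi> \<eta>
  have [measurable]: "case_prod T1 \<in> borel_measurable (borel \<Otimes>\<^sub>M borel)" "case_prod T2 \<in> borel_measurable (borel \<Otimes>\<^sub>M borel)" "case_prod T3 \<in> borel_measurable (borel \<Otimes>\<^sub>M borel)"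
    unfolding T1_def T2_def T3_def by measurable
  \<comment> \<open>Among three vectors of which one is the sum of the other two, the two longest
    have lengths within a factor 2 of each other.\<close>
  have cases: "R \<eta> (\<xi> - \<eta>) \<or> R (\<xi> - \<eta>) \<eta> \<or> (R \<xi> (\<eta> - \<xi>) \<and> norm (\<eta> - \<xi>) \<le> 3 * norm \<eta>)" for \<xi> \<eta>
  proof -
    have t: "norm \<xi> \<le> norm \<eta> + norm (\<xi> - \<eta>)" "norm (\<xi> - \<eta>) \<le> norm \<xi> + norm \<eta>" "norm \<eta> \<le> norm \<xi> + norm (\<xi> - \<eta>)"
      using norm_triangle_ineq[of \<eta> "\<xi> - \<eta>"] norm_triangle_ineq4[of \<xi> \<eta>] norm_triangle_ineq4[of \<xi> "\<xi> - \<eta>"] by auto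
    then show ?thesis unfolding R_def by (auto simp: norm_minus_commute[of \<eta> \<xi>])
  qed
  have b1: "0 \<le> 1 - a" "1 - a < 1" "0 \<le> a" "a < 1" using a by auto
  have I1: "(\<integral>\<^sup>+\<xi>. \<integral>\<^sup>+\<eta>. T1 \<xi> \<eta> \<partial>lborel \<partial>lborel) \<le> ennreal (9 * wball (1 - a) * z * y * x)"
  proof -
    have "(\<integral>\<^sup>+\<xi>. \<integral>\<^sup>+\<eta>. T1 \<xi> \<eta> \<partial>lborel \<partial>lborel) = (\<integral>\<^sup>+\<eta>. \<integral>\<^sup>+\<xi>. T1 \<xi> \<eta> \<partial>lborel \<partial>lborel)"
      by (rule nn_Fubini_swap) measurable
    also have "\<dots> = (\<integral>\<^sup>+\<eta>. \<integral>\<^sup>+q. T1 (\<eta> + q) \<eta> \<partial>lborel \<partial>lborel)"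
      by (rule nn_integral_cong, rule nn_integral_shift[symmetric]) measurable
    also have "\<dots> = (\<integral>\<^sup>+q. \<integral>\<^sup>+\<eta>. T1 (\<eta> + q) \<eta> \<partial>lborel \<partial>lborel)"
      by (rule nn_Fubini_swap) measurable
    also have "\<dots> = (\<integral>\<^sup>+q. \<integral>\<^sup>+p. (if norm p \<le> 3 * norm q \<and> norm p \<le> 3 * norm (p + q) \<and> norm (p + q) \<le> 3 * norm q
        then ennreal (norm p powr (- (1 - a)) * norm q powr ((1 - a) - 1)) * h p * g q * f (p + q) else 0) \<partial>lborel \<partial>lborel)"
      unfolding T1_def R_def by (intro nn_integral_cong) (simp add: mult_ac)
    also have "\<dots> \<le> ennreal (9 * wball (1 - a) * z * y * x)"
      by (rule Schur_low[OF b1(1,2) _ _ _ nh ng nf]) measurable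
    finally show ?thesis .
  qed
  have I2: "(\<integral>\<^sup>+\<xi>. \<integral>\<^sup>+\<eta>. T2 \<xi> \<eta> \<partial>lborel \<partial>lborel) \<le> ennreal (9 * wball a * y * z * x)"
  proof -
    have "(\<integral>\<^sup>+\<xi>. \<integral>\<^sup>+\<eta>. T2 \<xi> \<eta> \<partial>lborel \<partial>lborel) = (\<integral>\<^sup>+\<eta>. \<integral>\<^sup>+\<xi>. T2 \<xi> \<eta> \<partial>lborel \<partial>lborel)"
      by (rule nn_Fubini_swap) measurable
    also have "\<dots> = (\<integral>\<^sup>+\<eta>. \<integral>\<^sup>+p. T2 (\<eta> + p) \<eta> \<partial>lborel \<partial>lborel)"
      by (rule nn_integral_cong, rule nn_integral_shift[symmetric]) measurable
    also have "\<dots> = (\<integral>\<^sup>+q. \<integral>\<^sup>+p. (if norm p \<le> 3 * norm q \<and> norm p \<le> 3 * norm (p + q) \<and> norm (p + q) \<le> 3 * norm q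
        then ennreal (norm p powr (- a) * norm q powr (a - 1)) * g p * h q * f (p + q) else 0) \<partial>lborel \<partial>lborel)"
      unfolding T2_def R_def by (intro nn_integral_cong) (simp add: mult_ac add.commute)
    also have "\<dots> \<le> ennreal (9 * wball a * y * z * x)"
      by (rule Schur_low[OF b1(3,4) _ _ _ ng nh nf]) measurable
    finally show ?thesis .
  qed
  \<comment> \<open>Here |\<xi> - \<eta>| and |\<eta>| are comparable, so the two powers merge into
    at most 3 / |q|, the weight of \<open>Schur_low\<close> with b = 0; this gives 27 = 3 *
    9.\<close>
  have I3: "(\<integral>\<^sup>+\<xi>. \<integral>\<^sup>+\<eta>. T3 \<xi> \<eta> \<partial>lborel \<partial>lborel) \<le> ennreal (27 * wball 0 * x * y * z)"
  proof -
    have "(\<integral>\<^sup>+\<xi>. \<integral>\<^sup>+\<eta>. T3 \<xi> \<eta> \<partial>lborel \<partial>lborel) = (\<integral>\<^sup>+\<xi>. \<integral>\<^sup>+q. T3 \<xi> (\<xi> + q) \<partial>lborel \<partial>lborel)"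
      by (rule nn_integral_cong, rule nn_integral_shift[symmetric]) measurable
    also have "\<dots> = (\<integral>\<^sup>+q. \<integral>\<^sup>+\<xi>. T3 \<xi> (\<xi> + q) \<partial>lborel \<partial>lborel)"
      by (rule nn_Fubini_swap) measurable
    also have "\<dots> \<le> (\<integral>\<^sup>+q. \<integral>\<^sup>+p. 3 * (if norm p \<le> 3 * norm q \<and> norm p \<le> 3 * norm (p + q) \<and> norm (p + q) \<le> 3 * norm q
        then ennreal (norm p powr (- 0) * norm q powr (0 - 1)) * f p * g (- q) * h (p + q) else 0) \<partial>lborel \<partial>lborel)"
    \<comment> \<open>Since \<open>0 powr 0 = 0\<close>, the factor \<open>norm p powr (- 0)\<close>
      is 1 only off the origin, so that point is discarded as a null set.\<close>
    proof (rule nn_integral_mono, rule nn_integral_mono_AE, use AE_lborel_singleton[of "0::pt"] in eventually_elim)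
      fix p q :: pt assume p0: "p \<noteq> 0"
      show "T3 p (p + q) \<le> 3 * (if norm p \<le> 3 * norm q \<and> norm p \<le> 3 * norm (p + q) \<and> norm (p + q) \<le> 3 * norm q
        then ennreal (norm p powr (- 0) * norm q powr (0 - 1)) * f p * g (- q) * h (p + q) else 0)"
      proof (cases "R p q \<and> norm q \<le> 3 * norm (p + q)")
        case True
        then have r: "norm p \<le> 3 * norm q" "norm p \<le> 3 * norm (p + q)" "norm (p + q) \<le> 3 * norm q" "norm q \<le> 3 * norm (p + q)"
          unfolding R_def by auto
        show ?thesis
        proof (cases "q = 0")
          case True
          then show ?thesis using r p0 by auto
        next
          case False
          then have q: "norm q > 0" "norm p > 0" using p0 by auto
          have "norm (p + q) powr (a - 1) \<le> (norm q / 3) powr (a - 1)"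
            using a q r by (intro powr_mono2') auto
          also have "\<dots> \<le> norm q powr (a - 1) * 3" using a by (intro powr_third_le) auto
          finally have "norm q powr (- a) * norm (p + q) powr (a - 1) \<le> norm q powr (- a) * (norm q powr (a - 1) * 3)"
            by (intro mult_left_mono) auto
          also have "\<dots> = 3 * norm q powr (- 1)" by (simp add: mult.assoc[symmetric] powr_add[symmetric])
          finally have le: "norm q powr (- a) * norm (p + q) powr (a - 1) \<le> 3 * (norm p powr (- 0) * norm q powr (0 - 1))"
            using q by simp
          have c: "norm p \<le> 3 * norm q \<and> norm p \<le> 3 * norm (p + q) \<and> norm (p + q) \<le> 3 * norm q"
            using r by blast
          have "T3 p (p + q) = ennreal (norm q powr (- a) * norm (p + q) powr (a - 1)) * (f p * g (- q) * h (p + q))"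
            using True by (simp add: T3_def mult_ac)
          also have "\<dots> \<le> ennreal (3 * (norm p powr (- 0) * norm q powr (0 - 1))) * (f p * g (- q) * h (p + q))"
            by (intro mult_right_mono ennreal_leI le) auto
          also have "\<dots> = 3 * (ennreal (norm p powr (- 0) * norm q powr (0 - 1)) * f p * g (- q) * h (p + q))"
            by (subst ennreal_mult) (auto simp: mult.assoc)
          finally show ?thesis unfolding if_P[OF c] .
        qed
      qed (auto simp: T3_def)
    qed
    also have "\<dots> = 3 * (\<integral>\<^sup>+q. \<integral>\<^sup>+p. (if norm p \<le> 3 * norm q \<and> norm p \<le> 3 * norm (p + q) \<and> norm (p + q) \<le> 3 * norm q
        then ennreal (norm p powr (- 0) * norm q powr (0 - 1)) * f p * g (- q) * h (p + q) else 0) \<partial>lborel \<partial>lborel)"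
      by (subst nn_integral_cmult[symmetric], measurable) (intro nn_integral_cong nn_integral_cmult, measurable)
    also have "\<dots> \<le> 3 * ennreal (9 * wball 0 * x * y * z)"
    proof (intro mult_left_mono Schur_low[of 0 f "\<lambda>q. g (- q)" h])
      show "(\<integral>\<^sup>+x. (g (- x))\<^sup>2 \<partial>lborel) \<le> ennreal (y\<^sup>2)"
        using nn_integral_reflect[of "\<lambda>x. (g x)\<^sup>2"] ng by simp
    qed (use nf ng nh in auto)
    also have "\<dots> = ennreal (27 * wball 0 * x * y * z)"
      using nf ng nh by (subst ennreal_numeral[symmetric], subst ennreal_mult[symmetric]) auto
    finally show ?thesis .
  qed
  have "(\<integral>\<^sup>+\<xi>. \<integral>\<^sup>+\<eta>. ?T \<xi> \<eta> \<partial>lborel \<partial>lborel) \<le> (\<integral>\<^sup>+\<xi>. \<integral>\<^sup>+\<eta>. T1 \<xi> \<eta> + T2 \<xi> \<eta> + T3 \<xi> \<eta> \<partial>lborel \<partial>lborel)"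
  proof (intro nn_integral_mono)
    fix \<xi> \<eta> show "?T \<xi> \<eta> \<le> T1 \<xi> \<eta> + T2 \<xi> \<eta> + T3 \<xi> \<eta>"
      using cases[of \<eta> \<xi>] unfolding T1_def T2_def T3_def
      by (elim disjE) (simp_all add: add_increasing add_increasing2)
  qed
  also have "\<dots> = (\<integral>\<^sup>+\<xi>. \<integral>\<^sup>+\<eta>. T1 \<xi> \<eta> \<partial>lborel \<partial>lborel) + (\<integral>\<^sup>+\<xi>. \<integral>\<^sup>+\<eta>. T2 \<xi> \<eta> \<partial>lborel \<partial>lborel) + (\<integral>\<^sup>+\<xi>. \<integral>\<^sup>+\<eta>. T3 \<xi> \<eta> \<partial>lborel \<partial>lborel)"
    by (simp add: nn_integral_add)
  also have "\<dots> \<le> ennreal (9 * wball (1 - a) * z * y * x) + ennreal (9 * wball a * y * z * x) + ennreal (27 * wball 0 * x * y * z)"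
    by (intro add_mono I1 I2 I3)
  also have "\<dots> = ennreal ((9 * wball (1 - a) + 9 * wball a + 27 * wball 0) * x * y * z)"
    using nf ng nh by (simp add: ennreal_plus[symmetric] algebra_simps del: ennreal_plus)
  finally show ?thesis .
qed

section \<open>Power weights at infinity\<close>

lemma powr_tail_finite:
  fixes s :: real
  assumes s: "1 < s"
  shows "(\<integral>\<^sup>+\<eta>. indicator (- ball (0::pt) 1) \<eta> * ennreal (norm \<eta> powr (- 2 * s)) \<partial>lborel) < \<infinity>"
proof -
  define m where "m = measure lborel (cball (0::pt) 1)"
  have m0: "m \<ge> 0" by (simp add: m_def)
  have m: "emeasure lborel (cball (0::pt) 1) = ennreal m"
    unfolding m_def using emeasure_cball_pt[of 1] by (intro emeasure_eq_ennreal_measure) (auto simp: less_top)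
  have mc: "emeasure lborel (cball (0::pt) r) = ennreal (r^2 * m)" if r: "r > 0" for r
  proof -
    have "emeasure lborel (cball (0::pt) r) = (\<integral>\<^sup>+x. indicator (cball (0::pt) r) x \<partial>lborel)" by simp
    also have "\<dots> = ennreal (r ^ DIM(pt)) * (\<integral>\<^sup>+x. indicator (cball (0::pt) r) (r *\<^sub>R x) \<partial>lborel)"
      by (rule nn_integral_scale) (use r in auto)
    also have "(\<lambda>x. indicator (cball (0::pt) r) (r *\<^sub>R x) :: ennreal) = indicator (cball (0::pt) 1)"
      using r by (auto simp: indicator_def fun_eq_iff)
    finally show ?thesis using m by (simp add: ennreal_mult m0)
  qed
  have pt: "indicator (- ball (0::pt) 1) \<eta> * ennreal (norm \<eta> powr (- 2 * s))
      \<le> (\<Sum>n. ennreal ((2^n) powr (- 2 * s)) * indicator (cball (0::pt) (2^Suc n)) \<eta>)" for \<eta>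
  proof (cases "\<eta> \<in> ball 0 1")
    case False
    then have n0: "1 \<le> norm \<eta>" by auto
    have ex: "\<exists>n. norm \<eta> < 2^n" using real_arch_pow[of 2 "norm \<eta>"] by auto
    define N where "N = (LEAST n. norm \<eta> < 2^n)"
    have N: "norm \<eta> < 2^N" unfolding N_def using ex by (rule LeastI_ex)
    have "N \<noteq> 0" using N n0 by (cases N) auto
    then obtain k where k: "N = Suc k" by (cases N) auto
    have "\<not> norm \<eta> < 2^k" using not_less_Least[of k "\<lambda>n. norm \<eta> < 2^n"] k by (auto simp: N_def)
    then have in_k: "2^k \<le> norm \<eta>" by simp
    then have "norm \<eta> powr (- 2 * s) \<le> (2^k) powr (- 2 * s)"
      using s by (intro powr_mono2') auto
    then have "ennreal (norm \<eta> powr (- 2 * s)) \<le> ennreal ((2^k) powr (- 2 * s)) * indicator (cball (0::pt) (2^Suc k)) \<eta>"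
      using N k by (simp add: ennreal_leI)
    also have "\<dots> \<le> (\<Sum>n. ennreal ((2^n) powr (- 2 * s)) * indicator (cball (0::pt) (2^Suc n)) \<eta>)"
      using sum_le_suminf[of "\<lambda>n. ennreal ((2^n) powr (- 2 * s)) * indicator (cball (0::pt) (2^Suc n)) \<eta>" "{k}"]
      by (simp del: sum_mult_indicator)
    finally show ?thesis using False by simp
  qed auto
  define q where "q = (2::real) powr (2 - 2 * s)"
  have q: "0 \<le> q" "q < 1" unfolding q_def using s powr_less_mono[of "2 - 2 * s" 0 2] by auto
  have q_pow: "(2^n) powr (- 2 * s) * ((2^Suc n)^2 * m) = 4 * m * q ^ n" for n
  proof -
    have "(2^n) powr (- 2 * s) * (2^n)^2 = ((2::real)^n) powr (- 2 * s) * (2^n) powr 2"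
      by simp
    also have "\<dots> = (2^n) powr (2 - 2 * s)" by (subst powr_add[symmetric]) (simp add: algebra_simps)
    also have "\<dots> = q ^ n"
      unfolding q_def by (simp add: powr_powr powr_realpow[symmetric] mult.commute)
    finally have e: "(2^n) powr (- 2 * s) * (2^n)^2 = q ^ n" .
    have "(2^n) powr (- 2 * s) * ((2^Suc n)^2 * m) = 4 * m * ((2^n) powr (- 2 * s) * (2^n)^2)"
      by (simp add: power_mult_distrib)
    then show ?thesis unfolding e .
  qed
  have "(\<integral>\<^sup>+\<eta>. indicator (- ball (0::pt) 1) \<eta> * ennreal (norm \<eta> powr (- 2 * s)) \<partial>lborel)
      \<le> (\<integral>\<^sup>+\<eta>. (\<Sum>n. ennreal ((2^n) powr (- 2 * s)) * indicator (cball (0::pt) (2^Suc n)) \<eta>) \<partial>lborel)"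
    by (intro nn_integral_mono pt)
  also have "\<dots> = (\<Sum>n. ennreal ((2^n) powr (- 2 * s)) * ennreal ((2^Suc n)^2 * m))"
    by (subst nn_integral_suminf) (auto simp: nn_integral_cmult_indicator mc simp del: power_Suc)
  also have "\<dots> = (\<Sum>n. ennreal (4 * m * q ^ n))"
    by (intro suminf_cong) (subst ennreal_mult[symmetric], simp, simp add: m0, simp only: q_pow)
  also have "\<dots> = ennreal (\<Sum>n. 4 * m * q ^ n)"
    using q by (intro suminf_ennreal2 summable_mult summable_geometric) (auto simp: m0)
  also have "\<dots> < \<infinity>" by simp
  finally show ?thesis .
qed

definition wtail :: "real \<Rightarrow> real" where
  "wtail s = sqrt (enn2real (\<integral>\<^sup>+\<eta>. indicator (- ball (0::pt) 1) \<eta> * ennreal (norm \<eta> powr (- 2 * s)) \<partial>lborel))"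

lemma wtail_nonneg [simp]: "wtail s \<ge> 0"
  by (simp add: wtail_def)

lemma nn_powr_tail:
  assumes s: "1 < s" and r: "r > 0"
  shows "(\<integral>\<^sup>+\<eta>. (indicator (- ball (0::pt) r) \<eta> * ennreal (norm \<eta> powr (- s)))\<^sup>2 \<partial>lborel) \<le> ennreal ((wtail s * r powr (1 - s))\<^sup>2)"
proof -
  have e: "(indicator (- ball (0::pt) r) \<eta> * ennreal (norm \<eta> powr (- s)))\<^sup>2 = indicator (- ball (0::pt) r) \<eta> * ennreal (norm \<eta> powr (- 2 * s))" for r \<eta>
    by (auto simp: indicator_def power2_eq_square ennreal_mult[symmetric] powr_add[symmetric])
  have "(\<integral>\<^sup>+\<eta>. (indicator (- ball (0::pt) r) \<eta> * ennreal (norm \<eta> powr (- s)))\<^sup>2 \<partial>lborel)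
     = ennreal (r ^ DIM(pt)) * (\<integral>\<^sup>+\<eta>. indicator (- ball (0::pt) r) (r *\<^sub>R \<eta>) * ennreal (norm (r *\<^sub>R \<eta>) powr (- 2 * s)) \<partial>lborel)"
    unfolding e by (rule nn_integral_scale) (use r in auto)
  also have "(\<lambda>\<eta>. indicator (- ball (0::pt) r) (r *\<^sub>R \<eta>) * ennreal (norm (r *\<^sub>R \<eta>) powr (- 2 * s)))
     = (\<lambda>\<eta>. ennreal (r powr (- 2 * s)) * (indicator (- ball (0::pt) 1) \<eta> * ennreal (norm \<eta> powr (- 2 * s))))"
    using r by (auto simp: indicator_def fun_eq_iff powr_mult ennreal_mult)
  also have "(\<integral>\<^sup>+\<eta>. ennreal (r powr (- 2 * s)) * (indicator (- ball (0::pt) 1) \<eta> * ennreal (norm \<eta> powr (- 2 * s))) \<partial>lborel)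
     = ennreal (r powr (- 2 * s)) * (\<integral>\<^sup>+\<eta>. (indicator (- ball (0::pt) 1) \<eta> * ennreal (norm \<eta> powr (- 2 * s))) \<partial>lborel)"
    by (rule nn_integral_cmult) measurable
  also have "(\<integral>\<^sup>+\<eta>. (indicator (- ball (0::pt) 1) \<eta> * ennreal (norm \<eta> powr (- 2 * s))) \<partial>lborel) = ennreal ((wtail s)\<^sup>2)"
    using powr_tail_finite[OF s] by (simp add: wtail_def less_top)
  also have "ennreal (r ^ DIM(pt)) * (ennreal (r powr (- 2 * s)) * ennreal ((wtail s)\<^sup>2)) = ennreal (r ^ 2 * (r powr (- 2 * s) * (wtail s)\<^sup>2))"
    using r by (simp add: ennreal_mult)
  also have "r ^ 2 * (r powr (- 2 * s) * (wtail s)\<^sup>2) = (wtail s * r powr (1 - s))\<^sup>2"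
  proof -
    have "(r powr (1 - s))\<^sup>2 = r powr (2 - 2 * s)" by (simp add: power2_eq_square powr_add[symmetric])
    also have "\<dots> = r powr 2 * r powr (- 2 * s)" by (simp add: powr_add[symmetric])
    also have "\<dots> = r ^ 2 * r powr (- 2 * s)" using r by simp
    finally show ?thesis by (simp add: power_mult_distrib mult_ac)
  qed
  finally show ?thesis by simp
qed

subsection \<open>Weighted norms\<close>

text \<open>The multiplier |D|^s on the Fourier side. The convention \<open>0 powr s = 0\<close>
  lets \<open>wt_wt\<close> hold for all exponents, negative ones included.\<close>

definition wt :: "real \<Rightarrow> (pt \<Rightarrow> complex) \<Rightarrow> pt \<Rightarrow> complex" where
  "wt s F \<xi> = complex_of_real (norm \<xi> powr s) * F \<xi>"

lemma wt_measurable [measurable]: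
  assumes [measurable]: "F \<in> borel_measurable borel"
  shows "wt s F \<in> borel_measurable borel"
  unfolding wt_def[abs_def] by measurable

lemma cmod_wt: "cmod (wt s F \<xi>) = norm \<xi> powr s * cmod (F \<xi>)"
  by (simp add: wt_def norm_mult)

lemma wt_diff: "wt s (\<lambda>\<xi>. F \<xi> - G \<xi>) = (\<lambda>\<xi>. wt s F \<xi> - wt s G \<xi>)"
  by (simp add: wt_def[abs_def] right_diff_distrib)

lemma wt_wt: "wt s (wt r F) = wt (s + r) F"
  by (simp add: wt_def[abs_def] powr_add mult.assoc)

text \<open>Frequencies up to \<open>R\<close> are charged to \<open>F\<close>, the higher ones to
  \<open>wt s F\<close>. The radius is left free: R = 1 gives the embedding \<open>wt_le_nH\<close>,
  while a large \<open>R\<close> makes the high part small in \<open>nH_small\<close>.\<close>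

lemma wt_interpolation:
  assumes F: "L2c F" "L2c (wt s F)" and r: "0 \<le> r" "r \<le> s" and R: "R > 0"
  shows "L2c (wt r F)" "l2 (wt r F) \<le> R powr r * l2 F + R powr (r - s) * l2 (wt s F)"
proof -
  note [measurable] = L2c_measurable[OF F(1)]
  define G where "G \<xi> = complex_of_real (R powr r) * complex_of_real (cmod (F \<xi>)) + complex_of_real (R powr (r - s)) * complex_of_real (cmod (wt s F \<xi>))" for \<xi>
  have L1: "L2c (\<lambda>\<xi>. complex_of_real (cmod (F \<xi>)))" "l2 (\<lambda>\<xi>. complex_of_real (cmod (F \<xi>))) = l2 F"
    using F(1) by (auto simp: L2c_def l2_def)
  have L2: "L2c (\<lambda>\<xi>. complex_of_real (cmod (wt s F \<xi>)))" "l2 (\<lambda>\<xi>. complex_of_real (cmod (wt s F \<xi>))) = l2 (wt s F)"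
    using F(2) by (auto simp: L2c_def l2_def)
  have G: "L2c G" unfolding G_def by (intro L2c_add L2c_cmult L1 L2)
  have lG: "l2 G \<le> R powr r * l2 F + R powr (r - s) * l2 (wt s F)"
    unfolding G_def using l2_triangle[OF L2c_cmult[OF L1(1), of "complex_of_real (R powr r)"] L2c_cmult[OF L2(1), of "complex_of_real (R powr (r - s))"]]
    by (simp add: l2_cmult L1 L2)
  have le: "cmod (wt r F \<xi>) \<le> 1 * cmod (G \<xi>)" for \<xi>
  proof -
    have p: "norm \<xi> powr r \<le> R powr r + R powr (r - s) * norm \<xi> powr s"
    proof (cases "norm \<xi> \<le> R")
      case True
      then have "norm \<xi> powr r \<le> R powr r" using r by (intro powr_mono2) auto
      then show ?thesis by (simp add: add_increasing2)
    next
      case False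
      then have "norm \<xi> powr r = norm \<xi> powr (r - s) * norm \<xi> powr s" by (simp add: powr_add[symmetric])
      also have "\<dots> \<le> R powr (r - s) * norm \<xi> powr s"
        using False R r by (intro mult_right_mono powr_mono2') auto
      finally show ?thesis by (simp add: add_increasing)
    qed
    have "cmod (wt r F \<xi>) \<le> (R powr r + R powr (r - s) * norm \<xi> powr s) * cmod (F \<xi>)"
      unfolding cmod_wt by (intro mult_right_mono p) auto
    also have "\<dots> = R powr r * cmod (F \<xi>) + R powr (r - s) * cmod (wt s F \<xi>)"
      by (simp add: cmod_wt distrib_right)
    also have "\<dots> = cmod (G \<xi>)"
    proof -
      have "G \<xi> = complex_of_real (R powr r * cmod (F \<xi>) + R powr (r - s) * cmod (wt s F \<xi>))" by (simp add: G_def)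
      then show ?thesis by (simp only: norm_of_real) simp
    qed
    finally show ?thesis by simp
  qed
  show "L2c (wt r F)" by (rule L2c_dominated(1)[OF G, where c=1]) (auto intro: le[simplified])
  have "l2 (wt r F) \<le> 1 * l2 G" by (rule L2c_dominated(2)[OF G, where c=1]) (auto intro: le[simplified])
  with lG show "l2 (wt r F) \<le> R powr r * l2 F + R powr (r - s) * l2 (wt s F)" by simp
qed

text \<open>A sum of two norms instead of the root of a sum of squares, so that triangle
  inequalities are immediate; \<open>nH_sq_le\<close> and \<open>sq_le_nH\<close> compare it with
  the squared Sobolev norm.\<close>

definition nH :: "real \<Rightarrow> (pt \<Rightarrow> complex) \<Rightarrow> real" where
  "nH s F = l2 F + l2 (wt s F)"

definition Hp :: "real \<Rightarrow> (pt \<Rightarrow> complex) \<Rightarrow> bool" where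
  "Hp s F \<longleftrightarrow> L2c F \<and> L2c (wt s F)"

lemma nH_nonneg [simp]: "nH s F \<ge> 0"
  by (simp add: nH_def)

lemma HpD: "Hp s F \<Longrightarrow> L2c F" "Hp s F \<Longrightarrow> L2c (wt s F)"
  by (auto simp: Hp_def)

lemma Hp_diff: "Hp s F \<Longrightarrow> Hp s G \<Longrightarrow> Hp s (\<lambda>\<xi>. F \<xi> - G \<xi>)"
  by (simp add: Hp_def wt_diff L2c_diff)

lemma nH_le_add:
  assumes "Hp s F" "Hp s G"
  shows "nH s F \<le> nH s G + nH s (\<lambda>x. F x - G x)"
  using l2_diff_abs[of F G] l2_diff_abs[of "wt s F" "wt s G"] assms by (simp add: Hp_def nH_def wt_diff)

lemma wt_le_nH:
  assumes "Hp s F" "0 \<le> r" "r \<le> s"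
  shows "L2c (wt r F)" "l2 (wt r F) \<le> nH s F"
  using wt_interpolation[of F s r 1] assms by (auto simp: Hp_def nH_def)

lemma ball_borel [measurable]: "ball x r \<in> sets borel"
  by (intro borel_open open_ball)

lemma nn_tail_L1:
  assumes s: "1 < s" and r: "r > 0" and F: "L2c (wt s F)" and [measurable]: "F \<in> borel_measurable borel"
  shows "(\<integral>\<^sup>+\<xi>. indicator (- ball 0 r) \<xi> * ennreal (cmod (F \<xi>)) \<partial>lborel) \<le> ennreal (wtail s * r powr (1 - s) * l2 (wt s F))"
proof -
  have "(\<integral>\<^sup>+\<xi>. indicator (- ball 0 r) \<xi> * ennreal (cmod (F \<xi>)) \<partial>lborel)
     = (\<integral>\<^sup>+\<xi>. (indicator (- ball 0 r) \<xi> * ennreal (norm \<xi> powr (- s))) * ennreal (cmod (wt s F \<xi>)) \<partial>lborel)"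
  proof (intro nn_integral_cong)
    fix \<xi> :: pt
    show "indicator (- ball 0 r) \<xi> * ennreal (cmod (F \<xi>)) = (indicator (- ball 0 r) \<xi> * ennreal (norm \<xi> powr (- s))) * ennreal (cmod (wt s F \<xi>))"
    proof (cases "\<xi> \<in> ball 0 r")
      case False
      then have "norm \<xi> > 0" using r by auto
      then have "norm \<xi> powr (- s) * cmod (wt s F \<xi>) = cmod (F \<xi>)"
        by (simp add: cmod_wt mult.assoc[symmetric] powr_add[symmetric])
      then show ?thesis using False by (simp add: ennreal_mult[symmetric])
    qed simp
  qed
  also have "\<dots> \<le> ennreal ((wtail s * r powr (1 - s)) * l2 (wt s F))"
  proof (rule nn_Cauchy_Schwarz)
    show "(\<integral>\<^sup>+\<xi>. (indicator (- ball (0::pt) r) \<xi> * ennreal (norm \<xi> powr (- s)))\<^sup>2 \<partial>lborel) \<le> ennreal ((wtail s * r powr (1 - s))\<^sup>2)"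
      by (rule nn_powr_tail[OF s r])
    show "(\<integral>\<^sup>+\<xi>. (ennreal (cmod (wt s F \<xi>)))\<^sup>2 \<partial>lborel) \<le> ennreal ((l2 (wt s F))\<^sup>2)"
      by (simp only: nn_integral_L2c'[OF F] order_refl)
  qed (measurable; simp)+
  finally show ?thesis .
qed

definition c1 :: "real \<Rightarrow> real" where
  "c1 s = l2 (\<lambda>x. complex_of_real (indicator (ball 0 1) x)) + wtail s"

lemma c1_nonneg [simp]: "c1 s \<ge> 0"
  by (simp add: c1_def)

text \<open>Cauchy--Schwarz against the indicator of the unit disc and, outside it, against
  |\<xi>|^(-s), which is square integrable there as s > 1. This is where a < 1/2 matters: it makes 2
  - 2a exceed 1, so solutions have integrable transforms and the velocity is bounded.\<close>

lemma Hp_integrable: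
  assumes s: "1 < s" and F: "Hp s F"
  shows "integrable lborel F" "norm1 F \<le> c1 s * nH s F"
proof -
  note [measurable] = L2c_measurable[OF HpD(1)[OF F]]
  define I where "I = (\<lambda>x. complex_of_real (indicator (ball (0::pt) 1) x))"
  have I: "L2c I" unfolding I_def by (rule L2c_indicator_ball)
  have "(\<integral>\<^sup>+\<xi>. ennreal (cmod (F \<xi>)) \<partial>lborel) = (\<integral>\<^sup>+\<xi>. ennreal (cmod (I \<xi>)) * ennreal (cmod (F \<xi>)) + indicator (- ball 0 1) \<xi> * ennreal (cmod (F \<xi>)) \<partial>lborel)"
    by (intro nn_integral_cong) (auto simp: I_def indicator_def)
  also have "\<dots> = (\<integral>\<^sup>+\<xi>. ennreal (cmod (I \<xi>)) * ennreal (cmod (F \<xi>)) \<partial>lborel) + (\<integral>\<^sup>+\<xi>. indicator (- ball 0 1) \<xi> * ennreal (cmod (F \<xi>)) \<partial>lborel)"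
    by (rule nn_integral_add) (simp_all add: I_def)
  also have "\<dots> \<le> ennreal (l2 I * l2 F) + ennreal (wtail s * 1 powr (1 - s) * l2 (wt s F))"
    by (intro add_mono nn_integral_mult_le I HpD(1)[OF F] nn_tail_L1 s HpD(2)[OF F]) auto
  also have "\<dots> = ennreal (l2 I * l2 F + wtail s * l2 (wt s F))"
    by (simp add: ennreal_plus[symmetric] del: ennreal_plus)
  also have "\<dots> \<le> ennreal (c1 s * nH s F)"
    unfolding c1_def I_def[symmetric] nH_def by (intro ennreal_leI) (simp add: algebra_simps)
  finally have le: "(\<integral>\<^sup>+\<xi>. ennreal (cmod (F \<xi>)) \<partial>lborel) \<le> ennreal (c1 s * nH s F)" .
  show i: "integrable lborel F"
    by (rule integrableI_bounded) (use le in \<open>auto intro: le_less_trans[OF _ ennreal_less_top]\<close>)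
  show "norm1 F \<le> c1 s * nH s F"
    using le by (simp add: nn_integral_norm1[OF i])
qed

subsection \<open>The bilinear operator\<close>

text \<open>The symbol of the transport term: the velocity multipliers at \<zeta> times the
  derivative multipliers at \<eta>, summed over the two components. It is the planar cross product
  of \<eta> and \<zeta> divided by |\<zeta>|.\<close>

definition kk :: "pt \<Rightarrow> pt \<Rightarrow> real" where
  "kk \<zeta> \<eta> = (\<zeta> $ 2 * \<eta> $ 1 - \<zeta> $ 1 * \<eta> $ 2) / norm \<zeta>"

lemma kk_measurable [measurable]:
  assumes [measurable]: "u \<in> borel_measurable M" "v \<in> borel_measurable M"
  shows "(\<lambda>x. kk (u x) (v x)) \<in> borel_measurable M"
proof -
  have [measurable]: "(\<lambda>x. (w x :: pt) $ i) \<in> borel_measurable M" if "w \<in> borel_measurable M" for w i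
    by (rule borel_measurable_continuous_on[OF _ that, of "\<lambda>y. y $ i"]) (intro continuous_intros)
  show ?thesis unfolding kk_def by measurable
qed

lemma kk_zero [simp]: "kk 0 \<eta> = 0"
  by (simp add: kk_def)

text \<open>Lagrange's identity: the squares of the cross and the inner product add up to the
  product of the squared norms.\<close>

lemma kk_le: "\<bar>kk \<zeta> \<eta>\<bar> \<le> norm \<eta>"
proof (cases "\<zeta> = 0")
  case False
  have nsq: "(norm x)\<^sup>2 = (x $ 1)\<^sup>2 + (x $ 2)\<^sup>2" for x :: pt
    unfolding power2_norm_eq_inner inner_vec_def sum_2 by (simp add: power2_eq_square)
  have "(norm \<zeta> * norm \<eta>)\<^sup>2 = (\<zeta> $ 2 * \<eta> $ 1 - \<zeta> $ 1 * \<eta> $ 2)\<^sup>2 + (\<zeta> $ 1 * \<eta> $ 1 + \<zeta> $ 2 * \<eta> $ 2)\<^sup>2"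
    unfolding power_mult_distrib nsq by (simp add: power2_eq_square algebra_simps)
  then have "(\<zeta> $ 2 * \<eta> $ 1 - \<zeta> $ 1 * \<eta> $ 2)\<^sup>2 \<le> (norm \<zeta> * norm \<eta>)\<^sup>2" by simp
  then have "\<bar>\<zeta> $ 2 * \<eta> $ 1 - \<zeta> $ 1 * \<eta> $ 2\<bar> \<le> norm \<zeta> * norm \<eta>"
    by (simp only: abs_le_square_iff[symmetric] abs_mult abs_norm_cancel)
  then show ?thesis using False by (simp add: kk_def pos_divide_le_eq mult.commute)
qed simp

text \<open>A cross product of a vector with itself vanishes, so both sides reduce to the cross
  product of \<xi> and \<eta> over |\<xi> - \<eta>|.\<close>

lemma kk_swap: "kk (\<eta> - \<xi>) \<xi> = - kk (\<xi> - \<eta>) \<eta>"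
  by (simp add: kk_def norm_minus_commute[of \<eta> \<xi>] minus_divide_left algebra_simps)

text \<open>The Fourier side of u . grad g, where \<open>F\<close> is the transform of the function
  generating the velocity and \<open>G\<close> that of the transported function \<open>g\<close>.
  The factor 1/(2 pi) belongs to the unitary normalisation.\<close>

definition Bop :: "(pt \<Rightarrow> complex) \<Rightarrow> (pt \<Rightarrow> complex) \<Rightarrow> pt \<Rightarrow> complex" where
  "Bop F G \<xi> = complex_of_real (1 / (2 * pi)) * (LINT \<eta>|lborel. complex_of_real (kk (\<xi> - \<eta>) \<eta>) * F (\<xi> - \<eta>) * G \<eta>)"

lemma cmod_Bop_integrand:
  "cmod (complex_of_real (kk (\<xi> - \<eta>) \<eta>) * F (\<xi> - \<eta>) * G \<eta>) \<le> cmod (F (\<xi> - \<eta>)) * cmod (wt 1 G \<eta>)"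
proof -
  have "\<bar>kk (\<xi> - \<eta>) \<eta>\<bar> * (cmod (F (\<xi> - \<eta>)) * cmod (G \<eta>)) \<le> norm \<eta> * (cmod (F (\<xi> - \<eta>)) * cmod (G \<eta>))"
    by (intro mult_right_mono kk_le) auto
  then show ?thesis by (simp add: norm_mult cmod_wt mult_ac)
qed

lemma Bop_measurable [measurable]:
  assumes [measurable]: "F \<in> borel_measurable borel" "G \<in> borel_measurable borel"
  shows "Bop F G \<in> borel_measurable borel"
  unfolding Bop_def[abs_def] by measurable

lemma Bop_integrable:
  assumes F: "L2c F" and G: "L2c (wt 1 G)" and [measurable]: "G \<in> borel_measurable borel"
  shows "integrable lborel (\<lambda>\<eta>. complex_of_real (kk (\<xi> - \<eta>) \<eta>) * F (\<xi> - \<eta>) * G \<eta>)"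
proof -
  note [measurable] = L2c_measurable[OF F]
  show ?thesis
  proof (rule Bochner_Integration.integrable_bound)
    show "integrable lborel (\<lambda>\<eta>. F (\<xi> - \<eta>) * wt 1 G \<eta>)"
      by (rule integrable_mult_L2c[OF L2c_const_minus(1)[OF F] G])
    show "AE \<eta> in lborel. norm (complex_of_real (kk (\<xi> - \<eta>) \<eta>) * F (\<xi> - \<eta>) * G \<eta>) \<le> norm (F (\<xi> - \<eta>) * wt 1 G \<eta>)"
      using cmod_Bop_integrand by (simp add: norm_mult[of "F _" "wt _ _ _"])
  qed measurable
qed

lemma Bop_L2c:
  assumes F: "integrable lborel F" and G: "L2c (wt 1 G)" and [measurable]: "G \<in> borel_measurable borel"
  shows "L2c (Bop F G)" "l2 (Bop F G) \<le> norm1 F * l2 (wt 1 G)"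
proof -
  have [measurable]: "F \<in> borel_measurable borel" using F by auto
  let ?K = "\<lambda>\<xi> \<eta>. complex_of_real (kk (\<xi> - \<eta>) \<eta>) * F (\<xi> - \<eta>) * G \<eta>"
  have K: "L2c (\<lambda>\<xi>. LINT \<eta>|lborel. ?K \<xi> \<eta>)" "l2 (\<lambda>\<xi>. LINT \<eta>|lborel. ?K \<xi> \<eta>) \<le> norm1 F * l2 (wt 1 G)"
  proof -
    have M: "case_prod ?K \<in> borel_measurable (borel \<Otimes>\<^sub>M borel)" by measurable
    show "L2c (\<lambda>\<xi>. LINT \<eta>|lborel. ?K \<xi> \<eta>)" "l2 (\<lambda>\<xi>. LINT \<eta>|lborel. ?K \<xi> \<eta>) \<le> norm1 F * l2 (wt 1 G)"
      by (rule L2c_kernel[of F "wt 1 G" ?K, OF F G M], rule cmod_Bop_integrand)+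
  qed
  show "L2c (Bop F G)" unfolding Bop_def[abs_def] by (intro L2c_cmult K)
  have "l2 (Bop F G) = 1 / (2 * pi) * l2 (\<lambda>\<xi>. LINT \<eta>|lborel. ?K \<xi> \<eta>)"
    unfolding Bop_def[abs_def] l2_cmult by (simp only: norm_of_real) simp
  also have "\<dots> \<le> 1 * l2 (\<lambda>\<xi>. LINT \<eta>|lborel. ?K \<xi> \<eta>)"
    using pi_ge_two by (intro mult_right_mono) auto
  finally show "l2 (Bop F G) \<le> norm1 F * l2 (wt 1 G)" using K(2) by simp
qed

lemma Bop_diff_left:
  assumes "L2c F" "L2c F'" "L2c (wt 1 G)" "G \<in> borel_measurable borel"
  shows "Bop (\<lambda>\<xi>. F \<xi> - F' \<xi>) G \<xi> = Bop F G \<xi> - Bop F' G \<xi>"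
  using Bop_integrable[OF assms(1,3,4), of \<xi>] Bop_integrable[OF assms(2,3,4), of \<xi>]
  unfolding Bop_def by (simp add: right_diff_distrib left_diff_distrib diff_divide_distrib)

lemma Bop_diff_right:
  assumes "L2c F" "L2c (wt 1 G)" "L2c (wt 1 G')" "G \<in> borel_measurable borel" "G' \<in> borel_measurable borel"
  shows "Bop F (\<lambda>\<xi>. G \<xi> - G' \<xi>) \<xi> = Bop F G \<xi> - Bop F G' \<xi>"
  using Bop_integrable[OF assms(1,2,4), of \<xi>] Bop_integrable[OF assms(1,3,5), of \<xi>]
  unfolding Bop_def by (simp add: right_diff_distrib left_diff_distrib diff_divide_distrib)

lemma Bop_herm:
  assumes "herm F" "herm G" and [measurable]: "F \<in> borel_measurable borel" "G \<in> borel_measurable borel"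
  shows "herm (Bop F G)"
  unfolding herm_def
proof
  fix \<xi>
  have "(LINT \<eta>|lborel. complex_of_real (kk (- \<xi> - \<eta>) \<eta>) * F (- \<xi> - \<eta>) * G \<eta>)
      = (LINT \<eta>|lborel. complex_of_real (kk (- \<xi> - - \<eta>) (- \<eta>)) * F (- \<xi> - - \<eta>) * G (- \<eta>))"
    by (rule integral_reflect[symmetric]) measurable
  also have "\<dots> = (LINT \<eta>|lborel. cnj (complex_of_real (kk (\<xi> - \<eta>) \<eta>) * F (\<xi> - \<eta>) * G \<eta>))"
  proof (intro Bochner_Integration.integral_cong refl)
    fix \<eta>
    have e: "- \<xi> - - \<eta> = - (\<xi> - \<eta>)" by simp
    have k: "kk (- (\<xi> - \<eta>)) (- \<eta>) = kk (\<xi> - \<eta>) \<eta>" by (simp add: kk_def norm_minus_commute algebra_simps)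
    show "complex_of_real (kk (- \<xi> - - \<eta>) (- \<eta>)) * F (- \<xi> - - \<eta>) * G (- \<eta>) = cnj (complex_of_real (kk (\<xi> - \<eta>) \<eta>) * F (\<xi> - \<eta>) * G \<eta>)"
    proof -
      have "F (- (\<xi> - \<eta>)) = cnj (F (\<xi> - \<eta>))" "G (- \<eta>) = cnj (G \<eta>)" using assms(1,2) unfolding herm_def by blast+
      then show ?thesis unfolding e k by (simp only: complex_cnj_mult complex_cnj_complex_of_real)
    qed
  qed
  also have "\<dots> = cnj (LINT \<eta>|lborel. complex_of_real (kk (\<xi> - \<eta>) \<eta>) * F (\<xi> - \<eta>) * G \<eta>)"
    by (rule Bochner_Integration.integral_cnj)
  finally show "Bop F G (- \<xi>) = cnj (Bop F G \<xi>)"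
    unfolding Bop_def by (simp only: complex_cnj_mult complex_cnj_complex_of_real)
qed

lemma Bop_cong_AE:
  assumes F: "AE \<xi> in lborel. F \<xi> = F' \<xi>" and G: "AE \<xi> in lborel. G \<xi> = G' \<xi>"
    and [measurable]: "F \<in> borel_measurable borel" "F' \<in> borel_measurable borel" "G \<in> borel_measurable borel" "G' \<in> borel_measurable borel"
  shows "Bop F G = Bop F' G'"
proof
  fix \<xi>
  have "(LINT \<eta>|lborel. complex_of_real (kk (\<xi> - \<eta>) \<eta>) * F (\<xi> - \<eta>) * G \<eta>) = (LINT \<eta>|lborel. complex_of_real (kk (\<xi> - \<eta>) \<eta>) * F' (\<xi> - \<eta>) * G' \<eta>)"
  proof (rule integral_cong_AE)
    show "AE \<eta> in lborel. complex_of_real (kk (\<xi> - \<eta>) \<eta>) * F (\<xi> - \<eta>) * G \<eta> = complex_of_real (kk (\<xi> - \<eta>) \<eta>) * F' (\<xi> - \<eta>) * G' \<eta>"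
      using AE_const_minus[OF F, of \<xi>] G by eventually_elim simp
  qed measurable
  then show "Bop F G \<xi> = Bop F' G' \<xi>" unfolding Bop_def by simp
qed

text \<open>The cancellation behind all energy estimates: exchanging \<open>\<xi>\<close> and \<open>\<eta>\<close> changes the sign of the
  kernel and conjugates the rest, which is the Fourier side of \<open>div u = 0\<close>.\<close>

lemma Bop_cancel:
  assumes T: "herm \<Theta>" "integrable lborel \<Theta>" and Y: "L2c Y" "L2c (wt 1 Y)"
  shows "Re (ip (Bop \<Theta> Y) Y) = 0"
proof -
  have [measurable]: "\<Theta> \<in> borel_measurable borel" "Y \<in> borel_measurable borel" using T L2c_measurable[OF Y(1)] by auto
  define g where "g \<xi> \<eta> = complex_of_real (kk (\<xi> - \<eta>) \<eta>) * \<Theta> (\<xi> - \<eta>) * Y \<eta> * cnj (Y \<xi>)" for \<xi> \<eta>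
  have [measurable]: "case_prod g \<in> borel_measurable (borel \<Otimes>\<^sub>M borel)" unfolding g_def by measurable
  have sw: "g \<eta> \<xi> = - cnj (g \<xi> \<eta>)" for \<xi> \<eta>
  proof -
    have "\<Theta> (\<eta> - \<xi>) = cnj (\<Theta> (\<xi> - \<eta>))" using T(1) unfolding herm_def by (metis minus_diff_eq)
    then show ?thesis unfolding g_def by (subst kk_swap) simp
  qed
  have fin: "(\<integral>\<^sup>+\<xi>. \<integral>\<^sup>+\<eta>. ennreal (norm (g \<xi> \<eta>)) \<partial>lborel \<partial>lborel) < \<infinity>"
  proof -
    have "(\<integral>\<^sup>+\<xi>. \<integral>\<^sup>+\<eta>. ennreal (norm (g \<xi> \<eta>)) \<partial>lborel \<partial>lborel) \<le> (\<integral>\<^sup>+\<xi>. \<integral>\<^sup>+\<eta>. ennreal (cmod (\<Theta> (\<xi> - \<eta>)) * cmod (wt 1 Y \<eta>) * cmod (Y \<xi>)) \<partial>lborel \<partial>lborel)"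
    proof (intro nn_integral_mono ennreal_leI)
      fix \<xi> \<eta>
      show "norm (g \<xi> \<eta>) \<le> cmod (\<Theta> (\<xi> - \<eta>)) * cmod (wt 1 Y \<eta>) * cmod (Y \<xi>)"
        unfolding g_def norm_mult[of _ "cnj (Y \<xi>)"] complex_mod_cnj by (intro mult_right_mono cmod_Bop_integrand) auto
    qed
    also have "\<dots> \<le> ennreal (norm1 \<Theta> * l2 (wt 1 Y) * l2 Y)" by (rule nn_trilinear_Young[OF T(2) Y(2,1)])
    also have "\<dots> < \<infinity>" by simp
    finally show ?thesis .
  qed
  let ?I = "LINT \<xi>|lborel. LINT \<eta>|lborel. g \<xi> \<eta>"
  have "?I = (LINT \<eta>|lborel. LINT \<xi>|lborel. g \<xi> \<eta>)"
    by (rule Fubini_swap(2)[OF _ fin]) measurable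
  also have "\<dots> = (LINT \<eta>|lborel. LINT \<xi>|lborel. - cnj (g \<eta> \<xi>))"
    by (subst sw) simp
  also have "\<dots> = - cnj ?I" by simp
  finally have "Re ?I = Re (- cnj ?I)" by (rule arg_cong)
  then have "Re ?I = 0" by simp
  moreover have "ip (Bop \<Theta> Y) Y = complex_of_real (1 / (2 * pi)) * ?I"
    unfolding ip_def Bop_def g_def by (simp only: integral_mult_left_zero[symmetric] integral_mult_right_zero[symmetric] mult_ac)
  moreover have "Re (complex_of_real r * z) = r * Re z" for r z by simp
  ultimately show ?thesis by (simp only: mult_zero_right)
qed

lemma norm_integral_le_nn_integral:
  fixes f :: "'a \<Rightarrow> 'b::{banach, second_countable_topology}"
  shows "ennreal (norm (integral\<^sup>L M f)) \<le> (\<integral>\<^sup>+x. ennreal (norm (f x)) \<partial>M)"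
  by (cases "integrable M f") (auto simp: integral_norm_bound_ennreal not_integrable_integral_eq)

definition cT :: "real \<Rightarrow> real" where
  "cT a = 9 * wball (1 - a) + 9 * wball a + 27 * wball 0"

lemma cT_nonneg [simp]: "cT a \<ge> 0" by (simp add: cT_def)

lemma cT_swap: "cT (1 - a) = cT a" by (simp add: cT_def)

lemma trilinear_L2c:
  assumes a: "0 < a" "a < 1" and V: "L2c V" and W: "L2c W" and F: "L2c F"
  shows "(\<integral>\<^sup>+\<xi>. \<integral>\<^sup>+\<eta>. ennreal (norm (\<xi> - \<eta>) powr (- a) * norm \<eta> powr (a - 1) * cmod (V \<xi>) * cmod (W (\<xi> - \<eta>)) * cmod (F \<eta>)) \<partial>lborel \<partial>lborel)
      \<le> ennreal (cT a * l2 V * l2 W * l2 F)"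
proof -
  note [measurable] = L2c_measurable[OF V] L2c_measurable[OF W] L2c_measurable[OF F]
  have "(\<integral>\<^sup>+\<xi>. \<integral>\<^sup>+\<eta>. ennreal (norm (\<xi> - \<eta>) powr (- a) * norm \<eta> powr (a - 1)) * ennreal (cmod (V \<xi>)) * ennreal (cmod (W (\<xi> - \<eta>))) * ennreal (cmod (F \<eta>)) \<partial>lborel \<partial>lborel)
      \<le> ennreal ((9 * wball (1 - a) + 9 * wball a + 27 * wball 0) * l2 V * l2 W * l2 F)"
    by (rule trilinear_estimate[OF a _ _ _ eq_refl[OF nn_integral_L2c'[OF V]] l2_nonneg eq_refl[OF nn_integral_L2c'[OF W]] l2_nonneg eq_refl[OF nn_integral_L2c'[OF F]] l2_nonneg]) measurable
  then show ?thesis unfolding cT_def by (simp add: ennreal_mult)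
qed

text \<open>The derivative |\<eta>| coming from the kernel is written as |\<eta>|^(a-1)
  |\<eta>|^(2-a), and 1 as |\<xi> - \<eta>|^(-a) |\<xi> - \<eta>|^a, which leaves exactly the
  trilinear weight. \<open>W\<close> is measured with a derivatives because the dissipation controls
  just those.\<close>

lemma Bop_bound:
  assumes a: "0 < a" "a < 1" and V: "L2c V" and W: "L2c (wt a W)" "W \<in> borel_measurable borel"
    and F: "L2c (wt (2 - a) F)" "F \<in> borel_measurable borel"
  shows "cmod (ip (Bop W F) V) \<le> cT a * l2 V * l2 (wt a W) * l2 (wt (2 - a) F)"
proof -
  note [measurable] = L2c_measurable[OF V] W(2) F(2)
  let ?g = "\<lambda>\<xi> \<eta>. complex_of_real (kk (\<xi> - \<eta>) \<eta>) * W (\<xi> - \<eta>) * F \<eta> * cnj (V \<xi>)"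
  have pt: "cmod (?g \<xi> \<eta>) \<le> norm (\<xi> - \<eta>) powr (- a) * norm \<eta> powr (a - 1) * cmod (V \<xi>) * cmod (wt a W (\<xi> - \<eta>)) * cmod (wt (2 - a) F \<eta>)" for \<xi> \<eta>
  proof (cases "\<xi> = \<eta> \<or> \<eta> = 0")
    case True
    then show ?thesis using kk_le[of "\<xi> - \<eta>" \<eta>] by (auto simp: norm_mult)
  next
    case False
    then have n: "norm (\<xi> - \<eta>) > 0" "norm \<eta> > 0" by auto
    have "norm (\<xi> - \<eta>) powr (- a) * norm (\<xi> - \<eta>) powr a = 1" using n by (simp add: powr_add[symmetric])
    moreover have "norm \<eta> powr (a - 1) * norm \<eta> powr (2 - a) = norm \<eta>" using n by (simp add: powr_add[symmetric])
    moreover have "norm (\<xi> - \<eta>) powr (- a) * norm \<eta> powr (a - 1) * cmod (V \<xi>) * cmod (wt a W (\<xi> - \<eta>)) * cmod (wt (2 - a) F \<eta>)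
      = (norm (\<xi> - \<eta>) powr (- a) * norm (\<xi> - \<eta>) powr a) * (norm \<eta> powr (a - 1) * norm \<eta> powr (2 - a)) * (cmod (W (\<xi> - \<eta>)) * cmod (F \<eta>) * cmod (V \<xi>))"
      unfolding cmod_wt by (simp only: mult_ac)
    ultimately have e: "norm (\<xi> - \<eta>) powr (- a) * norm \<eta> powr (a - 1) * cmod (V \<xi>) * cmod (wt a W (\<xi> - \<eta>)) * cmod (wt (2 - a) F \<eta>)
      = norm \<eta> * (cmod (W (\<xi> - \<eta>)) * cmod (F \<eta>) * cmod (V \<xi>))" by simp
    show ?thesis unfolding e using mult_right_mono[OF kk_le[of "\<xi> - \<eta>" \<eta>], of "cmod (W (\<xi> - \<eta>)) * cmod (F \<eta>) * cmod (V \<xi>)"]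
      by (simp add: norm_mult mult.assoc)
  qed
  have "ip (Bop W F) V = complex_of_real (1 / (2 * pi)) * (LINT \<xi>|lborel. LINT \<eta>|lborel. ?g \<xi> \<eta>)"
    unfolding ip_def Bop_def by (simp only: integral_mult_left_zero[symmetric] integral_mult_right_zero[symmetric] mult_ac)
  then have "cmod (ip (Bop W F) V) = 1 / (2 * pi) * cmod (LINT \<xi>|lborel. LINT \<eta>|lborel. ?g \<xi> \<eta>)"
    by (simp only: norm_mult norm_of_real) simp
  also have "\<dots> \<le> 1 * cmod (LINT \<xi>|lborel. LINT \<eta>|lborel. ?g \<xi> \<eta>)"
    using pi_ge_two by (intro mult_right_mono) auto
  also have "\<dots> \<le> cT a * l2 V * l2 (wt a W) * l2 (wt (2 - a) F)"
  proof -
    have "(\<integral>\<^sup>+\<xi>. ennreal (norm (LINT \<eta>|lborel. ?g \<xi> \<eta>)) \<partial>lborel) \<le> (\<integral>\<^sup>+\<xi>. \<integral>\<^sup>+\<eta>. ennreal (norm (?g \<xi> \<eta>)) \<partial>lborel \<partial>lborel)"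
      by (intro nn_integral_mono norm_integral_le_nn_integral)
    also have "\<dots> \<le> (\<integral>\<^sup>+\<xi>. \<integral>\<^sup>+\<eta>. ennreal (norm (\<xi> - \<eta>) powr (- a) * norm \<eta> powr (a - 1) * cmod (V \<xi>) * cmod (wt a W (\<xi> - \<eta>)) * cmod (wt (2 - a) F \<eta>)) \<partial>lborel \<partial>lborel)"
      by (intro nn_integral_mono ennreal_leI pt)
    also have "\<dots> \<le> ennreal (cT a * l2 V * l2 (wt a W) * l2 (wt (2 - a) F))"
      by (rule trilinear_L2c[OF a V W(1) F(1)])
    finally show ?thesis unfolding mult_1 by (rule norm_integral_le_nn) simp
  qed
  finally show ?thesis .
qed

subsection \<open>The commutator estimate\<close>

text \<open>The mean value theorem gives s m^(s-1) |x - y| with m = max x y, and m is at most 2 max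
  d y. Both s and 2^(s-1) are at most 2, hence the 4.\<close>

lemma powr_diff_le:
  fixes x y d s :: real
  assumes nn: "0 \<le> x" "0 \<le> y" and d: "\<bar>x - y\<bar> \<le> d" and s: "1 \<le> s" "s \<le> 2"
  shows "\<bar>x powr s - y powr s\<bar> \<le> 4 * d * (d powr (s - 1) + y powr (s - 1))"
proof -
  have main: "v powr s - u powr s \<le> s * v powr (s - 1) * (v - u)" if uv: "0 \<le> u" "u \<le> v" for u v :: real
  proof (cases "u = 0 \<or> u = v")
    case True
    show ?thesis
    proof (cases "u = v")
      case False
      have u: "u = 0" using True False by blast
      have v: "v > 0" using u False uv by linarith
      have "v powr s = v powr (s - 1) * v"
        using v powr_add[of v "s - 1" 1] by simp
      also have "\<dots> \<le> s * (v powr (s - 1) * v)"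
        using s v mult_right_mono[of 1 s "v powr (s - 1) * v"] by simp
      finally show ?thesis unfolding u by (simp add: mult.assoc)
    qed simp
  next
    case False
    then have "0 < u" "u < v" using uv by auto
    have "\<exists>z. u < z \<and> z < v \<and> v powr s - u powr s = (v - u) * (s * z powr (s - 1))"
    proof (rule MVT2[OF \<open>u < v\<close>])
      fix x assume "u \<le> x" "x \<le> v"
      then show "((\<lambda>x. x powr s) has_real_derivative s * x powr (s - 1)) (at x)"
        using \<open>0 < u\<close> by (auto intro!: has_real_derivative_powr)
    qed
    then obtain z where z: "u < z" "z < v" "v powr s - u powr s = (v - u) * (s * z powr (s - 1))" by blast
    have "z powr (s - 1) \<le> v powr (s - 1)" using z s \<open>0 < u\<close> by (intro powr_mono2) auto
    then have "(v - u) * (s * z powr (s - 1)) \<le> (v - u) * (s * v powr (s - 1))"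
      using uv s by (intro mult_left_mono) auto
    then show ?thesis using z by (simp add: mult_ac)
  qed
  let ?m = "max x y"
  have d0: "d \<ge> 0" using d by linarith
  have "\<bar>x powr s - y powr s\<bar> \<le> s * ?m powr (s - 1) * \<bar>x - y\<bar>"
  proof (cases "x \<le> y")
    case True
    then have "x powr s \<le> y powr s" using nn s by (intro powr_mono2) auto
    then show ?thesis using main[of x y] True nn by (simp add: max_def)
  next
    case False
    then have "y powr s \<le> x powr s" using nn s by (intro powr_mono2) auto
    then show ?thesis using main[of y x] False nn by (simp add: max_def)
  qed
  also have "\<dots> \<le> 2 * (2 * (d powr (s - 1) + y powr (s - 1))) * d"
  proof (intro mult_mono)
    have "?m \<le> 2 * max d y" using d nn by auto
    then have "?m powr (s - 1) \<le> (2 * max d y) powr (s - 1)" using nn s by (intro powr_mono2) auto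
    also have "\<dots> = 2 powr (s - 1) * max d y powr (s - 1)" using d0 by (simp add: powr_mult)
    also have "\<dots> \<le> 2 * (d powr (s - 1) + y powr (s - 1))"
    proof (intro mult_mono)
      have "2 powr (s - 1) \<le> 2 powr (1::real)" using s by (intro powr_mono) auto
      then show "2 powr (s - 1) \<le> (2::real)" by simp
      show "max d y powr (s - 1) \<le> d powr (s - 1) + y powr (s - 1)" by (auto simp: max_def)
    qed auto
    finally show "?m powr (s - 1) \<le> 2 * (d powr (s - 1) + y powr (s - 1))" .
  qed (use s d d0 in simp_all)
  finally show ?thesis by (simp add: mult_ac)
qed

definition supp :: "real \<Rightarrow> (pt \<Rightarrow> complex) \<Rightarrow> bool" where
  "supp N F \<longleftrightarrow> (\<forall>\<xi>. norm \<xi> \<ge> N \<longrightarrow> F \<xi> = 0)"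

lemma L2c_wt_supp:
  assumes F: "L2c F" "supp N F" and N: "N \<ge> 0" and r: "r \<ge> 0"
  shows "L2c (wt r F)" "l2 (wt r F) \<le> N powr r * l2 F"
proof -
  note [measurable] = L2c_measurable[OF F(1)]
  have "cmod (wt r F \<xi>) \<le> N powr r * cmod (F \<xi>)" for \<xi>
  proof (cases "norm \<xi> > N")
    case False
    then have "norm \<xi> powr r \<le> N powr r" using r by (intro powr_mono2) auto
    then show ?thesis unfolding cmod_wt by (intro mult_right_mono) auto
  qed (use F(2) in \<open>auto simp: supp_def cmod_wt\<close>)
  then show "L2c (wt r F)" "l2 (wt r F) \<le> N powr r * l2 F"
    by (auto intro!: L2c_dominated[OF F(1), where c="N powr r"] AE_I2)
qed

lemma supp_wt: "supp N F \<Longrightarrow> supp N (wt r F)"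
  by (simp add: supp_def wt_def)

text \<open>With s = 2 - a and Y = |\<xi>|^s F, half of the weight 2s is moved onto
  \<open>Bop F F\<close>. Subtracting \<open>Bop F Y\<close>, whose pairing with \<open>Y\<close>
  has real part 0 by \<open>Bop_cancel\<close>, leaves a kernel with the factor |\<xi>|^s -
  |\<eta>|^s. By \<open>powr_diff_le\<close> it splits into two terms: in one |D|^2 falls on the
  velocity factor and |D|^s on the other, in the second the roles are exchanged. They are trilinear
  forms with exponents a and 1 - a, each with constant 4, which makes 8. The bounded support of
  \<open>F\<close> keeps all pairings finite.\<close>

theorem commutator_estimate:
  assumes a: "0 < a" "a < 1" and F: "L2c F" "supp N F" "herm F" and N: "N \<ge> 0"
  shows "\<bar>Re (ip (Bop F F) (wt (2 * (2 - a)) F))\<bar> \<le> 8 * cT a * l2 (wt (2 - a) F) * l2 (wt 2 F) * l2 (wt (2 - a) F)"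
proof -
  define s where "s = 2 - a"
  have s: "1 \<le> s" "s \<le> 2" using a by (auto simp: s_def)
  define Y where "Y = wt s F"
  note [measurable] = L2c_measurable[OF F(1)]
  have W: "L2c (wt r F)" if "r \<ge> 0" for r by (rule L2c_wt_supp(1)[OF F(1,2) N that])
  have Y: "L2c Y" unfolding Y_def using s by (intro W) auto
  have WY: "L2c (wt 1 Y)" unfolding Y_def wt_wt using s by (intro W) auto
  note [measurable] = L2c_measurable[OF Y]
  have "Hp 2 F" using F(1) W[of 2] by (simp add: Hp_def)
  then have Fi: "integrable lborel F" by (intro Hp_integrable(1)[of 2]) auto
  define K where "K \<xi> \<eta> = complex_of_real (kk (\<xi> - \<eta>) \<eta>) * F (\<xi> - \<eta>) * (complex_of_real (norm \<xi> powr s - norm \<eta> powr s) * F \<eta>)" for \<xi> \<eta>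
  have D: "complex_of_real (norm \<xi> powr s) * Bop F F \<xi> - Bop F Y \<xi> = complex_of_real (1 / (2 * pi)) * (LINT \<eta>|lborel. K \<xi> \<eta>)" for \<xi>
  proof -
    have i1: "integrable lborel (\<lambda>\<eta>. complex_of_real (norm \<xi> powr s) * (complex_of_real (kk (\<xi> - \<eta>) \<eta>) * F (\<xi> - \<eta>) * F \<eta>))"
      by (intro integrable_mult_right Bop_integrable F(1) W) auto
    have i2: "integrable lborel (\<lambda>\<eta>. complex_of_real (kk (\<xi> - \<eta>) \<eta>) * F (\<xi> - \<eta>) * Y \<eta>)"
      by (intro Bop_integrable F(1) WY) auto
    have "(LINT \<eta>|lborel. K \<xi> \<eta>) = (LINT \<eta>|lborel. complex_of_real (norm \<xi> powr s) * (complex_of_real (kk (\<xi> - \<eta>) \<eta>) * F (\<xi> - \<eta>) * F \<eta>)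
        - complex_of_real (kk (\<xi> - \<eta>) \<eta>) * F (\<xi> - \<eta>) * Y \<eta>)"
      unfolding K_def Y_def wt_def by (intro Bochner_Integration.integral_cong refl) (simp add: algebra_simps)
    also have "\<dots> = complex_of_real (norm \<xi> powr s) * (LINT \<eta>|lborel. complex_of_real (kk (\<xi> - \<eta>) \<eta>) * F (\<xi> - \<eta>) * F \<eta>)
        - (LINT \<eta>|lborel. complex_of_real (kk (\<xi> - \<eta>) \<eta>) * F (\<xi> - \<eta>) * Y \<eta>)"
      by (subst Bochner_Integration.integral_diff[OF i1 i2]) simp
    finally show ?thesis unfolding Bop_def by (simp only: right_diff_distrib mult.left_commute)
  qed
  have LB: "L2c (Bop F F)" by (intro Bop_L2c(1) Fi W) auto
  have LBY: "L2c (Bop F Y)" by (intro Bop_L2c(1) Fi WY) auto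
  have LW: "L2c (wt (2 * s) F)" using s by (intro W) auto
  have pairs: "Bop F F \<xi> * cnj (wt (2 * s) F \<xi>) = complex_of_real (norm \<xi> powr s) * Bop F F \<xi> * cnj (Y \<xi>)" for \<xi>
  proof -
    have "norm \<xi> powr (2 * s) = norm \<xi> powr s * norm \<xi> powr s" by (simp add: powr_add[symmetric])
    then show ?thesis by (simp add: wt_def Y_def mult_ac)
  qed
  have "ip (Bop F F) (wt (2 * s) F) - ip (Bop F Y) Y = (LINT \<xi>|lborel. Bop F F \<xi> * cnj (wt (2 * s) F \<xi>) - Bop F Y \<xi> * cnj (Y \<xi>))"
    unfolding ip_def by (rule Bochner_Integration.integral_diff[symmetric]; intro integrable_ip LB LBY LW Y)
  also have "\<dots> = (LINT \<xi>|lborel. (complex_of_real (1 / (2 * pi)) * (LINT \<eta>|lborel. K \<xi> \<eta>)) * cnj (Y \<xi>))"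
    unfolding pairs by (simp only: left_diff_distrib[symmetric] D)
  finally have eq: "ip (Bop F F) (wt (2 * s) F) - ip (Bop F Y) Y = (LINT \<xi>|lborel. (complex_of_real (1 / (2 * pi)) * (LINT \<eta>|lborel. K \<xi> \<eta>)) * cnj (Y \<xi>))" .
  have l2Y: "Y = wt (2 - a) F" by (simp add: Y_def s_def)
  have pt: "cmod (K \<xi> \<eta>) * cmod (Y \<xi>) \<le> 4 * (norm (\<xi> - \<eta>) powr (- a) * norm \<eta> powr (a - 1) * cmod (Y \<xi>) * cmod (wt 2 F (\<xi> - \<eta>)) * cmod (Y \<eta>))
      + 4 * (norm (\<xi> - \<eta>) powr (- (1 - a)) * norm \<eta> powr ((1 - a) - 1) * cmod (Y \<xi>) * cmod (Y (\<xi> - \<eta>)) * cmod (wt 2 F \<eta>))" for \<xi> \<eta>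
  proof (cases "\<xi> = \<eta> \<or> \<eta> = 0")
    case True
    then show ?thesis using kk_le[of "\<xi> - \<eta>" \<eta>] by (auto simp: norm_mult K_def)
  next
    case False
    define d where "d = norm (\<xi> - \<eta>)"
    define n where "n = norm \<eta>"
    have n: "d > 0" "n > 0" using False by (auto simp: d_def n_def)
    let ?P = "cmod (F (\<xi> - \<eta>)) * cmod (F \<eta>) * cmod (Y \<xi>)"
    have "\<bar>norm \<xi> - norm \<eta>\<bar> \<le> d" unfolding d_def by (rule norm_triangle_ineq3)
    then have p: "\<bar>norm \<xi> powr s - n powr s\<bar> \<le> 4 * d * (d powr (s - 1) + n powr (s - 1))"
      unfolding n_def by (intro powr_diff_le s) auto
    have "cmod (K \<xi> \<eta>) * cmod (Y \<xi>) = (\<bar>kk (\<xi> - \<eta>) \<eta>\<bar> * \<bar>norm \<xi> powr s - n powr s\<bar>) * ?P"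
      unfolding K_def n_def by (simp only: norm_mult norm_of_real mult_ac)
    also have "\<dots> \<le> (n * (4 * d * (d powr (s - 1) + n powr (s - 1)))) * ?P"
      using kk_le[of "\<xi> - \<eta>" \<eta>] p unfolding n_def by (intro mult_right_mono mult_mono) auto
    also have "\<dots> = 4 * ((d * d powr (s - 1)) * n) * ?P + 4 * (d * (n * n powr (s - 1))) * ?P"
      by (simp add: algebra_simps)
    also have "\<dots> = 4 * ((d powr (- a) * d powr 2) * (n powr (a - 1) * n powr s)) * ?P + 4 * ((d powr (- (1 - a)) * d powr s) * (n powr ((1 - a) - 1) * n powr 2)) * ?P"
    proof -
      have e1: "d powr (- a) * d powr 2 = d * d powr (s - 1)"
        using n powr_add[of d 1 "s - 1"] powr_add[of d "- a" 2] by (simp add: s_def)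
      have e2: "n powr (a - 1) * n powr s = n" using n powr_add[of n "a - 1" s] by (simp add: s_def)
      have e3: "d powr (- (1 - a)) * d powr s = d" using n powr_add[of d "- (1 - a)" s] by (simp add: s_def)
      have e4: "n powr ((1 - a) - 1) * n powr 2 = n * n powr (s - 1)"
        using n powr_add[of n 1 "s - 1"] powr_add[of n "- a" 2] by (simp add: s_def)
      show ?thesis by (simp only: e1 e2 e3 e4)
    qed
    also have "\<dots> = 4 * (d powr (- a) * n powr (a - 1) * cmod (Y \<xi>) * (d powr 2 * cmod (F (\<xi> - \<eta>))) * (n powr s * cmod (F \<eta>)))
      + 4 * (d powr (- (1 - a)) * n powr ((1 - a) - 1) * cmod (Y \<xi>) * (d powr s * cmod (F (\<xi> - \<eta>))) * (n powr 2 * cmod (F \<eta>)))"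
      by (simp only: mult_ac)
    finally show ?thesis unfolding d_def n_def by (simp only: Y_def cmod_wt)
  qed
  have "cmod (LINT \<xi>|lborel. (complex_of_real (1 / (2 * pi)) * (LINT \<eta>|lborel. K \<xi> \<eta>)) * cnj (Y \<xi>)) \<le> 8 * cT a * l2 Y * l2 (wt 2 F) * l2 Y"
  proof (rule norm_integral_le_nn)
    have Km [measurable]: "case_prod K \<in> borel_measurable (borel \<Otimes>\<^sub>M borel)" unfolding K_def by measurable
    have aux: "ennreal (4 * x + 4 * y) = ennreal 4 * ennreal x + ennreal 4 * ennreal y" if "x \<ge> 0" "y \<ge> 0" for x y
      using that by (simp add: ennreal_mult del: ennreal_numeral)
    let ?S1 = "\<lambda>\<xi> \<eta>. norm (\<xi> - \<eta>) powr (- a) * norm \<eta> powr (a - 1) * cmod (Y \<xi>) * cmod (wt 2 F (\<xi> - \<eta>)) * cmod (Y \<eta>)"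
    let ?S2 = "\<lambda>\<xi> \<eta>. norm (\<xi> - \<eta>) powr (- (1 - a)) * norm \<eta> powr ((1 - a) - 1) * cmod (Y \<xi>) * cmod (Y (\<xi> - \<eta>)) * cmod (wt 2 F \<eta>)"
    have "(\<integral>\<^sup>+\<xi>. ennreal (norm ((complex_of_real (1 / (2 * pi)) * (LINT \<eta>|lborel. K \<xi> \<eta>)) * cnj (Y \<xi>))) \<partial>lborel)
      \<le> (\<integral>\<^sup>+\<xi>. \<integral>\<^sup>+\<eta>. ennreal (cmod (K \<xi> \<eta>) * cmod (Y \<xi>)) \<partial>lborel \<partial>lborel)"
    proof (rule nn_integral_mono)
      fix \<xi>
      have "norm ((complex_of_real (1 / (2 * pi)) * (LINT \<eta>|lborel. K \<xi> \<eta>)) * cnj (Y \<xi>)) = 1 / (2 * pi) * (cmod (LINT \<eta>|lborel. K \<xi> \<eta>) * cmod (Y \<xi>))"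
        by (simp only: norm_mult norm_of_real complex_mod_cnj) simp
      also have "\<dots> \<le> 1 * (cmod (LINT \<eta>|lborel. K \<xi> \<eta>) * cmod (Y \<xi>))"
        using pi_ge_two by (intro mult_right_mono) auto
      finally have "ennreal (norm ((complex_of_real (1 / (2 * pi)) * (LINT \<eta>|lborel. K \<xi> \<eta>)) * cnj (Y \<xi>))) \<le> ennreal (cmod (LINT \<eta>|lborel. K \<xi> \<eta>)) * ennreal (cmod (Y \<xi>))"
        by (simp add: ennreal_mult[symmetric])
      also have "\<dots> \<le> (\<integral>\<^sup>+\<eta>. ennreal (cmod (K \<xi> \<eta>)) \<partial>lborel) * ennreal (cmod (Y \<xi>))"
        by (intro mult_right_mono norm_integral_le_nn_integral) auto
      also have "\<dots> = (\<integral>\<^sup>+\<eta>. ennreal (cmod (K \<xi> \<eta>) * cmod (Y \<xi>)) \<partial>lborel)"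
        by (subst nn_integral_multc[symmetric]) (auto simp: ennreal_mult)
      finally show "ennreal (norm ((complex_of_real (1 / (2 * pi)) * (LINT \<eta>|lborel. K \<xi> \<eta>)) * cnj (Y \<xi>))) \<le> (\<integral>\<^sup>+\<eta>. ennreal (cmod (K \<xi> \<eta>) * cmod (Y \<xi>)) \<partial>lborel)" .
    qed
    also have "\<dots> \<le> (\<integral>\<^sup>+\<xi>. \<integral>\<^sup>+\<eta>. ennreal 4 * ennreal (?S1 \<xi> \<eta>) + ennreal 4 * ennreal (?S2 \<xi> \<eta>) \<partial>lborel \<partial>lborel)"
    proof (intro nn_integral_mono)
      fix \<xi> \<eta>
      have "ennreal (cmod (K \<xi> \<eta>) * cmod (Y \<xi>)) \<le> ennreal (4 * ?S1 \<xi> \<eta> + 4 * ?S2 \<xi> \<eta>)"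
        by (intro ennreal_leI pt)
      also have "\<dots> = ennreal 4 * ennreal (?S1 \<xi> \<eta>) + ennreal 4 * ennreal (?S2 \<xi> \<eta>)"
        by (rule aux) (intro mult_nonneg_nonneg powr_ge_zero norm_ge_zero)+
      finally show "ennreal (cmod (K \<xi> \<eta>) * cmod (Y \<xi>)) \<le> ennreal 4 * ennreal (?S1 \<xi> \<eta>) + ennreal 4 * ennreal (?S2 \<xi> \<eta>)" .
    qed
    also have "\<dots> = ennreal 4 * (\<integral>\<^sup>+\<xi>. \<integral>\<^sup>+\<eta>. ennreal (?S1 \<xi> \<eta>) \<partial>lborel \<partial>lborel) + ennreal 4 * (\<integral>\<^sup>+\<xi>. \<integral>\<^sup>+\<eta>. ennreal (?S2 \<xi> \<eta>) \<partial>lborel \<partial>lborel)"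
      by (simp add: nn_integral_add nn_integral_cmult del: ennreal_numeral)
    also have "\<dots> \<le> ennreal 4 * ennreal (cT a * l2 Y * l2 (wt 2 F) * l2 Y) + ennreal 4 * ennreal (cT (1 - a) * l2 Y * l2 Y * l2 (wt 2 F))"
      using a by (intro add_mono mult_left_mono trilinear_L2c Y W) auto
    also have "\<dots> = ennreal (8 * cT a * l2 Y * l2 (wt 2 F) * l2 Y)"
      unfolding cT_swap by (simp add: ennreal_mult[symmetric] ennreal_plus[symmetric] mult_ac del: ennreal_plus ennreal_numeral)
    finally show "(\<integral>\<^sup>+\<xi>. ennreal (norm ((complex_of_real (1 / (2 * pi)) * (LINT \<eta>|lborel. K \<xi> \<eta>)) * cnj (Y \<xi>))) \<partial>lborel) \<le> ennreal (8 * cT a * l2 Y * l2 (wt 2 F) * l2 Y)" .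
  qed simp
  then have "\<bar>Re (ip (Bop F F) (wt (2 * s) F) - ip (Bop F Y) Y)\<bar> \<le> 8 * cT a * l2 Y * l2 (wt 2 F) * l2 Y"
    unfolding eq using abs_Re_le_cmod order_trans by blast
  moreover have "Re (ip (Bop F Y) Y) = 0" by (rule Bop_cancel[OF F(3) Fi Y WY])
  ultimately show ?thesis unfolding l2Y s_def by simp
qed

subsection \<open>Energy estimates\<close>

lemma Hp_zero: "Hp s (\<lambda>\<xi>. 0)" and nH_zero: "nH s (\<lambda>\<xi>. 0) = 0"
  by (simp_all add: Hp_def nH_def wt_def[abs_def])

lemma Bop_zero: "Bop (\<lambda>\<xi>. 0) (\<lambda>\<xi>. 0) = (\<lambda>\<xi>. 0)"
  by (simp add: Bop_def[abs_def])

lemma ip_wt: "ip (wt (r + r') F) G = ip (wt r F) (wt r' G)"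
  unfolding ip_def wt_def by (intro Bochner_Integration.integral_cong refl) (simp add: powr_add mult_ac)

lemma Re_ip_commute: "Re (ip F G) = Re (ip G F)"
  by (subst ip_commute) simp

lemma herm_diff: "herm F \<Longrightarrow> herm G \<Longrightarrow> herm (\<lambda>\<xi>. F \<xi> - G \<xi>)"
  by (simp add: herm_def)

lemma herm_wt: "herm F \<Longrightarrow> herm (wt r F)"
  by (simp add: herm_def wt_def)

lemma herm_trunc: "herm F \<Longrightarrow> herm (trunc N F)"
  by (simp add: herm_def trunc_def indicator_def)

lemma supp_trunc: "supp N (trunc N F)"
  by (simp add: supp_def trunc_def)

lemma supp_mono: "supp N F \<Longrightarrow> N \<le> N' \<Longrightarrow> supp N' F"
  by (auto simp: supp_def)

lemma ip_trunc_left: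
  assumes "supp N G"
  shows "ip (trunc N F) G = ip F G"
proof -
  have "trunc N F \<xi> * cnj (G \<xi>) = F \<xi> * cnj (G \<xi>)" for \<xi>
    using assms by (cases "norm \<xi> \<ge> N") (auto simp: supp_def trunc_def indicator_def)
  then show ?thesis unfolding ip_def by (intro Bochner_Integration.integral_cong refl)
qed

lemma l2_trunc_le: "L2c F \<Longrightarrow> l2 (trunc N F) \<le> l2 F"
  using L2c_dominated(2)[of F "trunc N F" 1] L2c_measurable[OF L2c_trunc]
  by (simp add: trunc_def norm_mult indicator_def)

lemma l2_trunc_diff_le:
  assumes F: "L2c F" and N: "N \<le> N'"
  shows "l2 (\<lambda>\<xi>. trunc N' F \<xi> - trunc N F \<xi>) \<le> l2 (\<lambda>\<xi>. F \<xi> - trunc N F \<xi>)"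
  using L2c_dominated(2)[OF L2c_diff[OF F L2c_trunc[OF F, of N]], of "\<lambda>\<xi>. trunc N' F \<xi> - trunc N F \<xi>" 1] N
    L2c_measurable[OF L2c_diff[OF L2c_trunc[OF F, of N'] L2c_trunc[OF F, of N]]]
  by (auto simp: trunc_def indicator_def)

lemma trunc_diff: "trunc N (\<lambda>\<xi>. F \<xi> - G \<xi>) = (\<lambda>\<xi>. trunc N F \<xi> - trunc N G \<xi>)"
  by (simp add: trunc_def[abs_def] right_diff_distrib)

locale sqg_exponent =
  fixes a :: real
  assumes a_pos: "0 < a" and a_half: "a < 1/2"
begin

definition Aop :: "(pt \<Rightarrow> complex) \<Rightarrow> pt \<Rightarrow> complex" where
  "Aop F \<xi> = wt (2 * a) F \<xi> + Bop F F \<xi>"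

text \<open>\<open>sg\<close> is the scaling critical regularity in which solutions live;
  \<open>ss\<close> lies half a dissipation above it and carries the estimates.\<close>

abbreviation "sg \<equiv> 2 - 2 * a"
abbreviation "ss \<equiv> 2 - a"

lemma a_less_1: "a < 1" and sg_gt_1: "1 < sg" and sg_le_ss: "sg \<le> ss" and ss_gt_1: "1 < ss"
  using a_pos a_half by auto

lemma Hp_ss_sg: "Hp ss F \<Longrightarrow> Hp sg F"
  using wt_le_nH(1)[of ss F sg] sg_gt_1 sg_le_ss by (auto simp: Hp_def)

lemma Hp_facts:
  assumes F: "Hp sg F"
  shows "L2c F" "F \<in> borel_measurable borel" "L2c (wt (2 * a) F)" "L2c (wt a F)" "L2c (wt 1 F)" "integrable lborel F"
    "l2 (wt (2 * a) F) \<le> nH sg F" "l2 (wt 1 F) \<le> nH sg F" "norm1 F \<le> c1 sg * nH sg F" "l2 F \<le> nH sg F"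
  using F wt_le_nH[OF F] a_pos a_half Hp_integrable[OF sg_gt_1 F] HpD(1)[OF F]
  by (auto simp: nH_def intro: L2c_measurable)

lemma Aop_L2c: "Hp sg F \<Longrightarrow> L2c (Aop F)"
  unfolding Aop_def[abs_def] using Hp_facts[of F] by (intro L2c_add Bop_L2c(1)) auto

definition "cA = 1 + c1 sg"

lemma cA_ge_1: "cA \<ge> 1" by (simp add: cA_def)

text \<open>Of the two ways to split a difference of quadratic terms, this one lets
  \<open>Bop G\<close> act on the difference, where \<open>Bop_cancel\<close> removes it, and puts
  the derivative of the other term on \<open>F\<close>.\<close>

lemma Aop_diff_eq:
  assumes F: "Hp sg F" and G: "Hp sg G"
  shows "Aop F \<xi> - Aop G \<xi> = wt (2 * a) (\<lambda>\<xi>. F \<xi> - G \<xi>) \<xi> + (Bop (\<lambda>\<xi>. F \<xi> - G \<xi>) F \<xi> + Bop G (\<lambda>\<xi>. F \<xi> - G \<xi>) \<xi>)"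
  using Hp_facts[OF F] Hp_facts[OF G]
  by (simp add: Aop_def wt_diff Bop_diff_left Bop_diff_right)

lemma Aop_diff_le:
  assumes F: "Hp sg F" and G: "Hp sg G"
  shows "l2 (\<lambda>\<xi>. Aop F \<xi> - Aop G \<xi>) \<le> cA * (1 + nH sg F + nH sg G) * nH sg (\<lambda>\<xi>. F \<xi> - G \<xi>)"
proof -
  let ?W = "\<lambda>\<xi>. F \<xi> - G \<xi>"
  have W: "Hp sg ?W" by (rule Hp_diff[OF F G])
  note f = Hp_facts[OF F] and g = Hp_facts[OF G] and w = Hp_facts[OF W]
  have b1: "L2c (Bop ?W F)" "l2 (Bop ?W F) \<le> norm1 ?W * l2 (wt 1 F)"
    by (rule Bop_L2c[OF w(6) f(5) f(2)])+
  have b2: "L2c (Bop G ?W)" "l2 (Bop G ?W) \<le> norm1 G * l2 (wt 1 ?W)"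
    by (rule Bop_L2c[OF g(6) w(5) w(2)])+
  have "l2 (\<lambda>\<xi>. Aop F \<xi> - Aop G \<xi>) = l2 (\<lambda>\<xi>. wt (2 * a) ?W \<xi> + (Bop ?W F \<xi> + Bop G ?W \<xi>))"
    by (simp only: Aop_diff_eq[OF F G])
  also have "\<dots> \<le> l2 (wt (2 * a) ?W) + l2 (\<lambda>\<xi>. Bop ?W F \<xi> + Bop G ?W \<xi>)"
    by (intro l2_triangle w L2c_add b1 b2)
  also have "l2 (\<lambda>\<xi>. Bop ?W F \<xi> + Bop G ?W \<xi>) \<le> l2 (Bop ?W F) + l2 (Bop G ?W)"
    by (intro l2_triangle b1 b2)
  also have "l2 (wt (2 * a) ?W) + (l2 (Bop ?W F) + l2 (Bop G ?W)) \<le> nH sg ?W + (c1 sg * nH sg ?W * nH sg F + c1 sg * nH sg G * nH sg ?W)"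
  proof (intro add_mono w)
    have "norm1 ?W * l2 (wt 1 F) \<le> c1 sg * nH sg ?W * nH sg F" by (intro mult_mono w f) auto
    with b1 show "l2 (Bop ?W F) \<le> c1 sg * nH sg ?W * nH sg F" by linarith
    have "norm1 G * l2 (wt 1 ?W) \<le> c1 sg * nH sg G * nH sg ?W" by (intro mult_mono w g) auto
    with b2 show "l2 (Bop G ?W) \<le> c1 sg * nH sg G * nH sg ?W" by linarith
  qed
  also have "\<dots> = (1 + c1 sg * (nH sg F + nH sg G)) * nH sg ?W" by (simp add: algebra_simps)
  also have "\<dots> \<le> (cA * (1 + nH sg F + nH sg G)) * nH sg ?W"
    unfolding cA_def by (intro mult_right_mono) (auto simp: algebra_simps)
  finally show ?thesis by simp
qed

lemma Aop_le:
  assumes F: "Hp sg F"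
  shows "l2 (Aop F) \<le> cA * (1 + nH sg F) * nH sg F"
  using Aop_diff_le[OF F Hp_zero] by (simp add: nH_zero Aop_def[of "\<lambda>\<xi>. 0"] Bop_zero wt_def[of _ "\<lambda>\<xi>. 0"])

lemma Aop_herm:
  assumes "Hp sg F" "herm F"
  shows "herm (Aop F)"
  using Bop_herm[OF assms(2,2)] Hp_facts(2)[OF assms(1)] herm_wt[OF assms(2)]
  by (simp add: herm_def Aop_def)

lemma energy_L2:
  assumes F: "Hp sg F" "herm F"
  shows "Re (ip (Aop F) F) \<ge> 0"
proof -
  note f = Hp_facts[OF F(1)]
  have "ip (Aop F) F = ip (wt (2 * a) F) F + ip (Bop F F) F"
    unfolding Aop_def[abs_def] by (intro ip_add_left f Bop_L2c(1))
  also have "ip (wt (2 * a) F) F = ip (wt a F) (wt a F)"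
    using ip_wt[of a a F F] by simp
  finally have "Re (ip (Aop F) F) = (l2 (wt a F))\<^sup>2 + Re (ip (Bop F F) F)" by (simp add: ip_self)
  also have "Re (ip (Bop F F) F) = 0" by (rule Bop_cancel[OF F(2) f(6) f(1) f(5)])
  finally show ?thesis by simp
qed

text \<open>The constant 32 comes from Young's inequality in \<open>energy_Hs\<close>; the added 1
  makes \<open>KK\<close> positive, as existence times are obtained by dividing by it.\<close>

definition "KK = 32 * (cT a)\<^sup>2 + 1"

lemma KK_pos: "KK > 0" by (simp add: KK_def add_nonneg_pos)

lemma energy_arith: "\<bar>q\<bar> \<le> c \<Longrightarrow> - 2 * (z + q) \<le> - 2 * z + 2 * c" for q c z :: real
  using abs_le_D2[of q c] by (simp add: algebra_simps)

lemma young_ineq: "p * q * 2 \<le> p\<^sup>2 + q\<^sup>2" for p q :: real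
  using sum_squares_bound[of p q] by simp

text \<open>Since 2a + 2(2-a) = 4, the dissipation contributes exactly the squared norm of |D|^2 F.
  It absorbs the one such factor in the commutator estimate and leaves the fourth power of the
  H^(2-a) seminorm.\<close>

lemma energy_Hs:
  assumes F: "L2c F" "supp N F" "herm F" and N: "N \<ge> 0"
  shows "- 2 * Re (ip (Aop F) (wt (2 * ss) F)) \<le> KK * (l2 (wt ss F)) ^ 4"
proof -
  have W: "L2c (wt r F)" if "r \<ge> 0" for r by (rule L2c_wt_supp(1)[OF F(1,2) N that])
  have "Hp sg F" using F(1) W sg_gt_1 by (simp add: Hp_def)
  note f = Hp_facts[OF this]
  have LW: "L2c (wt (2 * ss) F)" using a_less_1 by (intro W) auto
  have "ip (Aop F) (wt (2 * ss) F) = ip (wt (2 * a) F) (wt (2 * ss) F) + ip (Bop F F) (wt (2 * ss) F)"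
    unfolding Aop_def[abs_def] by (intro ip_add_left f Bop_L2c(1) LW)
  also have "ip (wt (2 * a) F) (wt (2 * ss) F) = ip (wt 2 F) (wt 2 F)"
  proof -
    have "ip (wt (2 * a) F) (wt (2 * ss) F) = (LINT \<xi>|lborel. complex_of_real (norm \<xi> powr (2 * a) * norm \<xi> powr (2 * ss)) * (F \<xi> * cnj (F \<xi>)))"
      unfolding ip_def wt_def by (intro Bochner_Integration.integral_cong refl) (simp add: mult_ac)
    also have "\<dots> = (LINT \<xi>|lborel. complex_of_real (norm \<xi> powr 2 * norm \<xi> powr 2) * (F \<xi> * cnj (F \<xi>)))"
      by (intro Bochner_Integration.integral_cong refl) (simp only: powr_add[symmetric], simp)
    also have "\<dots> = ip (wt 2 F) (wt 2 F)"
      unfolding ip_def wt_def by (intro Bochner_Integration.integral_cong refl) (simp add: mult_ac)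
    finally show ?thesis .
  qed
  finally have e: "Re (ip (Aop F) (wt (2 * ss) F)) = (l2 (wt 2 F))\<^sup>2 + Re (ip (Bop F F) (wt (2 * ss) F))"
    by (simp add: ip_self)
  let ?y = "l2 (wt ss F)" and ?z = "l2 (wt 2 F)"
  have "\<bar>Re (ip (Bop F F) (wt (2 * ss) F))\<bar> \<le> 8 * cT a * ?y * ?z * ?y"
    by (rule commutator_estimate[OF a_pos a_less_1 F N])
  then have "- 2 * Re (ip (Aop F) (wt (2 * ss) F)) \<le> - 2 * ?z\<^sup>2 + 2 * (8 * cT a * ?y * ?z * ?y)"
    unfolding e by (rule energy_arith)
  \<comment> \<open>Young's inequality for 2z and 8 c y^2, halved, with c = \<open>cT a\<close>; all
    of the available 2 z^2 is spent.\<close>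
  also have "2 * (8 * cT a * ?y * ?z * ?y) \<le> 2 * ?z\<^sup>2 + 32 * (cT a)\<^sup>2 * ?y ^ 4"
    using young_ineq[of "2 * ?z" "8 * cT a * ?y\<^sup>2"] by (simp add: power_mult_distrib power2_eq_square power4_eq_xxxx mult_ac)
  finally have "- 2 * Re (ip (Aop F) (wt (2 * ss) F)) \<le> 32 * (cT a)\<^sup>2 * ?y ^ 4" by simp
  also have "\<dots> \<le> KK * ?y ^ 4" unfolding KK_def by (intro mult_right_mono) auto
  finally show ?thesis .
qed

text \<open>Only \<open>F\<close> is assumed in H^(2-a). The term in which \<open>G\<close>
  transports the difference cancels, and in the other one the derivative falls on \<open>F\<close>,
  while the |D|^a norm of the difference is absorbed by the dissipation. This asymmetry allows a
  comparison with a solution known only in H^(2-2a).\<close>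

lemma energy_diff:
  assumes F: "Hp ss F" and G: "Hp sg G" "herm G"
  shows "- 2 * Re (ip (\<lambda>\<xi>. Aop F \<xi> - Aop G \<xi>) (\<lambda>\<xi>. F \<xi> - G \<xi>)) \<le> KK * (l2 (wt ss F))\<^sup>2 * (l2 (\<lambda>\<xi>. F \<xi> - G \<xi>))\<^sup>2"
proof -
  let ?W = "\<lambda>\<xi>. F \<xi> - G \<xi>"
  have F': "Hp sg F" by (rule Hp_ss_sg[OF F])
  have W: "Hp sg ?W" by (rule Hp_diff[OF F' G(1)])
  note f = Hp_facts[OF F'] and g = Hp_facts[OF G(1)] and w = Hp_facts[OF W]
  have b1: "L2c (Bop ?W F)" by (rule Bop_L2c[OF w(6) f(5) f(2)])
  have b2: "L2c (Bop G ?W)" by (rule Bop_L2c[OF g(6) w(5) w(2)])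
  have "ip (\<lambda>\<xi>. Aop F \<xi> - Aop G \<xi>) ?W = ip (\<lambda>\<xi>. wt (2 * a) ?W \<xi> + (Bop ?W F \<xi> + Bop G ?W \<xi>)) ?W"
    by (simp only: Aop_diff_eq[OF F' G(1)])
  also have "\<dots> = ip (wt (2 * a) ?W) ?W + (ip (Bop ?W F) ?W + ip (Bop G ?W) ?W)"
    by (simp only: ip_add_left[OF w(3) L2c_add[OF b1 b2] w(1)] ip_add_left[OF b1 b2 w(1)])
  also have "ip (wt (2 * a) ?W) ?W = ip (wt a ?W) (wt a ?W)"
    using ip_wt[of a a ?W ?W] by simp
  finally have "Re (ip (\<lambda>\<xi>. Aop F \<xi> - Aop G \<xi>) ?W) = (l2 (wt a ?W))\<^sup>2 + (Re (ip (Bop ?W F) ?W) + Re (ip (Bop G ?W) ?W))"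
    by (simp add: ip_self)
  also have "Re (ip (Bop G ?W) ?W) = 0" by (rule Bop_cancel[OF G(2) g(6) w(1) w(5)])
  finally have e: "Re (ip (\<lambda>\<xi>. Aop F \<xi> - Aop G \<xi>) ?W) = (l2 (wt a ?W))\<^sup>2 + Re (ip (Bop ?W F) ?W)" by simp
  let ?p = "l2 (wt a ?W)" and ?y = "l2 (wt ss F)" and ?w = "l2 ?W"
  have "cmod (ip (Bop ?W F) ?W) \<le> cT a * ?w * ?p * ?y"
    by (rule Bop_bound[OF a_pos a_less_1 w(1) w(4) w(2) HpD(2)[OF F] f(2)])
  then have "\<bar>Re (ip (Bop ?W F) ?W)\<bar> \<le> cT a * ?w * ?p * ?y"
    using abs_Re_le_cmod order_trans by blast
  then have "- 2 * Re (ip (\<lambda>\<xi>. Aop F \<xi> - Aop G \<xi>) ?W) \<le> - 2 * ?p\<^sup>2 + 2 * (cT a * ?w * ?p * ?y)"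
    unfolding e by (rule energy_arith)
  also have "2 * (cT a * ?w * ?p * ?y) \<le> ?p\<^sup>2 + (cT a)\<^sup>2 * ?w\<^sup>2 * ?y\<^sup>2"
    using young_ineq[of ?p "cT a * ?w * ?y"] by (simp add: power_mult_distrib mult_ac)
  also have "- 2 * ?p\<^sup>2 + (?p\<^sup>2 + (cT a)\<^sup>2 * ?w\<^sup>2 * ?y\<^sup>2) \<le> (cT a)\<^sup>2 * ?w\<^sup>2 * ?y\<^sup>2" by simp
  finally have "- 2 * Re (ip (\<lambda>\<xi>. Aop F \<xi> - Aop G \<xi>) ?W) \<le> (cT a)\<^sup>2 * (?y\<^sup>2 * ?w\<^sup>2)"
    by (simp add: mult_ac)
  also have "\<dots> \<le> KK * (?y\<^sup>2 * ?w\<^sup>2)" unfolding KK_def by (intro mult_right_mono) auto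
  finally show ?thesis by (simp add: mult.assoc)
qed

subsection \<open>A one-sided Gronwall inequality\<close>

end

text \<open>Only increments to the right are assumed, since the piecewise linear interpolants are
  not differentiable at their nodes. The comparison function \<open>c\<close> uses an enlarged
  \<open>e\<close>. At the last time before \<open>t\<close> with u \<le> c, the increment bound and
  1 + K r \<le> exp(K r) extend the inequality a little further, a contradiction; then the
  enlargement tends to 0.\<close>

lemma Gronwall_right:
  fixes u :: "real \<Rightarrow> real"
  assumes cont: "continuous_on {0..T} u" and nn: "K \<ge> 0" "e \<ge> 0" "u 0 \<ge> 0"
    and gr: "\<And>t \<epsilon>. 0 \<le> t \<Longrightarrow> t < T \<Longrightarrow> \<epsilon> > 0 \<Longrightarrow> \<exists>\<rho>>0. \<forall>r. 0 < r \<longrightarrow> r < \<rho> \<longrightarrow> t + r \<le> T \<longrightarrow> u (t + r) \<le> u t + r * (K * u t + e + \<epsilon>)"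
    and t: "0 \<le> t" "t \<le> T"
  shows "u t \<le> exp (K * t) * (u 0 + e * t)"
proof -
  have main: "u t \<le> exp (K * t) * (u 0 + (e + 2 * \<epsilon>) * t)" if \<epsilon>: "\<epsilon> > 0" for \<epsilon>
  proof (rule ccontr)
    define c where "c x = exp (K * x) * (u 0 + (e + 2 * \<epsilon>) * x)" for x
    assume "\<not> u t \<le> exp (K * t) * (u 0 + (e + 2 * \<epsilon>) * t)"
    then have bad: "u t > c t" by (simp add: c_def)
    define S where "S = {x \<in> {0..t}. u x - c x \<le> 0}"
    have contc: "continuous_on {0..t} (\<lambda>x. u x - c x)"
      unfolding c_def by (intro continuous_intros continuous_on_subset[OF cont]) (use t in auto)
    have "closed S"
      unfolding S_def using continuous_closed_preimage[OF contc closed_real_atLeastAtMost, of "{..0}"] 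
      by (simp add: vimage_def Int_def)
    moreover have S0: "0 \<in> S" unfolding S_def c_def using t by simp
    moreover have bdd: "bdd_above S" unfolding S_def by (rule bdd_aboveI[of _ t]) auto
    ultimately have sup: "Sup S \<in> S" using closed_contains_Sup[of S] by blast
    define t0 where "t0 = Sup S"
    have t0: "0 \<le> t0" "t0 \<le> t" "u t0 \<le> c t0" using sup[folded t0_def] unfolding S_def by auto
    have "t0 \<noteq> t" using t0(3) bad by auto
    then have lt: "t0 < t" using t0 by simp
    obtain \<rho> where \<rho>: "\<rho> > 0" "\<And>r. 0 < r \<Longrightarrow> r < \<rho> \<Longrightarrow> t0 + r \<le> T \<Longrightarrow> u (t0 + r) \<le> u t0 + r * (K * u t0 + e + \<epsilon>)"
      using gr[of t0 \<epsilon>] t0 lt t \<epsilon> by auto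
    define r where "r = min (\<rho> / 2) ((t - t0) / 2)"
    have r: "0 < r" "r < \<rho>" "t0 + r \<le> t" unfolding r_def using \<rho> lt by (auto simp: min_def field_simps)
    have B: "u 0 + (e + 2 * \<epsilon>) * t0 \<ge> 0" using nn \<epsilon> t0 by simp
    have "u (t0 + r) \<le> u t0 + r * (K * u t0 + e + \<epsilon>)" using \<rho>(2)[of r] r t by auto
    also have "\<dots> \<le> c t0 + r * (K * c t0 + e + 2 * \<epsilon>)"
      using t0(3) nn r \<epsilon> by (intro add_mono mult_left_mono) auto
    also have "\<dots> \<le> c (t0 + r)"
    proof -
      have x1: "exp (K * t0) * (1 + K * r) \<le> exp (K * (t0 + r))"
      proof -
        have "1 + K * r \<le> exp (K * r)" by (rule exp_ge_add_one_self)
        then have "exp (K * t0) * (1 + K * r) \<le> exp (K * t0) * exp (K * r)" by (intro mult_left_mono) auto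
        then show ?thesis by (simp add: exp_add[symmetric] distrib_left)
      qed
      have x2: "1 \<le> exp (K * (t0 + r))" using nn t0 r by simp
      have "c t0 + r * (K * c t0 + e + 2 * \<epsilon>) = exp (K * t0) * (1 + K * r) * (u 0 + (e + 2 * \<epsilon>) * t0) + 1 * ((e + 2 * \<epsilon>) * r)"
        unfolding c_def by (simp add: algebra_simps)
      also have "\<dots> \<le> exp (K * (t0 + r)) * (u 0 + (e + 2 * \<epsilon>) * t0) + exp (K * (t0 + r)) * ((e + 2 * \<epsilon>) * r)"
        using nn \<epsilon> r by (intro add_mono mult_right_mono x1 x2 B) auto
      also have "\<dots> = c (t0 + r)" unfolding c_def by (simp add: algebra_simps)
      finally show ?thesis .
    qed
    finally have "t0 + r \<in> S" unfolding S_def using t0 r by auto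
    then have "t0 + r \<le> t0" unfolding t0_def using cSup_upper[OF _ bdd] by blast
    then show False using r by simp
  qed
  show ?thesis
  proof (rule tendsto_lowerbound)
    show "((\<lambda>\<epsilon>. exp (K * t) * (u 0 + (e + 2 * \<epsilon>) * t)) \<longlongrightarrow> exp (K * t) * (u 0 + e * t)) (at_right 0)"
      by (auto intro!: tendsto_eq_intros)
    show "\<forall>\<^sub>F \<epsilon> in at_right 0. u t \<le> exp (K * t) * (u 0 + (e + 2 * \<epsilon>) * t)"
      using eventually_at_right_less[of "0::real"] by eventually_elim (rule main)
  qed simp
qed

lemma l2_sq_expansion:
  assumes "L2c W" "L2c R"
  shows "(l2 (\<lambda>\<xi>. W \<xi> - complex_of_real r * R \<xi>))\<^sup>2 = (l2 W)\<^sup>2 - 2 * r * Re (ip R W) + r\<^sup>2 * (l2 R)\<^sup>2"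
proof -
  have "Re (cnj (complex_of_real r) * ip W R) = r * Re (ip R W)"
    using Re_ip_commute[of W R] by simp
  then show ?thesis using l2_diff_sq[OF assms, of "complex_of_real r"] by simp
qed

context sqg_exponent
begin

subsection \<open>Truncated Euler scheme\<close>

text \<open>The states of the truncated equation. On them every weighted norm of nonnegative order
  is bounded by \<open>l2\<close> with a constant depending on \<open>N\<close>, so an explicit
  Euler step stays in this class.\<close>

definition good :: "real \<Rightarrow> (pt \<Rightarrow> complex) \<Rightarrow> bool" where
  "good N F \<longleftrightarrow> L2c F \<and> supp N F \<and> herm F"

definition stp :: "real \<Rightarrow> real \<Rightarrow> (pt \<Rightarrow> complex) \<Rightarrow> pt \<Rightarrow> complex" where
  "stp N r F \<xi> = F \<xi> - complex_of_real r * trunc N (Aop F) \<xi>"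

lemma good_Hp: "good N F \<Longrightarrow> N \<ge> 0 \<Longrightarrow> r \<ge> 0 \<Longrightarrow> Hp r F"
  using L2c_wt_supp(1) by (auto simp: good_def Hp_def)

lemma good_nH:
  assumes "good N F" "N \<ge> 0"
  shows "nH sg F \<le> (1 + N powr sg) * l2 F"
  using L2c_wt_supp(2)[of F N sg] assms sg_gt_1 by (simp add: good_def nH_def distrib_right)

lemma good_diff: "good N F \<Longrightarrow> good N G \<Longrightarrow> good N (\<lambda>\<xi>. F \<xi> - G \<xi>)"
  by (auto simp: good_def L2c_diff herm_diff supp_def)

lemma good_cmult: "good N F \<Longrightarrow> good N (\<lambda>\<xi>. complex_of_real r * F \<xi>)"
  by (auto simp: good_def L2c_cmult herm_def supp_def)

lemma good_mono: "good N F \<Longrightarrow> N \<le> N' \<Longrightarrow> good N' F"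
  by (auto simp: good_def supp_mono)

lemma good_trunc_Aop:
  assumes "good N F" "N \<ge> 0"
  shows "good N (trunc N (Aop F))"
proof -
  have H: "Hp sg F" using good_Hp[OF assms, of sg] sg_gt_1 by simp
  show ?thesis using assms(1) Aop_L2c[OF H] Aop_herm[OF H]
    by (simp add: good_def L2c_trunc supp_trunc herm_trunc)
qed

lemma good_stp: "good N F \<Longrightarrow> N \<ge> 0 \<Longrightarrow> good N (stp N r F)"
  unfolding stp_def[abs_def] by (intro good_diff good_cmult good_trunc_Aop)

text \<open>It bounds one increment of the scheme both in \<open>L^2\<close> and in the H^(2-a)
  seminorm for states of \<open>L^2\<close> norm at most \<open>L\<close>. It grows with
  \<open>N\<close>, which is harmless because the step size is chosen after
  \<open>N\<close>.\<close>

definition bD :: "real \<Rightarrow> real \<Rightarrow> real" where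
  "bD N L = (1 + N powr ss) * (cA * (1 + (1 + N powr sg) * L) * ((1 + N powr sg) * L))"

lemma bD_bounds:
  assumes F: "good N F" and N: "N \<ge> 0" and L: "l2 F \<le> L"
  shows "l2 (trunc N (Aop F)) \<le> bD N L" "l2 (wt ss (trunc N (Aop F))) \<le> bD N L"
proof -
  have H: "Hp sg F" using good_Hp[OF F N, of sg] sg_gt_1 by simp
  have L0: "L \<ge> 0" using L l2_nonneg[of F] by linarith
  have n: "nH sg F \<le> (1 + N powr sg) * L"
    using good_nH[OF F N] L mult_left_mono[OF L, of "1 + N powr sg"] by simp
  let ?B = "cA * (1 + (1 + N powr sg) * L) * ((1 + N powr sg) * L)"
  have B: "l2 (Aop F) \<le> ?B"
    by (rule order_trans[OF Aop_le[OF H]]) (use n cA_ge_1 L0 in \<open>intro mult_mono; simp\<close>)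
  have t: "l2 (trunc N (Aop F)) \<le> ?B" using l2_trunc_le[OF Aop_L2c[OF H], of N] B by linarith
  have B0: "0 \<le> ?B" using t l2_nonneg[of "trunc N (Aop F)"] by linarith
  have "?B \<le> bD N L" unfolding bD_def using B0 by (simp add: distrib_right)
  with t show "l2 (trunc N (Aop F)) \<le> bD N L" by linarith
  have "l2 (wt ss (trunc N (Aop F))) \<le> N powr ss * l2 (trunc N (Aop F))"
    using good_trunc_Aop[OF F N] N ss_gt_1 by (intro L2c_wt_supp(2)) (auto simp: good_def)
  also have "\<dots> \<le> N powr ss * ?B" by (intro mult_left_mono t) auto
  also have "\<dots> \<le> bD N L" unfolding bD_def using B0 by (simp add: distrib_right)
  finally show "l2 (wt ss (trunc N (Aop F))) \<le> bD N L" .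
qed

lemma bD_nonneg: "L \<ge> 0 \<Longrightarrow> bD N L \<ge> 0"
  unfolding bD_def using cA_ge_1 by (intro mult_nonneg_nonneg) auto

text \<open>Expanding the square of a step, the linear term is governed by the energy inequalities
  and the quadratic term r^2 is the price of discretisation. The truncation drops out of the linear
  term because the state and its weighted versions live below \<open>N\<close>.\<close>

lemma stp_estimates:
  assumes F: "good N F" and N: "N \<ge> 0" and L: "l2 F \<le> L" and r: "r \<ge> 0"
  shows "(l2 (stp N r F))\<^sup>2 \<le> (l2 F)\<^sup>2 + r\<^sup>2 * (bD N L)\<^sup>2"
    and "(l2 (wt ss (stp N r F)))\<^sup>2 \<le> (l2 (wt ss F))\<^sup>2 + r * (KK * ((l2 (wt ss F))\<^sup>2)\<^sup>2) + r\<^sup>2 * (bD N L)\<^sup>2"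
    and "l2 (\<lambda>\<xi>. stp N r F \<xi> - stp N r' F \<xi>) \<le> bD N L * \<bar>r - r'\<bar>"
proof -
  have H: "Hp sg F" using good_Hp[OF F N, of sg] sg_gt_1 by simp
  let ?R = "trunc N (Aop F)"
  have gR: "good N ?R" by (rule good_trunc_Aop[OF F N])
  have LF: "L2c F" "herm F" "supp N F" and LR: "L2c ?R" "supp N ?R" using F gR by (auto simp: good_def)
  note D = bD_bounds[OF F N L]
  have D2: "(l2 ?R)\<^sup>2 \<le> (bD N L)\<^sup>2" "(l2 (wt ss ?R))\<^sup>2 \<le> (bD N L)\<^sup>2"
    using D by (auto intro!: power_mono)
  have "(l2 (stp N r F))\<^sup>2 = (l2 F)\<^sup>2 - 2 * r * Re (ip ?R F) + r\<^sup>2 * (l2 ?R)\<^sup>2"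
    unfolding stp_def[abs_def] by (rule l2_sq_expansion[OF LF(1) LR(1)])
  moreover have "Re (ip ?R F) \<ge> 0" unfolding ip_trunc_left[OF LF(3)] by (rule energy_L2[OF H LF(2)])
  moreover have "r\<^sup>2 * (l2 ?R)\<^sup>2 \<le> r\<^sup>2 * (bD N L)\<^sup>2" by (intro mult_left_mono D2) auto
  ultimately show "(l2 (stp N r F))\<^sup>2 \<le> (l2 F)\<^sup>2 + r\<^sup>2 * (bD N L)\<^sup>2"
    using r mult_nonneg_nonneg[of r "Re (ip ?R F)"] by linarith
  have W: "L2c (wt ss F)" "L2c (wt ss ?R)" using LF LR N ss_gt_1 L2c_wt_supp(1) by auto
  have "wt ss (stp N r F) = (\<lambda>\<xi>. wt ss F \<xi> - complex_of_real r * wt ss ?R \<xi>)"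
    unfolding stp_def[abs_def] wt_def[abs_def] by (simp add: right_diff_distrib mult_ac)
  then have e: "(l2 (wt ss (stp N r F)))\<^sup>2 = (l2 (wt ss F))\<^sup>2 - 2 * r * Re (ip (wt ss ?R) (wt ss F)) + r\<^sup>2 * (l2 (wt ss ?R))\<^sup>2"
    using l2_sq_expansion[OF W, of r] by simp
  have "ip (wt ss ?R) (wt ss F) = ip ?R (wt (2 * ss) F)"
  proof -
    have "norm \<xi> powr (2 * ss) = norm \<xi> powr ss * norm \<xi> powr ss" for \<xi> :: pt by (simp add: powr_add[symmetric])
    then show ?thesis unfolding ip_def wt_def by (intro Bochner_Integration.integral_cong refl) (simp add: mult_ac)
  qed
  also have "\<dots> = ip (Aop F) (wt (2 * ss) F)" by (rule ip_trunc_left[OF supp_wt[OF LF(3)]])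
  finally have i: "ip (wt ss ?R) (wt ss F) = ip (Aop F) (wt (2 * ss) F)" .
  have "r * (- 2 * Re (ip (Aop F) (wt (2 * ss) F))) \<le> r * (KK * (l2 (wt ss F)) ^ 4)"
    by (intro mult_left_mono r energy_Hs[OF LF(1,3,2) N])
  moreover have "((l2 (wt ss F))\<^sup>2)\<^sup>2 = (l2 (wt ss F)) ^ 4" by simp
  moreover have "r\<^sup>2 * (l2 (wt ss ?R))\<^sup>2 \<le> r\<^sup>2 * (bD N L)\<^sup>2" by (intro mult_left_mono D2) auto
  ultimately show "(l2 (wt ss (stp N r F)))\<^sup>2 \<le> (l2 (wt ss F))\<^sup>2 + r * (KK * ((l2 (wt ss F))\<^sup>2)\<^sup>2) + r\<^sup>2 * (bD N L)\<^sup>2"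
    unfolding e i by (simp add: algebra_simps)
  have "l2 (\<lambda>\<xi>. stp N r F \<xi> - stp N r' F \<xi>) = l2 (\<lambda>\<xi>. complex_of_real (r' - r) * ?R \<xi>)"
    by (simp add: stp_def algebra_simps)
  also have "\<dots> = \<bar>r - r'\<bar> * l2 ?R" unfolding l2_cmult norm_of_real by (simp add: abs_minus_commute)
  also have "\<dots> \<le> \<bar>r - r'\<bar> * bD N L" by (intro mult_left_mono D) auto
  finally show "l2 (\<lambda>\<xi>. stp N r F \<xi> - stp N r' F \<xi>) \<le> bD N L * \<bar>r - r'\<bar>" by (simp add: mult.commute)
qed

end

text \<open>The bound \<open>M\<close> on the squared H^(2-a) seminorm is spent as follows: a half
  on the data, a quarter on the growth T KK M^2 allowed by \<open>TM\<close>, and a quarter on the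
  accumulated discretisation error. The 1 added to the squared \<open>L^2\<close> norm of the data
  likewise pays for that error. The third smallness condition bounds the error made by freezing
  \<open>Aop\<close> during a step.\<close>

locale euler = sqg_exponent +
  fixes \<Theta>0 :: "pt \<Rightarrow> complex" and N h T M \<epsilon> :: real
  assumes data: "L2c \<Theta>0" "herm \<Theta>0" "L2c (wt ss \<Theta>0)"
    and N: "N \<ge> 0" and h: "h > 0" and T: "T \<ge> 0" and M: "M > 0" "2 * (l2 (wt ss \<Theta>0))\<^sup>2 \<le> M" and TM: "T * (4 * KK * M) \<le> 1"
    and small: "h * (T * (bD N (sqrt ((l2 \<Theta>0)\<^sup>2 + 1)))\<^sup>2) \<le> 1" "h * (T * (bD N (sqrt ((l2 \<Theta>0)\<^sup>2 + 1)))\<^sup>2) \<le> M / 4"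
      "h * (cA * (1 + 2 * ((1 + N powr sg) * sqrt ((l2 \<Theta>0)\<^sup>2 + 1))) * (1 + N powr sg) * bD N (sqrt ((l2 \<Theta>0)\<^sup>2 + 1))) \<le> \<epsilon>"
begin

definition "L = sqrt ((l2 \<Theta>0)\<^sup>2 + 1)"
definition "D = bD N L"

lemma L_sq: "L\<^sup>2 = (l2 \<Theta>0)\<^sup>2 + 1" and L_nonneg: "L \<ge> 0"
  by (simp_all add: L_def add_nonneg_nonneg)

lemma D_nonneg: "D \<ge> 0" unfolding D_def by (rule bD_nonneg[OF L_nonneg])

definition eul :: "nat \<Rightarrow> pt \<Rightarrow> complex" where
  "eul j = (stp N h ^^ j) (trunc N \<Theta>0)"

definition cell :: "real \<Rightarrow> nat" where
  "cell t = nat \<lfloor>t / h\<rfloor>"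

definition X :: "real \<Rightarrow> pt \<Rightarrow> complex" where
  "X t = stp N (t - real (cell t) * h) (eul (cell t))"

text \<open>Minus the right derivative of \<open>X\<close>, constant on each time cell.\<close>

definition R :: "real \<Rightarrow> pt \<Rightarrow> complex" where
  "R t = trunc N (Aop (eul (cell t)))"

lemma cell_bounds:
  assumes "t \<ge> 0"
  shows "real (cell t) * h \<le> t" "t < real (cell t) * h + h"
proof -
  have f: "real (cell t) = of_int \<lfloor>t / h\<rfloor>" unfolding cell_def using assms h by simp
  have "of_int \<lfloor>t / h\<rfloor> \<le> t / h" "t / h < of_int \<lfloor>t / h\<rfloor> + 1" by linarith+
  then have 1: "real (cell t) \<le> t / h" and 2: "t / h < real (cell t) + 1" by (simp_all only: f)
  show "real (cell t) * h \<le> t" using 1 h by (simp only: pos_le_divide_eq)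
  show "t < real (cell t) * h + h" using 2 h by (simp add: pos_divide_less_eq distrib_right)
qed

lemma cell_eqI:
  assumes "real j * h \<le> t" "t < real j * h + h"
  shows "cell t = j"
proof -
  have "of_int (int j) \<le> t / h" using assms(1) h by (simp add: pos_le_divide_eq)
  moreover have "t / h < of_int (int j) + 1" using assms(2) h by (simp add: pos_divide_less_eq distrib_right)
  ultimately have "\<lfloor>t / h\<rfloor> = int j" by (intro floor_unique)
  then show ?thesis by (simp add: cell_def)
qed

text \<open>The bounds are affine in the time \<tau>, so full steps and the partial step inside the
  current cell propagate them in the same way; up to time \<open>T\<close> they stay within the
  budget of the locale.\<close>

definition inv_at :: "real \<Rightarrow> (pt \<Rightarrow> complex) \<Rightarrow> bool" where
  "inv_at \<tau> F \<longleftrightarrow> good N F \<and> (l2 F)\<^sup>2 \<le> (l2 \<Theta>0)\<^sup>2 + \<tau> * (h * D\<^sup>2) \<and> (l2 (wt ss F))\<^sup>2 \<le> M / 2 + \<tau> * (KK * M\<^sup>2 + h * D\<^sup>2)"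

lemma inv_bounds:
  assumes F: "inv_at \<tau> F" and \<tau>: "0 \<le> \<tau>" "\<tau> \<le> T"
  shows "l2 F \<le> L" "(l2 (wt ss F))\<^sup>2 \<le> M"
proof -
  have *: "\<tau> * (h * D\<^sup>2) \<le> h * (T * D\<^sup>2)"
    using mult_right_mono[OF \<tau>(2), of "h * D\<^sup>2"] h by (simp add: mult_ac)
  have s1: "h * (T * D\<^sup>2) \<le> 1" "h * (T * D\<^sup>2) \<le> M / 4" using small(1,2) unfolding D_def L_def by auto
  have "(l2 F)\<^sup>2 \<le> L\<^sup>2" using F * s1 unfolding inv_at_def L_sq by linarith
  then show "l2 F \<le> L" by (rule power2_le_imp_le[OF _ L_nonneg])
  have "\<tau> * (KK * M\<^sup>2) \<le> T * (KK * M\<^sup>2)" using \<tau> KK_pos by (intro mult_right_mono) auto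
  also have "\<dots> = (T * (4 * KK * M)) * (M / 4)" by (simp add: power2_eq_square)
  also have "\<dots> \<le> 1 * (M / 4)" using TM M by (intro mult_right_mono) auto
  finally have "\<tau> * (KK * M\<^sup>2) \<le> M / 4" by simp
  moreover have "\<tau> * (KK * M\<^sup>2 + h * D\<^sup>2) = \<tau> * (KK * M\<^sup>2) + \<tau> * (h * D\<^sup>2)" by (rule distrib_left)
  ultimately show "(l2 (wt ss F))\<^sup>2 \<le> M" using F * s1 unfolding inv_at_def by linarith
qed

lemma inv_stp:
  assumes F: "inv_at \<tau> F" and \<tau>: "0 \<le> \<tau>" "\<tau> \<le> T" and r: "0 \<le> r" "r \<le> h"
  shows "inv_at (\<tau> + r) (stp N r F)"
proof -
  note b = inv_bounds[OF F \<tau>]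
  have g: "good N F" using F by (simp add: inv_at_def)
  note e = stp_estimates[OF g N b(1) r(1), folded D_def]
  have r2: "r\<^sup>2 * D\<^sup>2 \<le> r * (h * D\<^sup>2)"
    using r mult_right_mono[of r h "r * D\<^sup>2"] by (simp add: power2_eq_square mult_ac)
  have y: "r * (KK * ((l2 (wt ss F))\<^sup>2)\<^sup>2) \<le> r * (KK * M\<^sup>2)"
    using r KK_pos b(2) by (intro mult_left_mono power_mono) auto
  have F1: "(l2 F)\<^sup>2 \<le> (l2 \<Theta>0)\<^sup>2 + \<tau> * (h * D\<^sup>2)" and F2: "(l2 (wt ss F))\<^sup>2 \<le> M / 2 + \<tau> * (KK * M\<^sup>2 + h * D\<^sup>2)"
    using F by (auto simp: inv_at_def)
  have "(l2 (stp N r F))\<^sup>2 \<le> (l2 \<Theta>0)\<^sup>2 + \<tau> * (h * D\<^sup>2) + r * (h * D\<^sup>2)"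
    using e(1) r2 F1 by linarith
  moreover have "(l2 (wt ss (stp N r F)))\<^sup>2 \<le> M / 2 + \<tau> * (KK * M\<^sup>2 + h * D\<^sup>2) + (r * (KK * M\<^sup>2) + r * (h * D\<^sup>2))"
    using e(2) r2 y F2 by linarith
  ultimately show ?thesis unfolding inv_at_def using good_stp[OF g N, of r]
    by (simp add: distrib_right distrib_left add.assoc)
qed

lemma inv_eul: "real j * h \<le> T \<Longrightarrow> inv_at (real j * h) (eul j)"
proof (induction j)
  case 0
  have "wt ss (trunc N \<Theta>0) = trunc N (wt ss \<Theta>0)" by (simp add: wt_def[abs_def] trunc_def[abs_def] mult_ac)
  then have "l2 (wt ss (trunc N \<Theta>0)) \<le> l2 (wt ss \<Theta>0)" using l2_trunc_le[OF data(3), of N] by simp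
  then have "(l2 (wt ss (trunc N \<Theta>0)))\<^sup>2 \<le> (l2 (wt ss \<Theta>0))\<^sup>2" by (intro power_mono) auto
  then have "(l2 (wt ss (trunc N \<Theta>0)))\<^sup>2 \<le> M / 2" using M(2) by linarith
  moreover have "(l2 (trunc N \<Theta>0))\<^sup>2 \<le> (l2 \<Theta>0)\<^sup>2" by (intro power_mono l2_trunc_le data) auto
  ultimately show ?case
    by (simp add: inv_at_def eul_def good_def L2c_trunc data supp_trunc herm_trunc)
next
  case (Suc j)
  have "real j * h \<le> T" using Suc.prems h by (simp add: distrib_right)
  from inv_stp[OF Suc.IH[OF this] _ this, of h]
  have "inv_at (real j * h + h) (stp N h (eul j))" using h by simp
  then show ?case by (simp add: eul_def distrib_right add.commute)
qed

lemma cell_le: "0 \<le> t \<Longrightarrow> t \<le> T \<Longrightarrow> real (cell t) * h \<le> T"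
  using cell_bounds(1)[of t] by linarith

lemma inv_X:
  assumes t: "0 \<le> t" "t \<le> T"
  shows "inv_at t (X t)"
proof -
  note c = cell_bounds[OF t(1)]
  have "inv_at (real (cell t) * h + (t - real (cell t) * h)) (stp N (t - real (cell t) * h) (eul (cell t)))"
    by (rule inv_stp[OF inv_eul[OF cell_le[OF t]]]) (use c cell_le[OF t] h in auto)
  then show ?thesis by (simp add: X_def)
qed

lemma stp_0: "stp N 0 F = F"
  by (simp add: stp_def[abs_def])

lemma eul_facts:
  assumes "real j * h \<le> T"
  shows "good N (eul j)" "l2 (eul j) \<le> L" "L2c (eul j)"
  using inv_bounds[OF inv_eul[OF assms]] inv_eul[OF assms] assms h by (auto simp: inv_at_def good_def)

lemma stp_eul_diff:
  assumes "real j * h \<le> T" "0 \<le> r"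
  shows "l2 (\<lambda>\<xi>. stp N r (eul j) \<xi> - stp N r' (eul j) \<xi>) \<le> D * \<bar>r - r'\<bar>"
  unfolding D_def using assms eul_facts[OF assms(1)] by (intro stp_estimates(3) N) auto

lemma eul_Lipschitz:
  assumes "j \<le> i" "real i * h \<le> T"
  shows "l2 (\<lambda>\<xi>. eul i \<xi> - eul j \<xi>) \<le> D * (real i * h - real j * h)"
  using assms
proof (induction i rule: dec_induct)
  case base
  then show ?case by simp
next
  case (step i)
  have i: "real i * h \<le> T" using step.prems h by (simp add: distrib_right)
  have "j \<le> i" using step by simp
  have "real j * h \<le> real i * h" using h \<open>j \<le> i\<close> by (intro mult_right_mono) auto
  then have j: "real j * h \<le> T" using i by linarith
  have "l2 (\<lambda>\<xi>. eul (Suc i) \<xi> - eul j \<xi>) \<le> l2 (\<lambda>\<xi>. eul (Suc i) \<xi> - eul i \<xi>) + l2 (\<lambda>\<xi>. eul i \<xi> - eul j \<xi>)"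
    by (intro l2_triangle3 eul_facts step.prems i j)
  also have "l2 (\<lambda>\<xi>. eul (Suc i) \<xi> - eul i \<xi>) \<le> D * h"
    using stp_eul_diff[OF i, of h 0] h by (simp add: stp_0 eul_def)
  finally show ?case using step.IH[OF i] by (simp add: algebra_simps)
qed

lemma X_L2c: "0 \<le> t \<Longrightarrow> t \<le> T \<Longrightarrow> L2c (X t)"
  using inv_X by (auto simp: inv_at_def good_def)

lemma X_Lipschitz_le:
  assumes u: "0 \<le> u" "u \<le> t" and t: "t \<le> T"
  shows "l2 (\<lambda>\<xi>. X t \<xi> - X u \<xi>) \<le> D * (t - u)"
proof -
  have t0: "0 \<le> t" and uT: "u \<le> T" using u t by auto
  note ct = cell_bounds[OF t0] and cu = cell_bounds[OF u(1)]
  have it: "real (cell t) * h \<le> T" and iu: "real (cell u) * h \<le> T" using ct cu u t by auto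
  have le: "cell u \<le> cell t"
  proof (rule ccontr)
    assume "\<not> cell u \<le> cell t"
    then have "real (cell t) + 1 \<le> real (cell u)" by simp
    then have "(real (cell t) + 1) * h \<le> real (cell u) * h" using h by (intro mult_right_mono) auto
    then show False using ct cu u by (simp add: distrib_right)
  qed
  show ?thesis
  proof (cases "cell u = cell t")
    case True
    then show ?thesis using stp_eul_diff[OF it, of "t - real (cell t) * h" "u - real (cell t) * h"] ct u
      by (simp add: X_def)
  next
    case False
    then have lt: "Suc (cell u) \<le> cell t" using le by simp
    have "real (Suc (cell u)) * h \<le> real (cell t) * h" using lt h by (intro mult_right_mono) auto
    then have su: "real (Suc (cell u)) * h \<le> T" using it by linarith
    \<comment> \<open>The way leads from \<open>t\<close> back to its node, along the nodes, and
      from the first node after \<open>u\<close> to \<open>u\<close>; the three durations add up to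
      t - u.\<close>
    have "l2 (\<lambda>\<xi>. X t \<xi> - X u \<xi>) \<le> l2 (\<lambda>\<xi>. X t \<xi> - eul (cell t) \<xi>) + l2 (\<lambda>\<xi>. eul (cell t) \<xi> - X u \<xi>)"
      by (intro l2_triangle3 X_L2c eul_facts it t t0 u uT)
    also have "l2 (\<lambda>\<xi>. eul (cell t) \<xi> - X u \<xi>) \<le> l2 (\<lambda>\<xi>. eul (cell t) \<xi> - eul (Suc (cell u)) \<xi>) + l2 (\<lambda>\<xi>. eul (Suc (cell u)) \<xi> - X u \<xi>)"
      by (intro l2_triangle3 X_L2c eul_facts it su u uT)
    also have "l2 (\<lambda>\<xi>. X t \<xi> - eul (cell t) \<xi>) \<le> D * (t - real (cell t) * h)"
      using stp_eul_diff[OF it, of "t - real (cell t) * h" 0] ct by (simp add: X_def stp_0)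
    also have "l2 (\<lambda>\<xi>. eul (cell t) \<xi> - eul (Suc (cell u)) \<xi>) \<le> D * (real (cell t) * h - real (Suc (cell u)) * h)"
      by (rule eul_Lipschitz[OF lt it])
    also have "l2 (\<lambda>\<xi>. eul (Suc (cell u)) \<xi> - X u \<xi>) \<le> D * (h - (u - real (cell u) * h))"
      using stp_eul_diff[OF iu, of h "u - real (cell u) * h"] cu h by (simp add: X_def eul_def)
    finally show ?thesis by (simp add: algebra_simps)
  qed
qed

lemma X_Lipschitz:
  assumes "0 \<le> u" "u \<le> T" "0 \<le> t" "t \<le> T"
  shows "l2 (\<lambda>\<xi>. X t \<xi> - X u \<xi>) \<le> D * \<bar>t - u\<bar>"
proof (cases "u \<le> t")
  case True
  then show ?thesis using X_Lipschitz_le[of u t] assms by simp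
next
  case False
  then show ?thesis using X_Lipschitz_le[of t u] assms l2_commute[of "X t" "X u"] by simp
qed

lemma X_right:
  assumes t: "0 \<le> t"
  shows "\<exists>\<rho>>0. \<forall>r. 0 \<le> r \<longrightarrow> r < \<rho> \<longrightarrow> X (t + r) = (\<lambda>\<xi>. X t \<xi> - complex_of_real r * R t \<xi>)"
proof (intro exI conjI allI impI)
  note c = cell_bounds[OF t]
  show "0 < real (cell t) * h + h - t" using c by simp
  fix r assume r: "0 \<le> r" "r < real (cell t) * h + h - t"
  have "cell (t + r) = cell t" by (rule cell_eqI) (use r c in auto)
  then show "X (t + r) = (\<lambda>\<xi>. X t \<xi> - complex_of_real r * R t \<xi>)"
    by (simp add: X_def R_def stp_def[abs_def] algebra_simps)
qed

text \<open>Inside a cell the interpolant is at most D h away from the node, and \<open>Aop\<close>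
  is Lipschitz on band-limited states of bounded norm.\<close>

lemma R_error:
  assumes t: "0 \<le> t" "t \<le> T"
  shows "good N (R t)" "l2 (\<lambda>\<xi>. R t \<xi> - trunc N (Aop (X t)) \<xi>) \<le> \<epsilon>"
proof -
  note c = cell_bounds[OF t(1)] and it = cell_le[OF t]
  let ?E = "eul (cell t)"
  note e = eul_facts[OF it]
  have gX: "good N (X t)" and lX: "l2 (X t) \<le> L" using inv_X[OF t] inv_bounds[OF inv_X[OF t] t] by (auto simp: inv_at_def)
  have HE: "Hp sg ?E" and HX: "Hp sg (X t)" using good_Hp[OF _ N, of _ sg] e gX sg_gt_1 by auto
  show "good N (R t)" unfolding R_def by (rule good_trunc_Aop[OF e(1) N])
  let ?c = "1 + N powr sg"
  have c0: "?c \<ge> 0" by (simp add: add_nonneg_nonneg)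
  have nE: "nH sg ?E \<le> ?c * L" using good_nH[OF e(1) N] mult_left_mono[OF e(2) c0] by linarith
  have nX: "nH sg (X t) \<le> ?c * L" using good_nH[OF gX N] mult_left_mono[OF lX c0] by linarith
  have "l2 (\<lambda>\<xi>. X t \<xi> - ?E \<xi>) \<le> D * (t - real (cell t) * h)"
    using stp_eul_diff[OF it, of "t - real (cell t) * h" 0] c by (simp add: X_def stp_0)
  also have "\<dots> \<le> D * h" using c D_nonneg by (intro mult_left_mono) auto
  finally have lD: "l2 (\<lambda>\<xi>. ?E \<xi> - X t \<xi>) \<le> D * h" using l2_commute[of ?E "X t"] by simp
  have nD: "nH sg (\<lambda>\<xi>. ?E \<xi> - X t \<xi>) \<le> ?c * (D * h)"
    using good_nH[OF good_diff[OF e(1) gX] N] mult_left_mono[OF lD c0] by linarith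
  have "l2 (\<lambda>\<xi>. R t \<xi> - trunc N (Aop (X t)) \<xi>) = l2 (trunc N (\<lambda>\<xi>. Aop ?E \<xi> - Aop (X t) \<xi>))"
    unfolding R_def trunc_diff ..
  also have "\<dots> \<le> l2 (\<lambda>\<xi>. Aop ?E \<xi> - Aop (X t) \<xi>)"
    by (intro l2_trunc_le L2c_diff Aop_L2c HE HX)
  also have "\<dots> \<le> cA * (1 + nH sg ?E + nH sg (X t)) * nH sg (\<lambda>\<xi>. ?E \<xi> - X t \<xi>)"
    by (rule Aop_diff_le[OF HE HX])
  also have "\<dots> \<le> cA * (1 + ?c * L + ?c * L) * (?c * (D * h))"
    using nE nX nD cA_ge_1 c0 L_nonneg by (intro mult_mono add_mono mult_nonneg_nonneg add_nonneg_nonneg) auto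
  also have "\<dots> = h * (cA * (1 + 2 * (?c * L)) * ?c * D)" by (simp add: algebra_simps)
  also have "\<dots> \<le> \<epsilon>" using small(3) unfolding D_def L_def by simp
  finally show "l2 (\<lambda>\<xi>. R t \<xi> - trunc N (Aop (X t)) \<xi>) \<le> \<epsilon>" .
qed

lemma X_0: "X 0 = trunc N \<Theta>0"
  by (simp add: X_def cell_def stp_0 eul_def)

end

subsection \<open>Convergence of the scheme\<close>

lemma continuous_on_if_Lipschitz:
  fixes f :: "real \<Rightarrow> real"
  assumes "\<And>t u. t \<in> S \<Longrightarrow> u \<in> S \<Longrightarrow> \<bar>f t - f u\<bar> \<le> D * \<bar>t - u\<bar>" "D \<ge> 0"
  shows "continuous_on S f"
  by (rule lipschitz_on_continuous_on[of D]) (rule lipschitz_onI, auto simp: dist_real_def assms)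

context sqg_exponent
begin

text \<open>What the convergence proof uses of an Euler interpolant. The step size has disappeared
  into the consistency error \<epsilon>; the Lipschitz constant is quantified because it depends on
  \<open>N\<close> and serves only for continuity in time.\<close>

definition approx :: "(pt \<Rightarrow> complex) \<Rightarrow> real \<Rightarrow> real \<Rightarrow> real \<Rightarrow> real \<Rightarrow> (real \<Rightarrow> pt \<Rightarrow> complex) \<Rightarrow> (real \<Rightarrow> pt \<Rightarrow> complex) \<Rightarrow> bool" where
  "approx \<Theta>0 N T M \<epsilon> X R \<longleftrightarrow>
     (\<forall>t\<in>{0..T}. good N (X t) \<and> l2 (X t) \<le> sqrt ((l2 \<Theta>0)\<^sup>2 + 1) \<and> (l2 (wt ss (X t)))\<^sup>2 \<le> M) \<and> X 0 = trunc N \<Theta>0 \<and>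
     (\<exists>D\<ge>0. \<forall>t\<in>{0..T}. \<forall>u\<in>{0..T}. l2 (\<lambda>\<xi>. X t \<xi> - X u \<xi>) \<le> D * \<bar>t - u\<bar>) \<and>
     (\<forall>t\<in>{0..T}. good N (R t) \<and> l2 (\<lambda>\<xi>. R t \<xi> - trunc N (Aop (X t)) \<xi>) \<le> \<epsilon>) \<and>
     (\<forall>t\<ge>0. \<exists>\<rho>>0. \<forall>r. 0 \<le> r \<longrightarrow> r < \<rho> \<longrightarrow> X (t + r) = (\<lambda>\<xi>. X t \<xi> - complex_of_real r * R t \<xi>))"

lemma approx_exists:
  assumes data: "L2c \<Theta>0" "herm \<Theta>0" "L2c (wt ss \<Theta>0)" and N: "N \<ge> 0" and T: "T \<ge> 0"
    and M: "M > 0" "2 * (l2 (wt ss \<Theta>0))\<^sup>2 \<le> M" and TM: "T * (4 * KK * M) \<le> 1" and \<epsilon>: "\<epsilon> > 0"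
  shows "\<exists>X R. approx \<Theta>0 N T M \<epsilon> X R"
proof -
  define Lb where "Lb = sqrt ((l2 \<Theta>0)\<^sup>2 + 1)"
  have L0: "Lb \<ge> 0" by (simp add: Lb_def add_nonneg_nonneg)
  define x where "x = T * (bD N Lb)\<^sup>2"
  define y where "y = cA * (1 + 2 * ((1 + N powr sg) * Lb)) * (1 + N powr sg) * bD N Lb"
  have x0: "x \<ge> 0" using T by (simp add: x_def)
  have y0: "y \<ge> 0" unfolding y_def using cA_ge_1 L0 bD_nonneg[OF L0]
    by (intro mult_nonneg_nonneg add_nonneg_nonneg) auto
  define m where "m = min (min 1 (M / 4)) \<epsilon>"
  have m: "m > 0" "m \<le> 1" "m \<le> M / 4" "m \<le> \<epsilon>" unfolding m_def using M \<epsilon> by auto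
  \<comment> \<open>The conditions on the step are h x \<le> 1, h x \<le> M/4 and h y \<le>
    \<epsilon>; this choice makes h x and h y at most \<open>m\<close>, and the 1 in the denominator
    prevents division by 0.\<close>
  define h where "h = m / (1 + x + y)"
  have h: "h > 0" unfolding h_def using m x0 y0 by simp
  have hq: "h * (1 + x + y) = m" unfolding h_def using x0 y0 by simp
  have "h * x \<le> m" using hq h x0 y0 mult_left_mono[of x "1 + x + y" h] by simp
  moreover have "h * y \<le> m" using hq h x0 y0 mult_left_mono[of y "1 + x + y" h] by simp
  ultimately interpret euler a \<Theta>0 N h T M \<epsilon>
    using data N h T M TM m by unfold_locales (auto simp: x_def y_def Lb_def)
  have "approx \<Theta>0 N T M \<epsilon> X R"
    unfolding approx_def
  proof (intro conjI ballI X_0)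
    fix t assume "t \<in> {0..T}"
    then have t: "0 \<le> t" "t \<le> T" by auto
    show "good N (X t)" using inv_X[OF t] by (simp add: inv_at_def)
    show "l2 (X t) \<le> sqrt ((l2 \<Theta>0)\<^sup>2 + 1)" using inv_bounds(1)[OF inv_X[OF t] t] by (simp only: L_def)
    show "(l2 (wt ss (X t)))\<^sup>2 \<le> M" by (rule inv_bounds(2)[OF inv_X[OF t] t])
    show "good N (R t)" "l2 (\<lambda>\<xi>. R t \<xi> - trunc N (Aop (X t)) \<xi>) \<le> \<epsilon>" by (rule R_error[OF t])+
  next
    show "\<exists>D\<ge>0. \<forall>t\<in>{0..T}. \<forall>u\<in>{0..T}. l2 (\<lambda>\<xi>. X t \<xi> - X u \<xi>) \<le> D * \<bar>t - u\<bar>"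
      using X_Lipschitz D_nonneg by (intro exI[of _ D]) auto
  next
    show "\<forall>t\<ge>0. \<exists>\<rho>>0. \<forall>r. 0 \<le> r \<longrightarrow> r < \<rho> \<longrightarrow> X (t + r) = (\<lambda>\<xi>. X t \<xi> - complex_of_real r * R t \<xi>)"
      using X_right by blast
  qed
  then show ?thesis by blast
qed

definition "ctail L M = sqrt M * (wtail ss + c1 ss) * (L + sqrt M)"

lemma ctail_nonneg: "L \<ge> 0 \<Longrightarrow> M \<ge> 0 \<Longrightarrow> ctail L M \<ge> 0"
  by (simp add: ctail_def)

text \<open>Two frequencies below N/2 add up to one below \<open>N\<close>. Outside the ball of
  radius \<open>N\<close> the quadratic term thus comes only from pairs with a frequency of at least
  N/2, and for those the H^(2-a) bound gives the decay N^(1-ss). The linear term vanishes there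
  because \<open>F\<close> does.\<close>

lemma tail_Aop:
  assumes F: "good N F" and N: "N > 0" and L: "l2 F \<le> L" and M: "(l2 (wt ss F))\<^sup>2 \<le> M"
  shows "l2 (\<lambda>\<xi>. Aop F \<xi> - trunc N (Aop F) \<xi>) \<le> ctail L M * (N / 2) powr (1 - ss)"
proof -
  have LF: "L2c F" "supp N F" using F by (auto simp: good_def)
  note [measurable] = L2c_measurable[OF LF(1)]
  have y: "l2 (wt ss F) \<le> sqrt M" using real_le_rsqrt[OF M] .
  have M0: "M \<ge> 0" using M zero_le_power2[of "l2 (wt ss F)"] by linarith
  have Hs: "Hp ss F" using good_Hp[OF F, of ss] N ss_gt_1 by simp
  have Hg: "Hp sg F" by (rule Hp_ss_sg[OF Hs])
  note f = Hp_facts[OF Hg]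
  define lo where "lo = trunc (N / 2) F"
  define hi where "hi = (\<lambda>\<xi>. F \<xi> - lo \<xi>)"
  have Llo: "L2c lo" unfolding lo_def by (rule L2c_trunc[OF LF(1)])
  have Lhi: "L2c hi" unfolding hi_def by (rule L2c_diff[OF LF(1) Llo])
  note [measurable] = L2c_measurable[OF Llo] L2c_measurable[OF Lhi]
  have w1lo: "L2c (wt 1 lo)"
    using L2c_trunc[OF f(5), of "N/2"] by (simp add: lo_def wt_def[abs_def] trunc_def[abs_def] mult_ac)
  have w1hi: "L2c (wt 1 hi)" unfolding hi_def wt_diff by (rule L2c_diff[OF f(5) w1lo])
  let ?d = "(N / 2) powr (1 - ss)"
  have hi_norm: "cmod (hi \<xi>) = indicator (- ball 0 (N/2)) \<xi> * cmod (F \<xi>)" for \<xi>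
    by (simp add: hi_def lo_def trunc_def indicator_def)
  have hi1: "integrable lborel hi" "norm1 hi \<le> wtail ss * ?d * sqrt M"
  proof -
    have "(\<integral>\<^sup>+\<xi>. ennreal (cmod (hi \<xi>)) \<partial>lborel) = (\<integral>\<^sup>+\<xi>. indicator (- ball 0 (N/2)) \<xi> * ennreal (cmod (F \<xi>)) \<partial>lborel)"
      by (intro nn_integral_cong) (auto simp: hi_norm indicator_def)
    also have "\<dots> \<le> ennreal (wtail ss * ?d * l2 (wt ss F))"
      by (intro nn_tail_L1 ss_gt_1 HpD(2)[OF Hs]) (use N in auto)
    finally have le: "(\<integral>\<^sup>+\<xi>. ennreal (cmod (hi \<xi>)) \<partial>lborel) \<le> ennreal (wtail ss * ?d * l2 (wt ss F))" .
    show i: "integrable lborel hi"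
      by (rule integrableI_bounded) (use le in \<open>auto intro: le_less_trans[OF _ ennreal_less_top]\<close>)
    have "norm1 hi \<le> wtail ss * ?d * l2 (wt ss F)" using le by (simp add: nn_integral_norm1[OF i])
    also have "\<dots> \<le> wtail ss * ?d * sqrt M" by (intro mult_left_mono y) auto
    finally show "norm1 hi \<le> wtail ss * ?d * sqrt M" .
  qed
  have hi2: "l2 (wt 1 hi) \<le> ?d * sqrt M"
  proof -
    have "l2 (wt 1 hi) \<le> ?d * l2 (wt ss F)"
    proof (rule L2c_dominated(2)[OF HpD(2)[OF Hs]])
      show "AE \<xi> in lborel. cmod (wt 1 hi \<xi>) \<le> ?d * cmod (wt ss F \<xi>)"
      proof (rule AE_I2)
        fix \<xi> :: pt
        show "cmod (wt 1 hi \<xi>) \<le> ?d * cmod (wt ss F \<xi>)"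
        proof (cases "norm \<xi> < N / 2")
          case False
          then have n: "norm \<xi> \<ge> N / 2" "norm \<xi> > 0" using N by auto
          have "norm \<xi> powr 1 = norm \<xi> powr (1 - ss) * norm \<xi> powr ss"
            by (simp only: powr_add[symmetric]) simp
          also have "\<dots> \<le> ?d * norm \<xi> powr ss"
            using n N ss_gt_1 by (intro mult_right_mono powr_mono2') auto
          finally have "norm \<xi> powr 1 * cmod (F \<xi>) \<le> ?d * norm \<xi> powr ss * cmod (F \<xi>)" by (intro mult_right_mono) auto
          then show ?thesis unfolding cmod_wt hi_norm using False by (simp add: mult.assoc)
        qed (simp add: cmod_wt hi_norm)
      qed
    qed auto
    also have "\<dots> \<le> ?d * sqrt M" by (intro mult_left_mono y) auto
    finally show ?thesis .
  qed
  have nF: "nH ss F \<le> L + sqrt M" using L y by (simp add: nH_def)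
  have w1F: "l2 (wt 1 F) \<le> L + sqrt M" using wt_le_nH(2)[OF Hs, of 1] nF ss_gt_1 by simp
  have ilo: "integrable lborel lo" using Bochner_Integration.integrable_diff[OF f(6) hi1(1)] by (simp add: hi_def)
  have n1lo: "norm1 lo \<le> c1 ss * (L + sqrt M)"
  proof -
    have "norm1 lo \<le> norm1 F"
      unfolding norm1_def
    proof (intro integral_mono integrable_norm ilo f(6))
      fix \<xi> show "cmod (lo \<xi>) \<le> cmod (F \<xi>)" by (simp add: lo_def trunc_def norm_mult indicator_def)
    qed
    also have "\<dots> \<le> c1 ss * nH ss F" by (rule Hp_integrable(2)[OF ss_gt_1 Hs])
    also have "\<dots> \<le> c1 ss * (L + sqrt M)" by (intro mult_left_mono nF) auto
    finally show ?thesis .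
  qed
  have b1: "L2c (Bop hi F)" "l2 (Bop hi F) \<le> norm1 hi * l2 (wt 1 F)"
    by (rule Bop_L2c[OF hi1(1) f(5) f(2)])+
  have b2: "L2c (Bop lo hi)" "l2 (Bop lo hi) \<le> norm1 lo * l2 (wt 1 hi)"
    by (rule Bop_L2c[OF ilo w1hi L2c_measurable[OF Lhi]])+
  have pt: "cmod (Aop F \<xi> - trunc N (Aop F) \<xi>) \<le> 1 * cmod (Bop hi F \<xi> + Bop lo hi \<xi>)" for \<xi>
  proof (cases "norm \<xi> < N")
    case False
    then have "wt (2 * a) F \<xi> = 0" using LF(2) by (simp add: supp_def wt_def)
    moreover have "Bop lo lo \<xi> = 0"
    proof -
      have "lo (\<xi> - \<eta>) * lo \<eta> = 0" for \<eta>
      proof (rule ccontr)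
        assume "lo (\<xi> - \<eta>) * lo \<eta> \<noteq> 0"
        then have "norm (\<xi> - \<eta>) < N / 2" "norm \<eta> < N / 2" by (auto simp: lo_def trunc_def indicator_def split: if_splits)
        then show False using False norm_triangle_ineq[of "\<xi> - \<eta>" \<eta>] by simp
      qed
      then show ?thesis unfolding Bop_def by (simp only: mult.assoc mult_zero_right Bochner_Integration.integral_zero)
    qed
    moreover have "Bop hi F \<xi> = Bop F F \<xi> - Bop lo F \<xi>"
      unfolding hi_def by (rule Bop_diff_left[OF LF(1) Llo f(5) f(2)])
    moreover have "Bop lo hi \<xi> = Bop lo F \<xi> - Bop lo lo \<xi>"
      unfolding hi_def by (rule Bop_diff_right[OF Llo f(5) w1lo f(2) L2c_measurable[OF Llo]])
    ultimately show ?thesis using False by (simp add: Aop_def trunc_def)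
  qed (simp add: trunc_def)
  have "l2 (\<lambda>\<xi>. Aop F \<xi> - trunc N (Aop F) \<xi>) \<le> 1 * l2 (\<lambda>\<xi>. Bop hi F \<xi> + Bop lo hi \<xi>)"
    by (rule L2c_dominated(2)[OF L2c_add[OF b1(1) b2(1)]])
      (use pt L2c_measurable[OF L2c_diff[OF Aop_L2c[OF Hg] L2c_trunc[OF Aop_L2c[OF Hg]]]] in auto)
  also have "\<dots> \<le> l2 (Bop hi F) + l2 (Bop lo hi)" using l2_triangle[OF b1(1) b2(1)] by simp
  also have "\<dots> \<le> (wtail ss * ?d * sqrt M) * (L + sqrt M) + (c1 ss * (L + sqrt M)) * (?d * sqrt M)"
  proof (rule add_mono)
    have "norm1 hi * l2 (wt 1 F) \<le> (wtail ss * ?d * sqrt M) * (L + sqrt M)"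
      using M0 by (intro mult_mono hi1 w1F) auto
    with b1 show "l2 (Bop hi F) \<le> (wtail ss * ?d * sqrt M) * (L + sqrt M)" by linarith
    have LL: "0 \<le> L + sqrt M" using w1F l2_nonneg[of "wt 1 F"] by linarith
    have "norm1 lo * l2 (wt 1 hi) \<le> (c1 ss * (L + sqrt M)) * (?d * sqrt M)"
      using LL by (intro mult_mono n1lo hi2) auto
    with b2 show "l2 (Bop lo hi) \<le> (c1 ss * (L + sqrt M)) * (?d * sqrt M)" by linarith
  qed
  also have "\<dots> = ctail L M * ?d" by (simp add: ctail_def algebra_simps)
  finally show ?thesis .
qed

text \<open>The difference of the two interpolants lives below \<open>N2\<close>, so in the pairing
  the larger truncation may be dropped and \<open>energy_diff\<close> applies with \<open>X1\<close>
  as the regular function. What remains are errors of size \<open>e0\<close>, paired with a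
  difference of norm at most 2L; doubling gives the factor 4L.\<close>

lemma compare_approx:
  assumes A1: "approx \<Theta>0 N1 T M \<epsilon>1 X1 R1" and A2: "approx \<Theta>0 N2 T M \<epsilon>2 X2 R2"
    and N: "0 < N1" "N1 \<le> N2" and M: "M \<ge> 0" and data: "L2c \<Theta>0" and t: "t \<in> {0..T}"
    and L_def: "L = sqrt ((l2 \<Theta>0)\<^sup>2 + 1)"
  shows "(l2 (\<lambda>\<xi>. X1 t \<xi> - X2 t \<xi>))\<^sup>2
    \<le> exp (KK * M * t) * ((l2 (\<lambda>\<xi>. \<Theta>0 \<xi> - trunc N1 \<Theta>0 \<xi>))\<^sup>2 + 4 * L * (ctail L M * (N1 / 2) powr (1 - ss) + \<epsilon>1 + \<epsilon>2) * t)"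
proof -
  have L0: "L \<ge> 0" by (simp add: L_def add_nonneg_nonneg)
  have N2: "0 < N2" using N by linarith
  define W where "W t = (\<lambda>\<xi>. X1 t \<xi> - X2 t \<xi>)" for t
  define e0 where "e0 = ctail L M * (N1 / 2) powr (1 - ss) + \<epsilon>1 + \<epsilon>2"
  define e where "e = 4 * L * e0"
  have p1: "good N1 (X1 t)" "l2 (X1 t) \<le> L" "(l2 (wt ss (X1 t)))\<^sup>2 \<le> M" "good N1 (R1 t)" "l2 (\<lambda>\<xi>. R1 t \<xi> - trunc N1 (Aop (X1 t)) \<xi>) \<le> \<epsilon>1"
    if "t \<in> {0..T}" for t using A1 that unfolding approx_def L_def by auto
  have p2: "good N2 (X2 t)" "l2 (X2 t) \<le> L" "good N2 (R2 t)" "l2 (\<lambda>\<xi>. R2 t \<xi> - trunc N2 (Aop (X2 t)) \<xi>) \<le> \<epsilon>2"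
    if "t \<in> {0..T}" for t using A2 that unfolding approx_def L_def by auto
  have T0: "0 \<le> T" using t by auto
  have e0: "e0 \<ge> 0"
  proof -
    have "\<epsilon>1 \<ge> 0" "\<epsilon>2 \<ge> 0" using order_trans[OF l2_nonneg p1(5)[of 0]] order_trans[OF l2_nonneg p2(4)[of 0]] T0 by auto
    then show ?thesis unfolding e0_def using ctail_nonneg[OF L0 M] by simp
  qed
  have gW: "good N2 (W t)" if "t \<in> {0..T}" for t
    unfolding W_def by (rule good_diff[OF good_mono[OF p1(1)[OF that] N(2)] p2(1)[OF that]])
  have LW: "L2c (W t)" if "t \<in> {0..T}" for t using gW[OF that] by (simp add: good_def)
  obtain D1 where D1: "D1 \<ge> 0" "\<And>t u. t \<in> {0..T} \<Longrightarrow> u \<in> {0..T} \<Longrightarrow> l2 (\<lambda>\<xi>. X1 t \<xi> - X1 u \<xi>) \<le> D1 * \<bar>t - u\<bar>"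
    using A1 unfolding approx_def by blast
  obtain D2 where D2: "D2 \<ge> 0" "\<And>t u. t \<in> {0..T} \<Longrightarrow> u \<in> {0..T} \<Longrightarrow> l2 (\<lambda>\<xi>. X2 t \<xi> - X2 u \<xi>) \<le> D2 * \<bar>t - u\<bar>"
    using A2 unfolding approx_def by blast
  have cont: "continuous_on {0..T} (\<lambda>t. l2 (W t))"
  proof (rule continuous_on_if_Lipschitz[where D="D1 + D2"])
    fix t u assume tu: "t \<in> {0..T}" "u \<in> {0..T}"
    have L1: "L2c (X1 t)" "L2c (X1 u)" "L2c (X2 t)" "L2c (X2 u)"
      using p1(1)[OF tu(1)] p1(1)[OF tu(2)] p2(1)[OF tu(1)] p2(1)[OF tu(2)] by (auto simp: good_def)
    have "\<bar>l2 (W t) - l2 (W u)\<bar> \<le> l2 (\<lambda>\<xi>. W t \<xi> - W u \<xi>)" by (rule l2_diff_abs[OF LW[OF tu(1)] LW[OF tu(2)]])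
    also have "(\<lambda>\<xi>. W t \<xi> - W u \<xi>) = (\<lambda>\<xi>. (X1 t \<xi> - X1 u \<xi>) - (X2 t \<xi> - X2 u \<xi>))" by (simp add: W_def algebra_simps)
    also have "l2 (\<lambda>\<xi>. (X1 t \<xi> - X1 u \<xi>) - (X2 t \<xi> - X2 u \<xi>)) \<le> l2 (\<lambda>\<xi>. X1 t \<xi> - X1 u \<xi>) + l2 (\<lambda>\<xi>. X2 t \<xi> - X2 u \<xi>)"
      by (intro l2_triangle_diff L2c_diff L1)
    also have "\<dots> \<le> D1 * \<bar>t - u\<bar> + D2 * \<bar>t - u\<bar>" by (intro add_mono D1(2) D2(2) tu)
    finally show "\<bar>l2 (W t) - l2 (W u)\<bar> \<le> (D1 + D2) * \<bar>t - u\<bar>" by (simp add: distrib_right)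
  qed (use D1 D2 in auto)
  have key: "- 2 * Re (ip (\<lambda>\<xi>. R1 t \<xi> - R2 t \<xi>) (W t)) \<le> KK * M * (l2 (W t))\<^sup>2 + e" if t: "t \<in> {0..T}" for t
  proof -
    note q1 = p1[OF t] and q2 = p2[OF t]
    have H1s: "Hp ss (X1 t)" using good_Hp[OF q1(1), of ss] N ss_gt_1 by simp
    have H1: "Hp sg (X1 t)" by (rule Hp_ss_sg[OF H1s])
    have H2: "Hp sg (X2 t)" using good_Hp[OF q2(1), of sg] N2 sg_gt_1 by simp
    have hX2: "herm (X2 t)" using q2(1) by (simp add: good_def)
    have LA: "L2c (Aop (X1 t))" "L2c (Aop (X2 t))" by (intro Aop_L2c H1 H2)+
    have LR: "L2c (R1 t)" "L2c (R2 t)" using q1(4) q2(3) by (auto simp: good_def)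
    define P where "P = (\<lambda>\<xi>. Aop (X1 t) \<xi> - Aop (X2 t) \<xi>)"
    have LP: "L2c P" unfolding P_def by (intro L2c_diff LA)
    \<comment> \<open>\<open>Q\<close> collects the two consistency errors and the frequencies
      between \<open>N1\<close> and \<open>N2\<close> of \<open>Aop (X1 t)\<close>, which
      \<open>tail_Aop\<close> controls.\<close>
    define Q where "Q = (\<lambda>\<xi>. (R1 t \<xi> - trunc N1 (Aop (X1 t)) \<xi>) - (R2 t \<xi> - trunc N2 (Aop (X2 t)) \<xi>) - (trunc N2 (Aop (X1 t)) \<xi> - trunc N1 (Aop (X1 t)) \<xi>))"
    have LQ: "L2c Q" unfolding Q_def by (intro L2c_diff LA LR L2c_trunc)
    have split: "(\<lambda>\<xi>. R1 t \<xi> - R2 t \<xi>) = (\<lambda>\<xi>. trunc N2 P \<xi> + Q \<xi>)"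
      unfolding Q_def P_def trunc_diff by (simp add: algebra_simps)
    have lQ: "l2 Q \<le> e0"
    proof -
      have "l2 Q \<le> l2 (\<lambda>\<xi>. (R1 t \<xi> - trunc N1 (Aop (X1 t)) \<xi>) - (R2 t \<xi> - trunc N2 (Aop (X2 t)) \<xi>)) + l2 (\<lambda>\<xi>. trunc N2 (Aop (X1 t)) \<xi> - trunc N1 (Aop (X1 t)) \<xi>)"
        unfolding Q_def by (intro l2_triangle_diff L2c_diff LA LR L2c_trunc)
      also have "l2 (\<lambda>\<xi>. (R1 t \<xi> - trunc N1 (Aop (X1 t)) \<xi>) - (R2 t \<xi> - trunc N2 (Aop (X2 t)) \<xi>)) \<le> l2 (\<lambda>\<xi>. R1 t \<xi> - trunc N1 (Aop (X1 t)) \<xi>) + l2 (\<lambda>\<xi>. R2 t \<xi> - trunc N2 (Aop (X2 t)) \<xi>)"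
        by (intro l2_triangle_diff L2c_diff LA LR L2c_trunc)
      also have "l2 (\<lambda>\<xi>. trunc N2 (Aop (X1 t)) \<xi> - trunc N1 (Aop (X1 t)) \<xi>) \<le> l2 (\<lambda>\<xi>. Aop (X1 t) \<xi> - trunc N1 (Aop (X1 t)) \<xi>)"
        by (rule l2_trunc_diff_le[OF LA(1) N(2)])
      also have "\<dots> \<le> ctail L M * (N1 / 2) powr (1 - ss)" by (rule tail_Aop[OF q1(1) N(1) q1(2,3)])
      finally show ?thesis using q1(5) q2(4) unfolding e0_def by linarith
    qed
    have lW: "l2 (W t) \<le> 2 * L"
      unfolding W_def using l2_triangle_diff[of "X1 t" "X2 t"] q1(1,2) q2(1,2) by (auto simp: good_def)
    have "ip (\<lambda>\<xi>. R1 t \<xi> - R2 t \<xi>) (W t) = ip (trunc N2 P) (W t) + ip Q (W t)"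
      unfolding split by (intro ip_add_left L2c_trunc LP LQ LW t)
    also have "ip (trunc N2 P) (W t) = ip P (W t)" using gW[OF t] by (intro ip_trunc_left) (simp add: good_def)
    finally have i: "Re (ip (\<lambda>\<xi>. R1 t \<xi> - R2 t \<xi>) (W t)) = Re (ip P (W t)) + Re (ip Q (W t))" by simp
    have "- 2 * Re (ip P (W t)) \<le> KK * (l2 (wt ss (X1 t)))\<^sup>2 * (l2 (W t))\<^sup>2"
      unfolding P_def W_def by (rule energy_diff[OF H1s H2 hX2])
    also have "\<dots> \<le> KK * M * (l2 (W t))\<^sup>2" using KK_pos q1(3) by (intro mult_right_mono mult_left_mono) auto
    finally have P: "- 2 * Re (ip P (W t)) \<le> KK * M * (l2 (W t))\<^sup>2" .
    have "\<bar>Re (ip Q (W t))\<bar> \<le> l2 Q * l2 (W t)" by (rule Re_ip_bound[OF LQ LW[OF t]])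
    also have "\<dots> \<le> e0 * (2 * L)" using lQ lW e0 by (intro mult_mono) auto
    finally have "- Re (ip Q (W t)) \<le> e0 * (2 * L)" by linarith
    then have *: "2 * (- Re (ip Q (W t))) \<le> 2 * (e0 * (2 * L))" by (rule mult_left_mono) simp
    have **: "- 2 * x = 2 * (- x)" "4 * x * y = 2 * (y * (2 * x))" for x y :: real by simp_all
    have Q: "- 2 * Re (ip Q (W t)) \<le> e" unfolding e_def ** by (rule *)
    have "- 2 * (Re (ip P (W t)) + Re (ip Q (W t))) = - 2 * Re (ip P (W t)) + - 2 * Re (ip Q (W t))"
      by (rule distrib_left)
    also have "\<dots> \<le> KK * M * (l2 (W t))\<^sup>2 + e" by (rule add_mono[OF P Q])
    finally show ?thesis unfolding i .
  qed
  have "(l2 (W t))\<^sup>2 \<le> exp (KK * M * t) * ((l2 (W 0))\<^sup>2 + e * t)"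
  proof (rule Gronwall_right[where u="\<lambda>t. (l2 (W t))\<^sup>2" and T=T])
    show "continuous_on {0..T} (\<lambda>t. (l2 (W t))\<^sup>2)" by (intro continuous_intros cont)
    show "0 \<le> KK * M" using KK_pos M by simp
    show "0 \<le> e" unfolding e_def using L0 e0 by simp
    fix t \<epsilon> :: real assume t: "0 \<le> t" "t < T" and \<epsilon>: "\<epsilon> > 0"
    then have tT: "t \<in> {0..T}" by simp
    obtain \<rho>1 where \<rho>1: "\<rho>1 > 0" "\<And>r. 0 \<le> r \<Longrightarrow> r < \<rho>1 \<Longrightarrow> X1 (t + r) = (\<lambda>\<xi>. X1 t \<xi> - complex_of_real r * R1 t \<xi>)"
      using A1 t unfolding approx_def by blast
    obtain \<rho>2 where \<rho>2: "\<rho>2 > 0" "\<And>r. 0 \<le> r \<Longrightarrow> r < \<rho>2 \<Longrightarrow> X2 (t + r) = (\<lambda>\<xi>. X2 t \<xi> - complex_of_real r * R2 t \<xi>)"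
      using A2 t unfolding approx_def by blast
    let ?R = "\<lambda>\<xi>. R1 t \<xi> - R2 t \<xi>"
    have LR: "L2c ?R" using p1(4)[OF tT] p2(3)[OF tT] by (auto simp: good_def intro: L2c_diff)
    define \<rho> where "\<rho> = min (min \<rho>1 \<rho>2) (\<epsilon> / (1 + (l2 ?R)\<^sup>2))"
    have \<rho>0: "\<rho> > 0" unfolding \<rho>_def using \<rho>1 \<rho>2 \<epsilon> by (simp add: add_pos_nonneg)
    have "(l2 (W (t + r)))\<^sup>2 \<le> (l2 (W t))\<^sup>2 + r * (KK * M * (l2 (W t))\<^sup>2 + e + \<epsilon>)" if r: "0 < r" "r < \<rho>" for r
    proof -
      have "W (t + r) = (\<lambda>\<xi>. W t \<xi> - complex_of_real r * ?R \<xi>)"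
        unfolding W_def using \<rho>1(2)[of r] \<rho>2(2)[of r] r unfolding \<rho>_def by (simp add: algebra_simps)
      then have "(l2 (W (t + r)))\<^sup>2 = (l2 (W t))\<^sup>2 - 2 * r * Re (ip ?R (W t)) + r\<^sup>2 * (l2 ?R)\<^sup>2"
        using l2_sq_expansion[OF LW[OF tT] LR, of r] by simp
      also have "\<dots> = (l2 (W t))\<^sup>2 + r * (- 2 * Re (ip ?R (W t)) + r * (l2 ?R)\<^sup>2)" by (simp add: algebra_simps power2_eq_square)
      also have "\<dots> \<le> (l2 (W t))\<^sup>2 + r * ((KK * M * (l2 (W t))\<^sup>2 + e) + \<epsilon>)"
      proof (intro add_left_mono mult_left_mono add_mono key[OF tT])
        have "r * (1 + (l2 ?R)\<^sup>2) \<le> \<epsilon>"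
          using r unfolding \<rho>_def by (simp add: pos_less_divide_eq add_pos_nonneg)
        then show "r * (l2 ?R)\<^sup>2 \<le> \<epsilon>" using r by (simp add: distrib_left)
      qed (use r in auto)
      finally show ?thesis by simp
    qed
    then show "\<exists>\<rho>>0. \<forall>r. 0 < r \<longrightarrow> r < \<rho> \<longrightarrow> t + r \<le> T \<longrightarrow> (l2 (W (t + r)))\<^sup>2 \<le> (l2 (W t))\<^sup>2 + r * (KK * M * (l2 (W t))\<^sup>2 + e + \<epsilon>)"
      using \<rho>0 by blast
  qed (use t in auto)
  also have "\<dots> \<le> exp (KK * M * t) * ((l2 (\<lambda>\<xi>. \<Theta>0 \<xi> - trunc N1 \<Theta>0 \<xi>))\<^sup>2 + e * t)"
  proof (intro mult_left_mono add_right_mono power_mono)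
    have "W 0 = (\<lambda>\<xi>. trunc N1 \<Theta>0 \<xi> - trunc N2 \<Theta>0 \<xi>)" using A1 A2 unfolding approx_def W_def by simp
    then have "l2 (W 0) = l2 (\<lambda>\<xi>. trunc N2 \<Theta>0 \<xi> - trunc N1 \<Theta>0 \<xi>)"
      using l2_commute[of "trunc N1 \<Theta>0" "trunc N2 \<Theta>0"] by simp
    also have "\<dots> \<le> l2 (\<lambda>\<xi>. \<Theta>0 \<xi> - trunc N1 \<Theta>0 \<xi>)" by (rule l2_trunc_diff_le[OF data N(2)])
    finally show "l2 (W 0) \<le> l2 (\<lambda>\<xi>. \<Theta>0 \<xi> - trunc N1 \<Theta>0 \<xi>)" .
  qed auto
  finally show ?thesis unfolding W_def e_def e0_def .
qed

text \<open>Convergence in \<open>L^2\<close> together with boundedness in H^(2-a) gives convergence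
  in H^(2-2a), with a \<delta> depending only on the bound.\<close>

lemma nH_small:
  assumes M: "M \<ge> 0" and \<eta>: "\<eta> > 0"
  shows "\<exists>\<delta>>0. \<forall>D. L2c D \<longrightarrow> L2c (wt ss D) \<longrightarrow> l2 (wt ss D) \<le> 2 * sqrt M \<longrightarrow> l2 D \<le> \<delta> \<longrightarrow> nH sg D \<le> \<eta>"
proof -
  \<comment> \<open>With the splitting radius r = q^(1/a) one has r^(sg-ss) = 1/q, so the high
    frequencies contribute at most \<eta>/2; \<delta> is then chosen for the low ones.\<close>
  define q where "q = 4 * sqrt M / \<eta> + 1"
  have q: "q \<ge> 1" unfolding q_def using M \<eta> by simp
  define r where "r = q powr (1 / a)"
  have r: "r > 0" unfolding r_def using q by simp
  have ra: "r powr (sg - ss) = 1 / q"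
    unfolding r_def using q a_pos by (simp add: powr_powr powr_minus_divide)
  have b: "r powr (sg - ss) * (2 * sqrt M) \<le> \<eta> / 2"
  proof -
    have "4 * sqrt M = \<eta> * (q - 1)" unfolding q_def using \<eta> by simp
    then have "2 * sqrt M \<le> (\<eta> / 2) * q" using \<eta> by (simp add: algebra_simps)
    then show ?thesis unfolding ra using q by (simp add: pos_divide_le_eq)
  qed
  define \<delta> where "\<delta> = \<eta> / (2 * (1 + r powr sg))"
  have \<delta>: "\<delta> > 0" unfolding \<delta>_def using \<eta> by (simp add: add_pos_nonneg)
  have \<delta>e: "(1 + r powr sg) * \<delta> = \<eta> / 2"
  proof -
    have "1 + r powr sg > 0" by (simp add: add_pos_nonneg)
    then show ?thesis unfolding \<delta>_def by (simp add: field_simps)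
  qed
  have "nH sg D \<le> \<eta>" if D: "L2c D" "L2c (wt ss D)" "l2 (wt ss D) \<le> 2 * sqrt M" "l2 D \<le> \<delta>" for D
  proof -
    have "l2 (wt sg D) \<le> r powr sg * l2 D + r powr (sg - ss) * l2 (wt ss D)"
      using wt_interpolation(2)[OF D(1,2) _ sg_le_ss r] sg_gt_1 by simp
    moreover have "r powr sg * l2 D \<le> r powr sg * \<delta>" by (intro mult_left_mono D) auto
    moreover have "r powr (sg - ss) * l2 (wt ss D) \<le> r powr (sg - ss) * (2 * sqrt M)" by (intro mult_left_mono D) auto
    moreover have "(1 + r powr sg) * \<delta> = \<delta> + r powr sg * \<delta>" by (simp add: distrib_right)
    ultimately show ?thesis using D(4) b \<delta>e unfolding nH_def by linarith
  qed
  then show ?thesis using \<delta> by blast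
qed

end

lemma tendsto_0_if_eventually_le:
  fixes g :: "'b \<Rightarrow> real"
  assumes "\<And>x. g x \<ge> 0" and "\<And>\<eta>. \<eta> > 0 \<Longrightarrow> \<forall>\<^sub>F x in F. g x \<le> \<eta>"
  shows "(g \<longlongrightarrow> 0) F"
proof (rule tendstoI)
  fix e :: real assume "e > 0"
  then have "\<forall>\<^sub>F x in F. g x \<le> e / 2" using assms(2)[of "e / 2"] by simp
  then show "\<forall>\<^sub>F x in F. dist (g x) 0 < e"
    by eventually_elim (use assms(1) \<open>e > 0\<close> in \<open>auto simp: dist_real_def abs_of_nonneg\<close>)
qed

lemma herm_lim:
  assumes "\<And>n. herm (F n)"
  shows "herm (\<lambda>\<xi>. if convergent (\<lambda>n. F n \<xi>) then lim (\<lambda>n. F n \<xi>) else 0)"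
  unfolding herm_def
proof
  fix \<xi>
  have e: "(\<lambda>n. F n (- \<xi>)) = (\<lambda>n. cnj (F n \<xi>))" using assms by (simp add: herm_def)
  show "(if convergent (\<lambda>n. F n (- \<xi>)) then lim (\<lambda>n. F n (- \<xi>)) else 0) = cnj (if convergent (\<lambda>n. F n \<xi>) then lim (\<lambda>n. F n \<xi>) else 0)"
  proof (cases "convergent (\<lambda>n. F n \<xi>)")
    case True
    then have "(\<lambda>n. F n \<xi>) \<longlonglongrightarrow> lim (\<lambda>n. F n \<xi>)" by (simp add: convergent_LIMSEQ_iff)
    then have c: "(\<lambda>n. cnj (F n \<xi>)) \<longlonglongrightarrow> cnj (lim (\<lambda>n. F n \<xi>))" by (rule tendsto_cnj)
    then show ?thesis unfolding e using True convergentI[OF c] limI[OF c] by simp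
  next
    case False
    have "\<not> convergent (\<lambda>n. cnj (F n \<xi>))"
    proof
      assume "convergent (\<lambda>n. cnj (F n \<xi>))"
      then obtain l where "(\<lambda>n. cnj (F n \<xi>)) \<longlonglongrightarrow> l" by (auto simp: convergent_def)
      from tendsto_cnj[OF this] have "(\<lambda>n. F n \<xi>) \<longlonglongrightarrow> cnj l" by simp
      then show False using False by (auto simp: convergent_def)
    qed
    then show ?thesis unfolding e using False by simp
  qed
qed

context sqg_exponent
begin

text \<open>A suitable sequence of truncations makes consecutive approximations 2^(-n)-close in
  \<open>L^2\<close>, uniformly in time, and \<open>Riesz_Fischer\<close> provides the limit. The
  H^(2-a) bound survives by \<open>L2c_Fatou\<close>; by \<open>nH_small\<close> the convergence
  improves to H^(2-2a), where \<open>Aop\<close> is locally Lipschitz into \<open>L^2\<close>. This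
  is what lets the tested equation pass to the limit.\<close>

theorem local_existence:
  assumes data: "L2c \<Theta>0" "herm \<Theta>0" "L2c (wt ss \<Theta>0)" and T: "T \<ge> 0"
    and M: "M > 0" "2 * (l2 (wt ss \<Theta>0))\<^sup>2 \<le> M" and TM: "T * (4 * KK * M) \<le> 1"
  shows "\<exists>\<Theta>. (\<forall>t\<in>{0..T}. Hp ss (\<Theta> t) \<and> herm (\<Theta> t) \<and> (l2 (wt ss (\<Theta> t)))\<^sup>2 \<le> M)
    \<and> (AE \<xi> in lborel. \<Theta> 0 \<xi> = \<Theta>0 \<xi>)
    \<and> (\<forall>t0\<in>{0..T}. ((\<lambda>t. nH sg (\<lambda>\<xi>. \<Theta> t \<xi> - \<Theta> t0 \<xi>)) \<longlongrightarrow> 0) (at t0 within {0..T}))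
    \<and> (\<forall>\<Phi>. L2c \<Phi> \<longrightarrow> (\<forall>t\<in>{0..T}. Re (ip (\<Theta> t) \<Phi>) = Re (ip (\<Theta> 0) \<Phi>) - integral {0..t} (\<lambda>\<tau>. Re (ip (Aop (\<Theta> \<tau>)) \<Phi>))))"
proof -
  define L where "L = sqrt ((l2 \<Theta>0)\<^sup>2 + 1)"
  have L0: "L \<ge> 0" by (simp add: L_def add_nonneg_nonneg)
  have M0: "M \<ge> 0" using M by simp
  define \<tau> where "\<tau> N = ctail L M * (N / 2) powr (1 - ss)" for N
  \<comment> \<open>The bound of \<open>compare_approx\<close>, made uniform in time, when the
    consistency error is 1/N at truncation \<open>N\<close> and at most that at larger ones. It
    bounds a squared distance, so it is compared with 4^(-n) below.\<close>
  define \<delta> where "\<delta> N = exp (KK * M * T) * ((l2 (\<lambda>\<xi>. \<Theta>0 \<xi> - trunc N \<Theta>0 \<xi>))\<^sup>2 + 4 * L * (\<tau> N + 1 / N + 1 / N) * T)" for N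
  have half: "LIM N at_top. N / (2::real) :> at_top"
    by (rule filterlim_at_top_mult_tendsto_pos[OF tendsto_const[of "1/2"], simplified]) (auto simp: filterlim_ident)
  have \<tau>0: "(\<tau> \<longlongrightarrow> 0) at_top"
    unfolding \<tau>_def using tendsto_mult_right_zero[OF tendsto_neg_powr[OF _ half, of "1 - ss"]] ss_gt_1 by simp
  have inv0: "((\<lambda>N::real. 1 / N) \<longlongrightarrow> 0) at_top"
    by (intro tendsto_divide_0[OF tendsto_const] filterlim_at_top_imp_at_infinity filterlim_ident)
  have "(\<delta> \<longlongrightarrow> exp (KK * M * T) * (0\<^sup>2 + 4 * L * (0 + 0 + 0) * T)) at_top"
    unfolding \<delta>_def by (intro tendsto_intros l2_trunc_tendsto_0 data \<tau>0 inv0)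
  then have \<delta>0: "(\<delta> \<longlongrightarrow> 0) at_top" by simp
  have "\<exists>g. \<forall>N\<ge>g. \<delta> N \<le> (1/4)^n" for n :: nat
  proof -
    have "\<forall>\<^sub>F N in at_top. \<delta> N < (1/4)^n" by (rule order_tendstoD(2)[OF \<delta>0]) simp
    then show ?thesis by (auto simp: eventually_at_top_linorder intro: less_imp_le)
  qed
  then obtain g where g: "\<And>n N. N \<ge> g n \<Longrightarrow> \<delta> N \<le> (1/4)^n" by metis
  \<comment> \<open>The sum makes the truncations nondecreasing and at least every threshold
    \<open>g i\<close> with i \<le> n; the other two terms make them positive and unbounded.\<close>
  define f where "f n = 1 + real n + (\<Sum>i\<le>n. \<bar>g i\<bar>)" for n
  have f1: "f n \<ge> 1" "f n \<ge> real n" for n unfolding f_def by (auto intro!: add_nonneg_nonneg sum_nonneg)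
  have fS: "f n \<le> f (Suc n)" for n unfolding f_def by simp
  have fg: "f n \<ge> g n" for n
  proof -
    have "\<bar>g n\<bar> \<le> (\<Sum>i\<le>n. \<bar>g i\<bar>)" by (rule member_le_sum) auto
    then show ?thesis unfolding f_def by simp
  qed
  have fpos: "f n > 0" for n using f1(1)[of n] by linarith
  have f_inf: "filterlim f at_top sequentially"
    by (rule filterlim_at_top_mono[OF filterlim_real_sequentially]) (intro always_eventually allI f1)
  have "\<exists>X R. approx \<Theta>0 (f n) T M (1 / f n) X R" for n
    using fpos[of n] by (intro approx_exists data T M TM) auto
  then obtain X R where A: "\<And>n. approx \<Theta>0 (f n) T M (1 / f n) (X n) (R n)" by metis
  have p: "good (f n) (X n t)" "l2 (X n t) \<le> L" "(l2 (wt ss (X n t)))\<^sup>2 \<le> M" "good (f n) (R n t)"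
      "l2 (\<lambda>\<xi>. R n t \<xi> - trunc (f n) (Aop (X n t)) \<xi>) \<le> 1 / f n"
    if "t \<in> {0..T}" for n t using A[of n] that unfolding approx_def L_def by auto
  have LX: "L2c (X n t)" "herm (X n t)" "L2c (wt ss (X n t))" "Hp ss (X n t)" if "t \<in> {0..T}" for n t
    using p(1)[OF that, of n] good_Hp[OF p(1)[OF that, of n], of ss] fpos[of n] ss_gt_1 by (auto simp: good_def Hp_def)
  have wtX: "l2 (wt ss (X n t)) \<le> sqrt M" if "t \<in> {0..T}" for n t by (rule real_le_rsqrt[OF p(3)[OF that]])
  have step: "l2 (\<lambda>\<xi>. X (Suc n) t \<xi> - X n t \<xi>) \<le> (1/2)^n" if t: "t \<in> {0..T}" for n t
  proof -
    have "(l2 (\<lambda>\<xi>. X n t \<xi> - X (Suc n) t \<xi>))\<^sup>2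
      \<le> exp (KK * M * t) * ((l2 (\<lambda>\<xi>. \<Theta>0 \<xi> - trunc (f n) \<Theta>0 \<xi>))\<^sup>2 + 4 * L * (\<tau> (f n) + 1 / f n + 1 / f (Suc n)) * t)"
      unfolding \<tau>_def by (rule compare_approx[OF A A fpos fS M0 data(1) t L_def])
    also have "\<dots> \<le> \<delta> (f n)"
    proof -
      have inv: "1 / f (Suc n) \<le> 1 / f n" using fS[of n] fpos[of n] by (intro divide_left_mono) auto
      have t0: "\<tau> (f n) \<ge> 0" unfolding \<tau>_def using ctail_nonneg[OF L0 M0] by simp
      have nn: "1 / f n \<ge> 0" "1 / f (Suc n) \<ge> 0" using fpos[of n] fpos[of "Suc n"] by auto
      let ?p = "\<tau> (f n) + 1 / f n + 1 / f (Suc n)" and ?q = "\<tau> (f n) + 1 / f n + 1 / f n"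
      have p0: "0 \<le> ?p" and q0: "0 \<le> ?q" using t0 nn by linarith+
      have pq: "?p \<le> ?q" using inv by linarith
      have "4 * L * ?p \<le> 4 * L * ?q" using L0 pq by (intro mult_left_mono) simp_all
      then have "4 * L * ?p * t \<le> 4 * L * ?q * T" by (rule mult_mono) (use L0 q0 t in simp_all)
      then have s: "(l2 (\<lambda>\<xi>. \<Theta>0 \<xi> - trunc (f n) \<Theta>0 \<xi>))\<^sup>2 + 4 * L * ?p * t \<le> (l2 (\<lambda>\<xi>. \<Theta>0 \<xi> - trunc (f n) \<Theta>0 \<xi>))\<^sup>2 + 4 * L * ?q * T"
        by (rule add_left_mono)
      have "KK * M * t \<le> KK * M * T" using t KK_pos M0 by (intro mult_left_mono) simp_all
      then have x: "exp (KK * M * t) \<le> exp (KK * M * T)" by simp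
      have "0 \<le> 4 * L * ?p * t" using L0 p0 t by simp
      then have "0 \<le> (l2 (\<lambda>\<xi>. \<Theta>0 \<xi> - trunc (f n) \<Theta>0 \<xi>))\<^sup>2 + 4 * L * ?p * t" by simp
      then show ?thesis unfolding \<delta>_def by (intro mult_mono x s) simp_all
    qed
    also have "\<dots> \<le> (1/4)^n" by (rule g[OF fg])
    also have "\<dots> = ((1/2)^n)\<^sup>2" by (simp add: power2_eq_square power_mult_distrib[symmetric])
    finally have "l2 (\<lambda>\<xi>. X n t \<xi> - X (Suc n) t \<xi>) \<le> (1/2)^n" by (rule power2_le_imp_le) simp
    then show ?thesis using l2_commute[of "X n t" "X (Suc n) t"] by simp
  qed
  define \<Theta> where "\<Theta> t = (\<lambda>\<xi>. if convergent (\<lambda>n. X n t \<xi>) then lim (\<lambda>n. X n t \<xi>) else 0)" for t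
  have RF: "L2c (\<Theta> t)" "\<And>n. l2 (\<lambda>\<xi>. X n t \<xi> - \<Theta> t \<xi>) \<le> 2 * (1/2)^n" "AE \<xi> in lborel. (\<lambda>n. X n t \<xi>) \<longlonglongrightarrow> \<Theta> t \<xi>" if t: "t \<in> {0..T}" for t
    using Riesz_Fischer[OF LX(1)[OF t] step[OF t] \<Theta>_def] by blast+
  have herm\<Theta>: "herm (\<Theta> t)" if "t \<in> {0..T}" for t unfolding \<Theta>_def by (rule herm_lim[OF LX(2)[OF that]])
  have wt\<Theta>: "L2c (wt ss (\<Theta> t))" "l2 (wt ss (\<Theta> t)) \<le> sqrt M" if t: "t \<in> {0..T}" for t
  proof -
    note [measurable] = L2c_measurable[OF RF(1)[OF t]]
    have ae: "AE \<xi> in lborel. (\<lambda>n. wt ss (X n t) \<xi>) \<longlonglongrightarrow> wt ss (\<Theta> t) \<xi>"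
      using RF(3)[OF t] unfolding wt_def by eventually_elim (intro tendsto_intros)
    show "L2c (wt ss (\<Theta> t))" "l2 (wt ss (\<Theta> t)) \<le> sqrt M"
      using L2c_Fatou[OF LX(3)[OF t] wtX[OF t] _ ae] by auto
  qed
  have H\<Theta>: "Hp ss (\<Theta> t)" "Hp sg (\<Theta> t)" if "t \<in> {0..T}" for t
    using RF(1)[OF that] wt\<Theta>[OF that] Hp_ss_sg[of "\<Theta> t"] by (auto simp: Hp_def)
  have HX: "Hp sg (X n t)" if "t \<in> {0..T}" for n t by (rule Hp_ss_sg[OF LX(4)[OF that]])
  have half0: "(\<lambda>n. c * (1/2)^n) \<longlonglongrightarrow> 0" for c :: real
    by (intro tendsto_mult_right_zero LIMSEQ_power_zero) simp
  have unif: "\<exists>n0. \<forall>n\<ge>n0. \<forall>t\<in>{0..T}. nH sg (\<lambda>\<xi>. X n t \<xi> - \<Theta> t \<xi>) \<le> \<eta>" if \<eta>: "\<eta> > 0" for \<eta>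
  proof -
    obtain d where d: "d > 0" "\<And>D. L2c D \<Longrightarrow> L2c (wt ss D) \<Longrightarrow> l2 (wt ss D) \<le> 2 * sqrt M \<Longrightarrow> l2 D \<le> d \<Longrightarrow> nH sg D \<le> \<eta>"
      using nH_small[OF M0 \<eta>] by blast
    obtain n0 where n0: "\<And>n. n \<ge> n0 \<Longrightarrow> 2 * (1/2)^n < d"
      using order_tendstoD(2)[OF half0[of 2] d(1)] by (auto simp: eventually_sequentially)
    have "nH sg (\<lambda>\<xi>. X n t \<xi> - \<Theta> t \<xi>) \<le> \<eta>" if "n \<ge> n0" and t: "t \<in> {0..T}" for n t
    proof (rule d(2))
      show "L2c (\<lambda>\<xi>. X n t \<xi> - \<Theta> t \<xi>)" by (intro L2c_diff LX(1) RF(1) t)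
      show "L2c (wt ss (\<lambda>\<xi>. X n t \<xi> - \<Theta> t \<xi>))" unfolding wt_diff by (intro L2c_diff LX(3) wt\<Theta>(1) t)
      show "l2 (wt ss (\<lambda>\<xi>. X n t \<xi> - \<Theta> t \<xi>)) \<le> 2 * sqrt M"
        unfolding wt_diff using l2_triangle_diff[OF LX(3)[OF t, of n] wt\<Theta>(1)[OF t]] wtX[OF t, of n] wt\<Theta>(2)[OF t] by linarith
      show "l2 (\<lambda>\<xi>. X n t \<xi> - \<Theta> t \<xi>) \<le> d" using RF(2)[OF t, of n] n0[OF \<open>n \<ge> n0\<close>] by linarith
    qed
    then show ?thesis by blast
  qed
  have cont: "((\<lambda>t. nH sg (\<lambda>\<xi>. \<Theta> t \<xi> - \<Theta> t0 \<xi>)) \<longlongrightarrow> 0) (at t0 within {0..T})" if t0: "t0 \<in> {0..T}" for t0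
  proof (rule tendsto_0_if_eventually_le[OF nH_nonneg])
    fix \<eta> :: real assume \<eta>: "\<eta> > 0"
    obtain d where d: "d > 0" "\<And>D. L2c D \<Longrightarrow> L2c (wt ss D) \<Longrightarrow> l2 (wt ss D) \<le> 2 * sqrt M \<Longrightarrow> l2 D \<le> d \<Longrightarrow> nH sg D \<le> \<eta>"
      using nH_small[OF M0 \<eta>] by blast
    obtain n where n: "4 * (1/2)^n < d / 2"
      using order_tendstoD(2)[OF half0[of 4], of "d / 2"] d(1) by (auto simp: eventually_sequentially)
    obtain D where D: "D \<ge> 0" "\<And>t u. t \<in> {0..T} \<Longrightarrow> u \<in> {0..T} \<Longrightarrow> l2 (\<lambda>\<xi>. X n t \<xi> - X n u \<xi>) \<le> D * \<bar>t - u\<bar>"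
      using A[of n] unfolding approx_def by blast
    have "nH sg (\<lambda>\<xi>. \<Theta> t \<xi> - \<Theta> t0 \<xi>) \<le> \<eta>" if t: "t \<in> {0..T}" and near: "\<bar>t - t0\<bar> < d / (2 * (D + 1))" for t
    proof (rule d(2))
      show "L2c (\<lambda>\<xi>. \<Theta> t \<xi> - \<Theta> t0 \<xi>)" by (intro L2c_diff RF(1) t t0)
      show "L2c (wt ss (\<lambda>\<xi>. \<Theta> t \<xi> - \<Theta> t0 \<xi>))" unfolding wt_diff by (intro L2c_diff wt\<Theta>(1) t t0)
      show "l2 (wt ss (\<lambda>\<xi>. \<Theta> t \<xi> - \<Theta> t0 \<xi>)) \<le> 2 * sqrt M"
        unfolding wt_diff using l2_triangle_diff[OF wt\<Theta>(1)[OF t] wt\<Theta>(1)[OF t0]] wt\<Theta>(2)[OF t] wt\<Theta>(2)[OF t0] by linarith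
      have "D * \<bar>t - t0\<bar> \<le> (D + 1) * \<bar>t - t0\<bar>" by (intro mult_right_mono) auto
      also have "\<dots> \<le> d / 2" using near D(1) by (simp add: field_simps)
      finally have "D * \<bar>t - t0\<bar> \<le> d / 2" .
      then have 1: "l2 (\<lambda>\<xi>. X n t \<xi> - X n t0 \<xi>) \<le> d / 2" using D(2)[OF t t0] by linarith
      have "l2 (\<lambda>\<xi>. \<Theta> t \<xi> - \<Theta> t0 \<xi>) \<le> l2 (\<lambda>\<xi>. \<Theta> t \<xi> - X n t \<xi>) + l2 (\<lambda>\<xi>. X n t \<xi> - \<Theta> t0 \<xi>)"
        by (intro l2_triangle3 RF(1) LX(1) t t0)
      also have "l2 (\<lambda>\<xi>. X n t \<xi> - \<Theta> t0 \<xi>) \<le> l2 (\<lambda>\<xi>. X n t \<xi> - X n t0 \<xi>) + l2 (\<lambda>\<xi>. X n t0 \<xi> - \<Theta> t0 \<xi>)"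
        by (intro l2_triangle3 RF(1) LX(1) t t0)
      finally show "l2 (\<lambda>\<xi>. \<Theta> t \<xi> - \<Theta> t0 \<xi>) \<le> d"
        using 1 n RF(2)[OF t, of n] RF(2)[OF t0, of n] l2_commute[of "\<Theta> t" "X n t"] by linarith
    qed
    moreover have "d / (2 * (D + 1)) > 0" using d(1) D(1) by simp
    ultimately show "\<forall>\<^sub>F t in at t0 within {0..T}. nH sg (\<lambda>\<xi>. \<Theta> t \<xi> - \<Theta> t0 \<xi>) \<le> \<eta>"
      unfolding eventually_at dist_real_def by blast
  qed
  have init: "AE \<xi> in lborel. \<Theta> 0 \<xi> = \<Theta>0 \<xi>"
  proof -
    have T0: "0 \<in> {0..T}" using T by simp
    have "l2 (\<lambda>\<xi>. \<Theta> 0 \<xi> - \<Theta>0 \<xi>) \<le> 2 * (1/2)^n + l2 (\<lambda>\<xi>. \<Theta>0 \<xi> - trunc (f n) \<Theta>0 \<xi>)" for n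
    proof -
      have "X n 0 = trunc (f n) \<Theta>0" using A[of n] unfolding approx_def by blast
      then show ?thesis
        using l2_triangle3[OF RF(1)[OF T0] LX(1)[OF T0, of n] data(1)] RF(2)[OF T0, of n]
          l2_commute[of "\<Theta> 0" "X n 0"] l2_commute[of "\<Theta>0" "trunc (f n) \<Theta>0"] by simp
    qed
    moreover have "(\<lambda>n. 2 * (1/2)^n + l2 (\<lambda>\<xi>. \<Theta>0 \<xi> - trunc (f n) \<Theta>0 \<xi>)) \<longlonglongrightarrow> 0 + 0"
      by (intro tendsto_add half0 filterlim_compose[OF l2_trunc_tendsto_0[OF data(1)] f_inf])
    ultimately have "l2 (\<lambda>\<xi>. \<Theta> 0 \<xi> - \<Theta>0 \<xi>) \<le> 0 + 0"
      by (intro LIMSEQ_le_const[of _ "0 + 0"]) auto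
    then have "l2 (\<lambda>\<xi>. \<Theta> 0 \<xi> - \<Theta>0 \<xi>) = 0" using l2_nonneg[of "\<lambda>\<xi>. \<Theta> 0 \<xi> - \<Theta>0 \<xi>"] by linarith
    then have "AE \<xi> in lborel. \<Theta> 0 \<xi> - \<Theta>0 \<xi> = 0" by (intro l2_eq_0_AE L2c_diff RF(1) T0 data)
    then show ?thesis by simp
  qed
  \<comment> \<open>The limit differs from \<open>X 0 t\<close> by at most 2 in \<open>L^2\<close>,
    hence L + 2. The norm \<open>nH sg\<close> contains the \<open>L^2\<close> norm once directly
    and once through interpolation.\<close>
  define B where "B = (L + 2) + (L + 2) + sqrt M"
  have nB: "nH sg F \<le> B" if "Hp ss F" "l2 F \<le> L + 2" "l2 (wt ss F) \<le> sqrt M" for F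
  proof -
    have "l2 (wt sg F) \<le> l2 F + l2 (wt ss F)" using wt_le_nH(2)[OF that(1), of sg] sg_gt_1 sg_le_ss by (simp add: nH_def)
    then show ?thesis using that unfolding nH_def B_def by linarith
  qed
  have l\<Theta>: "l2 (\<Theta> t) \<le> L + 2" if t: "t \<in> {0..T}" for t
    using l2_diff_abs[OF LX(1)[OF t, of 0] RF(1)[OF t]] RF(2)[OF t, of 0] p(2)[OF t, of 0] by simp
  have B\<Theta>: "nH sg (\<Theta> t) \<le> B" if t: "t \<in> {0..T}" for t by (rule nB[OF H\<Theta>(1)[OF t] l\<Theta>[OF t] wt\<Theta>(2)[OF t]])
  have BX: "nH sg (X n t) \<le> B" if t: "t \<in> {0..T}" for n t
    using p(2)[OF t, of n] by (intro nB LX(4) wtX t) linarith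
  have B0: "B \<ge> 0" unfolding B_def using L0 M0 by simp
  define CA where "CA = cA * (1 + B + B)"
  have CA0: "CA \<ge> 0" unfolding CA_def using cA_ge_1 B0 by simp
  have lipA: "l2 (\<lambda>\<xi>. Aop F \<xi> - Aop G \<xi>) \<le> CA * nH sg (\<lambda>\<xi>. F \<xi> - G \<xi>)"
    if F: "Hp sg F" "nH sg F \<le> B" and G: "Hp sg G" "nH sg G \<le> B" for F G
  proof -
    have "cA * (1 + nH sg F + nH sg G) \<le> CA" unfolding CA_def using cA_ge_1 F G by (intro mult_left_mono) linarith+
    then have "cA * (1 + nH sg F + nH sg G) * nH sg (\<lambda>\<xi>. F \<xi> - G \<xi>) \<le> CA * nH sg (\<lambda>\<xi>. F \<xi> - G \<xi>)"
      by (intro mult_right_mono) auto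
    with Aop_diff_le[OF F(1) G(1)] show ?thesis by linarith
  qed
  have err: "\<exists>n0. \<forall>n\<ge>n0. \<forall>t\<in>{0..T}. l2 (\<lambda>\<xi>. R n t \<xi> - Aop (\<Theta> t) \<xi>) \<le> \<eta>" if \<eta>: "\<eta> > 0" for \<eta>
  proof -
    have "(\<lambda>n. 1 / f n + \<tau> (f n)) \<longlonglongrightarrow> 0 + 0"
      by (intro tendsto_add filterlim_compose[OF inv0 f_inf] filterlim_compose[OF \<tau>0 f_inf])
    then have "(\<lambda>n. 1 / f n + \<tau> (f n)) \<longlonglongrightarrow> 0" by simp
    then have "\<forall>\<^sub>F n in sequentially. 1 / f n + \<tau> (f n) < \<eta> / 2"
      by (rule order_tendstoD(2)) (use \<eta> in simp)
    then obtain n1 where n1: "\<And>n. n \<ge> n1 \<Longrightarrow> 1 / f n + \<tau> (f n) < \<eta> / 2"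
      unfolding eventually_sequentially by blast
    obtain n2 where n2: "\<And>n t. n \<ge> n2 \<Longrightarrow> t \<in> {0..T} \<Longrightarrow> nH sg (\<lambda>\<xi>. X n t \<xi> - \<Theta> t \<xi>) \<le> \<eta> / (2 * (CA + 1))"
    proof -
      have "\<eta> / (2 * (CA + 1)) > 0" using \<eta> CA0 by simp
      from unif[OF this] show ?thesis using that by blast
    qed
    have "l2 (\<lambda>\<xi>. R n t \<xi> - Aop (\<Theta> t) \<xi>) \<le> \<eta>" if n: "n \<ge> max n1 n2" and t: "t \<in> {0..T}" for n t
    proof -
      have LR: "L2c (R n t)" using p(4)[OF t, of n] by (simp add: good_def)
      have LA: "L2c (Aop (X n t))" "L2c (Aop (\<Theta> t))" by (intro Aop_L2c HX H\<Theta>(2) t)+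
      note LT = L2c_trunc[OF LA(1), of "f n"]
      have "l2 (\<lambda>\<xi>. R n t \<xi> - Aop (\<Theta> t) \<xi>) \<le> l2 (\<lambda>\<xi>. R n t \<xi> - trunc (f n) (Aop (X n t)) \<xi>) + l2 (\<lambda>\<xi>. trunc (f n) (Aop (X n t)) \<xi> - Aop (\<Theta> t) \<xi>)"
        by (rule l2_triangle3[OF LR LT LA(2)])
      moreover have "l2 (\<lambda>\<xi>. trunc (f n) (Aop (X n t)) \<xi> - Aop (\<Theta> t) \<xi>) \<le> l2 (\<lambda>\<xi>. trunc (f n) (Aop (X n t)) \<xi> - Aop (X n t) \<xi>) + l2 (\<lambda>\<xi>. Aop (X n t) \<xi> - Aop (\<Theta> t) \<xi>)"
        by (rule l2_triangle3[OF LT LA(1,2)])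
      moreover have "l2 (\<lambda>\<xi>. trunc (f n) (Aop (X n t)) \<xi> - Aop (X n t) \<xi>) \<le> \<tau> (f n)"
        using tail_Aop[OF p(1)[OF t] fpos p(2)[OF t] p(3)[OF t], of n] l2_commute[of "trunc (f n) (Aop (X n t))" "Aop (X n t)"]
        by (simp add: \<tau>_def)
      moreover have "l2 (\<lambda>\<xi>. Aop (X n t) \<xi> - Aop (\<Theta> t) \<xi>) \<le> \<eta> / 2"
      proof -
        have "l2 (\<lambda>\<xi>. Aop (X n t) \<xi> - Aop (\<Theta> t) \<xi>) \<le> CA * nH sg (\<lambda>\<xi>. X n t \<xi> - \<Theta> t \<xi>)"
          by (rule lipA[OF HX[OF t] BX[OF t] H\<Theta>(2)[OF t] B\<Theta>[OF t]])
        also have "\<dots> \<le> CA * (\<eta> / (2 * (CA + 1)))" using n by (intro mult_left_mono CA0 n2 t) auto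
        also have "\<dots> \<le> (CA + 1) * (\<eta> / (2 * (CA + 1)))" using CA0 \<eta> by (intro mult_right_mono) auto
        also have "\<dots> = \<eta> / 2"
        proof -
          have nz: "CA + 1 \<noteq> 0" using CA0 by linarith
          show ?thesis by (simp only: times_divide_eq_right mult.commute[of 2] nonzero_mult_divide_mult_cancel_left[OF nz])
        qed
        finally show ?thesis .
      qed
      ultimately show ?thesis using p(5)[OF t, of n] n1[of n] n by linarith
    qed
    then show ?thesis by blast
  qed
  have weak: "Re (ip (\<Theta> t) \<Phi>) = Re (ip (\<Theta> 0) \<Phi>) - integral {0..t} (\<lambda>\<tau>. Re (ip (Aop (\<Theta> \<tau>)) \<Phi>))"
    if \<Phi>: "L2c \<Phi>" and t: "t \<in> {0..T}" for \<Phi> t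
  proof -
    define G where "G u = Re (ip (Aop (\<Theta> u)) \<Phi>)" for u
    have G_diff: "\<bar>G u - G v\<bar> \<le> CA * nH sg (\<lambda>\<xi>. \<Theta> u \<xi> - \<Theta> v \<xi>) * l2 \<Phi>" if u: "u \<in> {0..T}" and v: "v \<in> {0..T}" for u v
    proof -
      have LA: "L2c (Aop (\<Theta> u))" "L2c (Aop (\<Theta> v))" by (intro Aop_L2c H\<Theta>(2) u v)+
      have "G u - G v = Re (ip (\<lambda>\<xi>. Aop (\<Theta> u) \<xi> - Aop (\<Theta> v) \<xi>) \<Phi>)"
        unfolding G_def by (simp add: ip_diff_left LA \<Phi>)
      also have "\<bar>\<dots>\<bar> \<le> l2 (\<lambda>\<xi>. Aop (\<Theta> u) \<xi> - Aop (\<Theta> v) \<xi>) * l2 \<Phi>" by (intro Re_ip_bound L2c_diff LA \<Phi>)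
      also have "\<dots> \<le> CA * nH sg (\<lambda>\<xi>. \<Theta> u \<xi> - \<Theta> v \<xi>) * l2 \<Phi>"
        by (intro mult_right_mono lipA H\<Theta>(2) B\<Theta> u v) auto
      finally show ?thesis .
    qed
    have contG: "continuous_on {0..T} G"
      unfolding continuous_on_def
    proof
      fix v assume v: "v \<in> {0..T}"
      have lim: "((\<lambda>u. CA * nH sg (\<lambda>\<xi>. \<Theta> u \<xi> - \<Theta> v \<xi>) * l2 \<Phi>) \<longlongrightarrow> CA * 0 * l2 \<Phi>) (at v within {0..T})"
        by (intro tendsto_intros cont v)
      then have lim: "((\<lambda>u. CA * nH sg (\<lambda>\<xi>. \<Theta> u \<xi> - \<Theta> v \<xi>) * l2 \<Phi>) \<longlongrightarrow> 0) (at v within {0..T})" by simp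
      show "(G \<longlongrightarrow> G v) (at v within {0..T})"
      proof (rule LIM_zero_cancel, rule Lim_null_comparison[OF _ lim])
        show "\<forall>\<^sub>F u in at v within {0..T}. norm (G u - G v) \<le> CA * nH sg (\<lambda>\<xi>. \<Theta> u \<xi> - \<Theta> v \<xi>) * l2 \<Phi>"
          unfolding eventually_at_filter by (intro always_eventually allI impI) (simp only: real_norm_def G_diff v)
      qed
    qed
    have intG: "G integrable_on {u..v}" if "0 \<le> u" "v \<le> T" for u v
      by (rule integrable_continuous_real[OF continuous_on_subset[OF contG]]) (use that in auto)
    have bound: "\<bar>Re (ip (X n t) \<Phi>) - Re (ip (X n 0) \<Phi>) + integral {0..t} G\<bar> \<le> \<eta> * l2 \<Phi> * T"
      if err: "\<And>t. t \<in> {0..T} \<Longrightarrow> l2 (\<lambda>\<xi>. R n t \<xi> - Aop (\<Theta> t) \<xi>) \<le> \<eta>" for n \<eta>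
    proof -
      have \<eta>0: "\<eta> \<ge> 0" using order_trans[OF l2_nonneg err[OF t]] .
      \<comment> \<open>As the approximations have only right derivatives, the integral identity for
        them is proved up to an error by \<open>Gronwall_right\<close> with K = 0; \<sigma> = 1 and
        \<sigma> = -1 give the two sides of the absolute value.\<close>
      define u where "u \<sigma> t = \<sigma> * (Re (ip (X n t) \<Phi>) - Re (ip (X n 0) \<Phi>) + integral {0..t} G)" for \<sigma> t :: real
      have LR: "L2c (R n t)" if "t \<in> {0..T}" for t using p(4)[OF that, of n] by (simp add: good_def)
      have one: "u \<sigma> t \<le> \<eta> * l2 \<Phi> * T" if \<sigma>: "\<bar>\<sigma>\<bar> = 1" for \<sigma>
      proof -
        have "u \<sigma> t \<le> exp (0 * t) * (u \<sigma> 0 + (\<eta> * l2 \<Phi>) * t)"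
        proof (rule Gronwall_right[where T=T])
          have cX: "continuous_on {0..T} (\<lambda>t. Re (ip (X n t) \<Phi>))"
          proof -
            obtain D where D: "D \<ge> 0" "\<And>t u. t \<in> {0..T} \<Longrightarrow> u \<in> {0..T} \<Longrightarrow> l2 (\<lambda>\<xi>. X n t \<xi> - X n u \<xi>) \<le> D * \<bar>t - u\<bar>"
              using A[of n] unfolding approx_def by blast
            show ?thesis
            proof (rule continuous_on_if_Lipschitz[where D="D * l2 \<Phi>"])
              fix t u assume tu: "t \<in> {0..T}" "u \<in> {0..T}"
              have "Re (ip (X n t) \<Phi>) - Re (ip (X n u) \<Phi>) = Re (ip (\<lambda>\<xi>. X n t \<xi> - X n u \<xi>) \<Phi>)"
                by (simp add: ip_diff_left LX(1)[OF tu(1)] LX(1)[OF tu(2)] \<Phi>)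
              also have "\<bar>\<dots>\<bar> \<le> l2 (\<lambda>\<xi>. X n t \<xi> - X n u \<xi>) * l2 \<Phi>" by (intro Re_ip_bound L2c_diff LX(1) \<Phi> tu)
              also have "\<dots> \<le> (D * \<bar>t - u\<bar>) * l2 \<Phi>" by (intro mult_right_mono D(2) tu) auto
              finally show "\<bar>Re (ip (X n t) \<Phi>) - Re (ip (X n u) \<Phi>)\<bar> \<le> D * l2 \<Phi> * \<bar>t - u\<bar>" by (simp add: mult_ac)
            qed (use D(1) in simp)
          qed
          show "continuous_on {0..T} (u \<sigma>)"
            unfolding u_def
            by (intro continuous_on_mult continuous_on_const continuous_on_add continuous_on_diff cX indefinite_integral_continuous_1 intG) auto
          show "0 \<le> \<eta> * l2 \<Phi>" using \<eta>0 by simp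
          show "0 \<le> u \<sigma> 0" by (simp add: u_def)
          fix t \<epsilon> :: real assume t: "0 \<le> t" "t < T" and \<epsilon>: "\<epsilon> > 0"
          then have tT: "t \<in> {0..T}" by simp
          obtain \<rho>1 where \<rho>1: "\<rho>1 > 0" "\<And>r. 0 \<le> r \<Longrightarrow> r < \<rho>1 \<Longrightarrow> X n (t + r) = (\<lambda>\<xi>. X n t \<xi> - complex_of_real r * R n t \<xi>)"
            using A[of n] t unfolding approx_def by blast
          obtain \<rho>2 where \<rho>2: "\<rho>2 > 0" "\<And>s. s \<in> {0..T} \<Longrightarrow> \<bar>s - t\<bar> < \<rho>2 \<Longrightarrow> \<bar>G s - G t\<bar> < \<epsilon>"
            using contG tT \<epsilon> unfolding continuous_on_iff dist_real_def by blast
          have "u \<sigma> (t + r) \<le> u \<sigma> t + r * (0 * u \<sigma> t + \<eta> * l2 \<Phi> + \<epsilon>)" if r: "0 < r" "r < min \<rho>1 \<rho>2" "t + r \<le> T" for r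
          proof -
            have i1: "integral {0..t + r} G = integral {0..t} G + integral {t..t + r} G"
              using t r intG[of 0 "t + r"] by (intro Henstock_Kurzweil_Integration.integral_combine[symmetric]) auto
            have i2: "Re (ip (X n (t + r)) \<Phi>) = Re (ip (X n t) \<Phi>) - r * Re (ip (R n t) \<Phi>)"
            proof -
              have "ip (\<lambda>\<xi>. X n t \<xi> - complex_of_real r * R n t \<xi>) \<Phi> = ip (X n t) \<Phi> - complex_of_real r * ip (R n t) \<Phi>"
                by (subst ip_diff_left[OF LX(1)[OF tT] L2c_cmult[OF LR[OF tT]] \<Phi>]) (simp only: ip_cmult_left)
              then show ?thesis using \<rho>1(2)[of r] r by simp
            qed
            have d: "u \<sigma> (t + r) = u \<sigma> t + (\<sigma> * (integral {t..t + r} G - r * G t) - \<sigma> * (r * (Re (ip (R n t) \<Phi>) - G t)))"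
              unfolding u_def i1 i2 by (simp add: algebra_simps)
            have "\<bar>integral {t..t + r} G - r * G t\<bar> \<le> \<epsilon> * r"
            proof -
              have "integral {t..t + r} G - r * G t = integral {t..t + r} (\<lambda>s. G s - G t)"
                using r t by (subst Henstock_Kurzweil_Integration.integral_diff) (auto intro!: intG simp: integral_const_real)
              moreover have "norm (integral {t..t + r} (\<lambda>s. G s - G t)) \<le> \<epsilon> * (t + r - t)"
              proof (rule integral_bound)
                show "continuous_on {t..t + r} (\<lambda>s. G s - G t)"
                  by (intro continuous_intros continuous_on_subset[OF contG]) (use t r in auto)
                fix s assume "s \<in> {t..t + r}"
                then show "norm (G s - G t) \<le> \<epsilon>" using \<rho>2(2)[of s] r t by (auto intro: less_imp_le)
              qed (use r in simp)
              ultimately show ?thesis by simp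
            qed
            then have 1: "\<sigma> * (integral {t..t + r} G - r * G t) \<le> \<epsilon> * r"
              using abs_ge_self[of "\<sigma> * (integral {t..t + r} G - r * G t)"] \<sigma> by (simp add: abs_mult)
            have "\<bar>Re (ip (R n t) \<Phi>) - G t\<bar> \<le> \<eta> * l2 \<Phi>"
            proof -
              have LA: "L2c (Aop (\<Theta> t))" by (intro Aop_L2c H\<Theta>(2) tT)
              have "Re (ip (R n t) \<Phi>) - G t = Re (ip (\<lambda>\<xi>. R n t \<xi> - Aop (\<Theta> t) \<xi>) \<Phi>)"
                unfolding G_def by (simp add: ip_diff_left LR[OF tT] LA \<Phi>)
              also have "\<bar>\<dots>\<bar> \<le> l2 (\<lambda>\<xi>. R n t \<xi> - Aop (\<Theta> t) \<xi>) * l2 \<Phi>" by (intro Re_ip_bound L2c_diff LA LR tT \<Phi>)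
              also have "\<dots> \<le> \<eta> * l2 \<Phi>" by (intro mult_right_mono err tT) auto
              finally show ?thesis .
            qed
            then have "\<bar>\<sigma> * (r * (Re (ip (R n t) \<Phi>) - G t))\<bar> \<le> r * (\<eta> * l2 \<Phi>)"
              unfolding abs_mult using \<sigma> r by (simp add: mult_left_mono)
            then have 2: "- (\<sigma> * (r * (Re (ip (R n t) \<Phi>) - G t))) \<le> r * (\<eta> * l2 \<Phi>)" by linarith
            have "r * (0 * u \<sigma> t + \<eta> * l2 \<Phi> + \<epsilon>) = r * (\<eta> * l2 \<Phi>) + \<epsilon> * r" by (simp add: algebra_simps)
            then show ?thesis unfolding d using 1 2 by linarith
          qed
          moreover have "min \<rho>1 \<rho>2 > 0" using \<rho>1 \<rho>2 by simp
          ultimately show "\<exists>\<rho>>0. \<forall>r. 0 < r \<longrightarrow> r < \<rho> \<longrightarrow> t + r \<le> T \<longrightarrow> u \<sigma> (t + r) \<le> u \<sigma> t + r * (0 * u \<sigma> t + \<eta> * l2 \<Phi> + \<epsilon>)"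
            by blast
        qed (use t in auto)
        also have "\<dots> = \<eta> * l2 \<Phi> * t" by (simp add: u_def)
        also have "\<dots> \<le> \<eta> * l2 \<Phi> * T" using t \<eta>0 by (intro mult_left_mono) auto
        finally show ?thesis .
      qed
      show ?thesis using one[of 1] one[of "- 1"] unfolding u_def by (simp add: abs_le_iff)
    qed
    define V where "V = Re (ip (\<Theta> t) \<Phi>) - Re (ip (\<Theta> 0) \<Phi>) + integral {0..t} G"
    have T0: "0 \<in> {0..T}" using T by simp
    have ipX: "\<bar>Re (ip (X n t) \<Phi>) - Re (ip (\<Theta> t) \<Phi>)\<bar> \<le> 2 * (1/2)^n * l2 \<Phi>" if t: "t \<in> {0..T}" for n t
    proof -
      have "Re (ip (X n t) \<Phi>) - Re (ip (\<Theta> t) \<Phi>) = Re (ip (\<lambda>\<xi>. X n t \<xi> - \<Theta> t \<xi>) \<Phi>)"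
        by (simp add: ip_diff_left LX(1)[OF t] RF(1)[OF t] \<Phi>)
      also have "\<bar>\<dots>\<bar> \<le> l2 (\<lambda>\<xi>. X n t \<xi> - \<Theta> t \<xi>) * l2 \<Phi>" by (intro Re_ip_bound L2c_diff LX(1) RF(1) t \<Phi>)
      also have "\<dots> \<le> 2 * (1/2)^n * l2 \<Phi>" by (intro mult_right_mono RF(2) t) auto
      finally show ?thesis .
    qed
    have "\<bar>V\<bar> \<le> \<eta>" if \<eta>: "\<eta> > 0" for \<eta>
    proof -
      define \<eta>' where "\<eta>' = \<eta> / (2 * (l2 \<Phi> * T + 1))"
      have pos: "l2 \<Phi> * T + 1 > 0" using T by (simp add: add_nonneg_pos)
      have \<eta>': "\<eta>' > 0" unfolding \<eta>'_def using \<eta> pos by simp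
      have small: "\<eta>' * l2 \<Phi> * T \<le> \<eta> / 2"
      proof -
        have "\<eta>' * (l2 \<Phi> * T) \<le> \<eta>' * (l2 \<Phi> * T + 1)" using \<eta>' by (intro mult_left_mono) auto
        also have "\<dots> = \<eta> / 2"
        proof -
          have nz: "l2 \<Phi> * T + 1 \<noteq> 0" using pos by linarith
          show ?thesis unfolding \<eta>'_def by (simp only: times_divide_eq_left mult.commute[of 2] nonzero_mult_divide_mult_cancel_right[OF nz] nonzero_mult_divide_mult_cancel_right2[OF nz])
        qed
        finally show ?thesis by (simp add: mult.assoc)
      qed
      obtain n1 where n1: "\<And>n t. n \<ge> n1 \<Longrightarrow> t \<in> {0..T} \<Longrightarrow> l2 (\<lambda>\<xi>. R n t \<xi> - Aop (\<Theta> t) \<xi>) \<le> \<eta>'"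
        using err[OF \<eta>'] by blast
      obtain n2 where n2: "\<And>n. n \<ge> n2 \<Longrightarrow> (4 * l2 \<Phi>) * (1/2)^n < \<eta> / 2"
        using order_tendstoD(2)[OF half0[of "4 * l2 \<Phi>"], of "\<eta> / 2"] \<eta> by (auto simp: eventually_sequentially)
      define n where "n = max n1 n2"
      have "\<bar>Re (ip (X n t) \<Phi>) - Re (ip (X n 0) \<Phi>) + integral {0..t} G\<bar> \<le> \<eta>' * l2 \<Phi> * T"
        by (rule bound) (rule n1, simp_all add: n_def)
      moreover have "4 * l2 \<Phi> * (1/2)^n = 2 * (1/2)^n * l2 \<Phi> + 2 * (1/2)^n * l2 \<Phi>" by simp
      ultimately show ?thesis
        using small n2[of n] ipX[OF t, of n] ipX[OF T0, of n] unfolding V_def n_def by linarith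
    qed
    then have "V = 0" using field_le_epsilon[of "\<bar>V\<bar>" 0] by auto
    then show ?thesis unfolding V_def G_def by simp
  qed
  have "(l2 (wt ss (\<Theta> t)))\<^sup>2 \<le> M" if t: "t \<in> {0..T}" for t
    using power_mono[OF wt\<Theta>(2)[OF t], of 2] M0 by simp
  then show ?thesis using H\<Theta>(1) herm\<Theta> init cont weak by blast
qed

end

subsection \<open>Solutions on the Fourier side and uniqueness\<close>

context sqg_exponent
begin

text \<open>The Fourier side of \<open>sqg_sol\<close> without reference to the datum. Hermitian
  test functions are the transforms of real ones. Continuity is stated with \<eta> and \<delta> in
  \<open>nH\<close>, and the time integral is the Henstock--Kurzweil integral, whose shift and
  combination rules serve the gluing below.\<close>

definition fsol :: "real \<Rightarrow> (real \<Rightarrow> pt \<Rightarrow> complex) \<Rightarrow> bool" where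
  "fsol T X \<longleftrightarrow> (\<forall>t\<in>{0..<T}. Hp sg (X t) \<and> herm (X t)) \<and>
     (\<forall>t0\<in>{0..<T}. \<forall>\<eta>>0. \<exists>\<delta>>0. \<forall>t\<in>{0..<T}. \<bar>t - t0\<bar> < \<delta> \<longrightarrow> nH sg (\<lambda>\<xi>. X t \<xi> - X t0 \<xi>) \<le> \<eta>) \<and>
     (\<forall>\<Phi>. L2c \<Phi> \<longrightarrow> herm \<Phi> \<longrightarrow> (\<forall>t\<in>{0..<T}. Re (ip (X t) \<Phi>) = Re (ip (X 0) \<Phi>) - integral {0..t} (\<lambda>\<tau>. Re (ip (Aop (X \<tau>)) \<Phi>))))"

lemma fsolD:
  assumes "fsol T X" "t \<in> {0..<T}"
  shows "Hp sg (X t)" "herm (X t)" "\<eta> > 0 \<Longrightarrow> \<exists>\<delta>>0. \<forall>s\<in>{0..<T}. \<bar>s - t\<bar> < \<delta> \<longrightarrow> nH sg (\<lambda>\<xi>. X s \<xi> - X t \<xi>) \<le> \<eta>"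
    "L2c \<Phi> \<Longrightarrow> herm \<Phi> \<Longrightarrow> Re (ip (X t) \<Phi>) = Re (ip (X 0) \<Phi>) - integral {0..t} (\<lambda>\<tau>. Re (ip (Aop (X \<tau>)) \<Phi>))"
  using assms unfolding fsol_def by blast+

lemma fsol_mono:
  assumes X: "fsol T X" and S: "S \<le> T"
  shows "fsol S X"
proof -
  have sub: "t \<in> {0..<T}" if "t \<in> {0..<S}" for t using that S by simp
  show ?thesis
    unfolding fsol_def
  proof (intro conjI ballI allI impI)
    fix t0 \<eta> :: real assume t0: "t0 \<in> {0..<S}" and \<eta>: "\<eta> > 0"
    show "\<exists>\<delta>>0. \<forall>t\<in>{0..<S}. \<bar>t - t0\<bar> < \<delta> \<longrightarrow> nH sg (\<lambda>\<xi>. X t \<xi> - X t0 \<xi>) \<le> \<eta>"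
      using fsolD(3)[OF X sub[OF t0] \<eta>] sub by blast
  qed (blast intro: fsolD(1,2,4)[OF X] sub)+
qed

text \<open>The error budget of one step: the inner product \<open>d\<close> enters twice with error
  e/4 and the squared increment \<open>q\<close> with e/2.\<close>

lemma Gronwall_step_arith:
  fixes w d q r g k e :: real
  assumes "d \<le> - (r * g) + e / 4 * r" "q \<le> r * (e / 2)" "r * (- 2 * g) \<le> r * k"
  shows "w + 2 * d + q \<le> w + r * (k + 0 + e)"
proof -
  have "2 * d \<le> 2 * (- (r * g) + e / 4 * r)" using assms(1) by simp
  also have "\<dots> = r * (- 2 * g) + r * (e / 2)" by (simp add: algebra_simps)
  finally have "w + 2 * d + q \<le> w + (r * k + r * (e / 2)) + r * (e / 2)" using assms(2,3) by linarith
  also have "\<dots> = w + r * (k + 0 + e)" by (simp add: algebra_simps)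
  finally show ?thesis .
qed

section \<open>Continuity in time and uniqueness\<close>

lemma fsol_Aop_continuous:
  assumes X: "fsol T X" and t: "t \<in> {0..<T}" and \<eta>: "\<eta> > 0"
  shows "\<exists>\<delta>>0. \<forall>s\<in>{0..<T}. \<bar>s - t\<bar> < \<delta> \<longrightarrow> l2 (\<lambda>\<xi>. Aop (X s) \<xi> - Aop (X t) \<xi>) \<le> \<eta>"
proof -
  define C where "C = cA * (2 + nH sg (X t) + nH sg (X t))"
  have C: "C > 0" unfolding C_def using cA_ge_1 nH_nonneg[of sg "X t"] by (intro mult_pos_pos) linarith+
  define \<eta>' where "\<eta>' = min 1 (\<eta> / C)"
  have \<eta>': "\<eta>' > 0" "\<eta>' \<le> 1" "C * \<eta>' \<le> \<eta>"
  proof -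
    show "\<eta>' > 0" "\<eta>' \<le> 1" unfolding \<eta>'_def using \<eta> C by auto
    have "\<eta>' \<le> \<eta> / C" unfolding \<eta>'_def by simp
    then show "C * \<eta>' \<le> \<eta>" using C by (simp add: pos_le_divide_eq mult.commute)
  qed
  obtain \<delta> where \<delta>: "\<delta> > 0" "\<And>s. s \<in> {0..<T} \<Longrightarrow> \<bar>s - t\<bar> < \<delta> \<Longrightarrow> nH sg (\<lambda>\<xi>. X s \<xi> - X t \<xi>) \<le> \<eta>'"
    using fsolD(3)[OF X t \<eta>'(1)] by blast
  have "l2 (\<lambda>\<xi>. Aop (X s) \<xi> - Aop (X t) \<xi>) \<le> \<eta>" if s: "s \<in> {0..<T}" "\<bar>s - t\<bar> < \<delta>" for s
  proof -
    note Hs = fsolD(1)[OF X s(1)] and Ht = fsolD(1)[OF X t] and n = \<delta>(2)[OF s]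
    have "nH sg (X s) \<le> nH sg (X t) + 1" using nH_le_add[OF Hs Ht] n \<eta>'(2) by linarith
    then have "cA * (1 + nH sg (X s) + nH sg (X t)) \<le> C" unfolding C_def using cA_ge_1 by (intro mult_left_mono) linarith+
    then have "cA * (1 + nH sg (X s) + nH sg (X t)) * nH sg (\<lambda>\<xi>. X s \<xi> - X t \<xi>) \<le> C * \<eta>'"
      using n C by (intro mult_mono) auto
    then show ?thesis using Aop_diff_le[OF Hs Ht] \<eta>'(3) by linarith
  qed
  then show ?thesis using \<delta>(1) by blast
qed

lemma fsol_ip_continuous:
  assumes X: "fsol T X" and \<Phi>: "L2c \<Phi>"
  shows "continuous_on {0..<T} (\<lambda>\<tau>. Re (ip (Aop (X \<tau>)) \<Phi>))"
  unfolding continuous_on_iff dist_real_def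
proof (intro ballI allI impI)
  fix t e :: real assume t: "t \<in> {0..<T}" and e: "e > 0"
  have p: "l2 \<Phi> + 1 > 0" by (simp add: add_nonneg_pos)
  obtain \<delta> where \<delta>: "\<delta> > 0" "\<And>s. s \<in> {0..<T} \<Longrightarrow> \<bar>s - t\<bar> < \<delta> \<Longrightarrow> l2 (\<lambda>\<xi>. Aop (X s) \<xi> - Aop (X t) \<xi>) \<le> e / 2 / (l2 \<Phi> + 1)"
    using fsol_Aop_continuous[OF X t, of "e / 2 / (l2 \<Phi> + 1)"] e p by auto
  have "\<bar>Re (ip (Aop (X s)) \<Phi>) - Re (ip (Aop (X t)) \<Phi>)\<bar> < e" if s: "s \<in> {0..<T}" "\<bar>s - t\<bar> < \<delta>" for s
  proof -
    have LA: "L2c (Aop (X s))" "L2c (Aop (X t))" by (intro Aop_L2c fsolD(1)[OF X] s t)+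
    have "Re (ip (Aop (X s)) \<Phi>) - Re (ip (Aop (X t)) \<Phi>) = Re (ip (\<lambda>\<xi>. Aop (X s) \<xi> - Aop (X t) \<xi>) \<Phi>)"
      by (simp add: ip_diff_left LA \<Phi>)
    also have "\<bar>\<dots>\<bar> \<le> l2 (\<lambda>\<xi>. Aop (X s) \<xi> - Aop (X t) \<xi>) * l2 \<Phi>" by (intro Re_ip_bound L2c_diff LA \<Phi>)
    also have "\<dots> \<le> e / 2 / (l2 \<Phi> + 1) * (l2 \<Phi> + 1)" by (intro mult_mono \<delta>(2) s) (use e p in auto)
    also have "\<dots> = e / 2"
    proof -
      have nz: "l2 \<Phi> + 1 \<noteq> 0" using p by linarith
      show ?thesis by (simp only: nonzero_eq_divide_eq[OF nz, symmetric])
    qed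
    also have "\<dots> < e" using e by simp
    finally show ?thesis .
  qed
  then show "\<exists>d>0. \<forall>s\<in>{0..<T}. \<bar>s - t\<bar> < d \<longrightarrow> \<bar>Re (ip (Aop (X s)) \<Phi>) - Re (ip (Aop (X t)) \<Phi>)\<bar> < e"
    using \<delta>(1) by blast
qed

lemma fsol_increment:
  assumes X: "fsol T X" and \<Phi>: "L2c \<Phi>" "herm \<Phi>" and st: "0 \<le> s" "s \<le> t" "t < T"
  shows "Re (ip (X t) \<Phi>) = Re (ip (X s) \<Phi>) - integral {s..t} (\<lambda>\<tau>. Re (ip (Aop (X \<tau>)) \<Phi>))"
proof -
  let ?G = "\<lambda>\<tau>. Re (ip (Aop (X \<tau>)) \<Phi>)"
  have "?G integrable_on {0..t}"
    by (rule integrable_continuous_real[OF continuous_on_subset[OF fsol_ip_continuous[OF X \<Phi>(1)]]]) (use st in auto)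
  then have "integral {0..t} ?G = integral {0..s} ?G + integral {s..t} ?G"
    using st by (intro Henstock_Kurzweil_Integration.integral_combine[symmetric]) auto
  then show ?thesis using fsolD(4)[OF X _ \<Phi>, of t] fsolD(4)[OF X _ \<Phi>, of s] st by simp
qed

text \<open>The equation can only be tested with functions fixed in time, so the difference
  \<open>W s\<close> is frozen on a short interval and the square of W s + D is expanded, with
  \<open>D\<close> the increment. The cross term is the energy inequality up to the continuity of
  \<open>G\<close>; the square of \<open>D\<close> is of order r^2. Only \<open>X\<close> has to be
  regular, as in \<open>energy_diff\<close>.\<close>

theorem fsol_unique:
  assumes X: "fsol T X" and Y: "fsol T Y" and init: "AE \<xi> in lborel. X 0 \<xi> = Y 0 \<xi>"
    and reg: "\<And>t. t \<in> {0..<T} \<Longrightarrow> Hp ss (X t) \<and> (l2 (wt ss (X t)))\<^sup>2 \<le> M" and M: "M \<ge> 0" and t: "t \<in> {0..<T}"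
  shows "AE \<xi> in lborel. X t \<xi> = Y t \<xi>"
proof -
  define W where "W t = (\<lambda>\<xi>. X t \<xi> - Y t \<xi>)" for t
  have HW: "Hp sg (W t)" if "t \<in> {0..<T}" for t unfolding W_def by (intro Hp_diff fsolD(1)[OF X] fsolD(1)[OF Y] that)
  have LW: "L2c (W t)" "herm (W t)" if "t \<in> {0..<T}" for t
    using HpD(1)[OF HW[OF that]] herm_diff[OF fsolD(2)[OF X that] fsolD(2)[OF Y that]] by (auto simp: W_def)
  define S where "S = t"
  have S: "0 \<le> S" "S < T" using t by (auto simp: S_def)
  have in_T: "s \<in> {0..<T}" if "s \<in> {0..S}" for s using that S by auto
  have "(l2 (W t))\<^sup>2 \<le> exp (KK * M * t) * ((l2 (W 0))\<^sup>2 + 0 * t)"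
  proof (rule Gronwall_right[where u="\<lambda>t. (l2 (W t))\<^sup>2" and T=S])
    have "continuous_on {0..S} (\<lambda>t. l2 (W t))"
      unfolding continuous_on_iff dist_real_def
    proof (intro ballI allI impI)
      fix s e :: real assume s: "s \<in> {0..S}" and e: "e > 0"
      obtain \<delta>1 where \<delta>1: "\<delta>1 > 0" "\<And>r. r \<in> {0..<T} \<Longrightarrow> \<bar>r - s\<bar> < \<delta>1 \<Longrightarrow> nH sg (\<lambda>\<xi>. X r \<xi> - X s \<xi>) \<le> e / 3"
        using fsolD(3)[OF X in_T[OF s], of "e / 3"] e by auto
      obtain \<delta>2 where \<delta>2: "\<delta>2 > 0" "\<And>r. r \<in> {0..<T} \<Longrightarrow> \<bar>r - s\<bar> < \<delta>2 \<Longrightarrow> nH sg (\<lambda>\<xi>. Y r \<xi> - Y s \<xi>) \<le> e / 3"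
        using fsolD(3)[OF Y in_T[OF s], of "e / 3"] e by auto
      have "\<bar>l2 (W r) - l2 (W s)\<bar> < e" if r: "r \<in> {0..S}" "\<bar>r - s\<bar> < min \<delta>1 \<delta>2" for r
      proof -
        have XY: "L2c (X r)" "L2c (X s)" "L2c (Y r)" "L2c (Y s)"
          using fsolD(1)[OF X in_T[OF r(1)]] fsolD(1)[OF X in_T[OF s]] fsolD(1)[OF Y in_T[OF r(1)]] fsolD(1)[OF Y in_T[OF s]] by (auto simp: Hp_def)
        have "\<bar>l2 (W r) - l2 (W s)\<bar> \<le> l2 (\<lambda>\<xi>. W r \<xi> - W s \<xi>)" by (intro l2_diff_abs LW in_T r s)
        also have "(\<lambda>\<xi>. W r \<xi> - W s \<xi>) = (\<lambda>\<xi>. (X r \<xi> - X s \<xi>) - (Y r \<xi> - Y s \<xi>))" by (simp add: W_def algebra_simps)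
        also have "l2 \<dots> \<le> l2 (\<lambda>\<xi>. X r \<xi> - X s \<xi>) + l2 (\<lambda>\<xi>. Y r \<xi> - Y s \<xi>)" by (intro l2_triangle_diff L2c_diff XY)
        also have "\<dots> \<le> e / 3 + e / 3"
          using \<delta>1(2)[OF in_T[OF r(1)]] \<delta>2(2)[OF in_T[OF r(1)]] r(2) l2_nonneg[of "wt sg (\<lambda>\<xi>. X r \<xi> - X s \<xi>)"] l2_nonneg[of "wt sg (\<lambda>\<xi>. Y r \<xi> - Y s \<xi>)"]
          unfolding nH_def by (intro add_mono) linarith+
        also have "\<dots> < e" using e by simp
        finally show ?thesis .
      qed
      then show "\<exists>d>0. \<forall>r\<in>{0..S}. \<bar>r - s\<bar> < d \<longrightarrow> \<bar>l2 (W r) - l2 (W s)\<bar> < e"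
        using \<delta>1(1) \<delta>2(1) by (intro exI[of _ "min \<delta>1 \<delta>2"]) auto
    qed
    then show "continuous_on {0..S} (\<lambda>t. (l2 (W t))\<^sup>2)" by (intro continuous_intros)
    show "0 \<le> KK * M" using KK_pos M by simp
    show "0 \<le> (0::real)" "0 \<le> (l2 (W 0))\<^sup>2" "0 \<le> t" "t \<le> S" using t by (auto simp: S_def)
    fix s \<epsilon> :: real assume s: "0 \<le> s" "s < S" and \<epsilon>: "\<epsilon> > 0"
    have sT: "s \<in> {0..<T}" using s S by auto
    define Ad where "Ad \<tau> = (\<lambda>\<xi>. Aop (X \<tau>) \<xi> - Aop (Y \<tau>) \<xi>)" for \<tau>
    have LA: "L2c (Aop (X \<tau>))" "L2c (Aop (Y \<tau>))" "L2c (Ad \<tau>)" if "\<tau> \<in> {0..<T}" for \<tau>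
      unfolding Ad_def using that by (auto intro!: L2c_diff Aop_L2c fsolD(1)[OF X] fsolD(1)[OF Y])
    \<comment> \<open>Near \<open>s\<close> each of the two values of \<open>Aop\<close> moves by at
      most 1.\<close>
    define C where "C = l2 (Ad s) + 2"
    have C0: "C > 0" unfolding C_def by (simp add: add_nonneg_pos)
    obtain \<delta>1 where \<delta>1: "\<delta>1 > 0" "\<And>r. r \<in> {0..<T} \<Longrightarrow> \<bar>r - s\<bar> < \<delta>1 \<Longrightarrow> l2 (\<lambda>\<xi>. Aop (X r) \<xi> - Aop (X s) \<xi>) \<le> 1"
      using fsol_Aop_continuous[OF X sT, of 1] by auto
    obtain \<delta>2 where \<delta>2: "\<delta>2 > 0" "\<And>r. r \<in> {0..<T} \<Longrightarrow> \<bar>r - s\<bar> < \<delta>2 \<Longrightarrow> l2 (\<lambda>\<xi>. Aop (Y r) \<xi> - Aop (Y s) \<xi>) \<le> 1"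
      using fsol_Aop_continuous[OF Y sT, of 1] by auto
    have lA: "l2 (Ad r) \<le> C" if r: "r \<in> {0..<T}" "\<bar>r - s\<bar> < \<delta>1" "\<bar>r - s\<bar> < \<delta>2" for r
    proof -
      have "l2 (\<lambda>\<xi>. Ad r \<xi> - Ad s \<xi>) = l2 (\<lambda>\<xi>. (Aop (X r) \<xi> - Aop (X s) \<xi>) - (Aop (Y r) \<xi> - Aop (Y s) \<xi>))"
        unfolding Ad_def by (simp add: algebra_simps)
      also have "\<dots> \<le> l2 (\<lambda>\<xi>. Aop (X r) \<xi> - Aop (X s) \<xi>) + l2 (\<lambda>\<xi>. Aop (Y r) \<xi> - Aop (Y s) \<xi>)"
        by (intro l2_triangle_diff L2c_diff LA r sT)
      finally show ?thesis
        using \<delta>1(2)[OF r(1,2)] \<delta>2(2)[OF r(1,3)] l2_diff_abs[OF LA(3)[OF r(1)] LA(3)[OF sT]] unfolding C_def by linarith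
    qed
    have ipd: "Re (ip (\<lambda>\<xi>. W v \<xi> - W u \<xi>) \<Phi>) = - integral {u..v} (\<lambda>\<tau>. Re (ip (Ad \<tau>) \<Phi>))" (is "_ = - integral _ ?A")
      and ipc: "continuous_on {0..<T} (\<lambda>\<tau>. Re (ip (Ad \<tau>) \<Phi>))"
      if \<Phi>: "L2c \<Phi>" "herm \<Phi>" and uv: "0 \<le> u" "u \<le> v" "v < T" for \<Phi> u v
    proof -
      have e: "Re (ip (Ad \<tau>) \<Phi>) = Re (ip (Aop (X \<tau>)) \<Phi>) - Re (ip (Aop (Y \<tau>)) \<Phi>)" if "\<tau> \<in> {0..<T}" for \<tau>
        unfolding Ad_def by (simp add: ip_diff_left LA[OF that] \<Phi>(1))
      note cX = fsol_ip_continuous[OF X \<Phi>(1)] and cY = fsol_ip_continuous[OF Y \<Phi>(1)]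
      show "continuous_on {0..<T} (\<lambda>\<tau>. Re (ip (Ad \<tau>) \<Phi>))"
        using continuous_on_diff[OF cX cY] by (rule continuous_on_eq) (simp only: e)
      have sub: "{u..v} \<subseteq> {0..<T}" using uv by auto
      have "integral {u..v} ?A = integral {u..v} (\<lambda>\<tau>. Re (ip (Aop (X \<tau>)) \<Phi>) - Re (ip (Aop (Y \<tau>)) \<Phi>))"
        by (rule integral_cong) (use sub e in blast)
      also have "\<dots> = integral {u..v} (\<lambda>\<tau>. Re (ip (Aop (X \<tau>)) \<Phi>)) - integral {u..v} (\<lambda>\<tau>. Re (ip (Aop (Y \<tau>)) \<Phi>))"
        by (intro Henstock_Kurzweil_Integration.integral_diff integrable_continuous_real continuous_on_subset[OF cX sub] continuous_on_subset[OF cY sub])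
      finally have i: "integral {u..v} ?A = integral {u..v} (\<lambda>\<tau>. Re (ip (Aop (X \<tau>)) \<Phi>)) - integral {u..v} (\<lambda>\<tau>. Re (ip (Aop (Y \<tau>)) \<Phi>))" .
      have mem: "u \<in> {0..<T}" "v \<in> {0..<T}" using uv by auto
      have "ip (\<lambda>\<xi>. W v \<xi> - W u \<xi>) \<Phi> = ip (W v) \<Phi> - ip (W u) \<Phi>" by (intro ip_diff_left LW mem \<Phi>)
      moreover have "ip (W v) \<Phi> = ip (X v) \<Phi> - ip (Y v) \<Phi>" "ip (W u) \<Phi> = ip (X u) \<Phi> - ip (Y u) \<Phi>"
        unfolding W_def using fsolD(1)[OF X] fsolD(1)[OF Y] mem \<Phi>(1) by (auto intro!: ip_diff_left simp: Hp_def)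
      ultimately show "Re (ip (\<lambda>\<xi>. W v \<xi> - W u \<xi>) \<Phi>) = - integral {u..v} ?A"
        using fsol_increment[OF X \<Phi> uv] fsol_increment[OF Y \<Phi> uv] i by simp
    qed
    have LWs: "L2c (W s)" "herm (W s)" using LW[OF sT] by auto
    define G where "G \<tau> = Re (ip (Ad \<tau>) (W s))" for \<tau>
    have cG: "continuous_on {0..<T} G" unfolding G_def by (rule ipc[OF LWs, of 0 0]) (use S in auto)
    obtain \<delta>3 where \<delta>3: "\<delta>3 > 0" "\<And>r. r \<in> {0..<T} \<Longrightarrow> \<bar>r - s\<bar> < \<delta>3 \<Longrightarrow> \<bar>G r - G s\<bar> < \<epsilon> / 4"
    proof -
      have e4: "\<epsilon> / 4 > 0" using \<epsilon> by simp
      show ?thesis using cG[unfolded continuous_on_iff dist_real_def, rule_format, OF sT e4] that by blast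
    qed
    define \<rho> where "\<rho> = min (min \<delta>1 \<delta>2) (min \<delta>3 (\<epsilon> / (2 * C\<^sup>2)))"
    have \<rho>0: "\<rho> > 0" unfolding \<rho>_def using \<delta>1 \<delta>2 \<delta>3 \<epsilon> C0 by simp
    have "(l2 (W (s + r)))\<^sup>2 \<le> (l2 (W s))\<^sup>2 + r * (KK * M * (l2 (W s))\<^sup>2 + 0 + \<epsilon>)" if r: "0 < r" "r < \<rho>" "s + r \<le> S" for r
    proof -
      have srT: "s + r \<in> {0..<T}" and sr: "0 \<le> s" "s \<le> s + r" "s + r < T" using s r S by auto
      have r123: "r < \<delta>1" "r < \<delta>2" "r < \<delta>3" "r < \<epsilon> / (2 * C\<^sup>2)" using r unfolding \<rho>_def by auto
      define D where "D = (\<lambda>\<xi>. W (s + r) \<xi> - W s \<xi>)"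
      have LD: "L2c D" "herm D" unfolding D_def by (intro L2c_diff LW srT LWs, intro herm_diff LW srT LWs)
      have sub: "{s..s + r} \<subseteq> {0..<T}" using sr by auto
      \<comment> \<open>The equation is tested with the increment \<open>D\<close> itself, regarded
        as fixed in time; this bounds its squared norm by C r times its norm.\<close>
      have lD: "l2 D \<le> C * r"
      proof (cases "l2 D = 0")
        case True
        then show ?thesis using C0 r by simp
      next
        case False
        then have pos: "l2 D > 0" using l2_nonneg[of D] by linarith
        have "(l2 D)\<^sup>2 = Re (ip D D)" by (simp add: ip_self)
        also have "\<dots> = - integral {s..s + r} (\<lambda>\<tau>. Re (ip (Ad \<tau>) D))" unfolding D_def[symmetric] using ipd[OF LD sr] by (simp add: D_def)
        also have "\<dots> \<le> norm (integral {s..s + r} (\<lambda>\<tau>. Re (ip (Ad \<tau>) D)))" by simp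
        also have "\<dots> \<le> (C * l2 D) * (s + r - s)"
        proof (rule integral_bound)
          show "continuous_on {s..s + r} (\<lambda>\<tau>. Re (ip (Ad \<tau>) D))"
            by (rule continuous_on_subset[OF ipc[OF LD, of 0 0] sub]) (use S in auto)
          fix \<tau> assume \<tau>: "\<tau> \<in> {s..s + r}"
          then have \<tau>T: "\<tau> \<in> {0..<T}" using sub by blast
          have "\<bar>Re (ip (Ad \<tau>) D)\<bar> \<le> l2 (Ad \<tau>) * l2 D" by (rule Re_ip_bound[OF LA(3)[OF \<tau>T] LD(1)])
          also have "\<dots> \<le> C * l2 D" using \<tau> r123 by (intro mult_right_mono lA \<tau>T) auto
          finally show "norm (Re (ip (Ad \<tau>) D)) \<le> C * l2 D" by simp
        qed (use r in simp)
        finally have "l2 D * l2 D \<le> (C * r) * l2 D" by (simp add: power2_eq_square mult_ac)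
        then show ?thesis using pos by (rule mult_right_le_imp_le)
      qed
      have "(l2 D)\<^sup>2 \<le> (C * r)\<^sup>2" using lD by (intro power_mono) auto
      also have "\<dots> = r * (r * C\<^sup>2)" by (simp add: power2_eq_square mult_ac)
      also have "\<dots> \<le> r * (\<epsilon> / 2)"
        using r r123(4) C0 by (intro mult_left_mono) (auto simp: field_simps)
      finally have D2: "(l2 D)\<^sup>2 \<le> r * (\<epsilon> / 2)" .
      have "Re (ip D (W s)) = - integral {s..s + r} G" unfolding D_def G_def by (rule ipd[OF LWs sr])
      moreover have "\<bar>integral {s..s + r} G - r * G s\<bar> \<le> \<epsilon> / 4 * r"
      proof -
        have "G integrable_on {s..s + r}" by (intro integrable_continuous_real continuous_on_subset[OF cG sub])
        then have "integral {s..s + r} G - r * G s = integral {s..s + r} (\<lambda>\<tau>. G \<tau> - G s)"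
          using r by (subst Henstock_Kurzweil_Integration.integral_diff) (auto simp: integral_const_real)
        moreover have "norm (integral {s..s + r} (\<lambda>\<tau>. G \<tau> - G s)) \<le> \<epsilon> / 4 * (s + r - s)"
        proof (rule integral_bound)
          show "continuous_on {s..s + r} (\<lambda>\<tau>. G \<tau> - G s)" by (intro continuous_intros continuous_on_subset[OF cG sub])
          fix \<tau> assume \<tau>: "\<tau> \<in> {s..s + r}"
          then have "\<tau> \<in> {0..<T}" "\<bar>\<tau> - s\<bar> < \<delta>3" using sub r123 by auto
          then show "norm (G \<tau> - G s) \<le> \<epsilon> / 4" using \<delta>3(2)[of \<tau>] by (simp add: less_imp_le)
        qed (use r in simp)
        ultimately show ?thesis by simp
      qed
      ultimately have ip1: "Re (ip D (W s)) \<le> - (r * G s) + \<epsilon> / 4 * r" by linarith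
      have "- 2 * G s \<le> KK * (l2 (wt ss (X s)))\<^sup>2 * (l2 (W s))\<^sup>2"
        unfolding G_def Ad_def W_def using reg[OF sT] by (intro energy_diff fsolD(1)[OF Y sT] fsolD(2)[OF Y sT]) auto
      also have "\<dots> \<le> KK * M * (l2 (W s))\<^sup>2" using KK_pos reg[OF sT] by (intro mult_right_mono mult_left_mono) auto
      finally have 3: "r * (- 2 * G s) \<le> r * (KK * M * (l2 (W s))\<^sup>2)" using r by (intro mult_left_mono) simp_all
      have 4: "(l2 (W (s + r)))\<^sup>2 = (l2 (W s))\<^sup>2 + 2 * Re (ip D (W s)) + (l2 D)\<^sup>2"
        using l2_add_sq[OF LWs(1) LD(1)] Re_ip_commute[of D "W s"] by (simp add: D_def)
      show ?thesis unfolding 4 by (rule Gronwall_step_arith[OF ip1 D2 3])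
    qed
    then show "\<exists>\<rho>>0. \<forall>r. 0 < r \<longrightarrow> r < \<rho> \<longrightarrow> s + r \<le> S \<longrightarrow> (l2 (W (s + r)))\<^sup>2 \<le> (l2 (W s))\<^sup>2 + r * (KK * M * (l2 (W s))\<^sup>2 + 0 + \<epsilon>)"
      using \<rho>0 by blast
  qed
  moreover have "l2 (W 0) = 0"
  proof -
    have "0 \<in> {0..<T}" using t by auto
    have "AE \<xi> in lborel. W 0 \<xi> = 0" using init unfolding W_def by simp
    from l2_cong_AE[OF LW(1)[OF \<open>0 \<in> {0..<T}\<close>] this] show ?thesis by simp
  qed
  ultimately have "l2 (W t) = 0" by simp
  then have "AE \<xi> in lborel. W t \<xi> = 0" by (intro l2_eq_0_AE LW t)
  then show ?thesis unfolding W_def by simp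
qed

end

subsection \<open>Sobolev norms on the physical side\<close>

lemma is_ft_l2:
  assumes "is_ft f F"
  shows "(\<integral>\<^sup>+x. ennreal ((f x)\<^sup>2) \<partial>lborel) = ennreal ((l2 F)\<^sup>2)"
proof -
  have f: "is_ftc (cr f) F" using assms by (simp add: is_ft_iff)
  have "(\<integral>\<^sup>+x. ennreal ((f x)\<^sup>2) \<partial>lborel) = (\<integral>\<^sup>+x. ennreal ((cmod (cr f x))\<^sup>2) \<partial>lborel)" by simp
  also have "\<dots> = ennreal ((l2 (cr f))\<^sup>2)" by (rule nn_integral_L2c[OF is_ftcD(1)[OF f]])
  finally show ?thesis using is_ftc_l2[OF f] by simp
qed

lemma ft_AE: "is_ft f F \<Longrightarrow> AE \<xi> in lborel. ft f \<xi> = F \<xi>"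
  using is_ft_unique[OF is_ft_ft[OF is_ftD(1)]] by blast

lemma nn_integral_wt_ft:
  assumes f: "is_ft f F"
  shows "(\<integral>\<^sup>+\<xi>. ennreal ((norm \<xi> powr s * cmod (ft f \<xi>))\<^sup>2) \<partial>lborel) = (\<integral>\<^sup>+\<xi>. ennreal ((cmod (wt s F \<xi>))\<^sup>2) \<partial>lborel)"
  using ft_AE[OF f] by (intro nn_integral_cong_AE) (auto simp: cmod_wt elim: eventually_mono)

lemma Hs_sqnorm_eq:
  assumes f: "is_ft f F" and F: "Hp s F"
  shows "Hs_sqnorm s f = ennreal ((l2 F)\<^sup>2 + (l2 (wt s F))\<^sup>2)"
  unfolding Hs_sqnorm_def is_ft_l2[OF f] nn_integral_wt_ft[OF f] nn_integral_L2c[OF HpD(2)[OF F]] by simp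

lemma in_Hs_iff:
  assumes f: "is_ft f F"
  shows "in_Hs s f \<longleftrightarrow> Hp s F"
proof
  assume "in_Hs s f"
  then have "(\<integral>\<^sup>+\<xi>. ennreal ((cmod (wt s F \<xi>))\<^sup>2) \<partial>lborel) < \<infinity>"
    unfolding in_Hs_def Hs_sqnorm_def nn_integral_wt_ft[OF f] by auto
  then have "L2c (wt s F)"
    using L2c_measurable[OF is_ftD(2)[OF f]] by (intro L2c_if_nn_finite) auto
  then show "Hp s F" using is_ftD(2)[OF f] by (simp add: Hp_def)
next
  assume "Hp s F"
  then show "in_Hs s f" unfolding in_Hs_def using f Hs_sqnorm_eq[OF f] by auto
qed

lemma in_Hs_hat:
  assumes "in_Hs s f"
  shows "is_ft f (hat f)" "Hp s (hat f)"
proof -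
  show h: "is_ft f (hat f)" using assms is_ft_hat is_ftD(1) unfolding in_Hs_def by blast
  show "Hp s (hat f)" using in_Hs_iff[OF h] assms by simp
qed

lemma nH_sq_le: "(nH s F)\<^sup>2 \<le> 2 * ((l2 F)\<^sup>2 + (l2 (wt s F))\<^sup>2)" and sq_le_nH: "(l2 F)\<^sup>2 + (l2 (wt s F))\<^sup>2 \<le> (nH s F)\<^sup>2"
  unfolding nH_def using sum_squares_bound[of "l2 F" "l2 (wt s F)"] by (auto simp: power2_sum)

lemma Hs_tendsto_iff:
  fixes S :: "real set"
  assumes f: "\<And>t. t \<in> S \<Longrightarrow> is_ft (\<theta> t) (X t) \<and> Hp s (X t)" and t0: "t0 \<in> S"
  shows "((\<lambda>t. Hs_sqnorm s (\<lambda>x. \<theta> t x - \<theta> t0 x)) \<longlongrightarrow> 0) (at t0 within S) \<longleftrightarrow>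
    (\<forall>\<eta>>0. \<exists>\<delta>>0. \<forall>t\<in>S. \<bar>t - t0\<bar> < \<delta> \<longrightarrow> nH s (\<lambda>\<xi>. X t \<xi> - X t0 \<xi>) \<le> \<eta>)" (is "?L \<longleftrightarrow> ?R")
proof -
  define e where "e t = (l2 (\<lambda>\<xi>. X t \<xi> - X t0 \<xi>))\<^sup>2 + (l2 (wt s (\<lambda>\<xi>. X t \<xi> - X t0 \<xi>)))\<^sup>2" for t
  have eq: "Hs_sqnorm s (\<lambda>x. \<theta> t x - \<theta> t0 x) = ennreal (e t)" if "t \<in> S" for t
    unfolding e_def using f[OF that] f[OF t0] by (intro Hs_sqnorm_eq is_ft_diff Hp_diff) auto
  have "?L \<longleftrightarrow> ((\<lambda>t. ennreal (e t)) \<longlongrightarrow> ennreal 0) (at t0 within S)"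
    unfolding ennreal_0 by (rule tendsto_cong) (auto simp: eventually_at_filter eq)
  also have "\<dots> \<longleftrightarrow> (e \<longlongrightarrow> 0) (at t0 within S)"
    by (rule tendsto_ennreal_iff) (auto simp: e_def)
  also have "\<dots> \<longleftrightarrow> ?R"
  proof
    assume lim: "(e \<longlongrightarrow> 0) (at t0 within S)"
    show ?R
    proof (intro allI impI)
      fix \<eta> :: real assume \<eta>: "\<eta> > 0"
      have "\<forall>\<^sub>F t in at t0 within S. e t < \<eta>\<^sup>2 / 2" by (rule order_tendstoD(2)[OF lim]) (use \<eta> in simp)
      then obtain \<delta> where \<delta>: "\<delta> > 0" "\<And>t. t \<in> S \<Longrightarrow> t \<noteq> t0 \<Longrightarrow> \<bar>t - t0\<bar> < \<delta> \<Longrightarrow> e t < \<eta>\<^sup>2 / 2"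
        unfolding eventually_at by (auto simp: dist_real_def)
      have "nH s (\<lambda>\<xi>. X t \<xi> - X t0 \<xi>) \<le> \<eta>" if t: "t \<in> S" "\<bar>t - t0\<bar> < \<delta>" for t
      \<comment> \<open>The limit ignores the time \<open>t0\<close> itself, where the difference
        vanishes.\<close>
      proof (cases "t = t0")
        case True
        then show ?thesis using \<eta> by (simp add: nH_zero)
      next
        case False
        have "(nH s (\<lambda>\<xi>. X t \<xi> - X t0 \<xi>))\<^sup>2 \<le> 2 * e t" unfolding e_def by (rule nH_sq_le)
        also have "\<dots> \<le> \<eta>\<^sup>2" using \<delta>(2)[OF t(1) False t(2)] by simp
        finally show ?thesis by (rule power2_le_imp_le) (use \<eta> in simp)
      qed
      then show "\<exists>\<delta>>0. \<forall>t\<in>S. \<bar>t - t0\<bar> < \<delta> \<longrightarrow> nH s (\<lambda>\<xi>. X t \<xi> - X t0 \<xi>) \<le> \<eta>" using \<delta>(1) by blast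
    qed
  next
    assume R: ?R
    show "(e \<longlongrightarrow> 0) (at t0 within S)"
    proof (rule tendsto_0_if_eventually_le)
      show "e t \<ge> 0" for t by (simp add: e_def)
      fix \<eta> :: real assume \<eta>: "\<eta> > 0"
      then obtain \<delta> where \<delta>: "\<delta> > 0" "\<And>t. t \<in> S \<Longrightarrow> \<bar>t - t0\<bar> < \<delta> \<Longrightarrow> nH s (\<lambda>\<xi>. X t \<xi> - X t0 \<xi>) \<le> sqrt \<eta>"
        using R[rule_format, of "sqrt \<eta>"] by auto
      have "e t \<le> \<eta>" if t: "t \<in> S" "\<bar>t - t0\<bar> < \<delta>" for t
      proof -
        have "e t \<le> (nH s (\<lambda>\<xi>. X t \<xi> - X t0 \<xi>))\<^sup>2" unfolding e_def by (rule sq_le_nH)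
        also have "\<dots> \<le> (sqrt \<eta>)\<^sup>2" by (intro power_mono \<delta>(2) t) auto
        finally show ?thesis using \<eta> by simp
      qed
      then show "\<forall>\<^sub>F t in at t0 within S. e t \<le> \<eta>" unfolding eventually_at dist_real_def using \<delta>(1) by blast
    qed
  qed
  finally show ?thesis .
qed

context sqg_exponent
begin

text \<open>The velocity multipliers have modulus at most 1, so the velocities have integrable
  transforms and can be the first factor in \<open>is_ft_mult\<close>. The two convolutions add up
  to the one with kernel \<open>kk\<close>.\<close>

lemma is_ft_rhs:
  assumes f: "is_ft f F" and F: "Hp sg F"
  shows "is_ft (sqg_rhs a f) (Aop F)"
proof -
  note h = Hp_facts[OF F]
  note [measurable] = h(2)
  have [measurable]: "(\<lambda>\<xi>::pt. \<xi> $ i) \<in> borel_measurable borel" for i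
    by (rule borel_measurable_continuous_onI) (intro continuous_intros)
  define m1 m2 n1 n2 where "m1 \<xi> = - (\<i> * complex_of_real (\<xi> $ 2)) / complex_of_real (norm \<xi>)"
    and "m2 \<xi> = (\<i> * complex_of_real (\<xi> $ 1)) / complex_of_real (norm \<xi>)"
    and "n1 \<xi> = \<i> * complex_of_real (\<xi> $ 1)" and "n2 \<xi> = \<i> * complex_of_real (\<xi> $ 2)" for \<xi> :: pt
  have [measurable]: "m1 \<in> borel_measurable borel" "m2 \<in> borel_measurable borel" "n1 \<in> borel_measurable borel" "n2 \<in> borel_measurable borel"
    unfolding m1_def m2_def n1_def n2_def by measurable
  have cmp: "\<bar>\<xi> $ i\<bar> \<le> norm \<xi>" for \<xi> :: pt and i by (rule component_le_norm_cart)
  have mb: "cmod (m1 \<xi>) \<le> 1" "cmod (m2 \<xi>) \<le> 1" for \<xi>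
    using cmp[of \<xi> 2] cmp[of \<xi> 1] by (auto simp: m1_def m2_def norm_mult norm_divide divide_le_eq_1)
  have nb: "cmod (n1 \<xi>) \<le> norm \<xi>" "cmod (n2 \<xi>) \<le> norm \<xi>" for \<xi>
    using cmp[of \<xi> 1] cmp[of \<xi> 2] by (auto simp: n1_def n2_def norm_mult)
  have LM: "L2c (\<lambda>\<xi>. m \<xi> * F \<xi>)" "integrable lborel (\<lambda>\<xi>. m \<xi> * F \<xi>)"
    if [measurable]: "m \<in> borel_measurable borel" and b: "\<And>\<xi>. cmod (m \<xi>) \<le> 1" for m
  proof -
    have "cmod (m \<xi> * F \<xi>) \<le> 1 * cmod (F \<xi>)" for \<xi> unfolding norm_mult by (intro mult_right_mono b) auto
    then show "L2c (\<lambda>\<xi>. m \<xi> * F \<xi>)" by (intro L2c_dominated(1)[OF h(1), where c=1] AE_I2) auto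
    show "integrable lborel (\<lambda>\<xi>. m \<xi> * F \<xi>)"
      using integrable_mult_bounded[OF h(6) _ b] by (simp add: mult.commute)
  qed
  have LN: "L2c (\<lambda>\<xi>. n \<xi> * F \<xi>)" if [measurable]: "n \<in> borel_measurable borel" and b: "\<And>\<xi>. cmod (n \<xi>) \<le> norm \<xi>" for n
  proof -
    have "cmod (n \<xi> * F \<xi>) \<le> 1 * cmod (wt 1 F \<xi>)" for \<xi>
      unfolding norm_mult cmod_wt using b[of \<xi>] by (simp add: mult_right_mono)
    then show ?thesis by (intro L2c_dominated(1)[OF h(5), where c=1] AE_I2) auto
  qed
  have d: "is_ft (Dpow (2 * a) f) (wt (2 * a) F)"
    unfolding Dpow_def wt_def[abs_def] using h(3) by (intro is_ft_fmult[OF f]) (auto simp: wt_def[abs_def])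
  have v1: "is_ft (vel1 f) (\<lambda>\<xi>. m1 \<xi> * F \<xi>)"
    unfolding vel1_def m1_def[symmetric] by (rule is_ft_fmult[OF f]) (use mb LM(1)[of m1] in \<open>auto simp: m1_def\<close>)
  have v2: "is_ft (vel2 f) (\<lambda>\<xi>. m2 \<xi> * F \<xi>)"
    unfolding vel2_def m2_def[symmetric] by (rule is_ft_fmult[OF f]) (use mb LM(1)[of m2] in \<open>auto simp: m2_def\<close>)
  have d1: "is_ft (dpart 1 f) (\<lambda>\<xi>. n1 \<xi> * F \<xi>)"
    unfolding dpart_def n1_def[symmetric] by (rule is_ft_fmult[OF f]) (use nb LN[of n1] in \<open>auto simp: n1_def\<close>)
  have d2: "is_ft (dpart 2 f) (\<lambda>\<xi>. n2 \<xi> * F \<xi>)"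
    unfolding dpart_def n2_def[symmetric] by (rule is_ft_fmult[OF f]) (use nb LN[of n2] in \<open>auto simp: n2_def\<close>)
  let ?c = "complex_of_real (1 / (2 * pi))"
  have p1: "is_ft (\<lambda>x. vel1 f x * dpart 1 f x) (\<lambda>\<xi>. ?c * (LINT \<eta>|lborel. m1 (\<xi> - \<eta>) * F (\<xi> - \<eta>) * (n1 \<eta> * F \<eta>)))"
    by (rule is_ft_mult[OF v1 LM(2) d1]) (measurable, rule mb)
  have p2: "is_ft (\<lambda>x. vel2 f x * dpart 2 f x) (\<lambda>\<xi>. ?c * (LINT \<eta>|lborel. m2 (\<xi> - \<eta>) * F (\<xi> - \<eta>) * (n2 \<eta> * F \<eta>)))"
    by (rule is_ft_mult[OF v2 LM(2) d2]) (measurable, rule mb)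
  have "is_ft (\<lambda>x. (Dpow (2 * a) f x + vel1 f x * dpart 1 f x) + vel2 f x * dpart 2 f x)
     (\<lambda>\<xi>. (wt (2 * a) F \<xi> + ?c * (LINT \<eta>|lborel. m1 (\<xi> - \<eta>) * F (\<xi> - \<eta>) * (n1 \<eta> * F \<eta>))) + ?c * (LINT \<eta>|lborel. m2 (\<xi> - \<eta>) * F (\<xi> - \<eta>) * (n2 \<eta> * F \<eta>)))"
    by (intro is_ft_add d p1 p2)
  also have "(\<lambda>\<xi>. (wt (2 * a) F \<xi> + ?c * (LINT \<eta>|lborel. m1 (\<xi> - \<eta>) * F (\<xi> - \<eta>) * (n1 \<eta> * F \<eta>))) + ?c * (LINT \<eta>|lborel. m2 (\<xi> - \<eta>) * F (\<xi> - \<eta>) * (n2 \<eta> * F \<eta>))) = Aop F"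
  proof
    fix \<xi>
    have i1: "integrable lborel (\<lambda>\<eta>. m1 (\<xi> - \<eta>) * F (\<xi> - \<eta>) * (n1 \<eta> * F \<eta>))"
      by (rule integrable_mult_L2c[OF L2c_const_minus(1)[OF LM(1)] LN]) (measurable, rule mb nb, measurable, rule mb nb)
    have i2: "integrable lborel (\<lambda>\<eta>. m2 (\<xi> - \<eta>) * F (\<xi> - \<eta>) * (n2 \<eta> * F \<eta>))"
      by (rule integrable_mult_L2c[OF L2c_const_minus(1)[OF LM(1)] LN]) (measurable, rule mb nb, measurable, rule mb nb)
    have k: "complex_of_real (kk \<zeta> \<eta>) = m1 \<zeta> * n1 \<eta> + m2 \<zeta> * n2 \<eta>" for \<zeta> \<eta>
    proof -
      have ii: "\<i> * x * (\<i> * y) = - (x * y)" for x y :: complex by (simp add: algebra_simps)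
      have "m1 \<zeta> * n1 \<eta> + m2 \<zeta> * n2 \<eta> = complex_of_real (kk \<zeta> \<eta>)"
        unfolding m1_def m2_def n1_def n2_def by (simp add: ii kk_def diff_divide_distrib)
      then show ?thesis by simp
    qed
    have "(LINT \<eta>|lborel. complex_of_real (kk (\<xi> - \<eta>) \<eta>) * F (\<xi> - \<eta>) * F \<eta>)
       = (LINT \<eta>|lborel. m1 (\<xi> - \<eta>) * F (\<xi> - \<eta>) * (n1 \<eta> * F \<eta>) + m2 (\<xi> - \<eta>) * F (\<xi> - \<eta>) * (n2 \<eta> * F \<eta>))"
      unfolding k by (intro Bochner_Integration.integral_cong refl) (simp add: algebra_simps)
    also have "\<dots> = (LINT \<eta>|lborel. m1 (\<xi> - \<eta>) * F (\<xi> - \<eta>) * (n1 \<eta> * F \<eta>)) + (LINT \<eta>|lborel. m2 (\<xi> - \<eta>) * F (\<xi> - \<eta>) * (n2 \<eta> * F \<eta>))"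
      by (rule Bochner_Integration.integral_add[OF i1 i2])
    finally show "(wt (2 * a) F \<xi> + ?c * (LINT \<eta>|lborel. m1 (\<xi> - \<eta>) * F (\<xi> - \<eta>) * (n1 \<eta> * F \<eta>))) + ?c * (LINT \<eta>|lborel. m2 (\<xi> - \<eta>) * F (\<xi> - \<eta>) * (n2 \<eta> * F \<eta>)) = Aop F \<xi>"
      unfolding Aop_def Bop_def by (simp only: distrib_left add.assoc)
  qed
  finally show ?thesis unfolding sqg_rhs_def[abs_def] .
qed

lemma ip_Aop_cong_AE:
  assumes "AE \<xi> in lborel. F \<xi> = G \<xi>" "Hp sg F" "Hp sg G" "L2c \<Phi>"
  shows "ip (Aop F) \<Phi> = ip (Aop G) \<Phi>" "ip F \<Phi> = ip G \<Phi>"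
proof -
  note [measurable] = Hp_facts(2)[OF assms(2)] Hp_facts(2)[OF assms(3)] L2c_measurable[OF assms(4)]
    L2c_measurable[OF Aop_L2c[OF assms(2)]] L2c_measurable[OF Aop_L2c[OF assms(3)]]
  have B: "Bop F F = Bop G G" by (rule Bop_cong_AE[OF assms(1,1)]) measurable
  have "AE \<xi> in lborel. Aop F \<xi> = Aop G \<xi>"
    using assms(1) by eventually_elim (simp add: Aop_def B wt_def)
  then show "ip (Aop F) \<Phi> = ip (Aop G) \<Phi>" by (rule ip_cong_AE) auto
  show "ip F \<Phi> = ip G \<Phi>" using assms(1) by (rule ip_cong_AE) auto
qed

text \<open>\<open>sqg_sol\<close> refers to the datum only through the tested equation. At time 0
  the time integral runs over a null set, and what is left is the third conclusion.\<close>

lemma sqg_sol_fsol: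
  assumes sol: "sqg_sol a \<theta>0 T \<theta>"
  shows "fsol T (\<lambda>t. hat (\<theta> t))" "\<And>t. t \<in> {0..<T} \<Longrightarrow> is_ft (\<theta> t) (hat (\<theta> t)) \<and> Hp sg (hat (\<theta> t))"
    "\<And>\<phi>. T > 0 \<Longrightarrow> L2 \<phi> \<Longrightarrow> (LINT x|lborel. \<theta> 0 x * \<phi> x) = (LINT x|lborel. \<theta>0 x * \<phi> x)"
proof -
  have ch: "cont_Hs sg T \<theta>" using sol by (simp add: sqg_sol_def)
  show h: "is_ft (\<theta> t) (hat (\<theta> t)) \<and> Hp sg (hat (\<theta> t))" if "t \<in> {0..<T}" for t
    using ch that in_Hs_hat[of sg "\<theta> t"] unfolding cont_Hs_def by blast
  have eq: "set_integrable lborel {0..t} (\<lambda>\<tau>. LINT x|lborel. sqg_rhs a (\<theta> \<tau>) x * \<phi> x)"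
      "(LINT x|lborel. \<theta> t x * \<phi> x) = (LINT x|lborel. \<theta>0 x * \<phi> x) - (LINT \<tau>:{0..t}|lborel. (LINT x|lborel. sqg_rhs a (\<theta> \<tau>) x * \<phi> x))"
    if "t \<in> {0..<T}" "L2 \<phi>" for t \<phi>
    using sol that unfolding sqg_sol_def by blast+
  have eq': "(LINT x|lborel. \<theta> t x * \<phi> x) = (LINT x|lborel. \<theta>0 x * \<phi> x) - integral {0..t} (\<lambda>\<tau>. LINT x|lborel. sqg_rhs a (\<theta> \<tau>) x * \<phi> x)"
    if "t \<in> {0..<T}" "L2 \<phi>" for t \<phi>
    using eq(2)[OF that] set_borel_integral_eq_integral(2)[OF eq(1)[OF that]] by simp
  show init: "(LINT x|lborel. \<theta> 0 x * \<phi> x) = (LINT x|lborel. \<theta>0 x * \<phi> x)" if "T > 0" "L2 \<phi>" for \<phi>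
    using eq'[of 0 \<phi>] that by simp
  show "fsol T (\<lambda>t. hat (\<theta> t))"
    unfolding fsol_def
  proof (intro conjI ballI)
    fix t assume t: "t \<in> {0..<T}"
    show "Hp sg (hat (\<theta> t))" using h[OF t] by blast
    show "herm (hat (\<theta> t))" by (rule herm_hat)
    have "((\<lambda>s. Hs_sqnorm sg (\<lambda>x. \<theta> s x - \<theta> t x)) \<longlongrightarrow> 0) (at t within {0..<T})"
      using ch t unfolding cont_Hs_def by blast
    then show "\<forall>\<eta>>0. \<exists>\<delta>>0. \<forall>s\<in>{0..<T}. \<bar>s - t\<bar> < \<delta> \<longrightarrow> nH sg (\<lambda>\<xi>. hat (\<theta> s) \<xi> - hat (\<theta> t) \<xi>) \<le> \<eta>"
      using Hs_tendsto_iff[of "{0..<T}" \<theta> "\<lambda>t. hat (\<theta> t)" sg t] h t by blast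
  next
    show "\<forall>\<Phi>. L2c \<Phi> \<longrightarrow> herm \<Phi> \<longrightarrow> (\<forall>t\<in>{0..<T}. Re (ip (hat (\<theta> t)) \<Phi>) = Re (ip (hat (\<theta> 0)) \<Phi>) - integral {0..t} (\<lambda>\<tau>. Re (ip (Aop (hat (\<theta> \<tau>))) \<Phi>)))"
    proof (intro allI impI ballI)
      fix \<Phi> t assume \<Phi>: "L2c \<Phi>" "herm \<Phi>" and t: "t \<in> {0..<T}"
      have T0: "0 \<in> {0..<T}" "T > 0" using t by auto
      obtain \<phi> where \<phi>: "is_ft \<phi> \<Phi>" using is_ft_surj[OF \<Phi>(1)] \<Phi>(2) unfolding herm_def by (auto simp del: complex_cnj_cancel_iff)
      have L: "L2 \<phi>" by (rule is_ftD(1)[OF \<phi>])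
      have "Re (ip (hat (\<theta> t)) \<Phi>) = (LINT x|lborel. \<theta> t x * \<phi> x)" using integral_eq_ip[OF conjunct1[OF h[OF t]] \<phi>] by simp
      also have "\<dots> = (LINT x|lborel. \<theta> 0 x * \<phi> x) - integral {0..t} (\<lambda>\<tau>. LINT x|lborel. sqg_rhs a (\<theta> \<tau>) x * \<phi> x)"
        using eq'[OF t L] init[OF T0(2) L] by simp
      also have "(LINT x|lborel. \<theta> 0 x * \<phi> x) = Re (ip (hat (\<theta> 0)) \<Phi>)" using integral_eq_ip[OF conjunct1[OF h[OF T0(1)]] \<phi>] by simp
      also have "integral {0..t} (\<lambda>\<tau>. LINT x|lborel. sqg_rhs a (\<theta> \<tau>) x * \<phi> x) = integral {0..t} (\<lambda>\<tau>. Re (ip (Aop (hat (\<theta> \<tau>))) \<Phi>))"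
      proof (rule integral_cong)
        fix \<tau> assume "\<tau> \<in> {0..t}"
        then have "\<tau> \<in> {0..<T}" using t by auto
        then show "(LINT x|lborel. sqg_rhs a (\<theta> \<tau>) x * \<phi> x) = Re (ip (Aop (hat (\<theta> \<tau>))) \<Phi>)"
          using h[of \<tau>] by (intro integral_eq_ip is_ft_rhs \<phi>) auto
      qed
      finally show "Re (ip (hat (\<theta> t)) \<Phi>) = Re (ip (hat (\<theta> 0)) \<Phi>) - integral {0..t} (\<lambda>\<tau>. Re (ip (Aop (hat (\<theta> \<tau>))) \<Phi>))" .
    qed
  qed
qed

lemma fsol_sqg_sol:
  assumes X: "fsol T X" and ft: "\<And>t. t \<in> {0..<T} \<Longrightarrow> is_ft (\<theta> t) (X t)"
    and init: "\<And>\<phi>. L2 \<phi> \<Longrightarrow> (LINT x|lborel. \<theta> 0 x * \<phi> x) = (LINT x|lborel. \<theta>0 x * \<phi> x)"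
  shows "sqg_sol a \<theta>0 T \<theta>"
  unfolding sqg_sol_def cont_Hs_def
proof (intro conjI ballI allI impI)
  note h = fsolD(1)[OF X]
  fix t assume t: "t \<in> {0..<T}"
  show "in_Hs sg (\<theta> t)" using in_Hs_iff[OF ft[OF t]] h[OF t] by simp
  show "((\<lambda>s. Hs_sqnorm sg (\<lambda>x. \<theta> s x - \<theta> t x)) \<longlongrightarrow> 0) (at t within {0..<T})"
    using Hs_tendsto_iff[of "{0..<T}" \<theta> X sg t] ft h t fsolD(3)[OF X t] by blast
  fix \<phi> assume L: "L2 \<phi>"
  let ?\<Phi> = "hat \<phi>" and ?G = "\<lambda>\<tau>. LINT x|lborel. sqg_rhs a (\<theta> \<tau>) x * \<phi> x"
  note \<phi> = is_ft_hat[OF L]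
  have \<Phi>: "L2c ?\<Phi>" "herm ?\<Phi>" by (rule L2c_hat[OF L], rule herm_hat)
  have G: "?G \<tau> = Re (ip (Aop (X \<tau>)) ?\<Phi>)" if "\<tau> \<in> {0..t}" for \<tau>
    using that t by (intro integral_eq_ip is_ft_rhs \<phi> ft h) auto
  have "continuous_on {0..t} (\<lambda>\<tau>. Re (ip (Aop (X \<tau>)) ?\<Phi>))"
    by (rule continuous_on_subset[OF fsol_ip_continuous[OF X \<Phi>(1)]]) (use t in auto)
  then have c: "continuous_on {0..t} ?G" by (rule continuous_on_eq) (simp add: G)
  show i: "set_integrable lborel {0..t} ?G" by (rule borel_integrable_atLeastAtMost'[OF c])
  have T0: "0 \<in> {0..<T}" using t by auto
  have "(LINT x|lborel. \<theta> t x * \<phi> x) = Re (ip (X t) ?\<Phi>)" by (rule integral_eq_ip[OF ft[OF t] \<phi>])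
  also have "\<dots> = Re (ip (X 0) ?\<Phi>) - integral {0..t} (\<lambda>\<tau>. Re (ip (Aop (X \<tau>)) ?\<Phi>))" by (rule fsolD(4)[OF X t \<Phi>])
  also have "Re (ip (X 0) ?\<Phi>) = (LINT x|lborel. \<theta>0 x * \<phi> x)" using integral_eq_ip[OF ft[OF T0] \<phi>] init[OF L] by simp
  also have "integral {0..t} (\<lambda>\<tau>. Re (ip (Aop (X \<tau>)) ?\<Phi>)) = integral {0..t} ?G" by (rule integral_cong) (simp add: G)
  also have "\<dots> = (LINT \<tau>:{0..t}|lborel. ?G \<tau>)" using set_borel_integral_eq_integral(2)[OF i] by simp
  finally show "(LINT x|lborel. \<theta> t x * \<phi> x) = (LINT x|lborel. \<theta>0 x * \<phi> x) - (LINT \<tau>:{0..t}|lborel. ?G \<tau>)" .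
qed

end

subsection \<open>Continuation of solutions\<close>

lemma nH_cong_AE:
  assumes "Hp s F" "AE \<xi> in lborel. F \<xi> = G \<xi>" and [measurable]: "G \<in> borel_measurable borel"
  shows "nH s F = nH s G"
proof -
  have "AE \<xi> in lborel. wt s F \<xi> = wt s G \<xi>" using assms(2) by eventually_elim (simp add: wt_def)
  then have "l2 (wt s F) = l2 (wt s G)" by (rule l2_cong_AE[OF HpD(2)[OF assms(1)]]) measurable
  then show ?thesis unfolding nH_def using l2_cong_AE[OF HpD(1)[OF assms(1)] assms(2,3)] by simp
qed

lemma nn_integral_inverse_distance_infinite:
  fixes c T :: real
  assumes c: "c > 0" and T: "T > 0"
  shows "(\<integral>\<^sup>+\<tau>. indicator {0..<T} \<tau> * ennreal (c / (T - \<tau>)) \<partial>lborel) = \<infinity>" (is "?I = \<infinity>")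
proof (rule ccontr)
  assume "?I \<noteq> \<infinity>"
  then obtain r where r: "?I = ennreal r" "r \<ge> 0" by (cases ?I) auto
  obtain n :: nat where n: "r / c < real n" using reals_Archimedean2 by blast
  \<comment> \<open>At a remaining distance of T exp(-n) the antiderivative -c ln(T - \<tau>) has
    grown by exactly c n.\<close>
  define b where "b = T - T * exp (- real n)"
  have b: "0 \<le> b" "b < T" unfolding b_def using T by auto
  define F where "F \<tau> = - c * ln (T - \<tau>)" for \<tau>
  have "(\<integral>\<^sup>+\<tau>. ennreal (c / (T - \<tau>)) * indicator {0..b} \<tau> \<partial>lborel) = ennreal (F b - F 0)"
  proof (rule nn_integral_FTC_Icc)
    fix \<tau> assume \<tau>: "\<tau> \<in> {0..b}"
    show "(F has_real_derivative c / (T - \<tau>)) (at \<tau>)"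
      unfolding F_def using \<tau> b by (auto intro!: derivative_eq_intros)
  qed (use b c in auto)
  also have "F b - F 0 = c * real n"
    unfolding F_def b_def using T by (simp add: ln_mult algebra_simps)
  finally have "ennreal (c * real n) = (\<integral>\<^sup>+\<tau>. ennreal (c / (T - \<tau>)) * indicator {0..b} \<tau> \<partial>lborel)" by simp
  also have "\<dots> \<le> ?I"
    using b by (intro nn_integral_mono) (auto simp: indicator_def)
  finally have "ennreal (c * real n) \<le> ennreal r" using r by simp
  then have "c * real n \<le> r" using r(2) by (simp add: ennreal_le_iff)
  then show False using n c by (simp add: field_simps)
qed

context sqg_exponent
begin

lemma fsol_has_integral:
  assumes X: "fsol T X" and \<Phi>: "L2c \<Phi>" "herm \<Phi>" and st: "0 \<le> s" "s \<le> t" "t < T"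
  shows "((\<lambda>\<tau>. Re (ip (Aop (X \<tau>)) \<Phi>)) has_integral (Re (ip (X s) \<Phi>) - Re (ip (X t) \<Phi>))) {s..t}"
proof -
  have "(\<lambda>\<tau>. Re (ip (Aop (X \<tau>)) \<Phi>)) integrable_on {s..t}"
    by (rule integrable_continuous_real[OF continuous_on_subset[OF fsol_ip_continuous[OF X \<Phi>(1)]]]) (use st in auto)
  then show ?thesis using fsol_increment[OF X \<Phi> st] by (simp add: has_integral_iff)
qed

lemma fsol_shift:
  assumes X: "fsol T X" and s: "0 \<le> s"
  shows "fsol (T - s) (\<lambda>t. X (s + t))"
  unfolding fsol_def
proof (intro conjI ballI allI impI)
  have sub: "s + t \<in> {0..<T}" if "t \<in> {0..<T - s}" for t using that s by auto
  show "Hp sg (X (s + t))" "herm (X (s + t))" if "t \<in> {0..<T - s}" for t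
    using fsolD(1,2)[OF X sub[OF that]] by auto
  fix t0 \<eta> :: real assume t0: "t0 \<in> {0..<T - s}" and \<eta>: "\<eta> > 0"
  obtain \<delta> where \<delta>: "\<delta> > 0" "\<And>t. t \<in> {0..<T} \<Longrightarrow> \<bar>t - (s + t0)\<bar> < \<delta> \<Longrightarrow> nH sg (\<lambda>\<xi>. X t \<xi> - X (s + t0) \<xi>) \<le> \<eta>"
    using fsolD(3)[OF X sub[OF t0] \<eta>] by blast
  show "\<exists>\<delta>>0. \<forall>t\<in>{0..<T - s}. \<bar>t - t0\<bar> < \<delta> \<longrightarrow> nH sg (\<lambda>\<xi>. X (s + t) \<xi> - X (s + t0) \<xi>) \<le> \<eta>"
    by (rule exI[of _ \<delta>]) (use \<delta> sub in auto)
next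
  fix \<Phi> t assume \<Phi>: "L2c \<Phi>" "herm \<Phi>" and t: "t \<in> {0..<T - s}"
  have "((\<lambda>\<tau>. Re (ip (Aop (X \<tau>)) \<Phi>)) has_integral (Re (ip (X s) \<Phi>) - Re (ip (X (s + t)) \<Phi>))) {0 + s..t + s}"
    using fsol_has_integral[OF X \<Phi> s, of "s + t"] t by (simp add: add.commute)
  then have "((\<lambda>\<tau>. Re (ip (Aop (X (s + \<tau>))) \<Phi>)) has_integral (Re (ip (X s) \<Phi>) - Re (ip (X (s + t)) \<Phi>))) {0..t}"
    unfolding has_integral_shift_Icc_real[symmetric] by (simp add: o_def)
  then show "Re (ip (X (s + t)) \<Phi>) = Re (ip (X (s + 0)) \<Phi>) - integral {0..t} (\<lambda>\<tau>. Re (ip (Aop (X (s + \<tau>))) \<Phi>))"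
    by (simp add: integral_unique)
qed

text \<open>\<open>Y\<close> starts at a time before \<open>T\<close> and agrees with
  \<open>X\<close> on the whole overlap, so up to null sets \<open>Z\<close> is \<open>X\<close>
  near every time before \<open>T\<close> and \<open>Y\<close> near every later one. Continuity at
  the seam is thereby inherited instead of being pieced together from one-sided limits.\<close>

lemma fsol_glue:
  assumes X: "fsol T X" and s: "0 \<le> s" "s < T" and Y: "fsol S Y" and S: "T \<le> s + S"
    and eq: "\<And>t. t \<in> {0..<T - s} \<Longrightarrow> AE \<xi> in lborel. Y t \<xi> = X (s + t) \<xi>"
  defines "Z \<equiv> \<lambda>t. if t < s then X t else Y (t - s)"
  shows "fsol (s + S) Z" "\<And>t. t \<in> {0..<T} \<Longrightarrow> AE \<xi> in lborel. Z t \<xi> = X t \<xi>"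
proof -
  have Hp: "Hp sg (Z t)" "herm (Z t)" if "t \<in> {0..<s + S}" for t
    using fsolD(1,2)[OF X, of t] fsolD(1,2)[OF Y, of "t - s"] that s unfolding Z_def by (auto split: if_splits)
  show ZX: "AE \<xi> in lborel. Z t \<xi> = X t \<xi>" if "t \<in> {0..<T}" for t
    using eq[of "t - s"] that unfolding Z_def by (auto split: if_splits)
  have sub: "t \<in> {0..<s + S}" if "t \<in> {0..<T}" for t using that S by auto
  show "fsol (s + S) Z"
    unfolding fsol_def
  proof (intro conjI ballI allI impI)
    fix t0 \<eta> :: real assume t0: "t0 \<in> {0..<s + S}" and \<eta>: "\<eta> > 0"
    show "\<exists>\<delta>>0. \<forall>t\<in>{0..<s + S}. \<bar>t - t0\<bar> < \<delta> \<longrightarrow> nH sg (\<lambda>\<xi>. Z t \<xi> - Z t0 \<xi>) \<le> \<eta>"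
    proof (cases "t0 < T")
      case True
      then have t0': "t0 \<in> {0..<T}" using t0 by simp
      obtain \<delta> where \<delta>: "\<delta> > 0" "\<And>t. t \<in> {0..<T} \<Longrightarrow> \<bar>t - t0\<bar> < \<delta> \<Longrightarrow> nH sg (\<lambda>\<xi>. X t \<xi> - X t0 \<xi>) \<le> \<eta>"
        using fsolD(3)[OF X t0' \<eta>] by blast
      have "nH sg (\<lambda>\<xi>. Z t \<xi> - Z t0 \<xi>) \<le> \<eta>" if t: "t \<in> {0..<s + S}" "\<bar>t - t0\<bar> < min \<delta> (T - t0)" for t
      proof -
        have t': "t \<in> {0..<T}" using t by auto
        have "nH sg (\<lambda>\<xi>. Z t \<xi> - Z t0 \<xi>) = nH sg (\<lambda>\<xi>. X t \<xi> - X t0 \<xi>)"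
        proof (rule nH_cong_AE)
          show "Hp sg (\<lambda>\<xi>. Z t \<xi> - Z t0 \<xi>)" by (intro Hp_diff Hp t(1) t0)
          show "AE \<xi> in lborel. Z t \<xi> - Z t0 \<xi> = X t \<xi> - X t0 \<xi>"
            using ZX[OF t'] ZX[OF t0'] by eventually_elim simp
          show "(\<lambda>\<xi>. X t \<xi> - X t0 \<xi>) \<in> borel_measurable borel"
            by (intro L2c_measurable HpD(1)[of sg] Hp_diff fsolD(1)[OF X] t' t0')
        qed
        then show ?thesis using \<delta>(2)[OF t'] t(2) by simp
      qed
      then show ?thesis using \<delta>(1) True by (intro exI[of _ "min \<delta> (T - t0)"]) auto
    next
      case False
      then have t0': "t0 - s \<in> {0..<S}" "t0 > s" using t0 s by auto
      obtain \<delta> where \<delta>: "\<delta> > 0" "\<And>t. t \<in> {0..<S} \<Longrightarrow> \<bar>t - (t0 - s)\<bar> < \<delta> \<Longrightarrow> nH sg (\<lambda>\<xi>. Y t \<xi> - Y (t0 - s) \<xi>) \<le> \<eta>"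
        using fsolD(3)[OF Y t0'(1) \<eta>] by blast
      have "nH sg (\<lambda>\<xi>. Z t \<xi> - Z t0 \<xi>) \<le> \<eta>" if t: "t \<in> {0..<s + S}" "\<bar>t - t0\<bar> < min \<delta> (t0 - s)" for t
      proof -
        have "\<not> t < s" "\<not> t0 < s" using t t0' by auto
        then have "Z t = Y (t - s)" "Z t0 = Y (t0 - s)" by (simp_all add: Z_def)
        moreover have "t - s \<in> {0..<S}" "\<bar>(t - s) - (t0 - s)\<bar> < \<delta>" using t t0' by auto
        ultimately show ?thesis using \<delta>(2)[of "t - s"] by simp
      qed
      then show ?thesis using \<delta>(1) t0'(2) by (intro exI[of _ "min \<delta> (t0 - s)"]) auto
    qed
  next
    fix \<Phi> t assume \<Phi>: "L2c \<Phi>" "herm \<Phi>" and t: "t \<in> {0..<s + S}"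
    let ?G = "\<lambda>\<tau>. Re (ip (Aop (Z \<tau>)) \<Phi>)"
    have ipZ: "Re (ip (Z \<tau>) \<Phi>) = Re (ip (X \<tau>) \<Phi>)" "?G \<tau> = Re (ip (Aop (X \<tau>)) \<Phi>)" if "\<tau> \<in> {0..<T}" for \<tau>
      using ip_Aop_cong_AE[OF ZX[OF that] Hp(1)[OF sub[OF that]] fsolD(1)[OF X that] \<Phi>(1)] by simp_all
    have low: "(?G has_integral (Re (ip (Z 0) \<Phi>) - Re (ip (Z r) \<Phi>))) {0..r}" if r: "0 \<le> r" "r < T" for r
    proof -
      have "((\<lambda>\<tau>. Re (ip (Aop (X \<tau>)) \<Phi>)) has_integral (Re (ip (Z 0) \<Phi>) - Re (ip (Z r) \<Phi>))) {0..r}"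
        using fsol_has_integral[OF X \<Phi> order_refl r] ipZ(1)[of 0] ipZ(1)[of r] r by simp
      then show ?thesis by (rule has_integral_eq[rotated]) (use ipZ(2) r in auto)
    qed
    have "(?G has_integral (Re (ip (Z 0) \<Phi>) - Re (ip (Z t) \<Phi>))) {0..t}"
    proof (cases "t < s")
      case True
      then show ?thesis using low[of t] t s by simp
    next
      case False
      have "((\<lambda>\<tau>. Re (ip (Aop (Y \<tau>)) \<Phi>)) has_integral (Re (ip (Y 0) \<Phi>) - Re (ip (Y (t - s)) \<Phi>))) {0..t - s}"
        by (rule fsol_has_integral[OF Y \<Phi>]) (use t False in auto)
      then have "((?G \<circ> (+) s) has_integral (Re (ip (Y 0) \<Phi>) - Re (ip (Y (t - s)) \<Phi>))) {0..t - s}"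
        by (rule has_integral_eq[rotated]) (simp add: Z_def)
      moreover have "Z s = Y 0" "Z t = Y (t - s)" using False by (simp_all add: Z_def)
      ultimately have "((?G \<circ> (+) s) has_integral (Re (ip (Z s) \<Phi>) - Re (ip (Z t) \<Phi>))) {0..t - s}" by (simp only:)
      then have "(?G has_integral (Re (ip (Z s) \<Phi>) - Re (ip (Z t) \<Phi>))) {s..t}"
        unfolding has_integral_shift_Icc_real by simp
      from has_integral_combine[OF s(1) _ low[OF s] this] show ?thesis using False by simp
    qed
    then show "Re (ip (Z t) \<Phi>) = Re (ip (Z 0) \<Phi>) - integral {0..t} ?G"
      by (simp add: integral_unique)
  qed (use Hp in auto)
qed

lemma fsol_exists:
  assumes data: "L2c \<Theta>0" "herm \<Theta>0" "L2c (wt ss \<Theta>0)" and T: "T \<ge> 0"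
    and M: "M > 0" "2 * (l2 (wt ss \<Theta>0))\<^sup>2 \<le> M" and TM: "T * (4 * KK * M) \<le> 1"
  shows "\<exists>\<Theta>. fsol T \<Theta> \<and> (AE \<xi> in lborel. \<Theta> 0 \<xi> = \<Theta>0 \<xi>) \<and> (\<forall>t\<in>{0..<T}. Hp ss (\<Theta> t) \<and> (l2 (wt ss (\<Theta> t)))\<^sup>2 \<le> M)"
proof -
  obtain \<Theta> where \<Theta>: "\<And>t. t \<in> {0..T} \<Longrightarrow> Hp ss (\<Theta> t) \<and> herm (\<Theta> t) \<and> (l2 (wt ss (\<Theta> t)))\<^sup>2 \<le> M"
      "AE \<xi> in lborel. \<Theta> 0 \<xi> = \<Theta>0 \<xi>"
      "\<And>t0. t0 \<in> {0..T} \<Longrightarrow> ((\<lambda>t. nH sg (\<lambda>\<xi>. \<Theta> t \<xi> - \<Theta> t0 \<xi>)) \<longlongrightarrow> 0) (at t0 within {0..T})"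
      "\<And>\<Phi> t. L2c \<Phi> \<Longrightarrow> t \<in> {0..T} \<Longrightarrow> Re (ip (\<Theta> t) \<Phi>) = Re (ip (\<Theta> 0) \<Phi>) - integral {0..t} (\<lambda>\<tau>. Re (ip (Aop (\<Theta> \<tau>)) \<Phi>))"
    using local_existence[OF assms] by blast
  have sub: "t \<in> {0..T}" if "t \<in> {0..<T}" for t using that by auto
  have "fsol T \<Theta>"
    unfolding fsol_def
  proof (intro conjI ballI allI impI)
    show "Hp sg (\<Theta> t)" "herm (\<Theta> t)" if "t \<in> {0..<T}" for t
      using \<Theta>(1)[OF sub[OF that]] Hp_ss_sg by auto
    show "Re (ip (\<Theta> t) \<Phi>) = Re (ip (\<Theta> 0) \<Phi>) - integral {0..t} (\<lambda>\<tau>. Re (ip (Aop (\<Theta> \<tau>)) \<Phi>))"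
      if "L2c \<Phi>" "t \<in> {0..<T}" for \<Phi> t
      using \<Theta>(4)[OF that(1) sub[OF that(2)]] .
    fix t0 \<eta> :: real assume t0: "t0 \<in> {0..<T}" and \<eta>: "\<eta> > 0"
    have "\<forall>\<^sub>F t in at t0 within {0..T}. nH sg (\<lambda>\<xi>. \<Theta> t \<xi> - \<Theta> t0 \<xi>) < \<eta>"
      by (rule order_tendstoD(2)[OF \<Theta>(3)[OF sub[OF t0]] \<eta>])
    then obtain \<delta> where \<delta>: "\<delta> > 0" "\<And>t. t \<in> {0..T} \<Longrightarrow> t \<noteq> t0 \<Longrightarrow> \<bar>t - t0\<bar> < \<delta> \<Longrightarrow> nH sg (\<lambda>\<xi>. \<Theta> t \<xi> - \<Theta> t0 \<xi>) < \<eta>"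
      unfolding eventually_at dist_real_def by blast
    have "nH sg (\<lambda>\<xi>. \<Theta> t \<xi> - \<Theta> t0 \<xi>) \<le> \<eta>" if "t \<in> {0..<T}" "\<bar>t - t0\<bar> < \<delta>" for t
      using \<delta>(2)[OF sub[OF that(1)] _ that(2)] \<eta> by (cases "t = t0") (auto simp: nH_zero)
    then show "\<exists>\<delta>>0. \<forall>t\<in>{0..<T}. \<bar>t - t0\<bar> < \<delta> \<longrightarrow> nH sg (\<lambda>\<xi>. \<Theta> t \<xi> - \<Theta> t0 \<xi>) \<le> \<eta>" using \<delta>(1) by blast
  qed
  then show ?thesis using \<Theta>(1,2) sub by blast
qed

text \<open>The smallness condition makes the time of existence granted by \<open>fsol_exists\<close>, which is inversely
  proportional to the squared norm of the data, twice the remaining time \<open>T - s\<close>.\<close>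

lemma sqg_sol_continuation:
  assumes sol: "sqg_sol a \<theta>0 T \<theta>" and s: "0 \<le> s" "s < T" and reg: "L2c (wt ss (hat (\<theta> s)))"
    and small: "(l2 (wt ss (hat (\<theta> s))))\<^sup>2 \<le> 1 / (16 * KK) / (T - s)"
  shows "\<exists>T' \<theta>'. T' > T \<and> sqg_sol a \<theta>0 T' \<theta>' \<and> (\<forall>t\<in>{0..<T}. AE x in lborel. \<theta>' t x = \<theta> t x)"
proof -
  note F = sqg_sol_fsol[OF sol]
  have sT: "s \<in> {0..<T}" "T > 0" using s by auto
  define M S where "M = 1 / (8 * KK) / (T - s)" and "S = 2 * (T - s)"
  have M: "M > 0" "S > 0" unfolding M_def S_def using KK_pos s by auto
  have "2 * (l2 (wt ss (hat (\<theta> s))))\<^sup>2 \<le> 2 * (1 / (16 * KK) / (T - s))" by (rule mult_left_mono[OF small]) simp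
  also have "\<dots> = M" by (simp add: M_def)
  finally have M2: "2 * (l2 (wt ss (hat (\<theta> s))))\<^sup>2 \<le> M" .
  have "S * (4 * KK * M) = 1" unfolding S_def M_def using KK_pos s by (simp add: field_simps)
  then have SM: "S * (4 * KK * M) \<le> 1" by simp
  obtain \<Theta> where \<Theta>: "fsol S \<Theta>" "AE \<xi> in lborel. \<Theta> 0 \<xi> = hat (\<theta> s) \<xi>" "\<And>t. t \<in> {0..<S} \<Longrightarrow> Hp ss (\<Theta> t) \<and> (l2 (wt ss (\<Theta> t)))\<^sup>2 \<le> M"
    using fsol_exists[OF HpD(1)[OF conjunct2[OF F(2)[OF sT(1)]]] herm_hat reg less_imp_le[OF M(2)] M(1) M2 SM] by blast
  have le: "T - s \<le> S" using s by (simp add: S_def)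
  \<comment> \<open>In \<open>fsol_unique\<close> the constructed solution is the regular one; the
    given solution enters only with its H^(2-2a) regularity.\<close>
  have eq: "AE \<xi> in lborel. \<Theta> t \<xi> = hat (\<theta> (s + t)) \<xi>" if t: "t \<in> {0..<T - s}" for t
    by (rule fsol_unique[OF fsol_mono[OF \<Theta>(1) le] fsol_shift[OF F(1) s(1)] _ \<Theta>(3) less_imp_le[OF M(1)] t])
      (use \<Theta>(2) le in auto)
  define Z where "Z = (\<lambda>t. if t < s then hat (\<theta> t) else \<Theta> (t - s))"
  have TS: "T \<le> s + S" using le by simp
  have Z: "fsol (s + S) Z" "\<And>t. t \<in> {0..<T} \<Longrightarrow> AE \<xi> in lborel. Z t \<xi> = hat (\<theta> t) \<xi>"
    unfolding Z_def by (rule fsol_glue[OF F(1) s \<Theta>(1) TS eq]; assumption)+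
  have "\<exists>f. is_ft f (Z t)" if "t \<in> {0..<s + S}" for t
    using is_ft_surj[OF HpD(1)[OF fsolD(1)[OF Z(1) that]]] fsolD(2)[OF Z(1) that]
    unfolding herm_def by (auto simp del: complex_cnj_cancel_iff)
  then obtain \<theta>' where \<theta>': "\<And>t. t \<in> {0..<s + S} \<Longrightarrow> is_ft (\<theta>' t) (Z t)" by metis
  have T': "T < s + S" unfolding S_def using s by simp
  have agree: "AE x in lborel. \<theta>' t x = \<theta> t x" if t: "t \<in> {0..<T}" for t
  proof (rule is_ft_inj)
    have t': "t \<in> {0..<s + S}" using t T' by auto
    show "is_ft (\<theta> t) (hat (\<theta> t))" using F(2)[OF t] by blast
    show "is_ft (\<theta>' t) (hat (\<theta> t))"
      by (rule is_ft_cong_AE[OF \<theta>'[OF t'] Z(2)[OF t]]) (use F(2)[OF t] HpD L2c_measurable in blast)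
  qed
  have "sqg_sol a \<theta>0 (s + S) \<theta>'"
  proof (rule fsol_sqg_sol[OF Z(1) \<theta>'])
    fix \<phi> assume L: "L2 \<phi>"
    have 0: "0 \<in> {0..<T}" "0 \<in> {0..<s + S}" using s T' by auto
    have m: "\<theta>' 0 \<in> borel_measurable lborel" "\<theta> 0 \<in> borel_measurable lborel" "\<phi> \<in> borel_measurable lborel"
      using is_ftD(1)[OF \<theta>'[OF 0(2)]] is_ftD(1)[OF conjunct1[OF F(2)[OF 0(1)]]] L unfolding L2_def by auto
    note [measurable] = m
    have "(LINT x|lborel. \<theta>' 0 x * \<phi> x) = (LINT x|lborel. \<theta> 0 x * \<phi> x)"
      by (rule integral_cong_AE) (measurable, use agree[OF 0(1)] in \<open>auto elim: eventually_mono\<close>)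
    then show "(LINT x|lborel. \<theta>' 0 x * \<phi> x) = (LINT x|lborel. \<theta>0 x * \<phi> x)" using F(3)[OF sT(2) L] by simp
  qed
  then show ?thesis using T' agree by blast
qed

text \<open>As sg + a = ss, the homogeneous part of the norm on the right is already the left
  side.\<close>

lemma nn_integral_wt_le_Hs_sqnorm_Dpow:
  assumes "in_Hs sg f"
  shows "(\<integral>\<^sup>+\<xi>. ennreal ((cmod (wt ss (hat f) \<xi>))\<^sup>2) \<partial>lborel) \<le> Hs_sqnorm sg (Dpow a f)"
proof -
  note f = in_Hs_hat[OF assms]
  note h = Hp_facts[OF f(2)]
  have "is_ft (Dpow a f) (wt a (hat f))"
    unfolding Dpow_def wt_def[abs_def] using h(4) by (intro is_ft_fmult[OF f(1)]) (auto simp: wt_def[abs_def])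
  note nn_integral_wt_ft[OF this, of sg]
  moreover have "wt sg (wt a (hat f)) = wt ss (hat f)" unfolding wt_wt by simp
  ultimately show ?thesis unfolding Hs_sqnorm_def by simp
qed

end

theorem theorem1p2:
  fixes \<alpha> Tstar :: real and \<theta>0 :: "pt \<Rightarrow> real" and \<theta> :: "real \<Rightarrow> pt \<Rightarrow> real"
  assumes "0 < \<alpha>" and "\<alpha> < 1/2"
    and "in_Hs (2 - 2 * \<alpha>) \<theta>0"
    and "sqg_maximal \<alpha> \<theta>0 Tstar \<theta>"
  shows "(\<integral>\<^sup>+ \<tau>. indicator {0..<Tstar} \<tau> * Hs_sqnorm (2 - 2 * \<alpha>) (Dpow \<alpha> (\<theta> \<tau>)) \<partial>lborel) = \<infinity>"
proof -
  interpret sqg_exponent \<alpha> using assms(1,2) by unfold_locales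
  have T: "Tstar > 0" and sol: "sqg_sol \<alpha> \<theta>0 Tstar \<theta>"
    and max: "\<nexists>T' \<theta>'. T' > Tstar \<and> sqg_sol \<alpha> \<theta>0 T' \<theta>' \<and> (\<forall>t\<in>{0..<Tstar}. AE x in lborel. \<theta>' t x = \<theta> t x)"
    using assms(4) by (simp_all add: sqg_maximal_def)
  have Hs: "in_Hs (2 - 2 * \<alpha>) (\<theta> \<tau>)" if "\<tau> \<in> {0..<Tstar}" for \<tau>
    using sol that by (simp add: sqg_sol_def cont_Hs_def)
  define c where "c = 1 / (16 * KK)"
  have c: "c > 0" using KK_pos by (simp add: c_def)
  \<comment> \<open>If the bound failed at \<tau>, the norm would be finite there, so the negated
    claim itself supplies the regularity that the continuation asks for.\<close>
  have low: "ennreal (c / (Tstar - \<tau>)) \<le> Hs_sqnorm (2 - 2 * \<alpha>) (Dpow \<alpha> (\<theta> \<tau>))" if \<tau>: "\<tau> \<in> {0..<Tstar}" for \<tau>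
  proof (rule ccontr)
    let ?W = "wt (2 - \<alpha>) (hat (\<theta> \<tau>))"
    assume "\<not> ?thesis"
    then have less: "(\<integral>\<^sup>+\<xi>. ennreal ((cmod (?W \<xi>))\<^sup>2) \<partial>lborel) < ennreal (c / (Tstar - \<tau>))"
      using nn_integral_wt_le_Hs_sqnorm_Dpow[OF Hs[OF \<tau>]] by (simp add: not_le)
    have [measurable]: "hat (\<theta> \<tau>) \<in> borel_measurable borel" using in_Hs_hat(2)[OF Hs[OF \<tau>]] HpD(1) L2c_measurable by blast
    have L: "L2c ?W" by (rule L2c_if_nn_finite) (measurable, use less in \<open>auto intro: less_trans\<close>)
    have "c / (Tstar - \<tau>) \<ge> 0" using c \<tau> by simp
    then have "(l2 ?W)\<^sup>2 \<le> 1 / (16 * KK) / (Tstar - \<tau>)"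
      using less unfolding nn_integral_L2c[OF L] c_def by (simp add: ennreal_less_iff)
    then show False using sqg_sol_continuation[OF sol _ _ L] \<tau> max by auto
  qed
  have "\<infinity> = (\<integral>\<^sup>+\<tau>. indicator {0..<Tstar} \<tau> * ennreal (c / (Tstar - \<tau>)) \<partial>lborel)"
    by (rule nn_integral_inverse_distance_infinite[OF c T, symmetric])
  also have "\<dots> \<le> (\<integral>\<^sup>+ \<tau>. indicator {0..<Tstar} \<tau> * Hs_sqnorm (2 - 2 * \<alpha>) (Dpow \<alpha> (\<theta> \<tau>)) \<partial>lborel)"
    using low by (intro nn_integral_mono) (auto simp: indicator_def)
  finally show ?thesis by (simp add: top.extremum_unique)
qed

end
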